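(* There is an absolute constant $\gamma>0$ such that the following holds. Let $p\in(1,\infty)$, $\alpha=1-1/p$ and $\beta>1-1/p$. Let $\sigma_j=j^{-\alpha}(\log(j+1))^{-\beta}$ for $1\le j\le N$, with associated $p$-ellipsoid $\mathcal{E}_p\subset\mathbb{R}^N$. If $p\ge2$, then there is a constant $c>0$ depending only on $p,\alpha,\beta$ such that for all $1\le n<N$ one has $$\mathcal{R}_n(\mathcal{E}_p)\approx n^{-1/2}(\log(n+1))^{-\beta}\left(\max\left\{1,\ \log(N/n)\,\frac{\log n}{\log N}\right\}\right)^{1-1/p},$$ with probability at least $1-3e^{-\gamma n}$ if $n\le cN$, and at least $1-e^{-\gamma n}-2e^{-\gamma pn^{2/p}}$ for the remaining values of $n$. If $p<2$, then for all $1\le n<N$ one has $$n^{-1/2}(\log(n+1))^{-\beta}\lesssim\mathcal{R}_n(\mathcal{E}_p)\lesssim n^{-1/2}(\log(n+1))^{-\beta}\left(\max\left\{1,\ \log(N/n)\,\frac{\log n}{\log N}\right\}\right)^{1-1/p},$$ with probability at least $1-2e^{-\gamma n}$.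
   Context: $\mathcal{E}_p=\{x\in\mathbb{R}^N:\sum_{i=1}^N(|x_i|/\sigma_i)^p\le1\}$. The $n$-th random radius is $\mathcal{R}_n(\mathcal{E}_p)=\max_{y\in E_n\cap\mathcal{E}_p}|y|$, where $|\cdot|$ is the Euclidean norm and $E_n$ is a random $n$-codimensional linear subspace of $\mathbb{R}^N$ distributed according to the normalized Haar measure on the Grassmannian. $a\lesssim b$ means $a\le Cb$ for a constant $C>0$ depending only on $p,\alpha,\beta$ (in particular independent of $n$ and $N$); $a\approx b$ means $a\lesssim b$ and $b\lesssim a$. The paper's range "$n\lesssim N$" is expressed as $n\le cN$. *)

theory Defs
  imports "HOL-Probability.Probability" "HOL-Library.Function_Algebras"
begin

(* R^N is rendered as the topspace of the library's Euclidean_space N: functions x :: nat => real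
   with x i = 0 for i >= N. Coordinates are therefore numbered from 0, so that x i is the
   (i+1)-st coordinate of the usual numbering. *)

abbreviation Rn :: "nat \<Rightarrow> (nat \<Rightarrow> real) set"
  where "Rn N \<equiv> topspace (Euclidean_space N)"

definition fscale :: "real \<Rightarrow> (nat \<Rightarrow> real) \<Rightarrow> (nat \<Rightarrow> real)"
  where "fscale c x = (\<lambda>i. c * x i)"

interpretation rfun: vector_space fscale
  by unfold_locales (auto simp: fscale_def fun_eq_iff algebra_simps)

definition grassmannian_codim :: "nat \<Rightarrow> nat \<Rightarrow> (nat \<Rightarrow> real) set set"
  where "grassmannian_codim N n =
    {E. E \<subseteq> Rn N \<and> rfun.subspace E \<and> rfun.dim E + n = N}"

definition orth_proj :: "nat \<Rightarrow> (nat \<Rightarrow> real) set \<Rightarrow> (nat \<Rightarrow> real) \<Rightarrow> (nat \<Rightarrow> real)"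
  where "orth_proj N E x = (THE y. y \<in> E \<and> (\<forall>z\<in>E. (\<Sum>i<N. (x i - y i) * z i) = 0))"

(* Matrix of the orthogonal projection onto E (entries outside N x N vanish). *)
definition proj_matrix :: "nat \<Rightarrow> (nat \<Rightarrow> real) set \<Rightarrow> nat \<Rightarrow> nat \<Rightarrow> real"
  where "proj_matrix N E i j = orth_proj N E (\<lambda>k. if k = j then 1 else 0) i"

(* The usual topology of the Grassmannian: E and F are close iff their orthogonal projections are.
   The topology on matrices is that of entrywise convergence. *)
definition grassmannian_topology :: "nat \<Rightarrow> nat \<Rightarrow> (nat \<Rightarrow> real) set topology"
  where "grassmannian_topology N n =
    pullback_topology (grassmannian_codim N n) (proj_matrix N) euclidean"

definition grassmannian_borel :: "nat \<Rightarrow> nat \<Rightarrow> (nat \<Rightarrow> real) set measure"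
  where "grassmannian_borel N n =
    sigma (grassmannian_codim N n) {U. openin (grassmannian_topology N n) U}"

definition orthogonal_mat :: "nat \<Rightarrow> (nat \<Rightarrow> nat \<Rightarrow> real) \<Rightarrow> bool"
  where "orthogonal_mat N Q \<longleftrightarrow>
    (\<forall>i<N. \<forall>j<N. (\<Sum>k<N. Q k i * Q k j) = (if i = j then 1 else 0))"

definition mat_apply :: "nat \<Rightarrow> (nat \<Rightarrow> nat \<Rightarrow> real) \<Rightarrow> (nat \<Rightarrow> real) \<Rightarrow> (nat \<Rightarrow> real)"
  where "mat_apply N Q x = (\<lambda>i. if i < N then \<Sum>j<N. Q i j * x j else 0)"

(* The normalized Haar measure is the unique Borel probability measure on the Grassmannian that is
   invariant under the action E |-> Q E of the orthogonal group. *)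
definition is_haar_grassmannian :: "nat \<Rightarrow> nat \<Rightarrow> (nat \<Rightarrow> real) set measure \<Rightarrow> bool"
  where "is_haar_grassmannian N n \<mu> \<longleftrightarrow>
    prob_space \<mu> \<and>
    space \<mu> = grassmannian_codim N n \<and>
    sets \<mu> = sets (grassmannian_borel N n) \<and>
    (\<forall>Q. orthogonal_mat N Q \<longrightarrow>
      (\<forall>A\<in>sets \<mu>. emeasure \<mu> ((\<lambda>E. mat_apply N Q ` E) ` A) = emeasure \<mu> A))"

(* The semiaxes s are numbered from 1, hence the index shift. *)
definition p_ellipsoid :: "nat \<Rightarrow> real \<Rightarrow> (nat \<Rightarrow> real) \<Rightarrow> (nat \<Rightarrow> real) set"
  where "p_ellipsoid N p s = {x \<in> Rn N. (\<Sum>i<N. (\<bar>x i\<bar> / s (Suc i)) powr p) \<le> 1}"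

(* The supremum is a maximum when K is compact and meets E, as for an ellipsoid and a subspace. *)
definition section_radius :: "nat \<Rightarrow> (nat \<Rightarrow> real) set \<Rightarrow> (nat \<Rightarrow> real) set \<Rightarrow> real"
  where "section_radius N K E = (SUP y \<in> E \<inter> K. L2_set y {..<N})"

definition log_semiaxis :: "real \<Rightarrow> real \<Rightarrow> nat \<Rightarrow> real"
  where "log_semiaxis \<alpha> \<beta> j = real j powr (-\<alpha>) * ln (real j + 1) powr (-\<beta>)"

definition base_rate :: "real \<Rightarrow> nat \<Rightarrow> real"
  where "base_rate \<beta> n = real n powr (-1/2) * ln (real n + 1) powr (-\<beta>)"

definition log_factor :: "real \<Rightarrow> nat \<Rightarrow> nat \<Rightarrow> real"
  where "log_factor p N n =
    (max 1 (ln (real N / real n) * (ln (real n) / ln (real N)))) powr (1 - 1 / p)"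

end

theory Submission imports Defs begin

text \<open>A Borel probability measure on the Grassmannian for which the measure of a ball does not depend
  on its centre is unique, so the kernel of an \<open>n\<close> by \<open>N\<close> Gaussian matrix and the span of
  \<open>N - n\<close> Gaussian vectors are both Haar distributed. Put \<open>q = p / (p - 1)\<close>.

  Upper bound, Gaussian rows \<open>G\<^sub>j\<close>: it suffices that \<open>\<Sum>\<^sub>j min(\<bar>\<langle>G\<^sub>j, x\<rangle>\<bar>, 1)\<close> is positive
  on the set of unit vectors \<open>x\<close> of gauge less than \<open>1 / \<rho>\<close>. Replacing the centred summands one at a
  time by Gaussian linear functionals bounds the probability of failure by \<open>exp (- c n)\<close> times the
  exponential moment of the supremum of one Gaussian functional \<open>\<langle>h, x\<rangle>\<close> over this set, which Young's
  inequality controls coordinate by coordinate; this determines the size of \<open>\<rho>\<close>.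

  Lower bound: for \<open>p < 2\<close> every \<open>E\<close> contains a flat enough vector supported on the first
  \<open>n + 1\<close> coordinates. For \<open>p \<ge> 2\<close> and \<open>n\<close> comparable to \<open>N\<close> a Gaussian vector of \<open>E\<close> is flat enough. For
  small \<open>n\<close> the same small ball inequality, applied to the transposed matrix \<open>H\<close> with rows \<open>H\<^sub>i\<close> and
  weights \<open>\<sigma>\<^sub>i\<^sup>q\<close>, bounds \<open>\<Sum>\<^sub>i \<sigma>\<^sub>i\<^sup>q \<bar>\<langle>u, H\<^sub>i\<rangle>\<bar>\<^sup>q\<close> from below for all unit \<open>u\<close>. By duality the image of
  the tail of the ellipsoid contains a ball, so a multiple of the first row is attained there, and the
  difference is a vector of the kernel with a large first coordinate.\<close>

section \<open>Orthonormal families and linear subspaces\<close>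

text \<open>The constant \<gamma> must not depend on p, \<alpha>, \<beta>. Hence the multiplier in
  the exponential moments is the absolute number \<open>rate_const\<close>, and every dependence on
  p is pushed into the radius. The comparison with one Gaussian functional replaces nets and
  chaining: only the support function of the index set is left, and it splits over coordinates. The
  logarithmic factor comes from a single sum. As \<alpha> q = 1, the q-th power of the j-th semiaxis
  is 1/j times ln(j+1)^(-\<beta> q). Between n and min(N, n^2) the logarithm is nearly constant, and
  the harmonic sum contributes about min(ln(N/n), ln n). Beyond n^2 the tail converges because
  \<beta> q > 1, and it contributes at most ln n in the same unit. The product ln(N/n) ln n / ln N
  is comparable to that minimum, and the power 1 - 1/p = 1/q undoes the q-th power. Two regimes are
  forced for p \<ge> 2: cancelling a large first coordinate takes many comparable weights beyond a
  multiple of n. For n proportional to N these are missing, and the l_p norm of a Gaussian vector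
  decides; its upper tail is only exponential in n^(2/p).\<close>

definition ip :: "nat \<Rightarrow> (nat \<Rightarrow> real) \<Rightarrow> (nat \<Rightarrow> real) \<Rightarrow> real"
  where "ip N x y = (\<Sum>i<N. x i * y i)"

definition lincomb :: "nat \<Rightarrow> (nat \<Rightarrow> real) \<Rightarrow> (nat \<Rightarrow> nat \<Rightarrow> real) \<Rightarrow> nat \<Rightarrow> real"
  where "lincomb k c f = (\<lambda>i. \<Sum>l<k. c l * f l i)"

definition lin_span :: "nat \<Rightarrow> (nat \<Rightarrow> nat \<Rightarrow> real) \<Rightarrow> (nat \<Rightarrow> real) set"
  where "lin_span k f = range (\<lambda>c. lincomb k c f)"

definition orthonormal :: "nat \<Rightarrow> nat \<Rightarrow> (nat \<Rightarrow> nat \<Rightarrow> real) \<Rightarrow> bool"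
  where "orthonormal N k f \<longleftrightarrow> (\<forall>l<k. f l \<in> Rn N) \<and>
    (\<forall>l<k. \<forall>m<k. ip N (f l) (f m) = (if l = m then 1 else 0))"

lemma Rn_iff: "x \<in> Rn N \<longleftrightarrow> (\<forall>i\<ge>N. x i = 0)"
  by (auto simp: topspace_Euclidean_space)

lemma Rn_eqI: "x \<in> Rn N \<Longrightarrow> y \<in> Rn N \<Longrightarrow> (\<And>i. i < N \<Longrightarrow> x i = y i) \<Longrightarrow> x = y"
  by (rule ext) (metis Rn_iff not_le)

lemma ip_commute: "ip N x y = ip N y x"
  by (simp add: ip_def mult.commute)

lemma ip_self_nonneg: "0 \<le> ip N x x"
  by (simp add: ip_def sum_nonneg)

lemma ip_self_eq_0: "ip N x x = 0 \<longleftrightarrow> (\<forall>i<N. x i = 0)"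
  by (auto simp: ip_def sum_nonneg_eq_0_iff)

lemma ip_self_Rn: "x \<in> Rn N \<Longrightarrow> ip N x x = 0 \<Longrightarrow> x = (\<lambda>_. 0)"
  by (auto simp: ip_self_eq_0 Rn_iff fun_eq_iff) (metis not_le)

lemma ip_diff_left: "ip N (\<lambda>i. x i - y i) z = ip N x z - ip N y z"
  by (simp add: ip_def left_diff_distrib sum_subtractf)
lemma ip_diff_right: "ip N z (\<lambda>i. x i - y i) = ip N z x - ip N z y"
  by (simp add: ip_def right_diff_distrib sum_subtractf)
lemma ip_scale_left: "ip N (\<lambda>i. c * x i) z = c * ip N x z"
  by (simp add: ip_def sum_distrib_left mult.assoc)
lemma ip_scale_right: "ip N z (\<lambda>i. c * x i) = c * ip N z x"
  by (simp add: ip_def sum_distrib_left mult.left_commute)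
lemma ip_divide_left: "ip N (\<lambda>i. x i / c) z = ip N x z / c"
  by (simp add: ip_def sum_divide_distrib)
lemma ip_divide_right: "ip N z (\<lambda>i. x i / c) = ip N z x / c"
  by (simp add: ip_def sum_divide_distrib)

lemma ip_lincomb_left: "ip N (lincomb k c f) z = (\<Sum>l<k. c l * ip N (f l) z)"
  unfolding ip_def lincomb_def sum_distrib_right sum_distrib_left
  by (subst sum.swap) (simp add: mult.assoc)

lemma ip_lincomb_right: "ip N z (lincomb k c f) = (\<Sum>l<k. c l * ip N z (f l))"
  using ip_lincomb_left[of N k c f z] by (simp add: ip_commute[of N z])

lemma lincomb_Rn: "(\<And>l. l < k \<Longrightarrow> f l \<in> Rn N) \<Longrightarrow> lincomb k c f \<in> Rn N"
  by (auto simp: Rn_iff lincomb_def)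

lemma lin_span_lincomb [intro]: "lincomb k c f \<in> lin_span k f"
  by (auto simp: lin_span_def)

lemma lin_span_Rn: "(\<And>l. l < k \<Longrightarrow> f l \<in> Rn N) \<Longrightarrow> lin_span k f \<subseteq> Rn N"
  using lincomb_Rn by (auto simp: lin_span_def)

lemma lin_span_base: assumes "l < k" shows "f l \<in> lin_span k f"
proof -
  have "lincomb k (\<lambda>m. if m = l then 1 else 0) f = f l"
    using assms by (auto simp: lincomb_def fun_eq_iff if_distrib[of "\<lambda>x. x * _"] cong: if_cong)
  then show ?thesis by (metis lin_span_lincomb)
qed

lemma lin_span_cong: "(\<And>l. l < k \<Longrightarrow> f l = g l) \<Longrightarrow> lin_span k f = lin_span k g"
  by (simp add: lin_span_def lincomb_def)

lemma lin_span_subset_subspace: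
  assumes E: "rfun.subspace E" and f: "\<And>l. l < k \<Longrightarrow> f l \<in> E"
  shows "lin_span k f \<subseteq> E"
proof -
  have "lincomb k c f \<in> E" for c
    using f
  proof (induction k)
    case 0
    then show ?case using rfun.subspace_0[OF E] by (simp add: lincomb_def zero_fun_def)
  next
    case (Suc k)
    have "lincomb (Suc k) c f = lincomb k c f + fscale (c k) (f k)"
      by (auto simp: lincomb_def fscale_def fun_eq_iff)
    then show ?case
      using Suc rfun.subspace_add[OF E] rfun.subspace_scale[OF E] by (metis less_Suc_eq)
  qed
  then show ?thesis by (auto simp: lin_span_def)
qed

lemma subspace_lin_span: "rfun.subspace (lin_span k f)"
  unfolding rfun.subspace_def
proof (intro conjI ballI allI)
  have "0 = lincomb k (\<lambda>_. 0) f" by (simp add: lincomb_def zero_fun_def)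
  then show "0 \<in> lin_span k f" by (metis lin_span_lincomb)
next
  fix x y assume "x \<in> lin_span k f" "y \<in> lin_span k f"
  then obtain c d where "x = lincomb k c f" "y = lincomb k d f" by (auto simp: lin_span_def)
  then have "x + y = lincomb k (\<lambda>l. c l + d l) f"
    by (auto simp: lincomb_def fun_eq_iff distrib_right sum.distrib)
  then show "x + y \<in> lin_span k f" by (metis lin_span_lincomb)
next
  fix c x assume "x \<in> lin_span k f"
  then obtain d where "x = lincomb k d f" by (auto simp: lin_span_def)
  then have "fscale c x = lincomb k (\<lambda>l. c * d l) f"
    by (auto simp: lincomb_def fscale_def fun_eq_iff sum_distrib_left mult.assoc)
  then show "fscale c x \<in> lin_span k f" by (metis lin_span_lincomb)
qed

lemma orthonormal_Rn: "orthonormal N k f \<Longrightarrow> l < k \<Longrightarrow> f l \<in> Rn N"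
  by (simp add: orthonormal_def)
lemma orthonormal_ip: "orthonormal N k f \<Longrightarrow> l < k \<Longrightarrow> m < k \<Longrightarrow> ip N (f l) (f m) = (if l = m then 1 else 0)"
  by (simp add: orthonormal_def)

lemma orthonormal_ip_lincomb: "orthonormal N k f \<Longrightarrow> m < k \<Longrightarrow> ip N (lincomb k c f) (f m) = c m"
  by (simp add: ip_lincomb_left orthonormal_ip if_distrib[of "\<lambda>x. _ * x"] cong: if_cong)

lemma orthonormal_lincomb_coeff:
  assumes "orthonormal N k f" "x \<in> lin_span k f" shows "x = lincomb k (\<lambda>l. ip N x (f l)) f"
proof -
  obtain c where c: "x = lincomb k c f" using assms by (auto simp: lin_span_def)
  show ?thesis using orthonormal_ip_lincomb[OF assms(1)]
    unfolding c by (simp add: lincomb_def)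
qed

lemma orthonormal_residual:
  assumes "orthonormal N k f" "m < k"
  shows "ip N (\<lambda>i. x i - lincomb k (\<lambda>l. ip N x (f l)) f i) (f m) = 0"
  using orthonormal_ip_lincomb[OF assms] by (simp add: ip_diff_left)

lemma orthonormal_bessel:
  assumes "orthonormal N k f" shows "(\<Sum>l<k. (ip N x (f l))\<^sup>2) \<le> ip N x x"
proof -
  let ?p = "lincomb k (\<lambda>l. ip N x (f l)) f"
  have pp: "ip N ?p ?p = (\<Sum>l<k. (ip N x (f l))\<^sup>2)"
    by (simp add: ip_lincomb_right[of N ?p] orthonormal_ip_lincomb[OF assms] power2_eq_square)
  have xp: "ip N x ?p = (\<Sum>l<k. (ip N x (f l))\<^sup>2)"
    by (simp add: ip_lincomb_right power2_eq_square)
  have "0 \<le> ip N (\<lambda>i. x i - ?p i) (\<lambda>i. x i - ?p i)" by (rule ip_self_nonneg)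
  also have "\<dots> = ip N x x - ip N x ?p - (ip N x ?p - ip N ?p ?p)"
    by (simp add: ip_diff_left ip_diff_right ip_commute)
  finally show ?thesis using pp xp by simp
qed

definition unitv :: "nat \<Rightarrow> nat \<Rightarrow> real" where "unitv j = (\<lambda>i. if i = j then 1 else 0)"

lemma unitv_apply: "unitv j i = (if i = j then 1 else 0)"
  by (simp add: unitv_def)

lemma ip_unitv_left: "ip N (unitv j) x = (if j < N then x j else 0)"
  by (auto simp: ip_def unitv_def if_distrib[of "\<lambda>x. x * _"] cong: if_cong)

text \<open>Sum the squares of all entries of the family in two ways: by vectors this is k, by
  coordinates each of the N sums is at most 1, by Bessel applied to a unit coordinate
  vector.\<close>

lemma orthonormal_card_le: assumes "orthonormal N k f" shows "k \<le> N"
proof -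
  have "real k = (\<Sum>l<k. ip N (f l) (f l))" using assms by (simp add: orthonormal_ip)
  also have "\<dots> = (\<Sum>i<N. \<Sum>l<k. (f l i)\<^sup>2)"
    unfolding ip_def by (subst sum.swap) (simp add: power2_eq_square)
  also have "\<dots> \<le> (\<Sum>i<N. 1)"
  proof (rule sum_mono)
    fix i assume i: "i \<in> {..<N}"
    have "(\<Sum>l<k. (f l i)\<^sup>2) = (\<Sum>l<k. (ip N (unitv i) (f l))\<^sup>2)"
      using i by (simp add: ip_unitv_left)
    also have "\<dots> \<le> ip N (unitv i) (unitv i)" by (rule orthonormal_bessel[OF assms])
    also have "\<dots> = 1" using i by (simp add: ip_unitv_left unitv_apply)
    finally show "(\<Sum>l<k. (f l i)\<^sup>2) \<le> 1" .
  qed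
  finally show ?thesis by simp
qed

lemma orthonormal_Suc:
  assumes "orthonormal N k f" "v \<in> Rn N" "ip N v v = 1" "\<And>l. l < k \<Longrightarrow> ip N v (f l) = 0"
  shows "orthonormal N (Suc k) (f(k := v))"
  using assms unfolding orthonormal_def
  by (auto simp: less_Suc_eq ip_commute)

text \<open>A missing vector of \<open>E\<close>, minus its projection and normalised, prolongs the
  family; this must stop because no orthonormal family has more than N members. With k = 0 it yields
  bases, with \<open>E\<close> the whole space it completes a family.\<close>

lemma orthonormal_extend:
  assumes E: "rfun.subspace E" "E \<subseteq> Rn N" and f: "orthonormal N k f" "\<And>l. l < k \<Longrightarrow> f l \<in> E"
  shows "\<exists>m g. k \<le> m \<and> orthonormal N m g \<and> (\<forall>l<k. g l = f l) \<and> E = lin_span m g"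
  using f
proof (induction "N - k" arbitrary: k f rule: less_induct)
  case less
  show ?case
  proof (cases "E = lin_span k f")
    case True
    then show ?thesis using less.prems by blast
  next
    case False
    moreover have "lin_span k f \<subseteq> E" using lin_span_subset_subspace E less.prems by blast
    ultimately obtain x where x: "x \<in> E" "x \<notin> lin_span k f" by blast
    define w where "w = (\<lambda>i. x i - lincomb k (\<lambda>l. ip N x (f l)) f i)"
    have "w = x - lincomb k (\<lambda>l. ip N x (f l)) f" by (auto simp: w_def)
    then have wE: "w \<in> E"
      using rfun.subspace_diff[OF E(1) x(1)] \<open>lin_span k f \<subseteq> E\<close> by (metis lin_span_lincomb subsetD)
    have w0: "ip N w w \<noteq> 0"
    proof
      assume "ip N w w = 0"
      then have "w = (\<lambda>_. 0)" using ip_self_Rn wE E(2) by blast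
      then have "x = lincomb k (\<lambda>l. ip N x (f l)) f" by (auto simp: w_def fun_eq_iff)
      then show False using x(2) by (metis lin_span_lincomb)
    qed
    define v where "v = (\<lambda>i. w i / sqrt (ip N w w))"
    have "v = fscale (1 / sqrt (ip N w w)) w" by (auto simp: v_def fscale_def)
    then have vE: "v \<in> E" using rfun.subspace_scale[OF E(1) wE] by simp
    have vv: "ip N v v = 1" using w0 ip_self_nonneg[of N w]
      by (simp add: v_def ip_divide_left ip_divide_right)
    have vf: "ip N v (f l) = 0" if "l < k" for l
      using orthonormal_residual[OF less.prems(1) that] by (simp add: v_def ip_divide_left w_def)
    have on: "orthonormal N (Suc k) (f(k := v))"
      using orthonormal_Suc[OF less.prems(1) _ vv vf] vE E(2) by blast
    have "N - Suc k < N - k" using orthonormal_card_le[OF on] by simp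
    from less.hyps[OF this on] vE less.prems(2)
    obtain m g where "Suc k \<le> m" "orthonormal N m g" "\<forall>l<Suc k. g l = (f(k := v)) l" "E = lin_span m g"
      by (metis fun_upd_apply less_Suc_eq)
    then show ?thesis
      by (intro exI[of _ m] exI[of _ g]) auto
  qed
qed

lemma dim_lin_span: assumes "orthonormal N k f" shows "rfun.dim (lin_span k f) = k"
proof -
  have inj: "inj_on f {..<k}"
    using orthonormal_ip[OF assms] by (intro inj_onI) (metis lessThan_iff zero_neq_one)
  have ind: "\<not> rfun.dependent (f ` {..<k})"
    unfolding rfun.dependent_def
  proof safe
    fix m assume m: "m < k" "f m \<in> rfun.span (f ` {..<k} - {f m})"
    \<comment> \<open>A hyperplane that contains every other member of the family but not
      \<open>f m\<close> itself.\<close>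
    let ?O = "{x. ip N x (f m) = 0}"
    have sub: "rfun.subspace ?O"
      unfolding rfun.subspace_def
      by (auto simp: ip_def fscale_def distrib_right sum.distrib mult.assoc sum_distrib_left[symmetric])
    have "rfun.span (f ` {..<k} - {f m}) \<subseteq> ?O"
      by (rule rfun.span_minimal[OF _ sub]) (use orthonormal_ip[OF assms] m in auto)
    then have "ip N (f m) (f m) = 0" using m(2) by auto
    then show False using orthonormal_ip[OF assms m(1) m(1)] by simp
  qed
  have "rfun.span (f ` {..<k}) = lin_span k f"
  proof
    show "rfun.span (f ` {..<k}) \<subseteq> lin_span k f"
      by (rule rfun.span_minimal[OF _ subspace_lin_span]) (auto intro: lin_span_base)
    show "lin_span k f \<subseteq> rfun.span (f ` {..<k})"
      by (rule lin_span_subset_subspace[OF rfun.subspace_span]) (auto intro: rfun.span_base)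
  qed
  then have "rfun.dim (lin_span k f) = card (f ` {..<k})"
    using rfun.dim_eq_card[OF _ ind] by (metis rfun.span_span)
  then show ?thesis using inj by (simp add: card_image)
qed

lemma subspace_Rn: "rfun.subspace (Rn N)"
  by (auto simp: rfun.subspace_def Rn_iff fscale_def)

lemma orthonormal_unitv: "orthonormal N N unitv"
  by (auto simp: orthonormal_def ip_unitv_left unitv_apply Rn_iff)

lemma lin_span_orthonormal_full: assumes "orthonormal N N f" shows "lin_span N f = Rn N"
proof -
  obtain m g where "N \<le> m" "orthonormal N m g" "\<forall>l<N. g l = f l" "Rn N = lin_span m g"
    using orthonormal_extend[OF subspace_Rn subset_refl assms] orthonormal_Rn[OF assms] by blast
  then show ?thesis using orthonormal_card_le[of N m g] lin_span_cong[of N f g] by (metis le_antisym)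
qed

lemma orthonormal_extend_full:
  assumes "orthonormal N k f" shows "\<exists>g. orthonormal N N g \<and> (\<forall>l<k. g l = f l)"
proof -
  obtain m g where g: "k \<le> m" "orthonormal N m g" "\<forall>l<k. g l = f l" "Rn N = lin_span m g"
    using orthonormal_extend[OF subspace_Rn subset_refl assms] orthonormal_Rn[OF assms] by blast
  have "rfun.dim (lin_span N unitv) = N" by (rule dim_lin_span[OF orthonormal_unitv])
  then have "m = N" using dim_lin_span[OF g(2)] g(4) lin_span_orthonormal_full[OF orthonormal_unitv] by metis
  then show ?thesis using g by blast
qed

section \<open>Points of the Grassmannian and their projections\<close>

lemma lin_span_in_grassmannian:
  "orthonormal N k f \<Longrightarrow> k + n = N \<Longrightarrow> lin_span k f \<in> grassmannian_codim N n"
  using lin_span_Rn[of k f N] orthonormal_Rn[of N k f]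
  by (auto simp: grassmannian_codim_def subspace_lin_span dim_lin_span)

lemma grassmannian_obtain_orthonormal:
  assumes "E \<in> grassmannian_codim N n"
  obtains f where "orthonormal N (N - n) f" "E = lin_span (N - n) f"
proof -
  have E: "E \<subseteq> Rn N" "rfun.subspace E" "rfun.dim E + n = N"
    using assms by (auto simp: grassmannian_codim_def)
  have "orthonormal N 0 unitv" by (simp add: orthonormal_def)
  then obtain m g where "orthonormal N m g" "E = lin_span m g"
    using orthonormal_extend[OF E(2,1), of 0 unitv] by auto
  moreover from this have "m = N - n" using dim_lin_span[of N m g] E(3) by simp
  ultimately show ?thesis using that by blast
qed

lemma orth_proj_lin_span:
  assumes "orthonormal N k f"
  shows "orth_proj N (lin_span k f) x = lincomb k (\<lambda>l. ip N x (f l)) f"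
  unfolding orth_proj_def
proof (rule the_equality)
  let ?p = "lincomb k (\<lambda>l. ip N x (f l)) f"
  have "(\<Sum>i<N. (x i - ?p i) * z i) = 0" if z: "z \<in> lin_span k f" for z
  proof -
    obtain c where c: "z = lincomb k c f" using z by (auto simp: lin_span_def)
    have "ip N (\<lambda>i. x i - ?p i) z = 0"
      unfolding c ip_lincomb_right using orthonormal_residual[OF assms] by simp
    then show ?thesis by (simp add: ip_def)
  qed
  then show "?p \<in> lin_span k f \<and> (\<forall>z\<in>lin_span k f. (\<Sum>i<N. (x i - ?p i) * z i) = 0)" by auto
next
  fix y assume y: "y \<in> lin_span k f \<and> (\<forall>z\<in>lin_span k f. (\<Sum>i<N. (x i - y i) * z i) = 0)"
  have "ip N (\<lambda>i. x i - y i) (f l) = 0" if "l < k" for l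
    using y lin_span_base[OF that, of f] by (simp add: ip_def)
  then have "ip N y (f l) = ip N x (f l)" if "l < k" for l
    using that by (simp add: ip_diff_left)
  then show "y = lincomb k (\<lambda>l. ip N x (f l)) f"
    using orthonormal_lincomb_coeff[OF assms, of y] y by (simp add: lincomb_def)
qed

lemma proj_matrix_lin_span:
  assumes "orthonormal N k f"
  shows "proj_matrix N (lin_span k f) i j = (\<Sum>l<k. f l i * f l j)"
proof -
  have "ip N (unitv j) (f l) = f l j" if "l < k" for l
    using orthonormal_Rn[OF assms that] by (auto simp: ip_unitv_left Rn_iff)
  then show ?thesis
    using orth_proj_lin_span[OF assms, of "unitv j"]
    by (simp add: proj_matrix_def unitv_def[symmetric] lincomb_def mult.commute)
qed

lemma orth_proj_matrix:
  assumes "E \<in> grassmannian_codim N n"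
  shows "orth_proj N E x i = (\<Sum>j<N. proj_matrix N E i j * x j)"
proof -
  obtain f where f: "orthonormal N (N - n) f" "E = lin_span (N - n) f"
    using grassmannian_obtain_orthonormal[OF assms] .
  show ?thesis
    unfolding f(2) orth_proj_lin_span[OF f(1)] proj_matrix_lin_span[OF f(1)] lincomb_def ip_def sum_distrib_right
    by (subst sum.swap) (simp add: mult_ac)
qed

lemma orth_proj_in: "E \<in> grassmannian_codim N n \<Longrightarrow> orth_proj N E x \<in> E"
  by (metis grassmannian_obtain_orthonormal orth_proj_lin_span lin_span_lincomb)

lemma orth_proj_id: "E \<in> grassmannian_codim N n \<Longrightarrow> x \<in> E \<Longrightarrow> orth_proj N E x = x"
  by (metis grassmannian_obtain_orthonormal orth_proj_lin_span orthonormal_lincomb_coeff)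

text \<open>The columns of an orthonormal basis are again orthonormal: expand a unit coordinate
  vector in the basis and read off one coordinate.\<close>

lemma orthonormal_complete:
  assumes "orthonormal N N f" "i < N" "j < N"
  shows "(\<Sum>l<N. f l i * f l j) = (if i = j then 1 else 0)"
proof -
  have "unitv j \<in> lin_span N f" using assms by (auto simp: lin_span_orthonormal_full Rn_iff unitv_def)
  from fun_cong[OF orthonormal_lincomb_coeff[OF assms(1) this], of i]
  show ?thesis using assms by (simp add: lincomb_def ip_unitv_left unitv_apply mult.commute)
qed

section \<open>The action of orthogonal matrices\<close>

lemma mat_apply_Rn: "mat_apply N Q x \<in> Rn N"
  by (simp add: Rn_iff mat_apply_def)

lemma mat_apply_lincomb:
  "mat_apply N Q (lincomb k c f) = lincomb k c (\<lambda>l. mat_apply N Q (f l))"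
proof
  fix i
  have "(\<Sum>j<N. Q i j * (\<Sum>l<k. c l * f l j)) = (\<Sum>l<k. c l * (\<Sum>j<N. Q i j * f l j))"
    unfolding sum_distrib_left by (subst sum.swap) (simp add: mult_ac)
  then show "mat_apply N Q (lincomb k c f) i = lincomb k c (\<lambda>l. mat_apply N Q (f l)) i"
    by (simp add: mat_apply_def lincomb_def)
qed

lemma mat_apply_lin_span: "mat_apply N Q ` lin_span k f = lin_span k (\<lambda>l. mat_apply N Q (f l))"
  by (simp add: lin_span_def image_image mat_apply_lincomb)

lemma ip_mat_apply:
  assumes "orthogonal_mat N Q"
  shows "ip N (mat_apply N Q x) (mat_apply N Q y) = ip N x y"
proof -
  have "ip N (mat_apply N Q x) (mat_apply N Q y)
      = (\<Sum>k<N. \<Sum>i<N. \<Sum>j<N. (Q k i * Q k j) * (x i * y j))"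
    by (simp add: ip_def mat_apply_def sum_product mult_ac)
  also have "\<dots> = (\<Sum>i<N. \<Sum>j<N. (\<Sum>k<N. Q k i * Q k j) * (x i * y j))"
    unfolding sum_distrib_right by (subst sum.swap, rule sum.cong[OF refl], rule sum.swap)
  also have "\<dots> = (\<Sum>i<N. \<Sum>j<N. (if i = j then 1 else 0) * (x i * y j))"
    using assms by (auto simp: orthogonal_mat_def intro!: sum.cong)
  also have "\<dots> = ip N x y"
    by (auto simp: ip_def if_distrib[of "\<lambda>x. x * _"] cong: if_cong)
  finally show ?thesis .
qed

lemma orthonormal_mat_apply: "orthogonal_mat N Q \<Longrightarrow> orthonormal N k f \<Longrightarrow> orthonormal N k (\<lambda>l. mat_apply N Q (f l))"
  by (simp add: orthonormal_def mat_apply_Rn ip_mat_apply)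

lemma orthonormal_transitive:
  assumes f: "orthonormal N k f" and g: "orthonormal N k g"
  shows "\<exists>Q. orthogonal_mat N Q \<and> (\<forall>l<k. mat_apply N Q (f l) = g l)"
proof -
  obtain f' g' where f': "orthonormal N N f'" "\<forall>l<k. f' l = f l" and g': "orthonormal N N g'" "\<forall>l<k. g' l = g l"
    using orthonormal_extend_full f g by metis
  \<comment> \<open>The linear map that carries the first completed basis to the second, written as
    a sum of outer products.\<close>
  define Q where "Q = (\<lambda>i j. \<Sum>l<N. g' l i * f' l j)"
  have kN: "k \<le> N" using orthonormal_card_le[OF f] .
  have Q: "mat_apply N Q (f' l) = g' l" if l: "l < N" for l
  proof (rule Rn_eqI[OF mat_apply_Rn orthonormal_Rn[OF g'(1) l]])
    fix i assume i: "i < N"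
    have "mat_apply N Q (f' l) i = (\<Sum>m<N. g' m i * ip N (f' m) (f' l))"
      using i unfolding mat_apply_def Q_def ip_def sum_distrib_right sum_distrib_left
      by (simp, subst sum.swap) (simp add: mult_ac)
    then show "mat_apply N Q (f' l) i = g' l i"
      using l by (simp add: orthonormal_ip[OF f'(1)] if_distrib[of "\<lambda>x. _ * x"] cong: if_cong)
  qed
  have "orthogonal_mat N Q"
    unfolding orthogonal_mat_def
  proof (intro allI impI)
    fix i j assume ij: "i < N" "j < N"
    have "(\<Sum>k<N. Q k i * Q k j) = (\<Sum>k<N. \<Sum>l<N. \<Sum>m<N. (g' l k * g' m k) * (f' l i * f' m j))"
      by (simp add: Q_def sum_product mult_ac)
    also have "\<dots> = (\<Sum>l<N. \<Sum>m<N. ip N (g' l) (g' m) * (f' l i * f' m j))"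
      unfolding ip_def sum_distrib_right by (subst sum.swap, rule sum.cong[OF refl], rule sum.swap)
    also have "\<dots> = (\<Sum>l<N. f' l i * f' l j)"
      by (simp add: orthonormal_ip[OF g'(1)] if_distrib[of "\<lambda>x. x * _"] cong: if_cong)
    finally show "(\<Sum>k<N. Q k i * Q k j) = (if i = j then 1 else 0)"
      using orthonormal_complete[OF f'(1) ij] by simp
  qed
  moreover have "mat_apply N Q (f l) = g l" if "l < k" for l
    using Q[of l] that kN f'(2) g'(2) by simp
  ultimately show ?thesis by blast
qed

lemma orthonormal_perp:
  assumes "orthonormal N N g" "k \<le> N"
  shows "{x \<in> Rn N. \<forall>l<k. ip N x (g l) = 0} = lin_span (N - k) (\<lambda>l. g (k + l))"
proof -
  have split: "lincomb N c g = lincomb (N - k) (\<lambda>l. c (k + l)) (\<lambda>l. g (k + l))"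
    if "\<And>l. l < k \<Longrightarrow> c l = 0" for c
  proof
    fix i
    have "(\<Sum>l<N. c l * g l i) = (\<Sum>l\<in>{k..<N}. c l * g l i)"
      by (rule sum.mono_neutral_right) (use that in auto)
    also have "\<dots> = (\<Sum>l<N - k. c (k + l) * g (k + l) i)"
      by (rule sum.reindex_bij_witness[of _ "\<lambda>l. k + l" "\<lambda>l. l - k"]) auto
    finally show "lincomb N c g i = lincomb (N - k) (\<lambda>l. c (k + l)) (\<lambda>l. g (k + l)) i"
      by (simp add: lincomb_def)
  qed
  show ?thesis
  proof (intro equalityI subsetI)
    fix x assume x: "x \<in> {x \<in> Rn N. \<forall>l<k. ip N x (g l) = 0}"
    then have "x = lincomb N (\<lambda>l. ip N x (g l)) g"
      using orthonormal_lincomb_coeff[OF assms(1)] lin_span_orthonormal_full[OF assms(1)] by auto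
    also have "\<dots> = lincomb (N - k) (\<lambda>l. ip N x (g (k + l))) (\<lambda>l. g (k + l))"
      using x by (intro split) auto
    finally show "x \<in> lin_span (N - k) (\<lambda>l. g (k + l))" by (metis lin_span_lincomb)
  next
    fix x assume "x \<in> lin_span (N - k) (\<lambda>l. g (k + l))"
    then obtain c where "x = lincomb (N - k) c (\<lambda>l. g (k + l))" by (auto simp: lin_span_def)
    then show "x \<in> {x \<in> Rn N. \<forall>l<k. ip N x (g l) = 0}"
      using assms orthonormal_Rn[OF assms(1)] lincomb_Rn[of "N - k" "\<lambda>l. g (k + l)" N c]
      by (auto simp: ip_lincomb_left orthonormal_ip[OF assms(1)] intro!: sum.neutral)
  qed
qed

section \<open>Gram--Schmidt orthogonalisation and the Grassmannian\<close>

text \<open>A vanishing residual is divided by \<open>sqrt 0\<close>, which gives the zero vector.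
  The recursion thus makes sense for dependent rows too, and \<open>gs_ok\<close> records that this
  default does not occur.\<close>

fun gs :: "nat \<Rightarrow> (nat \<Rightarrow> nat \<Rightarrow> real) \<Rightarrow> nat \<Rightarrow> nat \<Rightarrow> real" where
  "gs N r k = (let v = (\<lambda>i. r k i - (\<Sum>l<k. ip N (r k) (gs N r l) * gs N r l i))
     in (\<lambda>i. v i / sqrt (ip N v v)))"

declare gs.simps [simp del]

definition gs_residual :: "nat \<Rightarrow> (nat \<Rightarrow> nat \<Rightarrow> real) \<Rightarrow> nat \<Rightarrow> nat \<Rightarrow> real"
  where "gs_residual N r k = (\<lambda>i. r k i - lincomb k (\<lambda>l. ip N (r k) (gs N r l)) (gs N r) i)"

definition gs_ok :: "nat \<Rightarrow> nat \<Rightarrow> (nat \<Rightarrow> nat \<Rightarrow> real) \<Rightarrow> bool"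
  where "gs_ok N k r \<longleftrightarrow> (\<forall>l<k. ip N (gs_residual N r l) (gs_residual N r l) \<noteq> 0)"

lemma gs_eq: "gs N r k = (\<lambda>i. gs_residual N r k i / sqrt (ip N (gs_residual N r k) (gs_residual N r k)))"
  by (subst gs.simps) (simp add: gs_residual_def lincomb_def Let_def)

lemma gs_cong: "(\<And>l. l \<le> k \<Longrightarrow> r l = r' l) \<Longrightarrow> gs N r k = gs N r' k"
proof (induction k rule: less_induct)
  case (less k)
  have "gs N r l = gs N r' l" if "l < k" for l
    by (rule less.IH[OF that]) (use less.prems that in auto)
  moreover have "r k = r' k" using less.prems by simp
  ultimately have "gs_residual N r k = gs_residual N r' k"
    by (simp add: gs_residual_def lincomb_def)
  then show ?case by (simp only: gs_eq[of N _ k])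
qed

lemma gs_residual_cong: "(\<And>l. l \<le> k \<Longrightarrow> r l = r' l) \<Longrightarrow> gs_residual N r k = gs_residual N r' k"
proof -
  assume *: "\<And>l. l \<le> k \<Longrightarrow> r l = r' l"
  have "gs N r l = gs N r' l" if "l < k" for l
    by (rule gs_cong) (use * that in auto)
  moreover have "r k = r' k" using * by simp
  ultimately show ?thesis by (simp add: gs_residual_def lincomb_def)
qed

lemma gs_Rn: "(\<And>l. l \<le> k \<Longrightarrow> r l \<in> Rn N) \<Longrightarrow> gs N r k \<in> Rn N"
proof (induction k rule: less_induct)
  case (less k)
  have "lincomb k (\<lambda>l. ip N (r k) (gs N r l)) (gs N r) \<in> Rn N"
    by (rule lincomb_Rn) (use less in auto)
  then show ?case using less.prems[of k] by (auto simp: gs_eq[of N r k] gs_residual_def Rn_iff)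
qed

lemma gs_orthonormal:
  assumes "\<And>l. l < k \<Longrightarrow> r l \<in> Rn N" "gs_ok N k r" shows "orthonormal N k (gs N r)"
  using assms
proof (induction k)
  case 0 then show ?case by (simp add: orthonormal_def)
next
  case (Suc k)
  have on: "orthonormal N k (gs N r)" using Suc by (auto simp: gs_ok_def)
  have ok: "ip N (gs_residual N r k) (gs_residual N r k) \<noteq> 0" using Suc.prems(2) by (auto simp: gs_ok_def)
  have "orthonormal N (Suc k) ((gs N r)(k := gs N r k))"
  proof (rule orthonormal_Suc[OF on gs_Rn])
    show "ip N (gs N r k) (gs N r k) = 1"
      using ok ip_self_nonneg[of N "gs_residual N r k"] by (simp add: gs_eq ip_divide_left ip_divide_right)
    show "ip N (gs N r k) (gs N r l) = 0" if "l < k" for l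
      unfolding gs_eq[of N r k] ip_divide_left
      using orthonormal_residual[OF on that, of "r k"] by (simp add: gs_residual_def)
  qed (use Suc.prems(1) in auto)
  then show ?case by simp
qed

lemma gs_row_in_lin_span:
  assumes "gs_ok N k r" "l < k" shows "r l \<in> lin_span k (gs N r)"
proof -
  have ok: "ip N (gs_residual N r l) (gs_residual N r l) \<noteq> 0" using assms by (auto simp: gs_ok_def)
  define s where "s = sqrt (ip N (gs_residual N r l) (gs_residual N r l))"
  have s: "s \<noteq> 0" using ok by (simp add: s_def)
  let ?c = "\<lambda>m. if m < l then ip N (r l) (gs N r m) else if m = l then s else 0"
  have "lincomb k ?c (gs N r) = r l"
  proof
    fix i
    have "lincomb k ?c (gs N r) i = (\<Sum>m<Suc l. ?c m * gs N r m i)"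
      unfolding lincomb_def by (rule sum.mono_neutral_right) (use assms(2) in auto)
    also have "\<dots> = lincomb l (\<lambda>m. ip N (r l) (gs N r m)) (gs N r) i + s * gs N r l i"
      by (simp add: lincomb_def)
    also have "s * gs N r l i = gs_residual N r l i"
      using s by (simp add: gs_eq[of N r l] s_def[symmetric])
    finally show "lincomb k ?c (gs N r) i = r l i" by (simp add: gs_residual_def)
  qed
  then show ?thesis by (metis lin_span_lincomb)
qed

lemma gs_perp:
  assumes "\<And>l. l < k \<Longrightarrow> ip N y (r l) = 0" shows "l < k \<Longrightarrow> ip N y (gs N r l) = 0"
proof (induction l rule: less_induct)
  case (less l)
  then have "ip N y (gs_residual N r l) = 0"
    using assms by (simp add: gs_residual_def ip_diff_right ip_lincomb_right)
  then show ?case by (simp add: gs_eq ip_divide_right)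
qed

lemma mat_apply_diff: "mat_apply N Q (\<lambda>i. x i - y i) = (\<lambda>i. mat_apply N Q x i - mat_apply N Q y i)"
  by (auto simp: mat_apply_def right_diff_distrib sum_subtractf)

lemma mat_apply_divide: "mat_apply N Q (\<lambda>i. x i / c) = (\<lambda>i. mat_apply N Q x i / c)"
  by (auto simp: mat_apply_def sum_divide_distrib)

text \<open>Gram--Schmidt uses only inner products and linear combinations, and an orthogonal matrix
  respects both. This equivariance is what makes spans and kernels of Gaussian matrices invariant in
  law.\<close>

lemma gs_mat_apply:
  assumes "orthogonal_mat N Q"
  shows "gs N (\<lambda>l. mat_apply N Q (r l)) k = mat_apply N Q (gs N r k)"
    and "gs_residual N (\<lambda>l. mat_apply N Q (r l)) k = mat_apply N Q (gs_residual N r k)"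
proof -
  have "gs N (\<lambda>l. mat_apply N Q (r l)) k = mat_apply N Q (gs N r k) \<and>
     gs_residual N (\<lambda>l. mat_apply N Q (r l)) k = mat_apply N Q (gs_residual N r k)"
  proof (induction k rule: less_induct)
    case (less k)
    have "lincomb k (\<lambda>l. ip N (mat_apply N Q (r k)) (gs N (\<lambda>l. mat_apply N Q (r l)) l)) (gs N (\<lambda>l. mat_apply N Q (r l)))
       = lincomb k (\<lambda>l. ip N (r k) (gs N r l)) (\<lambda>l. mat_apply N Q (gs N r l))"
      using less by (simp add: lincomb_def ip_mat_apply[OF assms])
    then have *: "gs_residual N (\<lambda>l. mat_apply N Q (r l)) k = mat_apply N Q (gs_residual N r k)"
      by (simp add: gs_residual_def mat_apply_diff mat_apply_lincomb)
    then show ?case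
      by (simp add: gs_eq[of N _ k] mat_apply_divide ip_mat_apply[OF assms])
  qed
  then show "gs N (\<lambda>l. mat_apply N Q (r l)) k = mat_apply N Q (gs N r k)"
    "gs_residual N (\<lambda>l. mat_apply N Q (r l)) k = mat_apply N Q (gs_residual N r k)" by auto
qed

lemma gs_ok_mat_apply:
  "orthogonal_mat N Q \<Longrightarrow> gs_ok N k (\<lambda>l. mat_apply N Q (r l)) = gs_ok N k r"
  by (simp add: gs_ok_def gs_mat_apply ip_mat_apply)

section \<open>The Borel sets of the Grassmannian and the distance of projections\<close>

lemma space_grassmannian_borel: "space (grassmannian_borel N n) = grassmannian_codim N n"
  by (simp add: grassmannian_borel_def space_measure_of_conv)

lemma openin_grassmannian:
  "openin (grassmannian_topology N n) U \<longleftrightarrow>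
    (\<exists>V. open V \<and> U = proj_matrix N -` V \<inter> grassmannian_codim N n)"
  by (simp add: grassmannian_topology_def openin_pullback_topology)

lemma sets_grassmannian_borel:
  "sets (grassmannian_borel N n) = sigma_sets (grassmannian_codim N n)
     {U. openin (grassmannian_topology N n) U}"
  unfolding grassmannian_borel_def
  by (rule sets_measure_of) (auto simp: openin_grassmannian)

lemma measurable_proj_matrix_full:
  "proj_matrix N \<in> borel_measurable (grassmannian_borel N n)"
proof (rule borel_measurableI)
  fix S :: "(nat \<Rightarrow> nat \<Rightarrow> real) set" assume "open S"
  then have "openin (grassmannian_topology N n) (proj_matrix N -` S \<inter> grassmannian_codim N n)"
    by (auto simp: openin_grassmannian)
  then show "proj_matrix N -` S \<inter> space (grassmannian_borel N n) \<in> sets (grassmannian_borel N n)"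
    by (auto simp: sets_grassmannian_borel space_grassmannian_borel)
qed

lemma measurable_proj_matrix:
  "(\<lambda>E. proj_matrix N E i j) \<in> borel_measurable (grassmannian_borel N n)"
  by (rule measurable_product_then_coordinatewise[OF measurable_product_then_coordinatewise[OF measurable_proj_matrix_full]])

text \<open>The topology is pulled back from matrices, which carry entrywise convergence in
  countably many entries, so measurability can be tested entry by entry.\<close>

lemma measurable_grassmannian:
  assumes "\<And>x. x \<in> space M \<Longrightarrow> f x \<in> grassmannian_codim N n"
    and "\<And>i j. (\<lambda>x. proj_matrix N (f x) i j) \<in> borel_measurable M"
  shows "f \<in> measurable M (grassmannian_borel N n)"
  unfolding grassmannian_borel_def
proof (rule measurable_measure_of)
  have full: "(\<lambda>x. proj_matrix N (f x)) \<in> borel_measurable M"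
    by (intro measurable_coordinatewise_then_product assms(2))
  fix y assume "y \<in> {U. openin (grassmannian_topology N n) U}"
  then obtain V where V: "open V" "y = proj_matrix N -` V \<inter> grassmannian_codim N n"
    by (auto simp: openin_grassmannian)
  have "f -` y \<inter> space M = (\<lambda>x. proj_matrix N (f x)) -` V \<inter> space M"
    using assms(1) by (auto simp: V(2))
  also have "\<dots> \<in> sets M" using full V(1) by measurable
  finally show "f -` y \<inter> space M \<in> sets M" .
qed (use assms(1) in \<open>auto simp: openin_grassmannian\<close>)

lemma proj_matrix_outside:
  assumes "E \<in> grassmannian_codim N n" "N \<le> i \<or> N \<le> j"
  shows "proj_matrix N E i j = 0"
proof -
  obtain f where f: "orthonormal N (N - n) f" "E = lin_span (N - n) f"
    using grassmannian_obtain_orthonormal[OF assms(1)] .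
  show ?thesis
    unfolding f(2) proj_matrix_lin_span[OF f(1)]
    using orthonormal_Rn[OF f(1)] assms(2) by (intro sum.neutral) (auto simp: Rn_iff)
qed

text \<open>The squared Hilbert--Schmidt distance of the projections. The square root is never taken
  because only balls matter, not the triangle inequality.\<close>

definition proj_dist :: "nat \<Rightarrow> (nat \<Rightarrow> real) set \<Rightarrow> (nat \<Rightarrow> real) set \<Rightarrow> real"
  where "proj_dist N E F = (\<Sum>i<N. \<Sum>j<N. (proj_matrix N E i j - proj_matrix N F i j)\<^sup>2)"

text \<open>Expand the square as tr P + tr Q - 2 tr PQ for the two projections. Only inner products
  between the two bases remain, whence the invariance under orthogonal matrices.\<close>

lemma proj_dist_lin_span:
  assumes f: "orthonormal N k f" and g: "orthonormal N k g"
  shows "proj_dist N (lin_span k f) (lin_span k g) = 2 * real k - 2 * (\<Sum>l<k. \<Sum>m<k. (ip N (f l) (g m))\<^sup>2)"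
proof -
  have cross: "(\<Sum>i<N. \<Sum>j<N. (\<Sum>l<k. a l i * a l j) * (\<Sum>m<k. b m i * b m j))
      = (\<Sum>l<k. \<Sum>m<k. (ip N (a l) (b m))\<^sup>2)" for a b :: "nat \<Rightarrow> nat \<Rightarrow> real"
  proof -
    have "(\<Sum>i<N. \<Sum>j<N. (\<Sum>l<k. a l i * a l j) * (\<Sum>m<k. b m i * b m j))
       = (\<Sum>i<N. \<Sum>j<N. \<Sum>l<k. \<Sum>m<k. (a l i * b m i) * (a l j * b m j))"
      by (simp add: sum_product mult_ac)
    also have "\<dots> = (\<Sum>i<N. \<Sum>l<k. \<Sum>m<k. \<Sum>j<N. (a l i * b m i) * (a l j * b m j))"
      by (rule sum.cong[OF refl], subst sum.swap, rule sum.cong[OF refl], rule sum.swap)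
    also have "\<dots> = (\<Sum>l<k. \<Sum>m<k. \<Sum>i<N. \<Sum>j<N. (a l i * b m i) * (a l j * b m j))"
      by (subst sum.swap, rule sum.cong[OF refl], rule sum.swap)
    also have "\<dots> = (\<Sum>l<k. \<Sum>m<k. (ip N (a l) (b m))\<^sup>2)"
      by (simp add: ip_def power2_eq_square sum_product)
    finally show ?thesis .
  qed
  have expand: "(\<Sum>i<N. \<Sum>j<N. (u i j - v i j)\<^sup>2) = (\<Sum>i<N. \<Sum>j<N. u i j * u i j)
      + (\<Sum>i<N. \<Sum>j<N. v i j * v i j) - 2 * (\<Sum>i<N. \<Sum>j<N. u i j * v i j)"
    for u v :: "nat \<Rightarrow> nat \<Rightarrow> real"
    unfolding sum_distrib_left sum.distrib[symmetric] sum_subtractf[symmetric]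
    by (intro sum.cong refl) (simp add: power2_eq_square algebra_simps)
  have self: "(\<Sum>l<k. \<Sum>m<k. (ip N (a l) (a m))\<^sup>2) = real k" if "orthonormal N k a" for a
    by (simp add: orthonormal_ip[OF that] if_distrib[of "\<lambda>x. x\<^sup>2"] cong: if_cong)
  have "proj_dist N (lin_span k f) (lin_span k g) =
      (\<Sum>i<N. \<Sum>j<N. (\<Sum>l<k. f l i * f l j) * (\<Sum>m<k. f m i * f m j))
    + (\<Sum>i<N. \<Sum>j<N. (\<Sum>l<k. g l i * g l j) * (\<Sum>m<k. g m i * g m j))
    - 2 * (\<Sum>i<N. \<Sum>j<N. (\<Sum>l<k. f l i * f l j) * (\<Sum>m<k. g m i * g m j))"
    unfolding proj_dist_def proj_matrix_lin_span[OF f] proj_matrix_lin_span[OF g] by (rule expand)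
  then show ?thesis unfolding cross by (simp add: self[OF f] self[OF g])
qed

lemma proj_dist_mat_apply:
  assumes "orthogonal_mat N Q" "E \<in> grassmannian_codim N n" "F \<in> grassmannian_codim N n"
  shows "proj_dist N (mat_apply N Q ` E) (mat_apply N Q ` F) = proj_dist N E F"
proof -
  obtain f where f: "orthonormal N (N - n) f" "E = lin_span (N - n) f"
    using grassmannian_obtain_orthonormal[OF assms(2)] .
  obtain g where g: "orthonormal N (N - n) g" "F = lin_span (N - n) g"
    using grassmannian_obtain_orthonormal[OF assms(3)] .
  show ?thesis
    unfolding f(2) g(2) mat_apply_lin_span proj_dist_lin_span[OF f(1) g(1)]
      proj_dist_lin_span[OF orthonormal_mat_apply[OF assms(1) f(1)] orthonormal_mat_apply[OF assms(1) g(1)]]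
    by (simp add: ip_mat_apply[OF assms(1)])
qed

lemma grassmannian_le: "E \<in> grassmannian_codim N n \<Longrightarrow> n \<le> N"
  by (auto simp: grassmannian_codim_def)

lemma mat_apply_grassmannian:
  assumes "orthogonal_mat N Q" "E \<in> grassmannian_codim N n"
  shows "mat_apply N Q ` E \<in> grassmannian_codim N n"
proof -
  obtain f where f: "orthonormal N (N - n) f" "E = lin_span (N - n) f"
    using grassmannian_obtain_orthonormal[OF assms(2)] .
  then show ?thesis
    unfolding f(2) mat_apply_lin_span
    by (intro lin_span_in_grassmannian orthonormal_mat_apply assms(1)) (use grassmannian_le[OF assms(2)] in auto)
qed

lemma grassmannian_transitive:
  assumes "E \<in> grassmannian_codim N n" "F \<in> grassmannian_codim N n"
  shows "\<exists>Q. orthogonal_mat N Q \<and> mat_apply N Q ` E = F"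
proof -
  obtain f where f: "orthonormal N (N - n) f" "E = lin_span (N - n) f"
    using grassmannian_obtain_orthonormal[OF assms(1)] .
  obtain g where g: "orthonormal N (N - n) g" "F = lin_span (N - n) g"
    using grassmannian_obtain_orthonormal[OF assms(2)] .
  obtain Q where "orthogonal_mat N Q" "\<forall>l<N - n. mat_apply N Q (f l) = g l"
    using orthonormal_transitive[OF f(1) g(1)] by blast
  then show ?thesis
    unfolding f(2) g(2) mat_apply_lin_span
    by (intro exI[of _ Q] conjI lin_span_cong) auto
qed

lemma orthogonal_mat_rows:
  assumes "orthogonal_mat N Q" "i < N" "j < N"
  shows "(\<Sum>k<N. Q i k * Q j k) = (if i = j then 1 else 0)"
proof -
  have "orthonormal N N (\<lambda>l i. if i < N then Q i l else 0)"
    using assms(1) by (auto simp: orthonormal_def ip_def Rn_iff orthogonal_mat_def)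
  from orthonormal_complete[OF this assms(2,3)] show ?thesis using assms(2,3) by simp
qed

lemma orthogonal_mat_transpose: "orthogonal_mat N Q \<Longrightarrow> orthogonal_mat N (\<lambda>i j. Q j i)"
  using orthogonal_mat_rows[of N Q] by (simp add: orthogonal_mat_def)

lemma mat_apply_transpose:
  assumes "orthogonal_mat N Q" "x \<in> Rn N"
  shows "mat_apply N Q (mat_apply N (\<lambda>i j. Q j i) x) = x"
proof (rule Rn_eqI[OF mat_apply_Rn assms(2)])
  fix i assume i: "i < N"
  have "mat_apply N Q (mat_apply N (\<lambda>i j. Q j i) x) i = (\<Sum>j<N. \<Sum>k<N. Q i j * Q k j * x k)"
    using i by (simp add: mat_apply_def sum_distrib_left mult.assoc)
  also have "\<dots> = (\<Sum>k<N. (\<Sum>j<N. Q i j * Q k j) * x k)"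
    by (subst sum.swap) (simp add: sum_distrib_right)
  also have "\<dots> = x i"
    using i by (simp add: orthogonal_mat_rows[OF assms(1)] if_distrib[of "\<lambda>x. x * _"] cong: if_cong)
  finally show "mat_apply N Q (mat_apply N (\<lambda>i j. Q j i) x) i = x i" .
qed

text \<open>Invariance of the distance gives one inclusion; for the other a point is moved back with
  the transposed matrix.\<close>

lemma mat_apply_ball:
  assumes Q: "orthogonal_mat N Q" and E: "E \<in> grassmannian_codim N n"
  shows "(\<lambda>F. mat_apply N Q ` F) ` {F \<in> grassmannian_codim N n. proj_dist N E F < r}
     = {F \<in> grassmannian_codim N n. proj_dist N (mat_apply N Q ` E) F < r}"
proof (intro equalityI subsetI)
  fix F assume "F \<in> (\<lambda>F. mat_apply N Q ` F) ` {F \<in> grassmannian_codim N n. proj_dist N E F < r}"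
  then show "F \<in> {F \<in> grassmannian_codim N n. proj_dist N (mat_apply N Q ` E) F < r}"
    using proj_dist_mat_apply[OF Q E] mat_apply_grassmannian[OF Q] by auto
next
  fix F assume F: "F \<in> {F \<in> grassmannian_codim N n. proj_dist N (mat_apply N Q ` E) F < r}"
  define F' where "F' = mat_apply N (\<lambda>i j. Q j i) ` F"
  have F': "F' \<in> grassmannian_codim N n"
    unfolding F'_def by (rule mat_apply_grassmannian[OF orthogonal_mat_transpose[OF Q]]) (use F in auto)
  have "F \<subseteq> Rn N" using F by (auto simp: grassmannian_codim_def)
  then have FF: "mat_apply N Q ` F' = F"
    unfolding F'_def image_image using mat_apply_transpose[OF Q]
    by (metis (no_types, lifting) image_cong image_ident subsetD)
  then have "proj_dist N E F' < r" using F proj_dist_mat_apply[OF Q E F'] by simp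
  then show "F \<in> (\<lambda>F. mat_apply N Q ` F) ` {F \<in> grassmannian_codim N n. proj_dist N E F < r}"
    using F' FF by blast
qed

section \<open>Uniqueness of ball-invariant probability measures\<close>

text \<open>Coordinates are kept abstract because the comparison of measures below is used twice: on
  the Grassmannian with the entries of the projection matrix, and on Euclidean space with the usual
  coordinates.\<close>

definition coord_box_gen :: "'a set \<Rightarrow> 'i set \<Rightarrow> ('i \<Rightarrow> 'a \<Rightarrow> real) \<Rightarrow> 'a set set"
  where "coord_box_gen \<Omega> I c = {{x \<in> \<Omega>. \<forall>i\<in>I. c i x \<in> V i} |V. \<forall>i. open (V i :: real set)}"

definition coord_dist :: "'i set \<Rightarrow> ('i \<Rightarrow> 'a \<Rightarrow> real) \<Rightarrow> 'a \<Rightarrow> 'a \<Rightarrow> real"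
  where "coord_dist I c x y = (\<Sum>i\<in>I. (c i x - c i y)\<^sup>2)"

definition coord_ball :: "'a measure \<Rightarrow> 'i set \<Rightarrow> ('i \<Rightarrow> 'a \<Rightarrow> real) \<Rightarrow> 'a \<Rightarrow> real \<Rightarrow> 'a set"
  where "coord_ball M I c x r = {y \<in> space M. coord_dist I c x y < r}"

lemma coord_dist_commute: "coord_dist I c x y = coord_dist I c y x"
  by (simp add: coord_dist_def power2_commute)

lemma coord_box_gen_subset: "coord_box_gen \<Omega> I c \<subseteq> Pow \<Omega>"
  by (auto simp: coord_box_gen_def)

lemma Int_stable_coord_box_gen: "Int_stable (coord_box_gen \<Omega> I c)"
proof (rule Int_stableI)
  fix a b assume "a \<in> coord_box_gen \<Omega> I c" "b \<in> coord_box_gen \<Omega> I c"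
  then obtain V W where "a = {x \<in> \<Omega>. \<forall>i\<in>I. c i x \<in> V i}" "\<forall>i. open (V i)"
    "b = {x \<in> \<Omega>. \<forall>i\<in>I. c i x \<in> W i}" "\<forall>i. open (W i)"
    by (auto simp: coord_box_gen_def)
  then show "a \<inter> b \<in> coord_box_gen \<Omega> I c"
    unfolding coord_box_gen_def by (intro CollectI exI[of _ "\<lambda>i. V i \<inter> W i"]) auto
qed

lemma coord_box_gen_coord_dist_open:
  assumes "finite I" "U \<in> coord_box_gen \<Omega> I c" "x \<in> U"
  shows "\<exists>r>0. \<forall>y\<in>\<Omega>. coord_dist I c x y < r \<longrightarrow> y \<in> U"
proof -
  obtain V where V: "U = {x \<in> \<Omega>. \<forall>i\<in>I. c i x \<in> V i}" "\<And>i. open (V i)"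
    using assms(2) by (auto simp: coord_box_gen_def)
  have "\<exists>\<delta>>0. \<forall>y. \<bar>c i x - y\<bar> < \<delta> \<longrightarrow> y \<in> V i" if "i \<in> I" for i
  proof -
    have "c i x \<in> V i" using assms(3) that V(1) by auto
    then obtain d where "d > 0" "\<And>y. dist y (c i x) < d \<Longrightarrow> y \<in> V i"
      using V(2)[of i] by (auto simp: open_dist)
    then show ?thesis by (intro exI[of _ d]) (auto simp: dist_real_def abs_minus_commute)
  qed
  then obtain \<delta> where \<delta>: "\<And>i. i \<in> I \<Longrightarrow> \<delta> i > 0" "\<And>i y. i \<in> I \<Longrightarrow> \<bar>c i x - y\<bar> < \<delta> i \<Longrightarrow> y \<in> V i"
    by metis
  \<comment> \<open>The element 1 keeps \<open>Min\<close> defined for an empty index set; squares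
    appear because \<open>coord_dist\<close> is a squared distance.\<close>
  define r where "r = Min (insert 1 ((\<lambda>i. (\<delta> i)\<^sup>2) ` I))"
  have "r > 0" unfolding r_def using \<delta>(1) assms(1) by (subst Min_gr_iff) (auto simp: less_imp_neq[symmetric])
  moreover have "y \<in> U" if y: "y \<in> \<Omega>" "coord_dist I c x y < r" for y
  proof -
    have "c i y \<in> V i" if i: "i \<in> I" for i
    proof (rule \<delta>(2)[OF i])
      have "(c i x - c i y)\<^sup>2 \<le> coord_dist I c x y"
        unfolding coord_dist_def by (rule member_le_sum[OF i]) (use assms(1) in auto)
      also have "\<dots> < (\<delta> i)\<^sup>2"
        using y(2) Min_le[of "insert 1 ((\<lambda>i. (\<delta> i)\<^sup>2) ` I)" "(\<delta> i)\<^sup>2"] assms(1) i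
        unfolding r_def by auto
      finally have "\<bar>c i x - c i y\<bar>\<^sup>2 < (\<delta> i)\<^sup>2" by simp
      then show "\<bar>c i x - c i y\<bar> < \<delta> i" using \<delta>(1)[OF i] power2_less_imp_less by fastforce
    qed
    then show ?thesis using y(1) V(1) by auto
  qed
  ultimately show ?thesis by blast
qed

text \<open>Christensen's argument: averaging the measure of small balls with respect to the
  other measure compares two measures for which the measure of a ball does not depend on its centre.\<close>

lemma uniformly_distributed_le:
  fixes M M' :: "'a measure" and c :: "'i \<Rightarrow> 'a \<Rightarrow> real" and g h :: "nat \<Rightarrow> ennreal"
  assumes I: "finite I" and M: "sigma_finite_measure M" and M': "sigma_finite_measure M'"
    and sets: "sets M' = sets M"
    and c[measurable]: "\<And>i. i \<in> I \<Longrightarrow> c i \<in> borel_measurable M"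
    and g: "\<And>x n. x \<in> space M \<Longrightarrow> emeasure M (coord_ball M I c x (e n)) = g n"
    and h: "\<And>x n. x \<in> space M \<Longrightarrow> emeasure M' (coord_ball M I c x (e n)) = h n"
    and h0: "\<And>n. h n > 0" "\<And>n. h n < \<infinity>"
    and e: "e \<longlonglongrightarrow> 0"
    and U: "U \<in> coord_box_gen (space M) I c" "U \<in> sets M"
  shows "emeasure M U \<le> liminf (\<lambda>n. g n / h n * emeasure M' U)"
proof -
  interpret M: sigma_finite_measure M by fact
  interpret M': sigma_finite_measure M' by fact
  interpret P: pair_sigma_finite M M' ..
  have space: "space M' = space M" using sets by (rule sets_eq_imp_space_eq)
  note U(2)[measurable]
  have U': "U \<in> sets M'" using U(2) sets by simp
  note U'[measurable]
  have c'[measurable]: "\<And>i. i \<in> I \<Longrightarrow> c i \<in> borel_measurable M'"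
    using c measurable_cong_sets[OF sets refl] by blast
  \<comment> \<open>The indicator of pairs of points of \<open>U\<close> that are close to each
    other. Integrating over the second variable first produces ball measures of \<open>M'\<close>,
    the other order those of \<open>M\<close>.\<close>
  define f where "f n x y = (indicator U x * indicator U y *
      (if coord_dist I c x y < e n then 1 else 0) :: ennreal)" for n x y
  have cd: "(\<lambda>z. coord_dist I c (fst z) (snd z)) \<in> borel_measurable (M \<Otimes>\<^sub>M M')"
    unfolding coord_dist_def by measurable
  have f[measurable]: "(\<lambda>z. f n (fst z) (snd z)) \<in> borel_measurable (M \<Otimes>\<^sub>M M')" for n
    unfolding f_def using cd by measurable
  have f2: "case_prod (f n) \<in> borel_measurable (M \<Otimes>\<^sub>M M')" for n
    using f[of n] by (simp add: case_prod_beta')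
  have cb: "coord_ball M I c x r \<in> sets M" for x r
    unfolding coord_ball_def coord_dist_def by measurable
  have fx: "(\<integral>\<^sup>+y. f n x y \<partial>M') = indicator U x * emeasure M' (U \<inter> coord_ball M I c x (e n))" for n x
  proof -
    have "(\<integral>\<^sup>+y. f n x y \<partial>M') = (\<integral>\<^sup>+y. indicator U x * indicator (U \<inter> coord_ball M I c x (e n)) y \<partial>M')"
      by (rule nn_integral_cong) (auto simp: f_def coord_ball_def space indicator_def)
    also have "\<dots> = indicator U x * emeasure M' (U \<inter> coord_ball M I c x (e n))"
      by (subst nn_integral_cmult) (use cb sets U' in auto)
    finally show ?thesis .
  qed
  have fy: "(\<integral>\<^sup>+x. f n x y \<partial>M) \<le> indicator U y * g n" if y: "y \<in> space M" for n y
  proof -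
    have "(\<integral>\<^sup>+x. f n x y \<partial>M) \<le> (\<integral>\<^sup>+x. indicator U y * indicator (coord_ball M I c y (e n)) x \<partial>M)"
      by (rule nn_integral_mono)
        (auto simp: f_def coord_ball_def indicator_def coord_dist_commute[of I c y])
    also have "\<dots> = indicator U y * g n"
      by (subst nn_integral_cmult) (use cb g[OF y] in auto)
    finally show ?thesis .
  qed
  have "emeasure M U = (\<integral>\<^sup>+x. indicator U x \<partial>M)" using U(2) by simp
  \<comment> \<open>\<open>U\<close> is open, so around each of its points the small balls
    eventually lie inside \<open>U\<close> and the quotient equals 1; Fatou then moves the liminf
    outside the integral.\<close>
  also have "\<dots> \<le> (\<integral>\<^sup>+x. liminf (\<lambda>n. (\<integral>\<^sup>+y. f n x y \<partial>M') / h n) \<partial>M)"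
  proof (rule nn_integral_mono)
    fix x assume x: "x \<in> space M"
    show "indicator U x \<le> liminf (\<lambda>n. (\<integral>\<^sup>+y. f n x y \<partial>M') / h n)"
    proof (cases "x \<in> U")
      case True
      obtain r where r: "r > 0" "\<forall>y\<in>space M. coord_dist I c x y < r \<longrightarrow> y \<in> U"
        using coord_box_gen_coord_dist_open[OF I U(1) True] by blast
      have "eventually (\<lambda>n. 1 \<le> (\<integral>\<^sup>+y. f n x y \<partial>M') / h n) sequentially"
        using order_tendstoD(2)[OF e r(1)]
      proof eventually_elim
        case (elim n)
        then have "U \<inter> coord_ball M I c x (e n) = coord_ball M I c x (e n)"
          using r(2) by (auto simp: coord_ball_def)
        then have "(\<integral>\<^sup>+y. f n x y \<partial>M') = h n" using fx h[OF x] True by simp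
        then show ?case using h0[of n] by (simp add: ennreal_divide_self)
      qed
      then have "1 \<le> liminf (\<lambda>n. (\<integral>\<^sup>+y. f n x y \<partial>M') / h n)" by (rule Liminf_bounded)
      then show ?thesis using True by simp
    qed simp
  qed
  also have "\<dots> \<le> liminf (\<lambda>n. \<integral>\<^sup>+x. (\<integral>\<^sup>+y. f n x y \<partial>M') / h n \<partial>M)"
    by (rule nn_integral_liminf) (use f2 in measurable)
  also have "\<dots> \<le> liminf (\<lambda>n. g n / h n * emeasure M' U)"
  proof (rule Liminf_mono, rule always_eventually, rule allI)
    fix n
    have "(\<integral>\<^sup>+x. (\<integral>\<^sup>+y. f n x y \<partial>M') / h n \<partial>M) = (\<integral>\<^sup>+x. (\<integral>\<^sup>+y. f n x y \<partial>M') \<partial>M) / h n"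
      by (rule nn_integral_divide) (use f2 in measurable)
    also have "(\<integral>\<^sup>+x. (\<integral>\<^sup>+y. f n x y \<partial>M') \<partial>M) = (\<integral>\<^sup>+y. (\<integral>\<^sup>+x. f n x y \<partial>M) \<partial>M')"
      by (rule P.Fubini'[symmetric, OF f2])
    also have "\<dots> \<le> (\<integral>\<^sup>+y. g n * indicator U y \<partial>M')"
      by (rule nn_integral_mono) (use fy space in \<open>auto simp: mult.commute\<close>)
    also have "\<dots> = g n * emeasure M' U" using U' by (simp add: nn_integral_cmult)
    finally show "(\<integral>\<^sup>+x. (\<integral>\<^sup>+y. f n x y \<partial>M') / h n \<partial>M) \<le> g n / h n * emeasure M' U"
      by (simp add: divide_right_mono_ennreal ennreal_times_divide mult.commute)
  qed
  finally show ?thesis .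
qed

section \<open>Ball measures and coordinate boxes on the Grassmannian\<close>

abbreviation proj_coord :: "nat \<Rightarrow> nat \<times> nat \<Rightarrow> (nat \<Rightarrow> real) set \<Rightarrow> real"
  where "proj_coord N \<equiv> \<lambda>ij E. proj_matrix N E (fst ij) (snd ij)"

abbreviation proj_index :: "nat \<Rightarrow> (nat \<times> nat) set"
  where "proj_index N \<equiv> {..<N} \<times> {..<N}"

lemma coord_dist_proj_dist: "coord_dist (proj_index N) (proj_coord N) E F = proj_dist N E F"
  by (simp add: coord_dist_def proj_dist_def sum.cartesian_product case_prod_beta)

text \<open>If one ball were null, all balls of that radius would be, and countably many of them
  cover the space: rounding all entries times m down to integers sorts the points into countably
  many cells, each contained in the ball around its representative.\<close>

lemma proj_dist_ball_pos:
  assumes K: "prob_space K" "sets K = sets (grassmannian_borel N n)"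
    and const: "\<And>E F. E \<in> space K \<Longrightarrow> F \<in> space K \<Longrightarrow>
      emeasure K (coord_ball K (proj_index N) (proj_coord N) E r) = emeasure K (coord_ball K (proj_index N) (proj_coord N) F r)"
    and r: "r > 0" and E: "E \<in> space K"
  shows "emeasure K (coord_ball K (proj_index N) (proj_coord N) E r) > 0"
proof (rule ccontr)
  interpret K: prob_space K by fact
  assume "\<not> ?thesis"
  then have 0: "emeasure K (coord_ball K (proj_index N) (proj_coord N) F r) = 0" if "F \<in> space K" for F
    using const[OF E that] by simp
  have [measurable]: "proj_coord N ij \<in> borel_measurable K" for ij
    using measurable_proj_matrix[of N "fst ij" "snd ij" n] measurable_cong_sets[OF K(2) refl] by blast
  have cb: "coord_ball K (proj_index N) (proj_coord N) F r \<in> sets K" for F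
    unfolding coord_ball_def coord_dist_def by measurable
  \<comment> \<open>Points of one cell differ by at most 1/m in each of the N^2 entries, so their
    squared distance is at most N^2/m^2 \<le> N^2/m < r.\<close>
  obtain m :: nat where m: "(real N)\<^sup>2 / r < real m" using reals_Archimedean2 by blast
  then have m0: "m > 0" using r by (cases m) (auto simp: divide_less_0_iff)
  define cell where "cell F = (\<lambda>ij\<in>proj_index N. \<lfloor>real m * proj_coord N ij F\<rfloor>)" for F
  have cnt: "countable (cell ` space K)"
  proof (rule countable_subset)
    show "cell ` space K \<subseteq> PiE (proj_index N) (\<lambda>_. UNIV)" unfolding cell_def by (rule image_subsetI) simp
    show "countable (PiE (proj_index N) (\<lambda>_. UNIV :: int set))" by (rule countable_PiE) simp_all
  qed
  define rep where "rep z = (SOME F. F \<in> space K \<and> cell F = z)" for z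
  have rep: "rep (cell F) \<in> space K \<and> cell (rep (cell F)) = cell F" if "F \<in> space K" for F
    unfolding rep_def by (rule someI) (use that in auto)
  have close: "proj_dist N (rep (cell F)) F < r" if F: "F \<in> space K" for F
  proof -
    have "(proj_coord N ij (rep (cell F)) - proj_coord N ij F)\<^sup>2 \<le> 1 / (real m)\<^sup>2" if "ij \<in> proj_index N" for ij
    proof -
      have "cell (rep (cell F)) ij = cell F ij" using rep[OF F] by simp
      then have "\<lfloor>real m * proj_coord N ij (rep (cell F))\<rfloor> = \<lfloor>real m * proj_coord N ij F\<rfloor>"
        using that by (simp add: cell_def)
      then have "\<bar>real m * proj_coord N ij (rep (cell F)) - real m * proj_coord N ij F\<bar> \<le> 1" by linarith
      then have "\<bar>real m * (proj_coord N ij (rep (cell F)) - proj_coord N ij F)\<bar> \<le> 1"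
        by (simp add: right_diff_distrib)
      then have "(real m * (proj_coord N ij (rep (cell F)) - proj_coord N ij F))\<^sup>2 \<le> 1"
        using abs_square_le_1 by blast
      then have "(real m)\<^sup>2 * (proj_coord N ij (rep (cell F)) - proj_coord N ij F)\<^sup>2 \<le> 1"
        by (simp only: power_mult_distrib)
      then show ?thesis using m0 by (simp add: pos_le_divide_eq mult.commute)
    qed
    then have "proj_dist N (rep (cell F)) F \<le> (\<Sum>ij\<in>proj_index N. 1 / (real m)\<^sup>2)"
      unfolding coord_dist_proj_dist[symmetric] coord_dist_def by (intro sum_mono) auto
    also have "\<dots> = (real N)\<^sup>2 / (real m)\<^sup>2" by (simp add: card_cartesian_product power2_eq_square)
    also have "\<dots> \<le> (real N)\<^sup>2 / real m" using m0 by (intro divide_left_mono) (auto simp: power2_eq_square)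
    also have "\<dots> < r" using m m0 r by (simp add: field_simps)
    finally show ?thesis .
  qed
  have "space K \<subseteq> (\<Union>z\<in>cell ` space K. coord_ball K (proj_index N) (proj_coord N) (rep z) r)"
    using close by (auto simp: coord_ball_def coord_dist_proj_dist)
  moreover have "(\<Union>z\<in>cell ` space K. coord_ball K (proj_index N) (proj_coord N) (rep z) r) \<in> null_sets K"
    by (rule null_sets_UN'[OF cnt]) (use rep 0 cb in auto)
  ultimately have "space K \<in> null_sets K" by (auto intro: null_sets_subset)
  then show False using K.emeasure_space_1 by (simp add: null_sets_def)
qed

text \<open>Entries outside the N by N block vanish on the Grassmannian, so finitely many
  coordinates already generate all Borel sets. The boxes form the intersection-stable generator for
  the uniqueness argument.\<close>

lemma sets_grassmannian_coord_box:
  "sets (grassmannian_borel N n) =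
    sigma_sets (grassmannian_codim N n) (coord_box_gen (grassmannian_codim N n) (proj_index N) (proj_coord N))"
  (is "_ = sigma_sets ?G ?B")
proof
  have sub: "?B \<subseteq> Pow ?G" by (auto simp: coord_box_gen_def)
  have "?B \<subseteq> sets (grassmannian_borel N n)"
  proof
    fix U assume "U \<in> ?B"
    then obtain V where V: "U = {x \<in> ?G. \<forall>i\<in>proj_index N. proj_coord N i x \<in> V i}" "\<And>i. open (V i)"
      by (auto simp: coord_box_gen_def)
    have [measurable]: "proj_coord N i \<in> borel_measurable (grassmannian_borel N n)" for i
      by (rule measurable_proj_matrix)
    have [measurable]: "V i \<in> sets borel" for i using V(2) by simp
    have "{x \<in> space (grassmannian_borel N n). \<forall>i\<in>proj_index N. proj_coord N i x \<in> V i} \<in> sets (grassmannian_borel N n)"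
      by measurable
    then show "U \<in> sets (grassmannian_borel N n)" by (simp add: V(1) space_grassmannian_borel)
  qed
  then show "sigma_sets ?G ?B \<subseteq> sets (grassmannian_borel N n)"
    using sets.sigma_sets_subset[of ?B "grassmannian_borel N n"]
    by (simp only: space_grassmannian_borel)
  have "(\<lambda>E. E) \<in> measurable (sigma ?G ?B) (grassmannian_borel N n)"
  proof (rule measurable_grassmannian)
    fix i j
    show "(\<lambda>E. proj_matrix N E i j) \<in> borel_measurable (sigma ?G ?B)"
    proof (cases "i < N \<and> j < N")
      case True
      show ?thesis
      proof (rule borel_measurableI)
        fix S :: "real set" assume S: "open S"
        have "(\<lambda>E. proj_matrix N E i j) -` S \<inter> space (sigma ?G ?B)
            = {x \<in> ?G. \<forall>k\<in>proj_index N. proj_coord N k x \<in> (if k = (i, j) then S else UNIV)}"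
          using True by (auto simp: space_measure_of_conv)
        also have "\<dots> \<in> ?B" unfolding coord_box_gen_def using S
          by (intro CollectI exI[of _ "\<lambda>k. if k = (i, j) then S else UNIV"]) auto
        finally show "(\<lambda>E. proj_matrix N E i j) -` S \<inter> space (sigma ?G ?B) \<in> sets (sigma ?G ?B)"
          using sub by (simp add: sets_measure_of)
      qed
    next
      case False
      then have "(\<lambda>E. proj_matrix N E i j) \<in> borel_measurable (sigma ?G ?B) \<longleftrightarrow>
          (\<lambda>E. 0 :: real) \<in> borel_measurable (sigma ?G ?B)"
        by (intro measurable_cong) (auto simp: space_measure_of_conv proj_matrix_outside not_less)
      then show ?thesis by simp
    qed
  qed (simp add: space_measure_of_conv)
  from measurable_sets[OF this] show "sets (grassmannian_borel N n) \<subseteq> sigma_sets ?G ?B"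
    using sub sets.sets_into_space[of _ "grassmannian_borel N n"]
    by (auto simp: sets_measure_of space_measure_of_conv space_grassmannian_borel Int_absorb2)
qed

text \<open>Weaker than invariance on all Borel sets but enough for uniqueness, and easy to verify
  for an image measure, since balls are given by an inequality and not as images of sets.\<close>

definition ball_invariant :: "nat \<Rightarrow> nat \<Rightarrow> (nat \<Rightarrow> real) set measure \<Rightarrow> bool"
  where "ball_invariant N n K \<longleftrightarrow> prob_space K \<and> sets K = sets (grassmannian_borel N n) \<and>
    (\<forall>Q E r. orthogonal_mat N Q \<longrightarrow> E \<in> grassmannian_codim N n \<longrightarrow>
      emeasure K {F \<in> grassmannian_codim N n. proj_dist N (mat_apply N Q ` E) F < r} =
      emeasure K {F \<in> grassmannian_codim N n. proj_dist N E F < r})"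

text \<open>The action is transitive, so the measures \<open>g j\<close> and \<open>h j\<close> of
  the j-th small ball do not depend on its centre. Both estimates share these two sequences, which
  lets their unknown ratio be eliminated afterwards.\<close>

lemma ball_invariant_le:
  assumes K: "ball_invariant N n K" and L: "ball_invariant N n L"
  shows "\<exists>g h :: nat \<Rightarrow> real. (\<forall>j. g j > 0 \<and> h j > 0) \<and>
    (\<forall>U \<in> coord_box_gen (grassmannian_codim N n) (proj_index N) (proj_coord N).
      emeasure K U \<le> liminf (\<lambda>j. ennreal (g j / h j) * emeasure L U) \<and>
      emeasure L U \<le> liminf (\<lambda>j. ennreal (h j / g j) * emeasure K U))"
proof -
  let ?G = "grassmannian_codim N n"
  let ?e = "\<lambda>j. inverse (real (Suc j))"
  have 1: "prob_space K" "sets K = sets (grassmannian_borel N n)"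
     "prob_space L" "sets L = sets (grassmannian_borel N n)"
    using K L by (auto simp: ball_invariant_def)
  interpret K: prob_space K by fact
  interpret L: prob_space L by fact
  have sp: "space K = ?G" "space L = ?G"
    using sets_eq_imp_space_eq[OF 1(2)] sets_eq_imp_space_eq[OF 1(4)] by (simp_all add: space_grassmannian_borel)
  obtain E where E: "E \<in> ?G" using K.not_empty sp by auto
  have cK: "emeasure K (coord_ball K (proj_index N) (proj_coord N) F r) = emeasure K (coord_ball K (proj_index N) (proj_coord N) E r)"
    if F: "F \<in> ?G" for F r
  proof -
    obtain Q where "orthogonal_mat N Q" "mat_apply N Q ` E = F"
      using grassmannian_transitive[OF E F] by blast
    then show ?thesis using K E by (auto simp: ball_invariant_def coord_ball_def coord_dist_proj_dist sp)
  qed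
  have cL: "emeasure L (coord_ball L (proj_index N) (proj_coord N) F r) = emeasure L (coord_ball L (proj_index N) (proj_coord N) E r)"
    if F: "F \<in> ?G" for F r
  proof -
    obtain Q where "orthogonal_mat N Q" "mat_apply N Q ` E = F"
      using grassmannian_transitive[OF E F] by blast
    then show ?thesis using L E by (auto simp: ball_invariant_def coord_ball_def coord_dist_proj_dist sp)
  qed
  have coord_ball_eq: "coord_ball L I c x r = coord_ball K I c x r" for I :: "(nat \<times> nat) set" and c x r
    by (simp add: coord_ball_def sp)
  define g h where "g j = measure K (coord_ball K (proj_index N) (proj_coord N) E (?e j))"
    and "h j = measure L (coord_ball L (proj_index N) (proj_coord N) E (?e j))" for j
  have g: "emeasure K (coord_ball K (proj_index N) (proj_coord N) F (?e j)) = ennreal (g j)" if "F \<in> ?G" for F j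
    by (subst cK[OF that]) (simp add: g_def K.emeasure_eq_measure)
  have h: "emeasure L (coord_ball L (proj_index N) (proj_coord N) F (?e j)) = ennreal (h j)" if "F \<in> ?G" for F j
    by (subst cL[OF that]) (simp add: h_def L.emeasure_eq_measure)
  have gpos: "g j > 0" for j
    using proj_dist_ball_pos[OF 1(1,2) _ _ E[folded sp(1)], of "?e j"] cK sp g[OF E, of j] by (simp add: ennreal_less_zero_iff)
  have hpos: "h j > 0" for j
    using proj_dist_ball_pos[OF 1(3,4) _ _ E[folded sp(2)], of "?e j"] cL sp h[OF E, of j] by (simp add: ennreal_less_zero_iff)
  have gen: "U \<in> sets (grassmannian_borel N n)" if "U \<in> coord_box_gen ?G (proj_index N) (proj_coord N)" for U
    using that by (auto simp: sets_grassmannian_coord_box)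
  have mK: "proj_coord N i \<in> borel_measurable K" for i
    using measurable_proj_matrix measurable_cong_sets[OF 1(2) refl] by blast
  have mL: "proj_coord N i \<in> borel_measurable L" for i
    using measurable_proj_matrix measurable_cong_sets[OF 1(4) refl] by blast
  have div: "ennreal a / ennreal b = ennreal (a / b)" if "a > 0" "b > 0" for a b
    using that by (simp add: divide_ennreal)
  show ?thesis
  proof (rule exI[of _ g], rule exI[of _ h], intro conjI allI ballI)
    fix U assume U: "U \<in> coord_box_gen ?G (proj_index N) (proj_coord N)"
    show "emeasure K U \<le> liminf (\<lambda>j. ennreal (g j / h j) * emeasure L U)"
      unfolding div[OF gpos hpos, symmetric]
      by (rule uniformly_distributed_le[where I="proj_index N" and c="proj_coord N" and e="?e"])
        (use K.sigma_finite_measure_axioms L.sigma_finite_measure_axioms 1 mK g h hpos sp U gen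
         LIMSEQ_inverse_real_of_nat in \<open>auto simp: coord_ball_eq[symmetric] ennreal_less_zero_iff simp del: of_nat_Suc\<close>)
    show "emeasure L U \<le> liminf (\<lambda>j. ennreal (h j / g j) * emeasure K U)"
      unfolding div[OF hpos gpos, symmetric]
      by (rule uniformly_distributed_le[where I="proj_index N" and c="proj_coord N" and e="?e"])
        (use K.sigma_finite_measure_axioms L.sigma_finite_measure_axioms 1 mL g h gpos sp U gen
         LIMSEQ_inverse_real_of_nat in \<open>auto simp: coord_ball_eq ennreal_less_zero_iff simp del: of_nat_Suc\<close>)
  qed (use gpos hpos in auto)
qed

text \<open>Applied to the whole space, the second estimate says that the liminf of h/g is at least
  1. Hence g/h is eventually below any number larger than 1, and the first estimate loses nothing in
  the limit.\<close>

lemma ball_invariant_mono: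
  assumes K: "ball_invariant N n K" and L: "ball_invariant N n L"
    and U: "U \<in> coord_box_gen (grassmannian_codim N n) (proj_index N) (proj_coord N)"
  shows "emeasure K U \<le> emeasure L U"
proof -
  let ?G = "grassmannian_codim N n"
  have 1: "prob_space K" "sets K = sets (grassmannian_borel N n)"
     "prob_space L" "sets L = sets (grassmannian_borel N n)"
    using K L by (auto simp: ball_invariant_def)
  interpret K: prob_space K by fact
  interpret L: prob_space L by fact
  have sp: "space K = ?G" "space L = ?G"
    using sets_eq_imp_space_eq[OF 1(2)] sets_eq_imp_space_eq[OF 1(4)] by (simp_all add: space_grassmannian_borel)
  obtain g h :: "nat \<Rightarrow> real" where gh: "\<And>j. g j > 0" "\<And>j. h j > 0"
    and le: "\<And>U. U \<in> coord_box_gen ?G (proj_index N) (proj_coord N) \<Longrightarrow>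
      emeasure K U \<le> liminf (\<lambda>j. ennreal (g j / h j) * emeasure L U)"
    and le': "\<And>U. U \<in> coord_box_gen ?G (proj_index N) (proj_coord N) \<Longrightarrow>
      emeasure L U \<le> liminf (\<lambda>j. ennreal (h j / g j) * emeasure K U)"
    using ball_invariant_le[OF K L] by blast
  have G: "?G \<in> coord_box_gen ?G (proj_index N) (proj_coord N)"
    unfolding coord_box_gen_def by (intro CollectI exI[of _ "\<lambda>_. UNIV"]) auto
  have lim: "1 \<le> liminf (\<lambda>j. ennreal (h j / g j))"
    using le'[OF G] K.emeasure_space_1 L.emeasure_space_1 sp by simp
  have "measure K U * (1 - \<epsilon>) \<le> measure L U" if \<epsilon>: "0 < \<epsilon>" "\<epsilon> < 1" for \<epsilon>
  proof -
    have "ennreal (1 - \<epsilon>) < 1" using \<epsilon> by (simp add: ennreal_less_one_iff)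
    also note lim
    finally have "eventually (\<lambda>j. ennreal (1 - \<epsilon>) < ennreal (h j / g j)) sequentially"
      by (rule less_LiminfD)
    then have "eventually (\<lambda>j. ennreal (g j / h j) * emeasure L U \<le> ennreal (1 / (1 - \<epsilon>)) * emeasure L U) sequentially"
    proof eventually_elim
      case (elim j)
      then have "1 - \<epsilon> < h j / g j" using \<epsilon> gh[of j] by (simp add: ennreal_less_iff)
      then have "g j / h j \<le> 1 / (1 - \<epsilon>)" using \<epsilon> gh[of j] by (simp add: field_simps)
      then show ?case by (intro mult_right_mono ennreal_leI) auto
    qed
    from Liminf_mono[OF this]
    have "emeasure K U \<le> ennreal (1 / (1 - \<epsilon>)) * emeasure L U"
      using order_trans[OF le[OF U]] by (simp add: Liminf_const)
    then have "measure K U \<le> 1 / (1 - \<epsilon>) * measure L U"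
      using \<epsilon> by (simp add: K.emeasure_eq_measure L.emeasure_eq_measure ennreal_mult[symmetric])
    then show ?thesis using \<epsilon> by (simp add: field_simps)
  qed
  note * = this
  have "measure K U \<le> measure L U"
  proof (rule field_le_mult_one_interval)
    fix z :: real assume "0 < z" "z < 1"
    then show "z * measure K U \<le> measure L U" using *[of "1 - z"] by (simp add: mult.commute)
  qed
  then show ?thesis by (simp add: K.emeasure_eq_measure L.emeasure_eq_measure)
qed

lemma ball_invariant_unique:
  assumes K: "ball_invariant N n K" and L: "ball_invariant N n L"
  shows "K = L"
proof -
  let ?G = "grassmannian_codim N n"
  let ?B = "coord_box_gen ?G (proj_index N) (proj_coord N)"
  have 1: "prob_space K" "sets K = sigma_sets ?G ?B" "sets L = sigma_sets ?G ?B"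
    using K L by (auto simp: ball_invariant_def sets_grassmannian_coord_box)
  interpret K: prob_space K by fact
  have "?G \<in> ?B"
    unfolding coord_box_gen_def by (intro CollectI exI[of _ "\<lambda>_. UNIV"]) auto
  then show ?thesis
    by (intro measure_eqI_generator_eq[OF Int_stable_coord_box_gen _ _ 1(2,3), of "\<lambda>_. ?G"])
      (auto intro: antisym[OF ball_invariant_mono[OF K L] ball_invariant_mono[OF L K]]
        dest: coord_box_gen_subset[THEN subsetD])
qed

lemma haar_ball_invariant: "is_haar_grassmannian N n \<mu> \<Longrightarrow> ball_invariant N n \<mu>"
  unfolding ball_invariant_def
proof (intro conjI allI impI)
  assume H: "is_haar_grassmannian N n \<mu>"
  then show "prob_space \<mu>" and s: "sets \<mu> = sets (grassmannian_borel N n)"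
    by (auto simp: is_haar_grassmannian_def)
  fix Q E r assume Q: "orthogonal_mat N Q" and E: "E \<in> grassmannian_codim N n"
  have [measurable]: "(\<lambda>E. proj_matrix N E i j) \<in> borel_measurable (grassmannian_borel N n)" for i j
    by (rule measurable_proj_matrix)
  have "{F \<in> space (grassmannian_borel N n). proj_dist N E F < r} \<in> sets (grassmannian_borel N n)"
    unfolding proj_dist_def by measurable
  then have "{F \<in> grassmannian_codim N n. proj_dist N E F < r} \<in> sets \<mu>"
    by (simp add: s space_grassmannian_borel)
  then show "emeasure \<mu> {F \<in> grassmannian_codim N n. proj_dist N (mat_apply N Q ` E) F < r} =
      emeasure \<mu> {F \<in> grassmannian_codim N n. proj_dist N E F < r}"
    using H Q by (auto simp: is_haar_grassmannian_def mat_apply_ball[OF Q E, symmetric])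
qed

section \<open>Gaussian vectors and matrices\<close>

abbreviation g1 :: "real measure"
  where "g1 \<equiv> density lborel (\<lambda>x. ennreal (std_normal_density x))"

abbreviation Lb :: "nat \<Rightarrow> (nat \<Rightarrow> real) measure"
  where "Lb N \<equiv> PiM {..<N} (\<lambda>_. lborel)"

abbreviation Gam :: "nat \<Rightarrow> (nat \<Rightarrow> real) measure"
  where "Gam N \<equiv> PiM {..<N} (\<lambda>_. g1)"

abbreviation GamM :: "nat \<Rightarrow> nat \<Rightarrow> (nat \<Rightarrow> nat \<Rightarrow> real) measure"
  where "GamM k N \<equiv> PiM {..<k} (\<lambda>_. Gam N)"

text \<open>The version of \<open>mat_apply\<close> for points of a product measure, which are
  \<open>undefined\<close> outside the index set instead of zero.\<close>

definition rot :: "nat \<Rightarrow> (nat \<Rightarrow> nat \<Rightarrow> real) \<Rightarrow> (nat \<Rightarrow> real) \<Rightarrow> nat \<Rightarrow> real"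
  where "rot N Q x = (\<lambda>i\<in>{..<N}. \<Sum>j<N. Q i j * x j)"

interpretation lb: product_sigma_finite "\<lambda>_::nat. lborel :: real measure"
  by standard

lemma prob_space_g1: "prob_space g1"
  by (rule prob_space_normal_density) simp

interpretation g1: prob_space g1
  by (rule prob_space_g1)

interpretation gam: product_sigma_finite "\<lambda>_::nat. g1"
  by (rule product_sigma_finite.intro) (rule g1.sigma_finite_measure_axioms)

lemma prob_space_Gam: "prob_space (Gam N)"
  by (rule prob_space_PiM) (rule prob_space_g1)

interpretation Gam: prob_space "Gam N" for N
  by (rule prob_space_Gam)

interpretation gamM: product_sigma_finite "\<lambda>_::nat. Gam N" for N
  by (rule product_sigma_finite.intro) (rule Gam.sigma_finite_measure_axioms)

interpretation GamM: prob_space "GamM k N" for k N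
  by (rule prob_space_PiM) (rule prob_space_Gam)

lemma space_Lb: "space (Lb N) = extensional {..<N}"
  by (auto simp: space_PiM PiE_def)

lemma space_Gam: "space (Gam N) = extensional {..<N}"
  by (auto simp: space_PiM PiE_def)

lemma sets_Gam_Lb: "sets (Gam N) = sets (Lb N)"
  by (intro sets_PiM_cong) auto

lemma rot_eq: "i < N \<Longrightarrow> rot N Q x i = mat_apply N Q x i"
  by (simp add: rot_def mat_apply_def)

lemma rot_sq: "orthogonal_mat N Q \<Longrightarrow> (\<Sum>i<N. (rot N Q x i)\<^sup>2) = (\<Sum>i<N. (x i)\<^sup>2)"
  using ip_mat_apply[of N Q x x] by (simp add: ip_def rot_eq power2_eq_square)

lemma measurable_rot_Lb [measurable]: "rot N Q \<in> measurable (Lb N) (Lb N)"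
  unfolding rot_def by measurable

lemma measurable_rot_Gam [measurable]: "rot N Q \<in> measurable (Gam N) (Gam N)"
  using measurable_rot_Lb measurable_cong_sets[OF sets_Gam_Lb sets_Gam_Lb] by blast

lemma Lb_translate: "distr (Lb N) (Lb N) (\<lambda>y. \<lambda>i\<in>{..<N}. a i + y i) = Lb N"
proof (rule lb.PiM_eqI)
  fix A :: "nat \<Rightarrow> real set" assume A: "\<And>i. i \<in> {..<N} \<Longrightarrow> A i \<in> sets lborel"
  have "(\<lambda>y. \<lambda>i\<in>{..<N}. a i + y i) -` (Pi\<^sub>E {..<N} A) \<inter> space (Lb N)
      = Pi\<^sub>E {..<N} (\<lambda>i. (+) (a i) -` A i)"
    by (auto simp: space_Lb PiE_def extensional_def Pi_iff)
  moreover have "emeasure lborel ((+) (a i) -` A i) = emeasure lborel (A i)" if "i < N" for i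
    using lborel_distr_plus[of "a i"] A[of i] that emeasure_distr[of "(+) (a i)" lborel borel "A i"] by simp
  moreover have "(+) (a i) -` A i \<in> sets lborel" if "i < N" for i
    using measurable_sets[of "(+) (a i)" lborel borel "A i"] A[of i] that by simp
  ultimately show "emeasure (distr (Lb N) (Lb N) (\<lambda>y. \<lambda>i\<in>{..<N}. a i + y i)) (Pi\<^sub>E {..<N} A)
      = (\<Prod>i\<in>{..<N}. emeasure lborel (A i))"
    using A lb.emeasure_PiM[of "{..<N}" "\<lambda>i. (+) (a i) -` A i"]
    by (subst emeasure_distr) (auto intro!: sets_PiM_I_finite prod.cong)
qed auto

section \<open>Rotation invariance of Lebesgue measure\<close>

abbreviation euclid_dist :: "nat \<Rightarrow> (nat \<Rightarrow> real) \<Rightarrow> (nat \<Rightarrow> real) \<Rightarrow> real"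
  where "euclid_dist N \<equiv> coord_dist {..<N} (\<lambda>i x. x i)"

abbreviation lball :: "nat \<Rightarrow> (nat \<Rightarrow> real) \<Rightarrow> real \<Rightarrow> (nat \<Rightarrow> real) set"
  where "lball N \<equiv> coord_ball (Lb N) {..<N} (\<lambda>i x. x i)"

lemma lball_sets [measurable]: "lball N x r \<in> sets (Lb N)"
  unfolding coord_ball_def coord_dist_def by measurable

lemma lball_translate: "emeasure (Lb N) (lball N x r) = emeasure (Lb N) (lball N (\<lambda>_. 0) r)"
proof -
  have "emeasure (Lb N) (lball N x r) = emeasure (distr (Lb N) (Lb N) (\<lambda>y. \<lambda>i\<in>{..<N}. x i + y i)) (lball N x r)"
    by (simp add: Lb_translate)
  also have "\<dots> = emeasure (Lb N) ((\<lambda>y. \<lambda>i\<in>{..<N}. x i + y i) -` lball N x r \<inter> space (Lb N))"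
    by (rule emeasure_distr) measurable
  also have "(\<lambda>y. \<lambda>i\<in>{..<N}. x i + y i) -` lball N x r \<inter> space (Lb N) = lball N (\<lambda>_. 0) r"
    by (auto simp: coord_ball_def coord_dist_def space_Lb)
  finally show ?thesis .
qed

lemma lball_rot:
  assumes Q: "orthogonal_mat N Q"
  shows "rot N Q -` lball N x r \<inter> space (Lb N) = lball N (rot N (\<lambda>i j. Q j i) x) r"
proof -
  have "euclid_dist N x (rot N Q y) = euclid_dist N (rot N (\<lambda>i j. Q j i) x) y" for y
  proof -
    let ?x = "\<lambda>i. if i < N then x i else 0"
    let ?z = "\<lambda>i. mat_apply N (\<lambda>i j. Q j i) ?x i - y i"
    have mx: "mat_apply N Q (mat_apply N (\<lambda>i j. Q j i) ?x) i = x i" if "i < N" for i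
      using mat_apply_transpose[OF Q, of ?x] that by (simp add: Rn_iff)
    have zx: "rot N (\<lambda>i j. Q j i) x i = mat_apply N (\<lambda>i j. Q j i) ?x i" if "i < N" for i
      using that by (simp add: rot_def mat_apply_def)
    have "euclid_dist N x (rot N Q y) = (\<Sum>i<N. (mat_apply N Q ?z i)\<^sup>2)"
      unfolding coord_dist_def mat_apply_diff by (intro sum.cong refl) (simp add: mx rot_eq)
    also have "\<dots> = ip N ?z ?z"
      using ip_mat_apply[OF Q, of ?z ?z] by (simp add: ip_def power2_eq_square)
    also have "\<dots> = euclid_dist N (rot N (\<lambda>i j. Q j i) x) y"
      unfolding coord_dist_def ip_def by (intro sum.cong refl) (simp add: zx power2_eq_square)
    finally show ?thesis .
  qed
  then show ?thesis by (auto simp: coord_ball_def space_Lb rot_def)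
qed

lemma lball_pos: assumes "r > 0" shows "emeasure (Lb N) (lball N x r) > 0"
proof -
  \<comment> \<open>The cube of half side 1/k lies in the ball, because N/k^2 \<le> N/k < r and r
    bounds the squared distance.\<close>
  obtain k :: nat where k: "real N / r < real k" using reals_Archimedean2 by blast
  have k0: "real k > 0" using k assms by (smt (verit) divide_nonneg_pos of_nat_0_le_iff)
  let ?A = "\<lambda>i::nat. {-1 / real k<..<1 / real k}"
  have "0 < (\<Prod>i\<in>{..<N}. emeasure lborel (?A i))" using k0 by (simp add: ennreal_power)
  also have "\<dots> = emeasure (Lb N) (Pi\<^sub>E {..<N} ?A)" by (subst lb.emeasure_PiM) auto
  also have "\<dots> \<le> emeasure (Lb N) (lball N (\<lambda>_. 0) r)"
  proof (rule emeasure_mono)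
    show "Pi\<^sub>E {..<N} ?A \<subseteq> lball N (\<lambda>_. 0) r"
    proof
      fix y assume y: "y \<in> Pi\<^sub>E {..<N} ?A"
      have "(y i)\<^sup>2 \<le> 1 / real k" if "i < N" for i
      proof -
        have "y i \<in> {-1 / real k<..<1 / real k}" by (rule PiE_mem[OF y]) (use that in simp)
        then have "\<bar>y i\<bar> \<le> 1 / real k" by (simp add: abs_le_iff)
        then have "(y i)\<^sup>2 \<le> (1 / real k)\<^sup>2" by (rule power2_le_iff_abs_le[THEN iffD2, rotated]) (use k0 in simp)
        also have "\<dots> \<le> 1 / real k" using k0 by (simp add: power2_eq_square field_simps)
        finally show ?thesis .
      qed
      then have "(\<Sum>i<N. (y i)\<^sup>2) \<le> (\<Sum>i<N. 1 / real k)" by (intro sum_mono) auto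
      also have "\<dots> < r" using k k0 assms by (simp add: field_simps)
      finally show "y \<in> lball N (\<lambda>_. 0) r" using y by (auto simp: coord_ball_def coord_dist_def space_Lb PiE_iff)
    qed
  qed measurable
  finally show ?thesis by (simp add: lball_translate[of N x])
qed

lemma lball_finite: "emeasure (Lb N) (lball N x r) < \<infinity>"
proof -
  have "emeasure (Lb N) (lball N (\<lambda>_. 0) r) \<le> emeasure (Lb N) (Pi\<^sub>E {..<N} (\<lambda>_. {-1-\<bar>r\<bar>..1+\<bar>r\<bar>}))"
  proof (rule emeasure_mono)
    show "lball N (\<lambda>_. 0) r \<subseteq> Pi\<^sub>E {..<N} (\<lambda>_. {-1-\<bar>r\<bar>..1+\<bar>r\<bar>})"
    proof
      fix y assume y: "y \<in> lball N (\<lambda>_. 0) r"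
      have "y i \<in> {-1-\<bar>r\<bar>..1+\<bar>r\<bar>}" if i: "i < N" for i
      proof -
        have "(y i)\<^sup>2 \<le> (\<Sum>i<N. (y i)\<^sup>2)" by (rule member_le_sum) (use i in auto)
        also have "\<dots> < r" using y by (simp add: coord_ball_def coord_dist_def)
        also have "r \<le> (1 + \<bar>r\<bar>)\<^sup>2"
        proof -
          have "(1 + \<bar>r\<bar>)\<^sup>2 = 1 + 2 * \<bar>r\<bar> + r\<^sup>2" by (simp add: power2_eq_square algebra_simps)
          then show ?thesis using zero_le_power2[of r] by linarith
        qed
        finally have "\<bar>y i\<bar>\<^sup>2 < (1 + \<bar>r\<bar>)\<^sup>2" by simp
        then have "\<bar>y i\<bar> < 1 + \<bar>r\<bar>" by (rule power2_less_imp_less) simp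
        then show ?thesis by auto
      qed
      then show "y \<in> Pi\<^sub>E {..<N} (\<lambda>_. {-1-\<bar>r\<bar>..1+\<bar>r\<bar>})"
        using y by (auto simp: coord_ball_def space_Lb PiE_def)
    qed
  qed (auto intro!: sets_PiM_I_finite)
  also have "\<dots> = (\<Prod>i\<in>{..<N}. emeasure lborel {-1-\<bar>r\<bar>..1+\<bar>r\<bar>})"
    by (subst lb.emeasure_PiM) auto
  also have "\<dots> < \<infinity>" by (simp add: power_less_top_ennreal)
  finally show ?thesis by (simp add: lball_translate[of N x])
qed

lemma sets_Lb_coord_box: "sets (Lb N) = sigma_sets (space (Lb N)) (coord_box_gen (space (Lb N)) {..<N} (\<lambda>i x. x i))"
  (is "_ = sigma_sets ?G ?B")
proof
  have sub: "?B \<subseteq> Pow ?G" by (rule coord_box_gen_subset)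
  have "?B \<subseteq> sets (Lb N)"
  proof
    fix U assume "U \<in> ?B"
    then obtain V where V: "U = {x \<in> ?G. \<forall>i\<in>{..<N}. x i \<in> V i}" "\<And>i. open (V i)"
      by (auto simp: coord_box_gen_def)
    have [measurable]: "V i \<in> sets borel" for i using V(2) by simp
    show "U \<in> sets (Lb N)" unfolding V(1) by measurable
  qed
  then show "sigma_sets ?G ?B \<subseteq> sets (Lb N)" by (rule sets.sigma_sets_subset)
  have "(\<lambda>x. x) \<in> measurable (sigma ?G ?B) (Lb N)"
  proof (rule measurable_PiM_single')
    fix i assume i: "i \<in> {..<N}"
    have "(\<lambda>x. x i) \<in> borel_measurable (sigma ?G ?B)"
    proof (rule borel_measurableI)
      fix S :: "real set" assume S: "open S"
      have "(\<lambda>x. x i) -` S \<inter> space (sigma ?G ?B)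
          = {x \<in> ?G. \<forall>k\<in>{..<N}. x k \<in> (if k = i then S else UNIV)}"
        using i by (auto simp: space_measure_of_conv)
      also have "\<dots> \<in> ?B" unfolding coord_box_gen_def using S
        by (intro CollectI exI[of _ "\<lambda>k. if k = i then S else UNIV"]) auto
      finally show "(\<lambda>x. x i) -` S \<inter> space (sigma ?G ?B) \<in> sets (sigma ?G ?B)"
        using sub by (simp add: sets_measure_of)
    qed
    then show "(\<lambda>x. x i) \<in> measurable (sigma ?G ?B) lborel" by simp
  qed (auto simp: space_measure_of_conv space_PiM)
  from measurable_sets[OF this] show "sets (Lb N) \<subseteq> sigma_sets ?G ?B"
    using sub sets.sets_into_space[of _ "Lb N"]
    by (auto simp: sets_measure_of space_measure_of_conv Int_absorb2)
qed

text \<open>The rotated measure gives a ball the Lebesgue measure of the ball around the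
  rotated-back centre, which by translation invariance is that of the ball around 0. Both measures
  thus agree on all balls, the ratio in the comparison is exactly 1, and the comparison applies in
  both directions, with no determinants involved.\<close>

lemma Lb_rot:
  assumes Q: "orthogonal_mat N Q"
  shows "distr (Lb N) (Lb N) (rot N Q) = Lb N"
proof -
  let ?M' = "distr (Lb N) (Lb N) (rot N Q)"
  let ?B = "coord_box_gen (space (Lb N)) {..<N} (\<lambda>i x. x i)"
  let ?e = "\<lambda>j. inverse (real (Suc j))"
  have fin: "emeasure (Lb N) (Pi\<^sub>E {..<N} (\<lambda>_. {-real k<..<real k})) < \<infinity>" for k
    by (subst lb.emeasure_PiM) (auto simp: ennreal_power ennreal_less_top)
  have sf: "sigma_finite_measure (Lb N)"
    using finite_product_sigma_finite.axioms lb.sigma_finite[of "{..<N}"] by simp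
  have ball: "emeasure ?M' (lball N x r) = emeasure (Lb N) (lball N (\<lambda>_. 0) r)" for x r
  proof -
    have "emeasure ?M' (lball N x r) = emeasure (Lb N) (rot N Q -` lball N x r \<inter> space (Lb N))"
      by (rule emeasure_distr) measurable
    then show ?thesis by (simp only: lball_rot[OF Q] lball_translate[of N "rot N (\<lambda>i j. Q j i) x"])
  qed
  have sf': "sigma_finite_measure ?M'"
  proof
    let ?A = "range (\<lambda>k::nat. lball N (\<lambda>_. 0) (real k))"
    have "x \<in> (\<Union>k::nat. lball N (\<lambda>_. 0) (real k))" if "x \<in> space (Lb N)" for x
      using reals_Archimedean2[of "euclid_dist N (\<lambda>_. 0) x"] that by (auto simp: coord_ball_def)
    then show "\<exists>A. countable A \<and> A \<subseteq> sets ?M' \<and> \<Union>A = space ?M' \<and> (\<forall>a\<in>A. emeasure ?M' a \<noteq> \<infinity>)"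
    proof (intro exI[of _ ?A] conjI)
      have "lball N (\<lambda>_. 0) r \<subseteq> space (Lb N)" for r by (auto simp: coord_ball_def)
      then show "\<Union>?A = space ?M'"
        using \<open>\<And>x. x \<in> space (Lb N) \<Longrightarrow> _\<close> by auto
      show "\<forall>a\<in>?A. emeasure ?M' a \<noteq> \<infinity>"
        using ball lball_finite[of N "\<lambda>_. 0"] by (auto simp: less_top)
    qed auto
  qed
  have gen: "U \<in> sets (Lb N)" if "U \<in> ?B" for U using that by (auto simp: sets_Lb_coord_box)
  have one: "emeasure (Lb N) (lball N (\<lambda>_. 0) (?e j)) / emeasure (Lb N) (lball N (\<lambda>_. 0) (?e j)) = 1" for j
    using lball_pos[of "?e j" N "\<lambda>_. 0"] lball_finite[of N "\<lambda>_. 0" "?e j"]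
    by (intro ennreal_divide_self) (auto simp: less_top)
  have sp: "space ?M' = space (Lb N)" by simp
  have cb: "coord_ball ?M' {..<N} (\<lambda>i x. x i) x r = lball N x r" for x r by (simp add: coord_ball_def)
  have le1: "emeasure (Lb N) U \<le> emeasure ?M' U" if U: "U \<in> ?B" for U
  proof -
    have "emeasure (Lb N) U \<le> liminf (\<lambda>n. emeasure (Lb N) (lball N (\<lambda>_. 0) (?e n))
        / emeasure (Lb N) (lball N (\<lambda>_. 0) (?e n)) * emeasure ?M' U)"
      by (rule uniformly_distributed_le[where I="{..<N}" and c="\<lambda>i x. x i" and e="?e"])
        (use sf sf' U gen lball_pos lball_finite ball lball_translate LIMSEQ_inverse_real_of_nat in
          \<open>auto simp del: of_nat_Suc\<close>)
    then show ?thesis by (simp only: one mult_1 Liminf_const sequentially_bot not_False_eq_True)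
  qed
  have le2: "emeasure ?M' U \<le> emeasure (Lb N) U" if U: "U \<in> ?B" for U
  proof -
    have "emeasure ?M' U \<le> liminf (\<lambda>n. emeasure (Lb N) (lball N (\<lambda>_. 0) (?e n))
        / emeasure (Lb N) (lball N (\<lambda>_. 0) (?e n)) * emeasure (Lb N) U)"
      by (rule uniformly_distributed_le[where I="{..<N}" and c="\<lambda>i x. x i" and e="?e"])
        (use sf sf' U gen lball_pos lball_finite ball lball_translate LIMSEQ_inverse_real_of_nat in
          \<open>auto simp: cb sp simp del: of_nat_Suc\<close>)
    then show ?thesis by (simp only: one mult_1 Liminf_const sequentially_bot not_False_eq_True)
  qed
  have "Lb N = ?M'"
  proof (rule measure_eqI_generator_eq[OF Int_stable_coord_box_gen coord_box_gen_subset])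
    show "range (\<lambda>k::nat. Pi\<^sub>E {..<N} (\<lambda>_. {-real k<..<real k})) \<subseteq> ?B"
    proof clarify
      fix k :: nat
      show "Pi\<^sub>E {..<N} (\<lambda>_. {-real k<..<real k}) \<in> ?B"
        unfolding coord_box_gen_def
        by (intro CollectI exI[of _ "\<lambda>_. {-real k<..<real k}"]) (auto simp: space_Lb PiE_def)
    qed
    show "(\<Union>k::nat. Pi\<^sub>E {..<N} (\<lambda>_. {-real k<..<real k})) = space (Lb N)"
    proof (intro equalityI subsetI)
      fix x assume x: "x \<in> space (Lb N)"
      obtain k :: nat where k: "(\<Sum>i<N. \<bar>x i\<bar>) < real k" using reals_Archimedean2 by blast
      have "\<bar>x i\<bar> < real k" if "i < N" for i
        using member_le_sum[of i "{..<N}" "\<lambda>i. \<bar>x i\<bar>"] that k by auto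
      then have "x i \<in> {-real k<..<real k}" if "i < N" for i
        using that by (metis abs_less_iff greaterThanLessThan_iff minus_less_iff)
      then have "x \<in> Pi\<^sub>E {..<N} (\<lambda>_. {-real k<..<real k})"
        using x by (auto simp: space_Lb PiE_def)
      then show "x \<in> (\<Union>k::nat. Pi\<^sub>E {..<N} (\<lambda>_. {-real k<..<real k}))" by blast
    qed (auto simp: space_Lb PiE_def)
    show "emeasure (Lb N) (Pi\<^sub>E {..<N} (\<lambda>_. {-real k<..<real k})) \<noteq> \<infinity>" for k :: nat
      using fin[of k] by simp
  qed (use le1 le2 sets_Lb_coord_box in \<open>auto intro: antisym\<close>)
  then show ?thesis by simp
qed

lemma Gam_density: "Gam N = density (Lb N) (\<lambda>x. \<Prod>i<N. ennreal (std_normal_density (x i)))"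
proof (rule gam.PiM_eqI[symmetric])
  show "sets (density (Lb N) (\<lambda>x. \<Prod>i<N. ennreal (std_normal_density (x i)))) = sets (Gam N)"
    by (simp add: sets_Gam_Lb)
next
  fix A :: "nat \<Rightarrow> real set" assume "\<And>i. i \<in> {..<N} \<Longrightarrow> A i \<in> sets g1"
  then have A: "\<And>i. i < N \<Longrightarrow> A i \<in> sets borel" by simp
  have ind: "indicator (Pi\<^sub>E {..<N} A) x = (\<Prod>i<N. indicator (A i) (x i) :: ennreal)"
    if x: "x \<in> space (Lb N)" for x
  proof (cases "x \<in> Pi\<^sub>E {..<N} A")
    case True
    then have "x i \<in> A i" if "i < N" for i using PiE_mem[OF True, of i] that by simp
    then have "(\<Prod>i<N. indicator (A i) (x i) :: ennreal) = 1" by (intro prod.neutral ballI) simp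
    then show ?thesis using True by simp
  next
    case False
    then have "\<exists>i<N. x i \<notin> A i" using x by (auto simp: space_Lb PiE_def)
    then obtain i where "i < N" "x i \<notin> A i" by blast
    then have "(\<Prod>i<N. indicator (A i) (x i) :: ennreal) = 0"
      by (intro prod_zero bexI[of _ i]) simp_all
    then show ?thesis using False by simp
  qed
  have "emeasure (density (Lb N) (\<lambda>x. \<Prod>i<N. ennreal (std_normal_density (x i)))) (Pi\<^sub>E {..<N} A)
     = (\<integral>\<^sup>+x. (\<Prod>i<N. ennreal (std_normal_density (x i))) * indicator (Pi\<^sub>E {..<N} A) x \<partial>Lb N)"
    using A by (intro emeasure_density) (auto intro!: sets_PiM_I_finite)
  also have "\<dots> = (\<integral>\<^sup>+x. (\<Prod>i<N. ennreal (std_normal_density (x i)) * indicator (A i) (x i)) \<partial>Lb N)"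
    by (rule nn_integral_cong) (simp add: ind prod.distrib)
  also have "\<dots> = (\<Prod>i<N. \<integral>\<^sup>+x. ennreal (std_normal_density x) * indicator (A i) x \<partial>lborel)"
    by (rule lb.product_nn_integral_prod) (use A in auto)
  also have "\<dots> = (\<Prod>i<N. emeasure g1 (A i))"
    by (intro prod.cong refl) (use A in \<open>auto simp: emeasure_density\<close>)
  finally show "emeasure (density (Lb N) (\<lambda>x. \<Prod>i<N. ennreal (std_normal_density (x i)))) (Pi\<^sub>E {..<N} A)
     = (\<Prod>i\<in>{..<N}. emeasure g1 (A i))" .
qed auto

text \<open>The Gaussian density depends only on the Euclidean norm, so the invariance is inherited
  from Lebesgue measure.\<close>

lemma Gam_rot:
  assumes Q: "orthogonal_mat N Q"
  shows "distr (Gam N) (Gam N) (rot N Q) = Gam N"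
proof -
  let ?f = "\<lambda>x. \<Prod>i<N. ennreal (std_normal_density (x i))"
  have fr: "?f (rot N Q x) = ?f x" for x
  proof -
    have "?f x = ennreal (\<Prod>i<N. std_normal_density (x i))" for x :: "nat \<Rightarrow> real"
      by (rule prod_ennreal) simp
    moreover have "(\<Prod>i<N. std_normal_density (x i)) = (1 / sqrt (2 * pi)) ^ N * exp (- (\<Sum>i<N. (x i)\<^sup>2) / 2)" for x :: "nat \<Rightarrow> real"
      by (simp add: std_normal_density_def prod_dividef exp_sum[symmetric] sum_negf sum_divide_distrib power_divide)
    ultimately show ?thesis using rot_sq[OF Q] by simp
  qed
  show ?thesis
  proof (rule measure_eqI)
    fix A assume "A \<in> sets (distr (Gam N) (Gam N) (rot N Q))"
    then have A: "A \<in> sets (Lb N)" "A \<in> sets (Gam N)" using sets_Gam_Lb by auto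
    note A(1)[measurable]
    have "emeasure (distr (Gam N) (Gam N) (rot N Q)) A = emeasure (Gam N) (rot N Q -` A \<inter> space (Gam N))"
      using A(2) by (rule emeasure_distr[OF measurable_rot_Gam])
    also have "\<dots> = emeasure (density (Lb N) ?f) (rot N Q -` A \<inter> space (Lb N))"
      by (simp add: Gam_density[symmetric] space_Gam space_Lb)
    also have "\<dots> = (\<integral>\<^sup>+x. ?f x * indicator (rot N Q -` A \<inter> space (Lb N)) x \<partial>Lb N)"
      by (rule emeasure_density) measurable
    also have "\<dots> = (\<integral>\<^sup>+x. ?f (rot N Q x) * indicator A (rot N Q x) \<partial>Lb N)"
      by (rule nn_integral_cong) (auto simp: fr indicator_def)
    also have "\<dots> = (\<integral>\<^sup>+x. ?f x * indicator A x \<partial>distr (Lb N) (Lb N) (rot N Q))"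
      by (subst nn_integral_distr) auto
    also have "\<dots> = emeasure (Gam N) A"
      unfolding Lb_rot[OF Q] Gam_density by (rule emeasure_density[symmetric]) measurable
    finally show "emeasure (distr (Gam N) (Gam N) (rot N Q)) A = emeasure (Gam N) A" .
  qed simp
qed

lemma GamM_rot:
  assumes Q: "orthogonal_mat N Q"
  shows "distr (GamM k N) (GamM k N) (compose {..<k} (rot N Q)) = GamM k N"
  by (subst distr_PiM_finite_prob_space') (auto simp: Gam_rot[OF Q] prob_space_Gam)

lemma Gam_component: "i < N \<Longrightarrow> distr (Gam N) g1 (\<lambda>x. x i) = g1"
  by (rule distr_PiM_component) (auto simp: prob_space_g1)

text \<open>Take an orthogonal matrix with first column u. Its transpose preserves the Gaussian
  measure and turns the first coordinate into the functional given by u.\<close>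

lemma Gam_linear:
  assumes "ip N u u = 1"
  shows "distr (Gam N) g1 (\<lambda>g. ip N u g) = g1"
proof -
  let ?u = "\<lambda>i. if i < N then u i else 0"
  have N: "0 < N" using assms by (cases N) (auto simp: ip_def)
  have "orthonormal N 1 (\<lambda>_. ?u)" using assms by (auto simp: orthonormal_def Rn_iff ip_def)
  moreover have "orthonormal N 1 unitv" using N orthonormal_unitv[of N] by (auto simp: orthonormal_def)
  ultimately obtain Q where Q: "orthogonal_mat N Q" "mat_apply N Q (unitv 0) = ?u"
    using orthonormal_transitive[of N 1 unitv "\<lambda>_. ?u"] by auto
  have Qu: "Q j 0 = u j" if "j < N" for j
    using fun_cong[OF Q(2), of j] that N
    by (simp add: mat_apply_def unitv_def if_distrib[of "\<lambda>x. _ * x"] cong: if_cong)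
  let ?R = "rot N (\<lambda>i j. Q j i)"
  have "g1 = distr (distr (Gam N) (Gam N) ?R) g1 (\<lambda>x. x 0)"
    using Gam_component[OF N] Gam_rot[OF orthogonal_mat_transpose[OF Q(1)]] by simp
  also have "\<dots> = distr (Gam N) g1 (\<lambda>x. ?R x 0)"
    by (subst distr_distr) (use N in \<open>auto simp: comp_def intro!: measurable_component_singleton\<close>)
  also have "\<dots> = distr (Gam N) g1 (\<lambda>g. ip N u g)"
    by (rule distr_cong) (use N in \<open>auto simp: rot_def ip_def Qu\<close>)
  finally show ?thesis by simp
qed

lemma nn_integral_Gam_linear:
  assumes "ip N u u = 1" and [measurable]: "f \<in> borel_measurable borel"
  shows "(\<integral>\<^sup>+g. f (ip N u g) \<partial>Gam N) = (\<integral>\<^sup>+x. f x \<partial>g1)"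
proof -
  have [measurable]: "(\<lambda>g. ip N u g) \<in> borel_measurable (Gam N)" unfolding ip_def by measurable
  have "(\<integral>\<^sup>+x. f x \<partial>g1) = (\<integral>\<^sup>+x. f x \<partial>distr (Gam N) g1 (\<lambda>g. ip N u g))"
    by (simp add: Gam_linear[OF assms(1)])
  also have "\<dots> = (\<integral>\<^sup>+g. f (ip N u g) \<partial>Gam N)"
    by (subst nn_integral_distr) auto
  finally show ?thesis by simp
qed

lemma Gam_uminus:
  assumes [measurable]: "f \<in> borel_measurable (Gam N)"
  shows "(\<integral>\<^sup>+g. f (\<lambda>i\<in>{..<N}. - g i) \<partial>Gam N) = (\<integral>\<^sup>+g. f g \<partial>Gam N)"
proof -
  let ?Q = "\<lambda>i j :: nat. if i = j then - 1 else 0 :: real"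
  have Q: "orthogonal_mat N ?Q"
    by (auto simp: orthogonal_mat_def if_distrib[of "\<lambda>x. x * _"] cong: if_cong)
  have r: "rot N ?Q g = (\<lambda>i\<in>{..<N}. - g i)" for g
    by (rule ext) (simp add: rot_def if_distrib[of "\<lambda>x. x * _"] cong: if_cong)
  have "(\<integral>\<^sup>+g. f g \<partial>Gam N) = (\<integral>\<^sup>+g. f g \<partial>distr (Gam N) (Gam N) (rot N ?Q))"
    by (simp add: Gam_rot[OF Q])
  also have "\<dots> = (\<integral>\<^sup>+g. f (rot N ?Q g) \<partial>Gam N)" by (subst nn_integral_distr) auto
  finally show ?thesis by (simp add: r)
qed

text \<open>The integrand times the density is again a centred normal density, of standard deviation
  1 / sqrt(1 - 2s), up to that factor. Both signs of s are used later.\<close>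

lemma g1_exp_square:
  fixes s :: real assumes "s < 1 / 2"
  shows "(\<integral>\<^sup>+x. ennreal (exp (s * x\<^sup>2)) \<partial>g1) = ennreal (1 / sqrt (1 - 2 * s))"
proof -
  define \<sigma> where "\<sigma> = 1 / sqrt (1 - 2 * s)"
  have \<sigma>: "\<sigma> > 0" "\<sigma>\<^sup>2 = 1 / (1 - 2 * s)" using assms by (auto simp: \<sigma>_def power_divide)
  have "std_normal_density x * exp (s * x\<^sup>2) = \<sigma> * normal_density 0 \<sigma> x" for x
  proof -
    have "- x\<^sup>2 / 2 + s * x\<^sup>2 = - x\<^sup>2 / (2 * \<sigma>\<^sup>2)" using assms by (simp add: \<sigma>(2) field_simps)
    then have e: "exp (- x\<^sup>2 / 2) * exp (s * x\<^sup>2) = exp (- x\<^sup>2 / (2 * \<sigma>\<^sup>2))"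
      by (simp only: exp_add[symmetric])
    have c: "1 / sqrt (2 * pi) = \<sigma> / sqrt (2 * pi * \<sigma>\<^sup>2)"
      using \<sigma>(1) by (simp add: real_sqrt_mult)
    have "std_normal_density x * exp (s * x\<^sup>2) = 1 / sqrt (2 * pi) * (exp (- x\<^sup>2 / 2) * exp (s * x\<^sup>2))"
      by (simp only: std_normal_density_def mult.assoc)
    also have "\<dots> = \<sigma> * normal_density 0 \<sigma> x"
      unfolding e c normal_density_def by simp
    finally show ?thesis .
  qed
  then have "(\<integral>\<^sup>+x. ennreal (exp (s * x\<^sup>2)) \<partial>g1) = (\<integral>\<^sup>+x. ennreal \<sigma> * ennreal (normal_density 0 \<sigma> x) \<partial>lborel)"
    by (subst nn_integral_density) (auto simp: ennreal_mult[symmetric] \<sigma>(1)[THEN less_imp_le])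
  also have "\<dots> = ennreal \<sigma> * (\<integral>\<^sup>+x. ennreal (normal_density 0 \<sigma> x) \<partial>lborel)"
    by (rule nn_integral_cmult) simp
  also have "(\<integral>\<^sup>+x. ennreal (normal_density 0 \<sigma> x) \<partial>lborel) = 1"
    using prob_space.emeasure_space_1[OF prob_space_normal_density[OF \<sigma>(1), of 0]]
    by (simp add: emeasure_density)
  finally show ?thesis by (simp add: \<sigma>_def)
qed

section \<open>Kernels and spans of Gaussian matrices\<close>

text \<open>Rows drawn from a product measure are \<open>undefined\<close> beyond N; padding with
  zeros puts them into \<open>Rn N\<close>.\<close>

definition pad :: "nat \<Rightarrow> (nat \<Rightarrow> nat \<Rightarrow> real) \<Rightarrow> nat \<Rightarrow> nat \<Rightarrow> real"
  where "pad N G j = (\<lambda>i. if i < N then G j i else 0)"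

lemma pad_Rn: "pad N G j \<in> Rn N"
  by (simp add: pad_def Rn_iff)

lemma ip_pad: "ip N x (pad N G j) = ip N x (G j)"
  by (simp add: ip_def pad_def)

lemma measurable_GamM_entry:
  assumes "l < k" "i < N" shows "(\<lambda>G. G l i) \<in> borel_measurable (GamM k N)"
proof -
  have "(\<lambda>G. G l) \<in> measurable (GamM k N) (Gam N)"
    by (rule measurable_component_singleton) (use assms in simp)
  moreover have "(\<lambda>g. g i) \<in> borel_measurable (Gam N)"
    using measurable_component_singleton[of i "{..<N}" "\<lambda>_. g1"] assms by simp
  ultimately show ?thesis by (rule measurable_compose)
qed

lemma measurable_pad: "l < k \<Longrightarrow> (\<lambda>G. pad N G l i) \<in> borel_measurable (GamM k N)"
  by (cases "i < N") (auto simp: pad_def measurable_GamM_entry)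

lemma measurable_ip:
  assumes "\<And>i. i < N \<Longrightarrow> (\<lambda>x. f x i) \<in> borel_measurable M" "\<And>i. i < N \<Longrightarrow> (\<lambda>x. g x i) \<in> borel_measurable M"
  shows "(\<lambda>x. ip N (f x) (g x)) \<in> borel_measurable M"
  unfolding ip_def using assms by (intro borel_measurable_sum borel_measurable_times) auto

lemma measurable_gs:
  assumes "l < k"
  shows "(\<lambda>G. gs N (pad N G) l i) \<in> borel_measurable (GamM k N)"
    and "(\<lambda>G. gs_residual N (pad N G) l i) \<in> borel_measurable (GamM k N)"
proof -
  have "(\<forall>i. (\<lambda>G. gs N (pad N G) l i) \<in> borel_measurable (GamM k N)) \<and>
    (\<forall>i. (\<lambda>G. gs_residual N (pad N G) l i) \<in> borel_measurable (GamM k N))"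
    using assms
  proof (induction l rule: less_induct)
    case (less l)
    have gsm: "(\<lambda>G. gs N (pad N G) m i) \<in> borel_measurable (GamM k N)" if "m < l" for m i
      using less that by auto
    have rm: "(\<lambda>G. pad N G l i) \<in> borel_measurable (GamM k N)" for i
      by (rule measurable_pad) (use less in simp)
    have res: "(\<lambda>G. gs_residual N (pad N G) l i) \<in> borel_measurable (GamM k N)" for i
      unfolding gs_residual_def lincomb_def
      by (intro borel_measurable_diff borel_measurable_sum borel_measurable_times rm gsm measurable_ip) auto
    then have "(\<lambda>G. gs N (pad N G) l i) \<in> borel_measurable (GamM k N)" for i
      unfolding gs_eq
      by (intro borel_measurable_divide borel_measurable_sqrt[THEN measurable_compose[rotated]] measurable_ip res)
    then show ?case using res by blast
  qed
  then show "(\<lambda>G. gs N (pad N G) l i) \<in> borel_measurable (GamM k N)"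
     "(\<lambda>G. gs_residual N (pad N G) l i) \<in> borel_measurable (GamM k N)" by auto
qed

lemma pred_gs_ok: "Measurable.pred (GamM k N) (\<lambda>G. gs_ok N k (pad N G))"
proof -
  have [measurable]: "(\<lambda>G. ip N (gs_residual N (pad N G) l) (gs_residual N (pad N G) l)) \<in> borel_measurable (GamM k N)"
    if "l \<in> {..<k}" for l
    by (intro measurable_ip measurable_gs) (use that in auto)
  have "gs_ok N k r \<longleftrightarrow> (\<forall>l\<in>{..<k}. ip N (gs_residual N r l) (gs_residual N r l) \<noteq> 0)" for r
    by (auto simp: gs_ok_def)
  then show ?thesis by simp
qed

lemma Gam_hyperplane:
  assumes "ip N a a = 1" shows "emeasure (Gam N) {y \<in> space (Gam N). ip N a y = 0} = 0"
proof -
  have [measurable]: "(\<lambda>y. ip N a y) \<in> borel_measurable (Gam N)" unfolding ip_def by measurable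
  have "emeasure (Gam N) {y \<in> space (Gam N). ip N a y = 0} = (\<integral>\<^sup>+y. indicator {0} (ip N a y) \<partial>Gam N)"
  proof -
    have "(\<integral>\<^sup>+y. indicator {0} (ip N a y) \<partial>Gam N) = (\<integral>\<^sup>+y. indicator {y \<in> space (Gam N). ip N a y = 0} y \<partial>Gam N)"
      by (rule nn_integral_cong) (auto simp: indicator_def)
    also have "\<dots> = emeasure (Gam N) {y \<in> space (Gam N). ip N a y = 0}"
      by (rule nn_integral_indicator) measurable
    finally show ?thesis by simp
  qed
  also have "\<dots> = (\<integral>\<^sup>+x. indicator {0} x \<partial>g1)" by (rule nn_integral_Gam_linear[OF assms]) simp
  also have "\<dots> = emeasure g1 {0}" by simp
  also have "\<dots> = 0"
  proof -
    have "AE x in lborel. x \<noteq> (0::real)" by (rule AE_lborel_singleton)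
    then have "AE x in g1. x \<noteq> 0" by (subst AE_density) auto
    then show ?thesis by (subst (asm) AE_iff_measurable[of "{0}"]) auto
  qed
  finally show ?thesis .
qed

text \<open>Fix the first k rows. A unit vector orthogonal to them exists because k < N, and a
  vanishing new residual forces the new row into the hyperplane orthogonal to that vector, a null
  set.\<close>

lemma AE_gs_ok: "k \<le> N \<Longrightarrow> AE G in GamM k N. gs_ok N k (pad N G)"
proof (induction k)
  case 0 then show ?case by (simp add: gs_ok_def)
next
  case (Suc k)
  let ?B = "{G \<in> space (GamM (Suc k) N). \<not> gs_ok N (Suc k) (pad N G)}"
  have B: "?B \<in> sets (GamM (Suc k) N)"
    using pred_gs_ok[where k="Suc k" and N=N] by (intro sets.sets_Collect_neg) (simp add: pred_def)
  have ins: "{..<Suc k} = insert k {..<k}" by auto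
  have "emeasure (GamM (Suc k) N) ?B = (\<integral>\<^sup>+G. indicator ?B G \<partial>GamM (Suc k) N)" using B by simp
  also have "\<dots> = (\<integral>\<^sup>+x. (\<integral>\<^sup>+y. indicator ?B (x(k := y)) \<partial>Gam N) \<partial>GamM k N)"
    unfolding ins by (rule gamM.product_nn_integral_insert) (use B in \<open>auto simp: ins\<close>)
  also have "\<dots> = (\<integral>\<^sup>+x. 0 \<partial>GamM k N)"
  proof (rule nn_integral_cong_AE)
    have "AE x in GamM k N. gs_ok N k (pad N x)" using Suc by simp
    then show "AE x in GamM k N. (\<integral>\<^sup>+y. indicator ?B (x(k := y)) \<partial>Gam N) = 0"
    proof eventually_elim
      case (elim x)
      let ?f = "gs N (pad N x)"
      have on: "orthonormal N k ?f" by (rule gs_orthonormal) (auto simp: pad_Rn elim)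
      obtain g where g: "orthonormal N N g" "\<forall>l<k. g l = ?f l" using orthonormal_extend_full[OF on] by blast
      have kN: "k < N" using Suc.prems by simp
      let ?H = "{y \<in> space (Gam N). ip N (g k) y = 0}"
      have "(\<integral>\<^sup>+y. indicator ?B (x(k := y)) \<partial>Gam N) \<le> (\<integral>\<^sup>+y. indicator ?H y \<partial>Gam N)"
      proof (rule nn_integral_mono)
        fix y assume y: "y \<in> space (Gam N)"
        have "y \<in> ?H" if bad: "x(k := y) \<in> ?B"
        proof -
          have r: "pad N (x(k := y)) l = pad N x l" if "l < k" for l
            using that by (auto simp: pad_def fun_eq_iff)
          have gse: "gs N (pad N (x(k := y))) l = ?f l" if "l < k" for l
            by (rule gs_cong) (use r that in auto)
          have rese: "gs_residual N (pad N (x(k := y))) l = gs_residual N (pad N x) l" if "l < k" for l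
            by (rule gs_residual_cong) (use r that in auto)
          have "gs_ok N k (pad N (x(k := y)))" using elim by (simp add: gs_ok_def rese)
          then have "ip N (gs_residual N (pad N (x(k := y))) k) (gs_residual N (pad N (x(k := y))) k) = 0"
            using bad by (auto simp: gs_ok_def less_Suc_eq)
          then have z: "gs_residual N (pad N (x(k := y))) k i = 0" if "i < N" for i
            using that by (simp add: ip_self_eq_0)
          have "ip N (g k) y = ip N (g k) (pad N (x(k := y)) k)" by (simp add: ip_def pad_def)
          also have "\<dots> = ip N (g k) (lincomb k (\<lambda>l. ip N (pad N (x(k := y)) k) (gs N (pad N (x(k := y))) l)) (gs N (pad N (x(k := y)))))"
            unfolding ip_def[of N "g k"]
          proof (intro sum.cong refl)
            fix i assume "i \<in> {..<N}"
            then show "g k i * pad N (x(k := y)) k i = g k i * lincomb k (\<lambda>l. ip N (pad N (x(k := y)) k)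
                (gs N (pad N (x(k := y))) l)) (gs N (pad N (x(k := y)))) i"
              using z[of i] by (simp only: gs_residual_def lessThan_iff) simp
          qed
          also have "\<dots> = 0"
            unfolding ip_lincomb_right
          proof (rule sum.neutral, rule ballI)
            fix l assume "l \<in> {..<k}"
            then show "ip N (pad N (x(k := y)) k) (gs N (pad N (x(k := y))) l) *
                ip N (g k) (gs N (pad N (x(k := y))) l) = 0"
              using orthonormal_ip[OF g(1) kN, of l] kN g(2) gse[of l] by auto
          qed
          finally show ?thesis using y by simp
        qed
        then show "indicator ?B (x(k := y)) \<le> (indicator ?H y :: ennreal)" by (auto simp: indicator_def)
      qed
      also have "\<dots> = emeasure (Gam N) ?H"
      proof (rule nn_integral_indicator)
        have [measurable]: "(\<lambda>y. ip N (g k) y) \<in> borel_measurable (Gam N)" unfolding ip_def by measurable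
        show "?H \<in> sets (Gam N)" by measurable
      qed
      also have "\<dots> = 0" by (rule Gam_hyperplane) (use orthonormal_ip[OF g(1) kN kN] in simp)
      finally show ?case by simp
    qed
  qed
  finally have "emeasure (GamM (Suc k) N) ?B = 0" by simp
  then show ?case using B by (subst AE_iff_measurable[of ?B]) auto
qed

lemma pad_compose_rot: "l < k \<Longrightarrow> pad N (compose {..<k} (rot N Q) G) l = mat_apply N Q (pad N G l)"
  by (auto simp: pad_def compose_def rot_def mat_apply_def fun_eq_iff)

lemma gs_compose_rot:
  assumes "orthogonal_mat N Q" "l < k"
  shows "gs N (pad N (compose {..<k} (rot N Q) G)) l = mat_apply N Q (gs N (pad N G) l)"
proof -
  have "gs N (pad N (compose {..<k} (rot N Q) G)) l = gs N (\<lambda>l. mat_apply N Q (pad N G l)) l"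
    by (rule gs_cong) (use assms in \<open>auto simp: pad_compose_rot\<close>)
  then show ?thesis by (simp add: gs_mat_apply[OF assms(1)])
qed

lemma gs_ok_compose_rot:
  assumes "orthogonal_mat N Q"
  shows "gs_ok N k (pad N (compose {..<k} (rot N Q) G)) = gs_ok N k (pad N G)"
proof -
  have "gs_residual N (pad N (compose {..<k} (rot N Q) G)) l = gs_residual N (\<lambda>l. mat_apply N Q (pad N G l)) l" if "l < k" for l
    by (rule gs_residual_cong) (use that in \<open>auto simp: pad_compose_rot\<close>)
  then have "gs_ok N k (pad N (compose {..<k} (rot N Q) G)) = gs_ok N k (\<lambda>l. mat_apply N Q (pad N G l))"
    by (simp add: gs_ok_def)
  then show ?thesis by (simp add: gs_ok_mat_apply[OF assms])
qed

text \<open>Rotating all rows preserves the law of the Gaussian matrix, so under an equivariant map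
  the measure of a ball does not depend on its centre, and the image must be the Haar measure.
  Equivariance is asked for only almost surely because dependent rows are mapped to a fixed
  subspace.\<close>

lemma haar_eq_distr:
  assumes \<mu>: "is_haar_grassmannian N n \<mu>"
    and \<Phi>[measurable]: "\<Phi> \<in> measurable (GamM k N) (grassmannian_borel N n)"
    and eq: "\<And>Q. orthogonal_mat N Q \<Longrightarrow>
      AE G in GamM k N. \<Phi> (compose {..<k} (rot N Q) G) = mat_apply N Q ` \<Phi> G"
  shows "\<mu> = distr (GamM k N) (grassmannian_borel N n) \<Phi>"
proof (rule ball_invariant_unique[OF haar_ball_invariant[OF \<mu>]])
  let ?D = "distr (GamM k N) (grassmannian_borel N n) \<Phi>"
  show "ball_invariant N n ?D"
    unfolding ball_invariant_def
  proof (intro conjI allI impI)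
    show "prob_space ?D" by (rule GamM.prob_space_distr) measurable
    show "sets ?D = sets (grassmannian_borel N n)" by simp
    fix Q E r assume Q: "orthogonal_mat N Q" and E: "E \<in> grassmannian_codim N n"
    have [measurable]: "(\<lambda>E. proj_matrix N E i j) \<in> borel_measurable (grassmannian_borel N n)" for i j
      by (rule measurable_proj_matrix)
    have [measurable]: "(\<lambda>F. proj_dist N E F) \<in> borel_measurable (grassmannian_borel N n)" for E
      unfolding proj_dist_def by measurable
    have [measurable]: "compose {..<k} (rot N Q) \<in> measurable (GamM k N) (GamM k N)"
      unfolding compose_def by measurable
    have sp: "\<Phi> G \<in> grassmannian_codim N n" if "G \<in> space (GamM k N)" for G
      using measurable_space[OF \<Phi> that] by (simp add: space_grassmannian_borel)
    have D: "emeasure ?D {F \<in> grassmannian_codim N n. proj_dist N E F < r} =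
        emeasure (GamM k N) {G \<in> space (GamM k N). proj_dist N E (\<Phi> G) < r}" for E
    proof -
      have m: "{F \<in> space (grassmannian_borel N n). proj_dist N E F < r} \<in> sets (grassmannian_borel N n)"
        by measurable
      show ?thesis
        by (subst emeasure_distr) (use m sp in \<open>auto simp: space_grassmannian_borel intro!: arg_cong[where f="emeasure _"]\<close>)
    qed
    let ?E = "mat_apply N Q ` E"
    have "emeasure (GamM k N) {G \<in> space (GamM k N). proj_dist N ?E (\<Phi> G) < r}
       = emeasure (distr (GamM k N) (GamM k N) (compose {..<k} (rot N Q))) {G \<in> space (GamM k N). proj_dist N ?E (\<Phi> G) < r}"
      by (simp add: GamM_rot[OF Q])
    also have "\<dots> = emeasure (GamM k N) (compose {..<k} (rot N Q) -` {G \<in> space (GamM k N). proj_dist N ?E (\<Phi> G) < r} \<inter> space (GamM k N))"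
      by (rule emeasure_distr) measurable
    also have "\<dots> = emeasure (GamM k N) {G \<in> space (GamM k N). proj_dist N E (\<Phi> G) < r}"
    proof (rule emeasure_eq_AE)
      show "AE G in GamM k N. G \<in> compose {..<k} (rot N Q) -` {G \<in> space (GamM k N). proj_dist N ?E (\<Phi> G) < r} \<inter> space (GamM k N)
          \<longleftrightarrow> G \<in> {G \<in> space (GamM k N). proj_dist N E (\<Phi> G) < r}"
        using eq[OF Q] AE_space
      proof eventually_elim
        case (elim G)
        have "compose {..<k} (rot N Q) G \<in> space (GamM k N)"
          using measurable_space[OF \<open>compose {..<k} (rot N Q) \<in> _\<close> elim(2)] .
        then show ?case using elim proj_dist_mat_apply[OF Q E sp[OF elim(2)]] by auto
      qed
    qed measurable
    finally show "emeasure ?D {F \<in> grassmannian_codim N n. proj_dist N ?E F < r} =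
      emeasure ?D {F \<in> grassmannian_codim N n. proj_dist N E F < r}" by (simp add: D)
  qed
qed

definition perp :: "nat \<Rightarrow> nat \<Rightarrow> (nat \<Rightarrow> nat \<Rightarrow> real) \<Rightarrow> (nat \<Rightarrow> real) set"
  where "perp N k g = {x \<in> Rn N. \<forall>l<k. ip N x (g l) = 0}"

lemma perp_grassmannian:
  assumes "orthonormal N k g"
  shows "perp N k g \<in> grassmannian_codim N k"
    and "proj_matrix N (perp N k g) i j = (if i = j \<and> i < N then 1 else 0) - (\<Sum>l<k. g l i * g l j)"
proof -
  obtain h where h: "orthonormal N N h" "\<forall>l<k. h l = g l" using orthonormal_extend_full[OF assms] by blast
  have k: "k \<le> N" using orthonormal_card_le[OF assms] .
  have p: "perp N k g = lin_span (N - k) (\<lambda>l. h (k + l))"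
    using orthonormal_perp[OF h(1) k] h(2) by (simp add: perp_def)
  have on: "orthonormal N (N - k) (\<lambda>l. h (k + l))" using h(1) by (auto simp: orthonormal_def)
  show "perp N k g \<in> grassmannian_codim N k"
    unfolding p by (rule lin_span_in_grassmannian[OF on]) (use k in simp)
  \<comment> \<open>The projection onto the complement is the identity on the first N coordinates
    minus the projection onto the span.\<close>
  have "(\<Sum>l<N. h l i * h l j) = (\<Sum>l<k. h l i * h l j) + (\<Sum>l\<in>{k..<N}. h l i * h l j)"
    using sum.atLeastLessThan_concat[of 0 k N "\<lambda>l. h l i * h l j"] k by (simp only: lessThan_atLeast0)
  also have "(\<Sum>l\<in>{k..<N}. h l i * h l j) = (\<Sum>l<N - k. h (k + l) i * h (k + l) j)"
    by (rule sum.reindex_bij_witness[of _ "\<lambda>l. k + l" "\<lambda>l. l - k"]) auto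
  also have "(\<Sum>l<k. h l i * h l j) = (\<Sum>l<k. g l i * g l j)" using h(2) by simp
  finally have "proj_matrix N (perp N k g) i j = (\<Sum>l<N. h l i * h l j) - (\<Sum>l<k. g l i * g l j)"
    unfolding p proj_matrix_lin_span[OF on] by simp
  also have "(\<Sum>l<N. h l i * h l j) = (if i = j \<and> i < N then 1 else 0)"
  proof (cases "i < N \<and> j < N")
    case True then show ?thesis using orthonormal_complete[OF h(1)] by simp
  next
    case False
    then have "(\<Sum>l<N. h l i * h l j) = 0"
      using orthonormal_Rn[OF h(1)] by (intro sum.neutral) (auto simp: Rn_iff not_less)
    then show ?thesis using False by auto
  qed
  finally show "proj_matrix N (perp N k g) i j = (if i = j \<and> i < N then 1 else 0) - (\<Sum>l<k. g l i * g l j)" .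
qed

lemma mat_apply_perp:
  assumes Q: "orthogonal_mat N Q" and g: "orthonormal N k g"
  shows "mat_apply N Q ` perp N k g = perp N k (\<lambda>l. mat_apply N Q (g l))"
proof (intro equalityI subsetI)
  fix x assume "x \<in> mat_apply N Q ` perp N k g"
  then show "x \<in> perp N k (\<lambda>l. mat_apply N Q (g l))"
    by (auto simp: perp_def mat_apply_Rn ip_mat_apply[OF Q])
next
  fix x assume x: "x \<in> perp N k (\<lambda>l. mat_apply N Q (g l))"
  let ?y = "mat_apply N (\<lambda>i j. Q j i) x"
  have xy: "mat_apply N Q ?y = x" by (rule mat_apply_transpose[OF Q]) (use x in \<open>simp add: perp_def\<close>)
  have "ip N ?y (g l) = 0" if "l < k" for l
    using ip_mat_apply[OF Q, of ?y "g l"] xy x that by (simp add: perp_def)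
  then have "?y \<in> perp N k g" by (simp add: perp_def mat_apply_Rn)
  then show "x \<in> mat_apply N Q ` perp N k g" using xy by (metis imageI)
qed

text \<open>Both random subspaces, the orthogonal complement and the span of Gaussian vectors, are set
  to an arbitrary fixed subspace on the null event that the vectors are linearly dependent.\<close>

definition ker_space :: "nat \<Rightarrow> nat \<Rightarrow> (nat \<Rightarrow> nat \<Rightarrow> real) \<Rightarrow> (nat \<Rightarrow> real) set"
  where "ker_space N n G = (if gs_ok N n (pad N G) then perp N n (gs N (pad N G)) else lin_span (N - n) unitv)"

definition span_space :: "nat \<Rightarrow> nat \<Rightarrow> (nat \<Rightarrow> nat \<Rightarrow> real) \<Rightarrow> (nat \<Rightarrow> real) set"
  where "span_space N k G = (if gs_ok N k (pad N G) then lin_span k (gs N (pad N G)) else lin_span k unitv)"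

lemma orthonormal_unitv_le: "k \<le> N \<Longrightarrow> orthonormal N k unitv"
  using orthonormal_unitv[of N] by (auto simp: orthonormal_def)

lemma measurable_ker_space:
  assumes "n \<le> N"
  shows "ker_space N n \<in> measurable (GamM n N) (grassmannian_borel N n)"
proof (rule measurable_grassmannian)
  show "ker_space N n G \<in> grassmannian_codim N n" for G
    using perp_grassmannian(1)[OF gs_orthonormal[of n "pad N G" N]] lin_span_in_grassmannian[OF orthonormal_unitv_le[of "N - n" N], of n] assms
    by (auto simp: ker_space_def pad_Rn)
  fix i j
  have ok: "{G \<in> space (GamM n N). gs_ok N n (pad N G)} \<in> sets (GamM n N)"
    using pred_gs_ok[where k=n and N=N] by (simp add: pred_def)
  have m: "(\<lambda>G. \<Sum>l<n. gs N (pad N G) l i * gs N (pad N G) l j) \<in> borel_measurable (GamM n N)"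
    by (intro borel_measurable_sum borel_measurable_times measurable_gs) auto
  have eq: "proj_matrix N (ker_space N n G) i j = (if gs_ok N n (pad N G) then
      (if i = j \<and> i < N then 1 else 0) - (\<Sum>l<n. gs N (pad N G) l i * gs N (pad N G) l j)
      else proj_matrix N (lin_span (N - n) unitv) i j)" for G
  proof (cases "gs_ok N n (pad N G)")
    case True
    show ?thesis using perp_grassmannian(2)[OF gs_orthonormal[OF pad_Rn True], of i j] True
      by (simp only: ker_space_def if_True)
  next
    case False then show ?thesis by (simp only: ker_space_def if_False)
  qed
  show "(\<lambda>G. proj_matrix N (ker_space N n G) i j) \<in> borel_measurable (GamM n N)"
    unfolding eq by (intro measurable_If borel_measurable_diff borel_measurable_const m ok)
qed

lemma measurable_span_space:
  assumes "k + n = N"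
  shows "span_space N k \<in> measurable (GamM k N) (grassmannian_borel N n)"
proof (rule measurable_grassmannian)
  show "span_space N k G \<in> grassmannian_codim N n" for G
    using lin_span_in_grassmannian[OF gs_orthonormal[of k "pad N G" N]] lin_span_in_grassmannian[OF orthonormal_unitv_le[of k N], of n] assms
    by (auto simp: span_space_def pad_Rn)
  fix i j
  have ok: "{G \<in> space (GamM k N). gs_ok N k (pad N G)} \<in> sets (GamM k N)"
    using pred_gs_ok[where k=k and N=N] by (simp add: pred_def)
  have m: "(\<lambda>G. \<Sum>l<k. gs N (pad N G) l i * gs N (pad N G) l j) \<in> borel_measurable (GamM k N)"
    by (intro borel_measurable_sum borel_measurable_times measurable_gs) auto
  have eq: "proj_matrix N (span_space N k G) i j = (if gs_ok N k (pad N G) then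
      (\<Sum>l<k. gs N (pad N G) l i * gs N (pad N G) l j) else proj_matrix N (lin_span k unitv) i j)" for G
  proof (cases "gs_ok N k (pad N G)")
    case True
    show ?thesis using proj_matrix_lin_span[OF gs_orthonormal[OF pad_Rn True], of i j] True
      by (simp only: span_space_def if_True)
  next
    case False then show ?thesis by (simp only: span_space_def if_False)
  qed
  show "(\<lambda>G. proj_matrix N (span_space N k G) i j) \<in> borel_measurable (GamM k N)"
    unfolding eq by (intro measurable_If borel_measurable_diff borel_measurable_const m ok)
qed

lemma haar_ker_space:
  assumes "is_haar_grassmannian N n \<mu>" "n \<le> N"
  shows "\<mu> = distr (GamM n N) (grassmannian_borel N n) (ker_space N n)"
proof (rule haar_eq_distr[OF assms(1) measurable_ker_space[OF assms(2)]])
  fix Q assume Q: "orthogonal_mat N Q"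
  show "AE G in GamM n N. ker_space N n (compose {..<n} (rot N Q) G) = mat_apply N Q ` ker_space N n G"
    using AE_gs_ok[OF assms(2)]
  proof eventually_elim
    case (elim G)
    have "perp N n (gs N (pad N (compose {..<n} (rot N Q) G))) = perp N n (\<lambda>l. mat_apply N Q (gs N (pad N G) l))"
      by (simp add: perp_def gs_compose_rot[OF Q])
    then show ?case
      using elim mat_apply_perp[OF Q gs_orthonormal[of n "pad N G" N]]
      by (simp add: ker_space_def gs_ok_compose_rot[OF Q] pad_Rn)
  qed
qed

lemma haar_span_space:
  assumes "is_haar_grassmannian N n \<mu>" "k + n = N"
  shows "\<mu> = distr (GamM k N) (grassmannian_borel N n) (span_space N k)"
proof (rule haar_eq_distr[OF assms(1) measurable_span_space[OF assms(2)]])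
  fix Q assume Q: "orthogonal_mat N Q"
  have "k \<le> N" using assms by simp
  from AE_gs_ok[OF this]
  show "AE G in GamM k N. span_space N k (compose {..<k} (rot N Q) G) = mat_apply N Q ` span_space N k G"
  proof eventually_elim
    case (elim G)
    have "lin_span k (gs N (pad N (compose {..<k} (rot N Q) G))) = lin_span k (\<lambda>l. mat_apply N Q (gs N (pad N G) l))"
      by (rule lin_span_cong) (simp add: gs_compose_rot[OF Q])
    then show ?case
      using elim by (simp add: span_space_def gs_ok_compose_rot[OF Q] mat_apply_lin_span)
  qed
qed

lemma perp_gs: assumes "gs_ok N n r" shows "perp N n (gs N r) = perp N n r"
proof -
  have "ip N x (r l) = 0" if x: "\<forall>l<n. ip N x (gs N r l) = 0" and l: "l < n" for x l
  proof -
    obtain c where c: "r l = lincomb n c (gs N r)"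
      using gs_row_in_lin_span[OF assms l] by (auto simp: lin_span_def)
    show ?thesis unfolding c ip_lincomb_right using x by simp
  qed
  then show ?thesis using gs_perp[of n N _ r] by (auto simp: perp_def)
qed

text \<open>Transfers Gaussian estimates to the Haar measure. The literal kernel may be used, since
  almost surely it has codimension n and coincides with \<open>ker_space\<close>.\<close>

lemma haar_ge_kernel:
  assumes \<mu>: "is_haar_grassmannian N n \<mu>" and n: "n \<le> N" and A: "A \<in> sets \<mu>"
    and B: "B \<in> sets (GamM n N)"
    and sub: "\<And>G. G \<in> B \<Longrightarrow> perp N n G \<in> grassmannian_codim N n \<Longrightarrow> perp N n G \<in> A"
  shows "measure (GamM n N) B \<le> measure \<mu> A"
proof -
  have A': "A \<in> sets (grassmannian_borel N n)" using A \<mu> by (simp add: is_haar_grassmannian_def)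
  note measurable_ker_space[OF n, measurable] and A'[measurable]
  have "measure (GamM n N) B \<le> measure (GamM n N) (ker_space N n -` A \<inter> space (GamM n N))"
  proof (rule GamM.finite_measure_mono_AE)
    show "AE G in GamM n N. G \<in> B \<longrightarrow> G \<in> ker_space N n -` A \<inter> space (GamM n N)"
      using AE_gs_ok[OF n] AE_space
    proof eventually_elim
      case (elim G)
      have "ker_space N n G = perp N n (pad N G)" using elim by (simp add: ker_space_def perp_gs)
      also have "\<dots> = perp N n G" by (simp add: perp_def ip_pad)
      finally have k: "ker_space N n G = perp N n G" .
      have "ker_space N n G \<in> grassmannian_codim N n"
        using measurable_space[OF measurable_ker_space[OF n] elim(2)] by (simp add: space_grassmannian_borel)
      then show ?case using sub[of G] k elim(2) by auto
    qed
  qed measurable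
  also have "\<dots> = measure (distr (GamM n N) (grassmannian_borel N n) (ker_space N n)) A"
    by (rule measure_distr[symmetric]) measurable
  finally show ?thesis by (simp add: haar_ker_space[OF \<mu> n, symmetric])
qed

text \<open>For events that one random vector of the subspace can certify. With n < N there is at
  least one spanning vector, and the law of the first one is the Gaussian measure.\<close>

lemma haar_ge_span:
  assumes \<mu>: "is_haar_grassmannian N n \<mu>" and n: "n < N" and A: "A \<in> sets \<mu>"
    and B: "B \<in> sets (Gam N)"
    and sub: "\<And>h E. h \<in> B \<Longrightarrow> E \<in> grassmannian_codim N n \<Longrightarrow> (\<lambda>i. if i < N then h i else 0) \<in> E \<Longrightarrow> E \<in> A"
  shows "measure (Gam N) B \<le> measure \<mu> A"
proof -
  define k where "k = N - n"
  have k: "k + n = N" "0 < k" "k \<le> N" using n by (auto simp: k_def)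
  have A': "A \<in> sets (grassmannian_borel N n)" using A \<mu> by (simp add: is_haar_grassmannian_def)
  note measurable_span_space[OF k(1), measurable] and A'[measurable] and B[measurable]
  have comp: "(\<lambda>G. G 0) \<in> measurable (GamM k N) (Gam N)"
    by (rule measurable_component_singleton) (use k in simp)
  note comp[measurable]
  have "distr (GamM k N) (Gam N) (\<lambda>G. G 0) = Gam N"
    by (rule distr_PiM_component) (use k in \<open>auto simp: prob_space_Gam\<close>)
  then have "measure (Gam N) B = measure (distr (GamM k N) (Gam N) (\<lambda>G. G 0)) B" by simp
  also have "\<dots> = measure (GamM k N) ((\<lambda>G. G 0) -` B \<inter> space (GamM k N))"
    by (rule measure_distr) measurable
  also have "\<dots> \<le> measure (GamM k N) (span_space N k -` A \<inter> space (GamM k N))"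
  proof (rule GamM.finite_measure_mono_AE)
    show "AE G in GamM k N. G \<in> (\<lambda>G. G 0) -` B \<inter> space (GamM k N) \<longrightarrow> G \<in> span_space N k -` A \<inter> space (GamM k N)"
      using AE_gs_ok[OF k(3)] AE_space
    proof eventually_elim
      case (elim G)
      have "pad N G 0 \<in> span_space N k G"
        using gs_row_in_lin_span[OF elim(1) k(2)] elim(1) by (simp add: span_space_def)
      moreover have "span_space N k G \<in> grassmannian_codim N n"
        using measurable_space[OF measurable_span_space[OF k(1)] elim(2)] by (simp add: space_grassmannian_borel)
      ultimately show ?case using sub[of "G 0" "span_space N k G"] elim(2) by (auto simp: pad_def)
    qed
  qed measurable
  also have "\<dots> = measure (distr (GamM k N) (grassmannian_borel N n) (span_space N k)) A"
    by (rule measure_distr[symmetric]) measurable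
  finally show ?thesis by (simp add: haar_span_space[OF \<mu> k(1), symmetric])
qed

section \<open>A Gaussian small ball inequality\<close>

text \<open>Bounded, so that exponential moments exist; 1-Lipschitz with value 0 at 0, so that
  contraction applies; of positive mean \<open>e0\<close>, which is the gain per row.\<close>

definition phi :: "real \<Rightarrow> real" where "phi t = min \<bar>t\<bar> 1"

definition e0 :: real where "e0 = (\<integral>x. phi x \<partial>g1)"

lemma phi_bounds: "0 \<le> phi t" "phi t \<le> 1" "phi t \<le> \<bar>t\<bar>"
  by (auto simp: phi_def)

lemma phi_lipschitz: "\<bar>phi s - phi t\<bar> \<le> \<bar>s - t\<bar>"
  by (auto simp: phi_def min_def abs_if)

lemma phi_measurable [measurable]: "phi \<in> borel_measurable borel"
  unfolding phi_def by measurable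

lemma measure_g1_UNIV [simp]: "measure g1 UNIV = 1"
  using g1.prob_space by simp

lemma integrable_phi: "integrable g1 phi"
  by (rule g1.integrable_const_bound[of _ 1]) (auto simp: phi_bounds)

lemma e0_pos: "0 < e0"
proof -
  have "0 \<le> e0" unfolding e0_def by (rule integral_nonneg_AE) (auto simp: phi_bounds)
  moreover have "e0 \<noteq> 0"
  proof
    assume "e0 = 0"
    then have "AE x in g1. phi x = 0"
      using integral_nonneg_eq_0_iff_AE[OF integrable_phi] by (auto simp: e0_def phi_bounds)
    then have "AE x in g1. x = 0" by (rule AE_mp) (auto simp: phi_def min_def split: if_splits)
    moreover have "AE x in lborel. x \<noteq> (0::real)" by (rule AE_lborel_singleton)
    then have "AE x in g1. x \<noteq> 0" by (subst AE_density) auto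
    ultimately have "AE x in g1. False" by eventually_elim simp
    then show False using g1.AE_False by simp
  qed
  ultimately show ?thesis by simp
qed

lemma e0_le_1: "e0 \<le> 1"
proof -
  have "e0 \<le> (\<integral>x. 1 \<partial>g1)" unfolding e0_def
    by (rule integral_mono[OF integrable_phi]) (auto simp: phi_bounds)
  then show ?thesis by (simp add: g1.prob_space)
qed

text \<open>Jensen's inequality, by integrating the tangent of the exponential at
  \<open>l * e0\<close>.\<close>

lemma exp_e0_le:
  assumes "0 \<le> l"
  shows "ennreal (exp (l * e0)) \<le> (\<integral>\<^sup>+x. ennreal (exp (l * phi x)) \<partial>g1)"
proof -
  have int: "integrable g1 (\<lambda>x. exp (l * phi x))"
    by (rule g1.integrable_const_bound[of _ "exp l"])
      (use assms phi_bounds in \<open>auto simp: mult_left_le\<close>)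
  have int2: "integrable g1 (\<lambda>x. exp (l * e0) * (1 + l * (phi x - e0)))"
    using integrable_phi by (intro integrable_mult_right integrable_add integrable_diff) auto
  have "exp (l * e0) = (\<integral>x. exp (l * e0) * (1 + l * (phi x - e0)) \<partial>g1)"
    using integrable_phi by (simp add: g1.prob_space e0_def[symmetric])
  also have "\<dots> \<le> (\<integral>x. exp (l * phi x) \<partial>g1)"
  proof (rule integral_mono[OF int2 int])
    fix x
    have "exp (l * e0) * (1 + l * (phi x - e0)) \<le> exp (l * e0) * exp (l * (phi x - e0))"
      by (intro mult_left_mono exp_ge_add_one_self) auto
    also have "\<dots> = exp (l * phi x)" by (simp add: exp_add[symmetric] algebra_simps)
    finally show "exp (l * e0) * (1 + l * (phi x - e0)) \<le> exp (l * phi x)" .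
  qed
  finally show ?thesis
    by (subst nn_integral_eq_integral[OF int]) auto
qed

section \<open>Contraction for maxima of exponentials\<close>

lemma exp_increment_mono:
  fixes a b d e :: real
  assumes "b \<le> a" "0 \<le> e" "e \<le> d"
  shows "exp (b + e) - exp b \<le> exp (a + d) - exp a"
proof -
  have "exp b * (exp e - 1) \<le> exp a * (exp d - 1)"
    by (rule mult_mono) (use assms in auto)
  then show ?thesis by (simp add: exp_add algebra_simps)
qed

text \<open>The two-point form of the Ledoux--Talagrand contraction principle. Gain and loss are
  increments of the exponential: the optimality hypotheses let the gaining increment start further
  to the right, and the Lipschitz hypothesis makes it longer.\<close>

lemma two_point_contraction_nonneg:
  fixes A B u v s t :: real
  assumes st: "0 \<le> s" "0 \<le> t" and u: "\<bar>u\<bar> \<le> s" and v: "\<bar>v\<bar> \<le> t" and uv: "\<bar>u - v\<bar> \<le> \<bar>s - t\<bar>"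
    and opt: "B + v \<le> A + u" "A - u \<le> B - v"
  shows "exp (A + u) + exp (B - v) \<le> exp (A + s) + exp (B - t) \<or>
         exp (A + u) + exp (B - v) \<le> exp (B + t) + exp (A - s)"
proof (cases "t \<le> s")
  case True
  have "exp ((B - t) + (t - v)) - exp (B - t) \<le> exp ((A + u) + (s - u)) - exp (A + u)"
    by (rule exp_increment_mono) (use True assms in auto)
  then show ?thesis by simp
next
  case False
  have "exp ((A - s) + (s + u)) - exp (A - s) \<le> exp ((B - v) + (t + v)) - exp (B - v)"
    by (rule exp_increment_mono) (use False assms in auto)
  then show ?thesis by (simp add: algebra_simps)
qed

text \<open>Two nonpositive values reduce to the nonnegative case by passing to -s and -t, which
  swaps the two alternatives. For opposite signs each exponential is dominated on its own.\<close>

lemma two_point_contraction: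
  fixes A B u v s t :: real
  assumes u: "\<bar>u\<bar> \<le> \<bar>s\<bar>" and v: "\<bar>v\<bar> \<le> \<bar>t\<bar>" and uv: "\<bar>u - v\<bar> \<le> \<bar>s - t\<bar>"
    and opt: "B + v \<le> A + u" "A - u \<le> B - v"
  shows "exp (A + u) + exp (B - v) \<le> exp (A + s) + exp (B - t) \<or>
         exp (A + u) + exp (B - v) \<le> exp (B + t) + exp (A - s)"
proof -
  consider "0 \<le> s" "0 \<le> t" | "s \<le> 0" "t \<le> 0" | "0 \<le> s" "t \<le> 0" | "s \<le> 0" "0 \<le> t" by linarith
  then show ?thesis
  proof cases
    case 1
    then show ?thesis using two_point_contraction_nonneg[of s t u v B A] assms by auto
  next
    case 2
    have *: "\<bar>- s - - t\<bar> = \<bar>s - t\<bar>" by simp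
    show ?thesis
      using two_point_contraction_nonneg[of "-s" "-t" u v B A, unfolded *] assms 2 by auto
  next
    case 3
    have "exp (A + u) \<le> exp (A + s)" "exp (B - v) \<le> exp (B - t)" using 3 u v by auto
    then show ?thesis by linarith
  next
    case 4
    have "exp (A + u) \<le> exp (A - s)" "exp (B - v) \<le> exp (B + t)" using 4 u v by auto
    then show ?thesis by linarith
  qed
qed

definition max_exp :: "'a set \<Rightarrow> ('a \<Rightarrow> real) \<Rightarrow> real"
  where "max_exp T f = Max ((\<lambda>x. exp (f x)) ` T)"

lemma max_exp_ge: "finite T \<Longrightarrow> x \<in> T \<Longrightarrow> exp (f x) \<le> max_exp T f"
  by (simp add: max_exp_def)

lemma max_exp_obtain:
  assumes "finite T" "T \<noteq> {}"
  obtains x where "x \<in> T" "max_exp T f = exp (f x)" "\<And>y. y \<in> T \<Longrightarrow> f y \<le> f x"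
proof -
  have "Max ((\<lambda>x. exp (f x)) ` T) \<in> (\<lambda>x. exp (f x)) ` T" by (rule Max_in) (use assms in auto)
  then obtain x where x: "x \<in> T" "max_exp T f = exp (f x)" by (auto simp: max_exp_def)
  then have "f y \<le> f x" if "y \<in> T" for y using max_exp_ge[OF assms(1) that, of f] by simp
  then show ?thesis using that x by blast
qed

lemma max_exp_le: "finite T \<Longrightarrow> T \<noteq> {} \<Longrightarrow> (\<And>x. x \<in> T \<Longrightarrow> exp (f x) \<le> c) \<Longrightarrow> max_exp T f \<le> c"
  by (metis max_exp_obtain)

lemma max_exp_pos: "finite T \<Longrightarrow> T \<noteq> {} \<Longrightarrow> 0 < max_exp T f"
  by (metis max_exp_obtain exp_gt_zero)

lemma max_exp_measurable:
  assumes "finite T" "\<And>x. x \<in> T \<Longrightarrow> (\<lambda>w. f w x) \<in> borel_measurable M"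
  shows "(\<lambda>w. max_exp T (f w)) \<in> borel_measurable M"
  unfolding max_exp_def
  by (rule borel_measurable_Max[OF assms(1)]) (use assms(2) in measurable)

text \<open>Let x be optimal for a + u and y for a - u. Whichever pairing of x and y the two-point
  lemma yields, the two maxima on the right dominate it.\<close>

lemma max_exp_contraction:
  fixes a u s :: "'a \<Rightarrow> real"
  assumes T: "finite T" "T \<noteq> {}"
    and u: "\<And>x. x \<in> T \<Longrightarrow> \<bar>u x\<bar> \<le> \<bar>s x\<bar>"
    and uv: "\<And>x y. x \<in> T \<Longrightarrow> y \<in> T \<Longrightarrow> \<bar>u x - u y\<bar> \<le> \<bar>s x - s y\<bar>"
  shows "max_exp T (\<lambda>x. a x + u x) + max_exp T (\<lambda>x. a x - u x) \<le> max_exp T (\<lambda>x. a x + s x) + max_exp T (\<lambda>x. a x - s x)"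
proof -
  obtain x where x: "x \<in> T" "max_exp T (\<lambda>x. a x + u x) = exp (a x + u x)" "\<And>y. y \<in> T \<Longrightarrow> a y + u y \<le> a x + u x"
    using max_exp_obtain[OF T, of "\<lambda>x. a x + u x"] by metis
  obtain y where y: "y \<in> T" "max_exp T (\<lambda>x. a x - u x) = exp (a y - u y)" "\<And>z. z \<in> T \<Longrightarrow> a z - u z \<le> a y - u y"
    using max_exp_obtain[OF T, of "\<lambda>x. a x - u x"] by metis
  have "exp (a x + u x) + exp (a y - u y) \<le> exp (a x + s x) + exp (a y - s y) \<or>
         exp (a x + u x) + exp (a y - u y) \<le> exp (a y + s y) + exp (a x - s x)"
    by (rule two_point_contraction) (use x y u uv in auto)
  then show ?thesis
    unfolding x(2) y(2)
    using max_exp_ge[OF T(1) x(1), of "\<lambda>x. a x + s x"] max_exp_ge[OF T(1) x(1), of "\<lambda>x. a x - s x"]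
      max_exp_ge[OF T(1) y(1), of "\<lambda>x. a x + s x"] max_exp_ge[OF T(1) y(1), of "\<lambda>x. a x - s x"]
    by linarith
qed

lemma exp_midpoint: "exp ((a + b) / 2) \<le> (exp a + exp b) / (2::real)"
proof -
  have "0 \<le> (exp (a / 2) - exp (b / 2))\<^sup>2" by simp
  also have "\<dots> = exp a + exp b - 2 * exp ((a + b) / 2)"
    by (simp add: power2_eq_square algebra_simps exp_add[symmetric] add_divide_distrib)
  finally show ?thesis by simp
qed

lemma measurable_ip_Gam [measurable]: "(\<lambda>g. ip N x g) \<in> borel_measurable (Gam N)"
  unfolding ip_def by measurable

text \<open>One step of the replacement of \<open>e0 - phi\<close> by a Gaussian linear functional: the mean
  \<open>e0\<close> is written as an average over a ghost copy, the two copies are decoupled by the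
  convexity of the exponential, and \<open>phi\<close> is removed by contraction since \<open>g\<close>
  and \<open>-g\<close> have the same law.\<close>

lemma gaussian_replacement_step:
  assumes T: "finite T" "T \<noteq> {}" "\<And>x. x \<in> T \<Longrightarrow> ip N x x = 1" and l: "0 \<le> l"
  shows "(\<integral>\<^sup>+g. ennreal (max_exp T (\<lambda>x. a x + l * (e0 - phi (ip N x g)))) \<partial>Gam N)
      \<le> (\<integral>\<^sup>+g. ennreal (max_exp T (\<lambda>x. a x + 2 * l * ip N x g)) \<partial>Gam N)"
proof -
  define P where "P g = max_exp T (\<lambda>x. a x + 2 * l * phi (ip N x g))" for g
  define M where "M g = max_exp T (\<lambda>x. a x - 2 * l * phi (ip N x g))" for g
  define Q where "Q g = max_exp T (\<lambda>x. a x + 2 * l * ip N x g)" for g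
  define R where "R g = max_exp T (\<lambda>x. a x - 2 * l * ip N x g)" for g
  have meas[measurable]: "P \<in> borel_measurable (Gam N)" "M \<in> borel_measurable (Gam N)"
    "Q \<in> borel_measurable (Gam N)" "R \<in> borel_measurable (Gam N)"
    unfolding P_def M_def Q_def R_def by (rule max_exp_measurable[OF T(1)]; measurable)+
  have nn: "0 \<le> P g" "0 \<le> M g" "0 \<le> Q g" "0 \<le> R g" for g
    unfolding P_def M_def Q_def R_def using max_exp_pos[OF T(1,2)] less_imp_le by blast+
  \<comment> \<open>Convexity separates the copies \<open>g'\<close> and \<open>g\<close> at the
    price of doubling l; this is the origin of the factor 2 in the conclusion.\<close>
  have split: "max_exp T (\<lambda>x. a x + l * (phi (ip N x g') - phi (ip N x g))) \<le> (P g' + M g) / 2" for g g'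
  proof (rule max_exp_le[OF T(1,2)])
    fix x assume x: "x \<in> T"
    have "a x + l * (phi (ip N x g') - phi (ip N x g))
        = ((a x + 2 * l * phi (ip N x g')) + (a x - 2 * l * phi (ip N x g))) / 2"
      by (simp add: algebra_simps)
    also have "exp \<dots> \<le> (exp (a x + 2 * l * phi (ip N x g')) + exp (a x - 2 * l * phi (ip N x g))) / 2"
      by (rule exp_midpoint)
    also have "\<dots> \<le> (P g' + M g) / 2"
      using max_exp_ge[OF T(1) x, of "\<lambda>x. a x + 2 * l * phi (ip N x g')"]
        max_exp_ge[OF T(1) x, of "\<lambda>x. a x - 2 * l * phi (ip N x g)"] by (simp add: P_def M_def)
    finally show "exp (a x + l * (phi (ip N x g') - phi (ip N x g))) \<le> (P g' + M g) / 2" .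
  qed
  \<comment> \<open>The maximum is attained at one x, and Jensen is applied there; only afterwards
    is the maximum over all of \<open>T\<close> restored inside the integral.\<close>
  have ghost: "ennreal (max_exp T (\<lambda>x. a x + l * (e0 - phi (ip N x g)))) \<le> (\<integral>\<^sup>+g'. ennreal ((P g' + M g) / 2) \<partial>Gam N)" for g
  proof -
    obtain x where x: "x \<in> T" and eq: "max_exp T (\<lambda>x. a x + l * (e0 - phi (ip N x g))) = exp (a x + l * (e0 - phi (ip N x g)))"
      using max_exp_obtain[OF T(1,2), of "\<lambda>x. a x + l * (e0 - phi (ip N x g))"] by blast
    let ?c = "exp (a x - l * phi (ip N x g))"
    have "ennreal (exp (a x + l * (e0 - phi (ip N x g)))) = ennreal ?c * ennreal (exp (l * e0))"
      by (simp add: ennreal_mult[symmetric] exp_add[symmetric] algebra_simps)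
    also have "\<dots> \<le> ennreal ?c * (\<integral>\<^sup>+z. ennreal (exp (l * phi z)) \<partial>g1)"
      by (intro mult_left_mono exp_e0_le l) auto
    also have "(\<integral>\<^sup>+z. ennreal (exp (l * phi z)) \<partial>g1) = (\<integral>\<^sup>+g'. ennreal (exp (l * phi (ip N x g'))) \<partial>Gam N)"
      by (rule nn_integral_Gam_linear[symmetric, OF T(3)[OF x]]) measurable
    also have "ennreal ?c * \<dots> = (\<integral>\<^sup>+g'. ennreal ?c * ennreal (exp (l * phi (ip N x g'))) \<partial>Gam N)"
      by (rule nn_integral_cmult[symmetric]) measurable
    also have "\<dots> \<le> (\<integral>\<^sup>+g'. ennreal ((P g' + M g) / 2) \<partial>Gam N)"
    proof (rule nn_integral_mono)
      fix g'
      have "?c * exp (l * phi (ip N x g')) = exp (a x + l * (phi (ip N x g') - phi (ip N x g)))"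
        by (simp add: exp_add[symmetric] algebra_simps)
      also have "\<dots> \<le> (P g' + M g) / 2"
        by (rule order_trans[OF max_exp_ge[OF T(1) x] split])
      finally show "ennreal ?c * ennreal (exp (l * phi (ip N x g'))) \<le> ennreal ((P g' + M g) / 2)"
        by (simp add: ennreal_mult[symmetric] ennreal_leI)
    qed
    finally show ?thesis by (simp only: eq)
  qed
  have half: "ennreal ((b + c) / 2) = ennreal (1/2) * ennreal b + ennreal (1/2) * ennreal c" if "0 \<le> b" "0 \<le> c" for b c
  proof -
    have "ennreal ((b + c) / 2) = ennreal (1/2 * b + 1/2 * c)" by (simp add: add_divide_distrib)
    also have "\<dots> = ennreal (1/2 * b) + ennreal (1/2 * c)" by (rule ennreal_plus) (use that in auto)
    also have "ennreal (1/2 * b) = ennreal (1/2) * ennreal b" by (rule ennreal_mult) (use that in auto)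
    also have "ennreal (1/2 * c) = ennreal (1/2) * ennreal c" by (rule ennreal_mult) (use that in auto)
    finally show ?thesis .
  qed
  have "(\<integral>\<^sup>+g. ennreal (max_exp T (\<lambda>x. a x + l * (e0 - phi (ip N x g)))) \<partial>Gam N)
      \<le> (\<integral>\<^sup>+g. (\<integral>\<^sup>+g'. ennreal ((P g' + M g) / 2) \<partial>Gam N) \<partial>Gam N)"
    by (rule nn_integral_mono) (rule ghost)
  also have "\<dots> = (\<integral>\<^sup>+g. ennreal (1/2) * (\<integral>\<^sup>+g'. ennreal (P g') \<partial>Gam N) + ennreal (1/2) * ennreal (M g) \<partial>Gam N)"
  proof (rule nn_integral_cong)
    fix g
    show "(\<integral>\<^sup>+g'. ennreal ((P g' + M g) / 2) \<partial>Gam N)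
      = ennreal (1/2) * (\<integral>\<^sup>+g'. ennreal (P g') \<partial>Gam N) + ennreal (1/2) * ennreal (M g)"
      unfolding half[OF nn(1) nn(2)]
      by (subst nn_integral_add) (auto simp: nn_integral_cmult Gam.emeasure_space_1)
  qed
  also have "\<dots> = ennreal (1/2) * (\<integral>\<^sup>+g. ennreal (P g) \<partial>Gam N) + ennreal (1/2) * (\<integral>\<^sup>+g. ennreal (M g) \<partial>Gam N)"
    by (subst nn_integral_add) (auto simp: nn_integral_cmult Gam.emeasure_space_1)
  also have "\<dots> = (\<integral>\<^sup>+g. ennreal ((P g + M g) / 2) \<partial>Gam N)"
    unfolding half[OF nn(1) nn(2)] by (subst nn_integral_add) (auto simp: nn_integral_cmult)
  also have "\<dots> \<le> (\<integral>\<^sup>+g. ennreal ((Q g + R g) / 2) \<partial>Gam N)"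
  proof (rule nn_integral_mono, rule ennreal_leI)
    fix g
    have "P g + M g \<le> Q g + R g"
      unfolding P_def M_def Q_def R_def
    proof (rule max_exp_contraction[OF T(1,2)])
      fix x y
      show "\<bar>2 * l * phi (ip N x g)\<bar> \<le> \<bar>2 * l * ip N x g\<bar>"
        using phi_bounds[of "ip N x g"] l by (simp add: abs_mult mult_left_mono)
      have "\<bar>2 * l * (phi (ip N x g) - phi (ip N y g))\<bar> \<le> \<bar>2 * l * (ip N x g - ip N y g)\<bar>"
        using phi_lipschitz[of "ip N x g" "ip N y g"] l by (simp add: abs_mult mult_left_mono)
      then show "\<bar>2 * l * phi (ip N x g) - 2 * l * phi (ip N y g)\<bar> \<le> \<bar>2 * l * ip N x g - 2 * l * ip N y g\<bar>"
        by (simp add: right_diff_distrib)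
    qed
    then show "(P g + M g) / 2 \<le> (Q g + R g) / 2" by simp
  qed
  also have "\<dots> = ennreal (1/2) * (\<integral>\<^sup>+g. ennreal (Q g) \<partial>Gam N) + ennreal (1/2) * (\<integral>\<^sup>+g. ennreal (R g) \<partial>Gam N)"
    unfolding half[OF nn(3) nn(4)] by (subst nn_integral_add) (auto simp: nn_integral_cmult)
  also have "(\<integral>\<^sup>+g. ennreal (R g) \<partial>Gam N) = (\<integral>\<^sup>+g. ennreal (Q g) \<partial>Gam N)"
  proof -
    have "Q (\<lambda>i\<in>{..<N}. - g i) = R g" for g
      by (simp add: Q_def R_def ip_def sum_negf)
    then show ?thesis using Gam_uminus[of "\<lambda>g. ennreal (Q g)" N] by simp
  qed
  also have "ennreal (1/2) * (\<integral>\<^sup>+g. ennreal (Q g) \<partial>Gam N) + ennreal (1/2) * (\<integral>\<^sup>+g. ennreal (Q g) \<partial>Gam N)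
      = (\<integral>\<^sup>+g. ennreal (Q g) \<partial>Gam N)"
  proof -
    have "ennreal (1/2) + ennreal (1/2) = 1" by (subst ennreal_plus[symmetric]) auto
    then show ?thesis by (simp only: distrib_right[symmetric] mult_1)
  qed
  finally show ?thesis by (simp add: Q_def)
qed

lemma measurable_ip_GamM: "j < n \<Longrightarrow> (\<lambda>G. ip N x (G j)) \<in> borel_measurable (GamM n N)"
  by (rule measurable_compose[of "\<lambda>G. G j" _ "Gam N"], rule measurable_component_singleton, simp,
    rule measurable_ip_Gam)

text \<open>The shift \<open>a\<close> is arbitrary so that it can absorb the rows not yet treated,
  and later the Gaussian term of the last row. The last row is replaced with the others frozen, then
  the others with the last one frozen, which takes Fubini in both orders.\<close>

lemma gaussian_replacement:
  assumes T: "finite T" "T \<noteq> {}" "\<And>x. x \<in> T \<Longrightarrow> ip N x x = 1" and l: "\<And>j. 0 \<le> l j"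
  shows "(\<integral>\<^sup>+G. ennreal (max_exp T (\<lambda>x. a x + (\<Sum>j<n. l j * (e0 - phi (ip N x (G j)))))) \<partial>GamM n N)
      \<le> (\<integral>\<^sup>+G. ennreal (max_exp T (\<lambda>x. a x + (\<Sum>j<n. 2 * l j * ip N x (G j)))) \<partial>GamM n N)"
proof (induction n arbitrary: a)
  case 0
  show ?case by simp
next
  case (Suc n)
  have ins: "{..<Suc n} = insert n {..<n}" by auto
  have m: "(\<lambda>G. ip N x (G j)) \<in> borel_measurable (GamM (Suc n) N)" if "j < Suc n" for x j
    using that by (rule measurable_ip_GamM)
  let ?f1 = "\<lambda>G. ennreal (max_exp T (\<lambda>x. (a x + (\<Sum>j<n. l j * (e0 - phi (ip N x (G j))))) + l n * (e0 - phi (ip N x (G n)))))"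
  let ?f2 = "\<lambda>G. ennreal (max_exp T (\<lambda>x. (a x + (\<Sum>j<n. l j * (e0 - phi (ip N x (G j))))) + 2 * l n * ip N x (G n)))"
  let ?f3 = "\<lambda>G. ennreal (max_exp T (\<lambda>x. (a x + 2 * l n * ip N x (G n)) + (\<Sum>j<n. 2 * l j * ip N x (G j))))"
  have ms: "(\<lambda>G. \<Sum>j<n. l j * (e0 - phi (ip N x (G j)))) \<in> borel_measurable (GamM (Suc n) N)" for x
    by (intro borel_measurable_sum borel_measurable_times borel_measurable_diff borel_measurable_const
        measurable_compose[OF m phi_measurable]) auto
  have m1: "?f1 \<in> borel_measurable (PiM (insert n {..<n}) (\<lambda>_. Gam N))"
    unfolding ins[symmetric]
    by (intro measurable_compose[OF max_exp_measurable[OF T(1)] measurable_ennreal] borel_measurable_add ms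
       borel_measurable_times borel_measurable_diff borel_measurable_const measurable_compose[OF m phi_measurable]) auto
  have m2: "?f2 \<in> borel_measurable (PiM (insert n {..<n}) (\<lambda>_. Gam N))"
    unfolding ins[symmetric]
    by (intro measurable_compose[OF max_exp_measurable[OF T(1)] measurable_ennreal] borel_measurable_add ms
       borel_measurable_times borel_measurable_diff borel_measurable_const m) auto
  have m3: "?f3 \<in> borel_measurable (PiM (insert n {..<n}) (\<lambda>_. Gam N))"
    unfolding ins[symmetric]
    by (intro measurable_compose[OF max_exp_measurable[OF T(1)] measurable_ennreal] borel_measurable_add borel_measurable_sum
       borel_measurable_times borel_measurable_diff borel_measurable_const m) auto
  have up: "ip N x ((G(n := y)) j) = ip N x (G j)" if "j < n" for x G y j using that by simp
  have "(\<integral>\<^sup>+G. ?f1 G \<partial>GamM (Suc n) N) = (\<integral>\<^sup>+G. (\<integral>\<^sup>+y. ?f1 (G(n := y)) \<partial>Gam N) \<partial>GamM n N)"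
    unfolding ins by (rule gamM.product_nn_integral_insert[OF _ _ m1]) auto
  also have "\<dots> \<le> (\<integral>\<^sup>+G. (\<integral>\<^sup>+y. ?f2 (G(n := y)) \<partial>Gam N) \<partial>GamM n N)"
  proof (rule nn_integral_mono)
    fix G
    show "(\<integral>\<^sup>+y. ?f1 (G(n := y)) \<partial>Gam N) \<le> (\<integral>\<^sup>+y. ?f2 (G(n := y)) \<partial>Gam N)"
      using gaussian_replacement_step[OF T l, of "\<lambda>x. a x + (\<Sum>j<n. l j * (e0 - phi (ip N x (G j))))" n]
      by simp
  qed
  also have "\<dots> = (\<integral>\<^sup>+G. ?f2 G \<partial>GamM (Suc n) N)"
    unfolding ins by (rule gamM.product_nn_integral_insert[symmetric, OF _ _ m2]) auto
  also have "\<dots> = (\<integral>\<^sup>+y. (\<integral>\<^sup>+G. ?f2 (G(n := y)) \<partial>GamM n N) \<partial>Gam N)"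
    unfolding ins by (rule gamM.product_nn_integral_insert_rev[OF _ _ m2]) auto
  also have "\<dots> \<le> (\<integral>\<^sup>+y. (\<integral>\<^sup>+G. ?f3 (G(n := y)) \<partial>GamM n N) \<partial>Gam N)"
  proof (rule nn_integral_mono)
    fix y
    show "(\<integral>\<^sup>+G. ?f2 (G(n := y)) \<partial>GamM n N) \<le> (\<integral>\<^sup>+G. ?f3 (G(n := y)) \<partial>GamM n N)"
      using Suc.IH[of "\<lambda>x. a x + 2 * l n * ip N x y"] by (simp add: add_ac)
  qed
  also have "\<dots> = (\<integral>\<^sup>+G. ?f3 G \<partial>GamM (Suc n) N)"
    unfolding ins by (rule gamM.product_nn_integral_insert_rev[symmetric, OF _ _ m3]) auto
  finally show ?case by (simp add: add_ac)
qed

text \<open>The entries of the transposed Gaussian matrix are compared with the Gaussian measure on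
  \<open>{..<N} \<times> {..<n}\<close>, where the order of the two indices is irrelevant.\<close>

definition transp :: "nat \<Rightarrow> nat \<Rightarrow> (nat \<Rightarrow> nat \<Rightarrow> real) \<Rightarrow> nat \<Rightarrow> nat \<Rightarrow> real"
  where "transp n N G = (\<lambda>i\<in>{..<N}. \<lambda>j\<in>{..<n}. G j i)"

interpretation gam2: product_sigma_finite "\<lambda>_::nat \<times> nat. g1"
  by (rule product_sigma_finite.intro) (rule g1.sigma_finite_measure_axioms)

lemma GamM_flat:
  "distr (GamM N n) (PiM ({..<N} \<times> {..<n}) (\<lambda>_. g1)) (\<lambda>G. \<lambda>z\<in>{..<N} \<times> {..<n}. G (fst z) (snd z))
    = PiM ({..<N} \<times> {..<n}) (\<lambda>_. g1)" (is "distr _ ?F ?V = _")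
  and GamM_flat_transp:
  "distr (GamM n N) (PiM ({..<N} \<times> {..<n}) (\<lambda>_. g1)) (\<lambda>G. \<lambda>z\<in>{..<N} \<times> {..<n}. G (snd z) (fst z))
    = PiM ({..<N} \<times> {..<n}) (\<lambda>_. g1)" (is "distr _ _ ?W = _")
proof -
  have V: "?V \<in> measurable (GamM N n) ?F"
  proof (rule measurable_PiM_single')
    show "(\<lambda>G. ?V G z) \<in> measurable (GamM N n) g1" if "z \<in> {..<N} \<times> {..<n}" for z
      using that measurable_GamM_entry[of "fst z" N "snd z" n] by auto
  qed (auto simp: space_PiM)
  have W: "?W \<in> measurable (GamM n N) ?F"
  proof (rule measurable_PiM_single')
    show "(\<lambda>G. ?W G z) \<in> measurable (GamM n N) g1" if "z \<in> {..<N} \<times> {..<n}" for z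
      using that measurable_GamM_entry[of "snd z" n "fst z" N] by auto
  qed (auto simp: space_PiM)
  have sp: "space (GamM k m) = PiE {..<k} (\<lambda>_. extensional {..<m})" for k m
    by (auto simp: space_PiM PiE_def)
  show "distr (GamM N n) ?F ?V = ?F"
  proof (rule gam2.PiM_eqI)
    fix A :: "nat \<times> nat \<Rightarrow> real set" assume A: "\<And>z. z \<in> {..<N} \<times> {..<n} \<Longrightarrow> A z \<in> sets g1"
    have "emeasure (distr (GamM N n) ?F ?V) (PiE ({..<N} \<times> {..<n}) A) = emeasure (GamM N n) (?V -` PiE ({..<N} \<times> {..<n}) A \<inter> space (GamM N n))"
      by (intro emeasure_distr V sets_PiM_I_finite A finite_cartesian_product finite_lessThan)
    also have "?V -` PiE ({..<N} \<times> {..<n}) A \<inter> space (GamM N n) = PiE {..<N} (\<lambda>i. PiE {..<n} (\<lambda>j. A (i, j)))"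
      (is "?L = ?R")
    proof (rule set_eqI)
      fix G
      have "G \<in> ?L \<longleftrightarrow> (\<forall>i<N. \<forall>j<n. G i j \<in> A (i, j)) \<and> G \<in> space (GamM N n)"
        unfolding vimage_def Int_iff mem_Collect_eq restrict_PiE_iff by (simp add: Ball_def) blast
      also have "\<dots> \<longleftrightarrow> G \<in> ?R"
        unfolding sp PiE_iff by (simp only: lessThan_iff Ball_def) blast
      finally show "G \<in> ?L \<longleftrightarrow> G \<in> ?R" .
    qed
    also have "emeasure (GamM N n) \<dots> = (\<Prod>i<N. emeasure (Gam n) (PiE {..<n} (\<lambda>j. A (i, j))))"
      by (intro gamM.emeasure_PiM sets_PiM_I_finite A finite_lessThan) auto
    also have "\<dots> = (\<Prod>i<N. \<Prod>j<n. emeasure g1 (A (i, j)))"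
      by (intro prod.cong refl gam.emeasure_PiM A finite_lessThan) auto
    also have "\<dots> = (\<Prod>z\<in>{..<N} \<times> {..<n}. emeasure g1 (A z))"
      by (simp add: prod.cartesian_product)
    finally show "emeasure (distr (GamM N n) ?F ?V) (PiE ({..<N} \<times> {..<n}) A) = (\<Prod>z\<in>{..<N} \<times> {..<n}. emeasure g1 (A z))" .
  qed auto
  show "distr (GamM n N) ?F ?W = ?F"
  proof (rule gam2.PiM_eqI)
    fix A :: "nat \<times> nat \<Rightarrow> real set" assume A: "\<And>z. z \<in> {..<N} \<times> {..<n} \<Longrightarrow> A z \<in> sets g1"
    have "emeasure (distr (GamM n N) ?F ?W) (PiE ({..<N} \<times> {..<n}) A) = emeasure (GamM n N) (?W -` PiE ({..<N} \<times> {..<n}) A \<inter> space (GamM n N))"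
      by (intro emeasure_distr W sets_PiM_I_finite A finite_cartesian_product finite_lessThan)
    also have "?W -` PiE ({..<N} \<times> {..<n}) A \<inter> space (GamM n N) = PiE {..<n} (\<lambda>j. PiE {..<N} (\<lambda>i. A (i, j)))"
      (is "?L = ?R")
    proof (rule set_eqI)
      fix G
      have "G \<in> ?L \<longleftrightarrow> (\<forall>i<N. \<forall>j<n. G j i \<in> A (i, j)) \<and> G \<in> space (GamM n N)"
        unfolding vimage_def Int_iff mem_Collect_eq restrict_PiE_iff by (simp add: Ball_def) blast
      also have "\<dots> \<longleftrightarrow> G \<in> ?R"
        unfolding sp PiE_iff by (simp only: lessThan_iff Ball_def) blast
      finally show "G \<in> ?L \<longleftrightarrow> G \<in> ?R" .
    qed
    also have "emeasure (GamM n N) \<dots> = (\<Prod>j<n. emeasure (Gam N) (PiE {..<N} (\<lambda>i. A (i, j))))"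
      by (intro gamM.emeasure_PiM sets_PiM_I_finite A finite_lessThan) auto
    also have "\<dots> = (\<Prod>j<n. \<Prod>i<N. emeasure g1 (A (i, j)))"
      by (intro prod.cong refl gam.emeasure_PiM A finite_lessThan) auto
    also have "\<dots> = (\<Prod>i<N. \<Prod>j<n. emeasure g1 (A (i, j)))" by (rule prod.swap)
    also have "\<dots> = (\<Prod>z\<in>{..<N} \<times> {..<n}. emeasure g1 (A z))"
      by (simp add: prod.cartesian_product)
    finally show "emeasure (distr (GamM n N) ?F ?W) (PiE ({..<N} \<times> {..<n}) A) = (\<Prod>z\<in>{..<N} \<times> {..<n}. emeasure g1 (A z))" .
  qed auto
qed

lemma measurable_transp: "transp n N \<in> measurable (GamM n N) (GamM N n)"
  unfolding transp_def
proof (rule measurable_restrict)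
  fix i assume i: "i \<in> {..<N}"
  show "(\<lambda>G. \<lambda>j\<in>{..<n}. G j i) \<in> measurable (GamM n N) (Gam n)"
    by (rule measurable_restrict) (use i measurable_GamM_entry[of _ n i N] in auto)
qed

lemma GamM_transp: "distr (GamM n N) (GamM N n) (transp n N) = GamM N n"
proof -
  let ?F = "PiM ({..<N} \<times> {..<n}) (\<lambda>_. g1)"
  let ?V = "\<lambda>G. \<lambda>z\<in>{..<N} \<times> {..<n}. G (fst z) (snd z)"
  let ?W = "\<lambda>G. \<lambda>z\<in>{..<N} \<times> {..<n}. G (snd z) (fst z)"
  let ?U = "\<lambda>w. \<lambda>i\<in>{..<N}. \<lambda>j\<in>{..<n}. w (i, j)"
  have V: "?V \<in> measurable (GamM N n) ?F"
  proof (rule measurable_PiM_single')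
    show "(\<lambda>G. ?V G z) \<in> measurable (GamM N n) g1" if "z \<in> {..<N} \<times> {..<n}" for z
      using that measurable_GamM_entry[of "fst z" N "snd z" n] by auto
  qed (auto simp: space_PiM)
  have W: "?W \<in> measurable (GamM n N) ?F"
  proof (rule measurable_PiM_single')
    show "(\<lambda>G. ?W G z) \<in> measurable (GamM n N) g1" if "z \<in> {..<N} \<times> {..<n}" for z
      using that measurable_GamM_entry[of "snd z" n "fst z" N] by auto
  qed (auto simp: space_PiM)
  have U: "?U \<in> measurable ?F (GamM N n)"
    by (intro measurable_restrict measurable_component_singleton) auto
  have "GamM N n = distr (GamM N n) (GamM N n) (\<lambda>G. G)" by (simp add: distr_id)
  also have "\<dots> = distr (GamM N n) (GamM N n) (\<lambda>G. ?U (?V G))"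
  proof (rule distr_cong)
    fix G assume "G \<in> space (GamM N n)"
    then show "G = ?U (?V G)"
      by (intro ext) (auto simp: space_PiM PiE_def extensional_def restrict_def Pi_def)
  qed auto
  also have "\<dots> = distr ?F (GamM N n) ?U"
    by (subst GamM_flat[of N n, symmetric], subst distr_distr[OF U V]) (simp add: comp_def)
  also have "\<dots> = distr (GamM n N) (GamM N n) (\<lambda>G. ?U (?W G))"
    by (subst GamM_flat_transp[of n N, symmetric], subst distr_distr[OF U W]) (simp add: comp_def)
  also have "(\<lambda>G. ?U (?W G)) = transp n N"
    by (auto simp: transp_def fun_eq_iff restrict_def)
  finally show ?thesis by simp
qed

text \<open>Each column contributes the Gaussian variable given by u, and the columns are
  independent. This collapses n functionals of n rows into one functional of one Gaussian
  vector.\<close>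

lemma GamM_row_combination:
  assumes "ip n u u = 1"
  shows "distr (GamM n N) (Gam N) (\<lambda>G. \<lambda>i\<in>{..<N}. \<Sum>j<n. u j * G j i) = Gam N"
proof -
  have c: "compose {..<N} (ip n u) \<in> measurable (GamM N n) (Gam N)"
    unfolding compose_def
    by (intro measurable_restrict measurable_compose[OF measurable_component_singleton]) auto
  have "Gam N = distr (GamM N n) (Gam N) (compose {..<N} (ip n u))"
    by (subst distr_PiM_finite_prob_space') (auto simp: prob_space_Gam prob_space_g1 Gam_linear[OF assms])
  also have "\<dots> = distr (distr (GamM n N) (GamM N n) (transp n N)) (Gam N) (compose {..<N} (ip n u))"
    by (simp only: GamM_transp)
  also have "\<dots> = distr (GamM n N) (Gam N) (compose {..<N} (ip n u) \<circ> transp n N)"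
    by (rule distr_distr[OF c measurable_transp])
  also have "compose {..<N} (ip n u) \<circ> transp n N = (\<lambda>G. \<lambda>i\<in>{..<N}. \<Sum>j<n. u j * G j i)"
    by (auto simp: fun_eq_iff compose_def transp_def ip_def restrict_def)
  finally show ?thesis by (rule sym)
qed

lemma measurable_row_combination:
  "(\<lambda>G. \<lambda>i\<in>{..<N}. \<Sum>j<n. u j * G j i) \<in> measurable (GamM n N) (Gam N)"
proof (rule measurable_restrict)
  fix i assume i: "i \<in> {..<N}"
  have "(\<lambda>G. \<Sum>j<n. u j * G j i) \<in> borel_measurable (GamM n N)"
    by (intro borel_measurable_sum borel_measurable_times borel_measurable_const measurable_GamM_entry) (use i in auto)
  then show "(\<lambda>G. \<Sum>j<n. u j * G j i) \<in> measurable (GamM n N) g1" by simp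
qed

text \<open>Exponential Markov inequality. After the replacement the exponent is twice the sum of
  the l_j <x, G_j>, which has the law of 2 s <x, h> for one Gaussian vector h. The majorant
  \<open>F\<close> stands for the supremum over \<open>T\<close>, so that bounds independent of
  \<open>T\<close> can be inserted.\<close>

lemma small_ball_finite:
  fixes l :: "nat \<Rightarrow> real"
  assumes T: "finite T" "T \<noteq> {}" "\<And>x. x \<in> T \<Longrightarrow> ip N x x = 1" and l: "\<And>j. 0 \<le> l j"
    and s: "s > 0" "s\<^sup>2 = (\<Sum>j<n. (l j)\<^sup>2)"
    and F: "\<And>h x. x \<in> T \<Longrightarrow> ennreal (exp (2 * s * ip N x h)) \<le> F h"
  shows "emeasure (GamM n N) {G \<in> space (GamM n N). \<exists>x\<in>T. (\<Sum>j<n. l j * phi (ip N x (G j))) \<le> t}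
     \<le> ennreal (exp (t - e0 * (\<Sum>j<n. l j))) * (\<integral>\<^sup>+h. F h \<partial>Gam N)"
proof -
  define u where "u j = l j / s" for j
  have uu: "ip n u u = 1"
  proof -
    have "ip n u u = (\<Sum>j<n. (l j)\<^sup>2) / s\<^sup>2"
      by (simp add: ip_def u_def power2_eq_square sum_divide_distrib)
    then show ?thesis unfolding s(2)[symmetric] using s(1) by simp
  qed
  let ?m = "\<lambda>G. max_exp T (\<lambda>x. 0 + (\<Sum>j<n. l j * (e0 - phi (ip N x (G j)))))"
  have mm: "?m \<in> borel_measurable (GamM n N)"
    by (intro max_exp_measurable[OF T(1)] borel_measurable_add borel_measurable_sum
       borel_measurable_times borel_measurable_diff borel_measurable_const
       measurable_compose[OF measurable_ip_GamM phi_measurable]) auto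
  let ?c = "exp (t - e0 * (\<Sum>j<n. l j))"
  have "{G \<in> space (GamM n N). \<exists>x\<in>T. (\<Sum>j<n. l j * phi (ip N x (G j))) \<le> t}
      \<subseteq> {G \<in> space (GamM n N). 1 \<le> ennreal ?c * ennreal (?m G)}"
  proof safe
    fix G x assume x: "x \<in> T" "(\<Sum>j<n. l j * phi (ip N x (G j))) \<le> t"
    have "(\<Sum>j<n. l j * (e0 - phi (ip N x (G j)))) = e0 * (\<Sum>j<n. l j) - (\<Sum>j<n. l j * phi (ip N x (G j)))"
      by (simp add: right_diff_distrib sum_subtractf sum_distrib_left mult.commute)
    then have "1 \<le> exp (t - e0 * (\<Sum>j<n. l j)) * exp (0 + (\<Sum>j<n. l j * (e0 - phi (ip N x (G j)))))"
      using x(2) by (simp add: exp_add[symmetric])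
    also have "\<dots> \<le> ?c * ?m G" by (intro mult_left_mono max_exp_ge[OF T(1) x(1)]) auto
    finally show "1 \<le> ennreal ?c * ennreal (?m G)"
      using max_exp_pos[OF T(1,2)] by (simp add: ennreal_mult[symmetric] less_imp_le)
  qed
  then have "emeasure (GamM n N) {G \<in> space (GamM n N). \<exists>x\<in>T. (\<Sum>j<n. l j * phi (ip N x (G j))) \<le> t}
      \<le> emeasure (GamM n N) {G \<in> space (GamM n N). 1 \<le> ennreal ?c * ennreal (?m G)}"
    by (rule emeasure_mono) (use mm in measurable)
  also have "\<dots> \<le> ennreal ?c * (\<integral>\<^sup>+G. ennreal (?m G) * indicator (space (GamM n N)) G \<partial>GamM n N)"
  proof -
    have "(\<lambda>G. ennreal (?m G) * indicator (space (GamM n N)) G) \<in> borel_measurable (GamM n N)"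
      using mm by measurable
    then show ?thesis by (rule nn_integral_Markov_inequality) simp
  qed
  also have "(\<integral>\<^sup>+G. ennreal (?m G) * indicator (space (GamM n N)) G \<partial>GamM n N) = (\<integral>\<^sup>+G. ennreal (?m G) \<partial>GamM n N)"
    by (rule nn_integral_cong) simp
  also have "\<dots> \<le> (\<integral>\<^sup>+G. ennreal (max_exp T (\<lambda>x. 0 + (\<Sum>j<n. 2 * l j * ip N x (G j)))) \<partial>GamM n N)"
    by (rule gaussian_replacement[OF T l])
  also have "\<dots> = (\<integral>\<^sup>+G. ennreal (max_exp T (\<lambda>x. 2 * s * ip N x (\<lambda>i\<in>{..<N}. \<Sum>j<n. u j * G j i))) \<partial>GamM n N)"
  proof -
    have "(\<Sum>j<n. 2 * l j * ip N x (G j)) = 2 * s * ip N x (\<lambda>i\<in>{..<N}. \<Sum>j<n. u j * G j i)" for x G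
    proof -
      have "2 * s * ip N x (\<lambda>i\<in>{..<N}. \<Sum>j<n. u j * G j i) = (\<Sum>i<N. \<Sum>j<n. 2 * l j * (x i * G j i))"
        using s(1) by (simp add: ip_def u_def sum_distrib_left mult_ac)
      also have "\<dots> = (\<Sum>j<n. 2 * l j * ip N x (G j))"
        by (subst sum.swap) (simp add: ip_def sum_distrib_left mult_ac)
      finally show ?thesis by simp
    qed
    then show ?thesis by simp
  qed
  also have "\<dots> = (\<integral>\<^sup>+h. ennreal (max_exp T (\<lambda>x. 2 * s * ip N x h)) \<partial>distr (GamM n N) (Gam N) (\<lambda>G. \<lambda>i\<in>{..<N}. \<Sum>j<n. u j * G j i))"
  proof -
    have "(\<lambda>h. ennreal (max_exp T (\<lambda>x. 2 * s * ip N x h))) \<in> borel_measurable (Gam N)"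
      by (rule measurable_compose[OF max_exp_measurable[OF T(1)] measurable_ennreal]) measurable
    then show ?thesis by (subst nn_integral_distr[OF measurable_row_combination]) (simp only: measurable_distr_eq1)+
  qed
  also have "\<dots> = (\<integral>\<^sup>+h. ennreal (max_exp T (\<lambda>x. 2 * s * ip N x h)) \<partial>Gam N)"
    by (simp only: GamM_row_combination[OF uu])
  also have "\<dots> \<le> (\<integral>\<^sup>+h. F h \<partial>Gam N)"
  proof (rule nn_integral_mono)
    fix h
    obtain x where "x \<in> T" "max_exp T (\<lambda>x. 2 * s * ip N x h) = exp (2 * s * ip N x h)"
      using max_exp_obtain[OF T(1,2), of "\<lambda>x. 2 * s * ip N x h"] by blast
    then show "ennreal (max_exp T (\<lambda>x. 2 * s * ip N x h)) \<le> F h" using F by simp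
  qed
  finally show ?thesis by (simp add: mult_left_mono)
qed

text \<open>The finite bound does not see the size of the set, so it passes to an increasing union
  of finite subsets of \<open>D\<close>. Countability also secures the measurability of the
  event.\<close>

lemma small_ball:
  fixes l :: "nat \<Rightarrow> real"
  assumes D: "countable D" "\<And>x. x \<in> D \<Longrightarrow> ip N x x = 1" and l: "\<And>j. 0 \<le> l j"
    and s: "s > 0" "s\<^sup>2 = (\<Sum>j<n. (l j)\<^sup>2)"
    and F: "\<And>h x. x \<in> D \<Longrightarrow> ennreal (exp (2 * s * ip N x h)) \<le> F h"
  shows "{G \<in> space (GamM n N). \<exists>x\<in>D. (\<Sum>j<n. l j * phi (ip N x (G j))) \<le> t} \<in> sets (GamM n N)"
    and "emeasure (GamM n N) {G \<in> space (GamM n N). \<exists>x\<in>D. (\<Sum>j<n. l j * phi (ip N x (G j))) \<le> t}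
     \<le> ennreal (exp (t - e0 * (\<Sum>j<n. l j))) * (\<integral>\<^sup>+h. F h \<partial>Gam N)"
proof -
  let ?A = "\<lambda>T. {G \<in> space (GamM n N). \<exists>x\<in>T. (\<Sum>j<n. l j * phi (ip N x (G j))) \<le> t}"
  have one: "{G \<in> space (GamM n N). (\<Sum>j<n. l j * phi (ip N x (G j))) \<le> t} \<in> sets (GamM n N)" for x
  proof -
    have "(\<lambda>G. \<Sum>j<n. l j * phi (ip N x (G j))) \<in> borel_measurable (GamM n N)"
      by (intro borel_measurable_sum borel_measurable_times borel_measurable_const
         measurable_compose[OF measurable_ip_GamM phi_measurable]) auto
    then show ?thesis by measurable
  qed
  have A: "?A T \<in> sets (GamM n N)" if "countable T" for T
  proof -
    have "?A T = (\<Union>x\<in>T. {G \<in> space (GamM n N). (\<Sum>j<n. l j * phi (ip N x (G j))) \<le> t})" by auto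
    also have "\<dots> \<in> sets (GamM n N)" by (rule sets.countable_UN''[OF that one])
    finally show ?thesis .
  qed
  show "?A D \<in> sets (GamM n N)" by (rule A[OF D(1)])
  show "emeasure (GamM n N) (?A D) \<le> ennreal (exp (t - e0 * (\<Sum>j<n. l j))) * (\<integral>\<^sup>+h. F h \<partial>Gam N)"
  proof (cases "D = {}")
    case False
    let ?T = "\<lambda>k. from_nat_into D ` {..k}"
    have T: "?T k \<subseteq> D" for k using from_nat_into[OF False] by auto
    have UN: "?A D = (\<Union>k. ?A (?T k))"
    proof (intro equalityI subsetI)
      fix G assume "G \<in> ?A D"
      then obtain x where x: "x \<in> D" "(\<Sum>j<n. l j * phi (ip N x (G j))) \<le> t" "G \<in> space (GamM n N)" by auto
      then have "x \<in> ?T (to_nat_on D x)" using from_nat_into_to_nat_on[OF D(1) x(1)] by (metis atMost_iff imageI order_refl)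
      then show "G \<in> (\<Union>k. ?A (?T k))" using x by blast
    qed (use T in blast)
    have inc: "incseq (\<lambda>k. ?A (?T k))" by (rule incseq_SucI) auto
    have "emeasure (GamM n N) (?A D) = (SUP k. emeasure (GamM n N) (?A (?T k)))"
      unfolding UN by (rule SUP_emeasure_incseq[symmetric]) (use A inc in auto)
    also have "\<dots> \<le> ennreal (exp (t - e0 * (\<Sum>j<n. l j))) * (\<integral>\<^sup>+h. F h \<partial>Gam N)"
    proof (rule SUP_least)
      fix k
      show "emeasure (GamM n N) (?A (?T k)) \<le> ennreal (exp (t - e0 * (\<Sum>j<n. l j))) * (\<integral>\<^sup>+h. F h \<partial>Gam N)"
        by (rule small_ball_finite[OF _ _ _ l s]) (use T[of k] D(2) F in auto)
    qed
    finally show ?thesis .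
  qed simp
qed

section \<open>Sections of the ellipsoid\<close>

definition gauge_pow :: "nat \<Rightarrow> real \<Rightarrow> (nat \<Rightarrow> real) \<Rightarrow> (nat \<Rightarrow> real) \<Rightarrow> real"
  where "gauge_pow N p s y = (\<Sum>i<N. (\<bar>y i\<bar> / s (Suc i)) powr p)"

lemma p_ellipsoid_gauge_pow: "p_ellipsoid N p s = {x \<in> Rn N. gauge_pow N p s x \<le> 1}"
  by (simp add: p_ellipsoid_def gauge_pow_def)

lemma L2_ip: "L2_set y {..<N} = sqrt (ip N y y)"
  by (simp add: L2_set_def ip_def power2_eq_square)

lemma gauge_pow_nonneg: "0 \<le> gauge_pow N p s y"
  by (simp add: gauge_pow_def sum_nonneg)

lemma gauge_pow_scale:
  assumes "\<And>j. 0 < s (Suc j)"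
  shows "gauge_pow N p s (\<lambda>i. c * y i) = \<bar>c\<bar> powr p * gauge_pow N p s y"
  unfolding gauge_pow_def sum_distrib_left
  using assms by (intro sum.cong refl) (simp add: abs_mult powr_mult[symmetric] less_imp_le)

lemma gauge_pow_eq_0:
  assumes "\<And>j. 0 < s (Suc j)"
  shows "gauge_pow N p s y = 0 \<longleftrightarrow> ip N y y = 0"
proof -
  have "gauge_pow N p s y = 0 \<longleftrightarrow> (\<forall>i<N. (\<bar>y i\<bar> / s (Suc i)) powr p = 0)"
    unfolding gauge_pow_def by (subst sum_nonneg_eq_0_iff) auto
  also have "\<dots> \<longleftrightarrow> (\<forall>i<N. y i = 0)" using assms by (auto simp: less_imp_neq[symmetric])
  finally show ?thesis by (simp add: ip_self_eq_0)
qed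

lemma p_ellipsoid_coord:
  assumes "\<And>j. 0 < s (Suc j)" "0 < p" "y \<in> p_ellipsoid N p s" "i < N"
  shows "\<bar>y i\<bar> \<le> s (Suc i)"
proof -
  have "(\<bar>y i\<bar> / s (Suc i)) powr p \<le> gauge_pow N p s y"
    unfolding gauge_pow_def by (rule member_le_sum) (use assms in auto)
  also have "\<dots> \<le> 1 powr p" using assms by (simp add: p_ellipsoid_gauge_pow)
  finally have "\<bar>y i\<bar> / s (Suc i) \<le> 1"
    using assms powr_less_mono2[of p 1 "\<bar>y i\<bar> / s (Suc i)"] by (force simp: not_less[symmetric])
  then show ?thesis using assms(1)[of i] by (simp add: field_simps)
qed

lemma section_radius_bdd:
  assumes "\<And>j. 0 < s (Suc j)" "0 < p"
  shows "bdd_above ((\<lambda>y. L2_set y {..<N}) ` (E \<inter> p_ellipsoid N p s))"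
proof (rule bdd_aboveI2)
  fix y assume y: "y \<in> E \<inter> p_ellipsoid N p s"
  have "L2_set y {..<N} \<le> (\<Sum>i<N. \<bar>y i\<bar>)" by (rule L2_set_le_sum_abs)
  also have "\<dots> \<le> (\<Sum>i<N. s (Suc i))"
    by (intro sum_mono p_ellipsoid_coord[where s=s, OF assms]) (use y in auto)
  finally show "L2_set y {..<N} \<le> (\<Sum>i<N. s (Suc i))" .
qed

lemma section_radius_ge:
  assumes "\<And>j. 0 < s (Suc j)" "0 < p" "y \<in> E" "y \<in> p_ellipsoid N p s"
  shows "sqrt (ip N y y) \<le> section_radius N (p_ellipsoid N p s) E"
  unfolding section_radius_def L2_ip[symmetric]
  by (rule cSUP_upper[OF _ section_radius_bdd[where s=s, OF assms(1,2)]]) (use assms in auto)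

lemma section_radius_le:
  assumes "E \<in> grassmannian_codim N n" "0 < p"
    "\<And>y. y \<in> E \<Longrightarrow> y \<in> p_ellipsoid N p s \<Longrightarrow> sqrt (ip N y y) \<le> c"
  shows "section_radius N (p_ellipsoid N p s) E \<le> c"
  unfolding section_radius_def
proof (rule cSUP_least)
  have "(\<lambda>_. 0) \<in> E" using assms(1) rfun.subspace_0[of E] by (auto simp: grassmannian_codim_def zero_fun_def)
  moreover have "(\<lambda>_. 0) \<in> p_ellipsoid N p s" by (auto simp: p_ellipsoid_gauge_pow gauge_pow_def Rn_iff)
  ultimately show "E \<inter> p_ellipsoid N p s \<noteq> {}" by blast
qed (use assms in \<open>auto simp: L2_ip\<close>)

lemma grassmannian_scale: "E \<in> grassmannian_codim N n \<Longrightarrow> y \<in> E \<Longrightarrow> (\<lambda>i. c * y i) \<in> E"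
  using rfun.subspace_scale[of E y c] by (auto simp: grassmannian_codim_def fscale_def)

lemma grassmannian_Rn: "E \<in> grassmannian_codim N n \<Longrightarrow> y \<in> E \<Longrightarrow> y \<in> Rn N"
  by (auto simp: grassmannian_codim_def)

lemma section_radius_ge_ratio:
  assumes s: "\<And>j. 0 < s (Suc j)" and p: "0 < p" and E: "E \<in> grassmannian_codim N n" and y: "y \<in> E"
    and t: "0 < t" "gauge_pow N p s y \<le> t powr p"
  shows "sqrt (ip N y y) / t \<le> section_radius N (p_ellipsoid N p s) E"
proof -
  let ?z = "\<lambda>i. (1 / t) * y i"
  have z: "?z \<in> E" by (rule grassmannian_scale[OF E y])
  have "gauge_pow N p s ?z = (1 / t) powr p * gauge_pow N p s y" by (subst gauge_pow_scale[where s=s, OF s]) (use t in simp)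
  also have "\<dots> \<le> (1 / t) powr p * t powr p" using t by (intro mult_left_mono) auto
  also have "\<dots> = 1" using t by (simp add: powr_mult[symmetric])
  finally have "?z \<in> p_ellipsoid N p s"
    using grassmannian_Rn[OF E z] by (simp add: p_ellipsoid_gauge_pow)
  from section_radius_ge[where s=s, OF s p z this]
  have "sqrt (ip N ?z ?z) \<le> section_radius N (p_ellipsoid N p s) E" .
  moreover have "ip N ?z ?z = ip N y y / t\<^sup>2" by (simp only: ip_scale_left ip_scale_right) (simp add: power2_eq_square)
  ultimately show ?thesis using t by (simp add: real_sqrt_divide)
qed

lemma section_radius_nonneg:
  assumes "\<And>j. 0 < s (Suc j)" "0 < p" "E \<in> grassmannian_codim N n"
  shows "0 \<le> section_radius N (p_ellipsoid N p s) E"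
proof -
  have "(\<lambda>_. 0) \<in> E" using assms(3) rfun.subspace_0[of E] by (auto simp: grassmannian_codim_def zero_fun_def)
  from section_radius_ge_ratio[where s=s, OF assms this, of 1] show ?thesis
    by (simp add: gauge_pow_def ip_def)
qed

text \<open>A countable dense subset of \<open>Rn N\<close>, indexed by a countable type; entries
  missing from the list count as zero.\<close>

definition rat_vec :: "nat \<Rightarrow> rat list \<Rightarrow> nat \<Rightarrow> real"
  where "rat_vec N l = (\<lambda>i. if i < N \<and> i < length l then of_rat (l ! i) else 0)"

lemma rat_vec_dense:
  assumes "y \<in> Rn N"
  obtains z :: "nat \<Rightarrow> rat list" where "\<And>i. (\<lambda>k. rat_vec N (z k) i) \<longlonglongrightarrow> y i"
proof -
  define z where "z k = map (\<lambda>i. of_int \<lfloor>real (Suc k) * y i\<rfloor> / of_nat (Suc k) :: rat) [0..<N]" for k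
  have "(\<lambda>k. rat_vec N (z k) i) \<longlonglongrightarrow> y i" for i
  proof (cases "i < N")
    case True
    have eq: "rat_vec N (z k) i = of_int \<lfloor>real (Suc k) * y i\<rfloor> / real (Suc k)" for k
      using True by (simp add: rat_vec_def z_def of_rat_divide of_rat_add)
    have "(\<lambda>k. y i - 1 / real (Suc k)) \<longlonglongrightarrow> y i - 0"
      by (intro tendsto_diff tendsto_const) (use LIMSEQ_inverse_real_of_nat in \<open>simp add: divide_inverse\<close>)
    then have lim: "(\<lambda>k. y i - 1 / real (Suc k)) \<longlonglongrightarrow> y i" by simp
    show ?thesis
      unfolding eq
    proof (rule tendsto_sandwich[OF _ _ lim tendsto_const])
      show "\<forall>\<^sub>F k in sequentially. y i - 1 / real (Suc k) \<le> of_int \<lfloor>real (Suc k) * y i\<rfloor> / real (Suc k)"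
      proof (rule always_eventually, rule allI)
        fix k
        have "real (Suc k) * y i - 1 \<le> of_int \<lfloor>real (Suc k) * y i\<rfloor>" by linarith
        then have "(real (Suc k) * y i - 1) / real (Suc k) \<le> of_int \<lfloor>real (Suc k) * y i\<rfloor> / real (Suc k)"
          by (rule divide_right_mono) simp
        then show "y i - 1 / real (Suc k) \<le> of_int \<lfloor>real (Suc k) * y i\<rfloor> / real (Suc k)"
          by (simp add: diff_divide_distrib del: of_nat_Suc)
      qed
      show "\<forall>\<^sub>F k in sequentially. of_int \<lfloor>real (Suc k) * y i\<rfloor> / real (Suc k) \<le> y i"
      proof (rule always_eventually, rule allI)
        fix k
        have "of_int \<lfloor>real (Suc k) * y i\<rfloor> / real (Suc k) \<le> real (Suc k) * y i / real (Suc k)"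
          by (rule divide_right_mono) auto
        then show "of_int \<lfloor>real (Suc k) * y i\<rfloor> / real (Suc k) \<le> y i" by (simp del: of_nat_Suc)
      qed
    qed
  next
    case False
    then have "rat_vec N (z k) i = 0" "y i = 0" for k using assms by (auto simp: rat_vec_def Rn_iff)
    then show ?thesis by simp
  qed
  then show ?thesis using that by blast
qed

lemma tendsto_ip:
  assumes "\<And>i. i < N \<Longrightarrow> (\<lambda>k. x k i) \<longlonglongrightarrow> x' i" "\<And>i. i < N \<Longrightarrow> (\<lambda>k. y k i) \<longlonglongrightarrow> y' i"
  shows "(\<lambda>k. ip N (x k) (y k)) \<longlonglongrightarrow> ip N x' y'"
  unfolding ip_def using assms by (intro tendsto_sum tendsto_mult) auto

lemma tendsto_gauge_pow:
  assumes "0 < p" "\<And>i. i < N \<Longrightarrow> (\<lambda>k. x k i) \<longlonglongrightarrow> x' i" "\<And>j. 0 < s (Suc j)"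
  shows "(\<lambda>k. gauge_pow N p s (x k)) \<longlonglongrightarrow> gauge_pow N p s x'"
  unfolding gauge_pow_def
proof (rule tendsto_sum)
  fix i assume "i \<in> {..<N}"
  then have "(\<lambda>k. \<bar>x k i\<bar> / s (Suc i)) \<longlonglongrightarrow> \<bar>x' i\<bar> / s (Suc i)"
    using assms(2)[of i] assms(3)[of i] by (intro tendsto_divide tendsto_rabs tendsto_const) auto
  then show "(\<lambda>k. (\<bar>x k i\<bar> / s (Suc i)) powr p) \<longlonglongrightarrow> (\<bar>x' i\<bar> / s (Suc i)) powr p"
    by (rule tendsto_powr'[OF _ tendsto_const]) (use assms in \<open>auto intro!: always_eventually simp: less_imp_le\<close>)
qed

text \<open>Homogeneous of degree 0, so approximating points may leave the ellipsoid; at the zero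
  vector the quotient takes the harmless value 0.\<close>

definition gauge_ratio :: "nat \<Rightarrow> real \<Rightarrow> (nat \<Rightarrow> real) \<Rightarrow> (nat \<Rightarrow> real) \<Rightarrow> real"
  where "gauge_ratio N p s y = sqrt (ip N y y) / gauge_pow N p s y powr (1 / p)"

lemma gauge_ratio_le:
  assumes s: "\<And>j. 0 < s (Suc j)" and p: "0 < p" and E: "E \<in> grassmannian_codim N n" and y: "y \<in> E"
  shows "gauge_ratio N p s y \<le> section_radius N (p_ellipsoid N p s) E"
proof (cases "gauge_pow N p s y = 0")
  case True
  then show ?thesis using section_radius_nonneg[where s=s, OF s p E] by (simp add: gauge_ratio_def)
next
  case False
  then have "0 < gauge_pow N p s y" using gauge_pow_nonneg[of N p s y] by simp
  then show ?thesis
    unfolding gauge_ratio_def using p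
    by (intro section_radius_ge_ratio[where s=s, OF s p E y]) (auto simp: powr_powr)
qed

text \<open>Points of \<open>E\<close> are limits of projections of rational vectors, which stay in
  \<open>E\<close>, and the ratio is continuous away from 0. This makes the radius a countable
  supremum of functions that are measurable in the entries of the projection.\<close>

lemma section_radius_eq_SUP:
  assumes s: "\<And>j. 0 < s (Suc j)" and p: "0 < p" and E: "E \<in> grassmannian_codim N n"
  shows "section_radius N (p_ellipsoid N p s) E = (SUP z. gauge_ratio N p s (orth_proj N E (rat_vec N z)))"
    and "bdd_above (range (\<lambda>z. gauge_ratio N p s (orth_proj N E (rat_vec N z))))"
proof -
  let ?r = "section_radius N (p_ellipsoid N p s) E"
  have le: "gauge_ratio N p s (orth_proj N E (rat_vec N z)) \<le> ?r" for z
    by (rule gauge_ratio_le[where s=s, OF s p E orth_proj_in[OF E]])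
  show bdd: "bdd_above (range (\<lambda>z. gauge_ratio N p s (orth_proj N E (rat_vec N z))))"
    by (rule bdd_aboveI2[of _ _ ?r]) (rule le)
  have "?r \<le> (SUP z. gauge_ratio N p s (orth_proj N E (rat_vec N z)))"
  proof (rule section_radius_le[OF E p])
    fix y assume y: "y \<in> E" "y \<in> p_ellipsoid N p s"
    show "sqrt (ip N y y) \<le> (SUP z. gauge_ratio N p s (orth_proj N E (rat_vec N z)))"
    proof (cases "gauge_pow N p s y = 0")
      case True
      then have "ip N y y = 0" using gauge_pow_eq_0[where s=s, OF s] by simp
      moreover have "0 \<le> gauge_ratio N p s (orth_proj N E (rat_vec N []))"
        by (simp add: gauge_ratio_def ip_self_nonneg)
      ultimately show ?thesis using cSUP_upper[OF _ bdd, of "[]"] by simp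
    next
      case False
      then have g0: "0 < gauge_pow N p s y" using gauge_pow_nonneg[of N p s y] by simp
      have g1: "gauge_pow N p s y \<le> 1" using y by (simp add: p_ellipsoid_gauge_pow)
      obtain z where z: "\<And>i. (\<lambda>k. rat_vec N (z k) i) \<longlonglongrightarrow> y i"
        using rat_vec_dense[OF grassmannian_Rn[OF E y(1)]] by blast
      have "(\<lambda>k. orth_proj N E (rat_vec N (z k)) i) \<longlonglongrightarrow> orth_proj N E y i" for i
        unfolding orth_proj_matrix[OF E] by (intro tendsto_sum tendsto_mult tendsto_const z)
      then have P: "(\<lambda>k. orth_proj N E (rat_vec N (z k)) i) \<longlonglongrightarrow> y i" for i
        by (simp add: orth_proj_id[OF E y(1)])
      have "(\<lambda>k. gauge_ratio N p s (orth_proj N E (rat_vec N (z k)))) \<longlonglongrightarrow> gauge_ratio N p s y"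
        unfolding gauge_ratio_def using g0
        by (intro tendsto_divide tendsto_real_sqrt tendsto_ip tendsto_powr tendsto_gauge_pow P p s tendsto_const) auto
      then have "gauge_ratio N p s y \<le> (SUP z. gauge_ratio N p s (orth_proj N E (rat_vec N z)))"
        by (rule LIMSEQ_le_const2) (auto intro!: cSUP_upper bdd)
      moreover have "sqrt (ip N y y) \<le> gauge_ratio N p s y"
      proof -
        have "gauge_pow N p s y powr (1 / p) \<le> 1" using g0 g1 p by (simp add: powr_le1)
        then show ?thesis unfolding gauge_ratio_def using g0
          by (simp add: le_divide_eq mult_left_le ip_self_nonneg)
      qed
      ultimately show ?thesis by simp
    qed
  qed
  moreover have "(SUP z. gauge_ratio N p s (orth_proj N E (rat_vec N z))) \<le> ?r"
    by (rule cSUP_least) (auto intro: le)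
  ultimately show "?r = (SUP z. gauge_ratio N p s (orth_proj N E (rat_vec N z)))" by (rule antisym)
qed

lemma measurable_section_radius:
  assumes s: "\<And>j. 0 < s (Suc j)" and p: "0 < p"
  shows "section_radius N (p_ellipsoid N p s) \<in> borel_measurable (grassmannian_borel N n)"
proof -
  have m: "(\<lambda>E. \<Sum>j<N. proj_matrix N E i j * rat_vec N z j) \<in> borel_measurable (grassmannian_borel N n)" for z i
    by (intro borel_measurable_sum borel_measurable_times borel_measurable_const measurable_proj_matrix)
  have pr: "(\<lambda>E. gauge_ratio N p s (\<lambda>i. \<Sum>j<N. proj_matrix N E i j * rat_vec N z j)) \<in> borel_measurable (grassmannian_borel N n)" for z
    unfolding gauge_ratio_def gauge_pow_def ip_def using m by measurable
  have op: "orth_proj N E x = (\<lambda>i. \<Sum>j<N. proj_matrix N E i j * x j)" if "E \<in> space (grassmannian_borel N n)" for E x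
    using orth_proj_matrix that by (auto simp: space_grassmannian_borel)
  have "(\<lambda>E. SUP z. gauge_ratio N p s (\<lambda>i. \<Sum>j<N. proj_matrix N E i j * rat_vec N z j)) \<in> borel_measurable (grassmannian_borel N n)"
  proof (rule borel_measurable_cSUP[OF _ pr])
    fix E assume E: "E \<in> space (grassmannian_borel N n)"
    show "bdd_above (range (\<lambda>z. gauge_ratio N p s (\<lambda>i. \<Sum>j<N. proj_matrix N E i j * rat_vec N z j)))"
      using section_radius_eq_SUP(2)[where s=s, OF s p, of E N n] E by (simp add: op space_grassmannian_borel)
  qed simp
  then show ?thesis
    by (rule subst[OF measurable_cong, rotated])
      (use section_radius_eq_SUP(1)[where s=s, OF s p, of _ N n] op in \<open>simp add: space_grassmannian_borel\<close>)
qed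

section \<open>Sums of logarithmic weights\<close>

lemma harmonic_le_ln:
  assumes "1 \<le> m" "m \<le> M" shows "(\<Sum>i\<in>{m<..M}. 1 / real i) \<le> ln (real M / real m)"
  using assms(2)
proof (induction M rule: dec_induct)
  case base then show ?case using assms by simp
next
  case (step k)
  have k: "1 \<le> k" using assms step by simp
  have "{m<..Suc k} = insert (Suc k) {m<..k}" using step by auto
  then have "(\<Sum>i\<in>{m<..Suc k}. 1 / real i) = 1 / real (Suc k) + (\<Sum>i\<in>{m<..k}. 1 / real i)" by simp
  also have "1 / real (Suc k) \<le> ln (real (Suc k) / real k)"
    using ln_ge_iff[of "real (Suc k) / real k"] ln_le_minus_one[of "real k / real (Suc k)"] k
    by (simp add: ln_div field_simps)
  also have "ln (real (Suc k) / real k) + (\<Sum>i\<in>{m<..k}. 1 / real i) \<le> ln (real (Suc k) / real m)"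
    using step k assms by (simp add: ln_div)
  finally show ?case by simp
qed

lemma harmonic_ge_ln:
  assumes "m \<le> M" shows "ln (real (M + 1) / real (m + 1)) \<le> (\<Sum>i\<in>{m<..M}. 1 / real i)"
  using assms
proof (induction M rule: dec_induct)
  case base then show ?case by simp
next
  case (step k)
  have "{m<..Suc k} = insert (Suc k) {m<..k}" using step by auto
  then have eq: "(\<Sum>i\<in>{m<..Suc k}. 1 / real i) = 1 / real (Suc k) + (\<Sum>i\<in>{m<..k}. 1 / real i)" by simp
  have "ln (real (Suc k + 1) / real (k + 1)) \<le> real (Suc k + 1) / real (k + 1) - 1"
    by (rule ln_le_minus_one) simp
  also have "\<dots> = 1 / real (Suc k)" by (simp add: field_simps)
  finally have "ln (real (Suc k + 1)) - ln (real (k + 1)) \<le> 1 / real (Suc k)"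
    by (simp add: ln_div del: of_nat_Suc of_nat_add)
  moreover have "ln (real (k + 1)) - ln (real (m + 1)) \<le> (\<Sum>i\<in>{m<..k}. 1 / real i)"
    using step.IH by (simp add: ln_div del: of_nat_Suc of_nat_add)
  ultimately have "ln (real (Suc k + 1)) - ln (real (m + 1)) \<le> 1 / real (Suc k) + (\<Sum>i\<in>{m<..k}. 1 / real i)"
    by simp
  then show ?case unfolding eq by (simp add: ln_div del: of_nat_Suc of_nat_add)
qed

text \<open>For s = \<beta> q this is the q-th power of the i-th semiaxis, as
  \<open>log_semiaxis_powr\<close> shows.\<close>

definition log_weight :: "real \<Rightarrow> nat \<Rightarrow> real"
  where "log_weight s i = 1 / real i * ln (real i + 1) powr (- s)"

lemma log_weight_pos: "1 \<le> i \<Longrightarrow> 0 < log_weight s i"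
  by (simp add: log_weight_def)

lemma log_weight_nonneg: "0 \<le> log_weight s i"
  by (simp add: log_weight_def)

text \<open>Integral test: the weight is compared with the increment of the power 1 - s of the
  logarithm. The factor 2 stems from ln(i+1) - ln i \<ge> 1/(i+1) \<ge> 1/(2i).\<close>

lemma log_weight_telescope:
  assumes "1 < s" "2 \<le> i"
  shows "log_weight s i \<le> 2 / (s - 1) * (ln (real i) powr (1 - s) - ln (real i + 1) powr (1 - s))"
proof -
  define a where "a = ln (real i)"
  define b where "b = ln (real i + 1)"
  have ab: "0 < a" "a < b" using assms by (auto simp: a_def b_def)
  have ba: "1 / (2 * real i) \<le> b - a"
  proof -
    have "ln (real i / (real i + 1)) \<le> real i / (real i + 1) - 1"
      by (rule ln_le_minus_one) (use assms in simp)
    also have "\<dots> = - (1 / (real i + 1))" by (simp add: field_simps)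
    finally have "1 / (real i + 1) \<le> b - a" using assms by (simp add: a_def b_def ln_div)
    moreover have "1 / (2 * real i) \<le> 1 / (real i + 1)" using assms by (intro divide_left_mono) auto
    ultimately show ?thesis by simp
  qed
  \<comment> \<open>Bernoulli's inequality for the negative exponent 1 - s, from ln z \<le> z - 1
    and exp z \<ge> 1 + z.\<close>
  have r: "1 + (s - 1) * (1 - a / b) \<le> (a / b) powr (1 - s)"
  proof -
    have "ln (a / b) \<le> a / b - 1" by (rule ln_le_minus_one) (use ab in simp)
    then have "(s - 1) * (1 - a / b) \<le> (1 - s) * ln (a / b)"
      using assms mult_left_mono[of "1 - a / b" "- ln (a / b)" "s - 1"] by (simp add: algebra_simps)
    also have "1 + \<dots> \<le> exp ((1 - s) * ln (a / b))" by (rule exp_ge_add_one_self)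
    finally show ?thesis using ab by (simp add: powr_def)
  qed
  have "b powr (1 - s) * (1 + (s - 1) * (1 - a / b)) \<le> b powr (1 - s) * (a / b) powr (1 - s)"
    using r by (intro mult_left_mono) auto
  also have "\<dots> = a powr (1 - s)" using ab by (simp add: powr_mult[symmetric])
  finally have "b powr (1 - s) * ((s - 1) * (1 - a / b)) \<le> a powr (1 - s) - b powr (1 - s)"
    by (simp add: algebra_simps)
  moreover have "b powr (1 - s) * ((s - 1) * (1 - a / b)) = (s - 1) * (b powr (- s) * (b - a))"
  proof -
    have "b powr (1 - s) = b powr (- s) * b" using ab powr_add[of b "- s" 1] by simp
    then show ?thesis using ab by (simp add: field_simps)
  qed
  moreover have "(s - 1) * (b powr (- s) * (1 / (2 * real i))) \<le> (s - 1) * (b powr (- s) * (b - a))"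
    using ba assms by (intro mult_left_mono) auto
  ultimately have "(s - 1) * (b powr (- s) * (1 / (2 * real i))) \<le> a powr (1 - s) - b powr (1 - s)" by simp
  then have "log_weight s i * ((s - 1) / 2) \<le> a powr (1 - s) - b powr (1 - s)"
    by (simp add: log_weight_def b_def[symmetric] mult_ac)
  then have "log_weight s i \<le> (a powr (1 - s) - b powr (1 - s)) / ((s - 1) / 2)"
    using assms by (subst pos_le_divide_eq) auto
  then show ?thesis by (simp add: a_def b_def mult.commute)
qed

lemma log_weight_tail:
  assumes "1 < s" "1 \<le> M" "M \<le> N"
  shows "(\<Sum>i\<in>{M<..N}. log_weight s i) \<le> 2 / (s - 1) * ln (real M + 1) powr (1 - s)"
proof -
  have "(\<Sum>i\<in>{M<..N}. log_weight s i) \<le> 2 / (s - 1) * (ln (real M + 1) powr (1 - s) - ln (real N + 1) powr (1 - s))"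
    using assms(3)
  proof (induction N rule: dec_induct)
    case base then show ?case by simp
  next
    case (step k)
    have "{M<..Suc k} = insert (Suc k) {M<..k}" using step by auto
    then have "(\<Sum>i\<in>{M<..Suc k}. log_weight s i) = log_weight s (Suc k) + (\<Sum>i\<in>{M<..k}. log_weight s i)" by simp
    moreover have "log_weight s (Suc k) \<le> 2 / (s - 1) * (ln (real k + 1) powr (1 - s) - ln (real (Suc k) + 1) powr (1 - s))"
      using log_weight_telescope[OF assms(1), of "Suc k"] step assms by (simp add: add.commute)
    ultimately show ?case using step.IH by (simp add: right_diff_distrib)
  qed
  also have "\<dots> \<le> 2 / (s - 1) * ln (real M + 1) powr (1 - s)"
    using assms by (intro mult_left_mono) auto
  finally show ?thesis .
qed

definition log_max :: "nat \<Rightarrow> nat \<Rightarrow> real"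
  where "log_max N n = max 1 (ln (real N / real n) * (ln (real n) / ln (real N)))"

lemma log_max_ge_1: "1 \<le> log_max N n"
  by (simp add: log_max_def)

text \<open>With a = ln n and d = ln(N/n), the product in \<open>log_max\<close> is a d / (a + d),
  half the harmonic mean of a and d. It lies between half their minimum and their minimum, and the
  minimum changes sides at N = n^2.\<close>

lemma log_max_upper_aux:
  assumes "1 \<le> n" "n < N"
  shows "N \<le> n\<^sup>2 \<Longrightarrow> ln (real N / real n) \<le> 2 * log_max N n"
    and "n\<^sup>2 \<le> N \<Longrightarrow> ln (real n) \<le> 2 * log_max N n"
    and "log_max N n \<le> max 1 (ln (real N / real n))"
    and "log_max N n \<le> max 1 (ln (real n))"
proof -
  define a where "a = ln (real n)"
  define b where "b = ln (real N)"
  have a: "0 \<le> a" "a < b" "0 < b" using assms by (auto simp: a_def b_def)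
  have Nn: "ln (real N / real n) = b - a" using assms by (simp add: ln_div a_def b_def)
  have L: "log_max N n = max 1 ((b - a) * (a / b))" by (simp add: log_max_def Nn a_def[symmetric] b_def[symmetric])
  have sq: "ln (real (n\<^sup>2)) = 2 * a" using assms by (simp add: a_def ln_realpow)
  show "ln (real N / real n) \<le> 2 * log_max N n" if "N \<le> n\<^sup>2"
  proof -
    have "b \<le> 2 * a" unfolding sq[symmetric] b_def using assms that
      by (subst ln_le_cancel_iff) auto
    then have "b - a \<le> 2 * ((b - a) * (a / b))"
      using a mult_left_mono[of 1 "2 * (a / b)" "b - a"] by (simp add: field_simps)
    then show ?thesis unfolding Nn L by linarith
  qed
  show "ln (real n) \<le> 2 * log_max N n" if "n\<^sup>2 \<le> N"
  proof -
    have "2 * a \<le> b" unfolding sq[symmetric] b_def using assms that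
      by (subst ln_le_cancel_iff) auto
    then have "1 / 2 \<le> (b - a) / b" using a by (simp add: field_simps)
    then have "a * (1 / 2) \<le> a * ((b - a) / b)" using a by (intro mult_left_mono) auto
    then have "a \<le> 2 * ((b - a) * (a / b))" by (simp add: mult_ac)
    then show ?thesis unfolding L a_def[symmetric] by linarith
  qed
  show "log_max N n \<le> max 1 (ln (real N / real n))"
  proof -
    have "(b - a) * (a / b) \<le> (b - a) * 1" using a by (intro mult_left_mono) auto
    then show ?thesis unfolding Nn L by simp
  qed
  show "log_max N n \<le> max 1 (ln (real n))"
  proof -
    have "a * ((b - a) / b) \<le> a * 1" using a by (intro mult_left_mono) auto
    then have "(b - a) * (a / b) \<le> a" by (simp add: mult_ac)
    then show ?thesis unfolding L a_def[symmetric] by simp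
  qed
qed

lemma ln2_ge_half: "1 / 2 \<le> ln (2::real)"
  using ln_le_minus_one[of "1 / 2 :: real"] by (simp add: ln_div)

text \<open>ln(n+1) exceeds ln(i+1) by at most ln(1/\<eta>), and ln(i+1) \<ge> ln 2 converts the
  additive error into a factor.\<close>

lemma ln_compare:
  assumes "0 < \<eta>" "\<eta> \<le> 1" "1 \<le> n" "1 \<le> i" "\<eta> * real n \<le> real i"
  shows "ln (real n + 1) \<le> (1 + ln (1 / \<eta>) / ln 2) * ln (real i + 1)"
proof -
  have "\<eta> * (real n + 1) \<le> real i + 1" using assms by (simp add: algebra_simps)
  then have "real n + 1 \<le> (real i + 1) * (1 / \<eta>)" using assms by (simp add: field_simps)
  then have "ln (real n + 1) \<le> ln ((real i + 1) * (1 / \<eta>))" using assms by (subst ln_le_cancel_iff) auto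
  also have "\<dots> = ln (real i + 1) + ln (1 / \<eta>)" using assms by (intro ln_mult_pos) auto
  also have "ln (1 / \<eta>) \<le> ln (1 / \<eta>) / ln 2 * ln (real i + 1)"
  proof -
    have "ln (1 / \<eta>) / ln 2 * ln 2 \<le> ln (1 / \<eta>) / ln 2 * ln (real i + 1)"
      using assms by (intro mult_left_mono) (auto intro!: divide_nonneg_pos)
    then show ?thesis by simp
  qed
  finally show ?thesis by (simp add: algebra_simps)
qed

lemma log_weight_upper_single:
  assumes "0 < \<eta>" "\<eta> \<le> 1" "1 \<le> n" "1 \<le> i" "\<eta> * real n \<le> real i" "0 \<le> s"
  shows "ln (real i + 1) powr (- s) \<le> (1 + ln (1 / \<eta>) / ln 2) powr s * ln (real n + 1) powr (- s)"
proof -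
  let ?k = "1 + ln (1 / \<eta>) / ln 2"
  have k: "1 \<le> ?k" using assms by (auto intro!: divide_nonneg_pos)
  have "ln (real i + 1) powr (- s) = ?k powr s * (?k * ln (real i + 1)) powr (- s)"
  proof -
    have "?k \<noteq> 0" using k by linarith
    then have "?k powr s * ?k powr (- s) = 1" by (simp only: powr_add[symmetric]) simp
    then show ?thesis by (simp only: powr_mult mult.assoc[symmetric] mult_1)
  qed
  also have "\<dots> \<le> ?k powr s * ln (real n + 1) powr (- s)"
    using ln_compare[OF assms(1-5)] assms k by (intro mult_left_mono powr_mono2') auto
  finally show ?thesis .
qed

text \<open>Three ranges, with l = ln(n+1)^(-s). Up to n each term is at most a multiple of l/n.
  From n to M = min(N, n^2) the logarithm is at least ln(n+1), and the harmonic sum is at most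
  ln(M/n). Beyond n^2 the convergent tail gives l ln(n+1), and there ln n is at most twice
  \<open>log_max\<close>.\<close>

lemma log_weight_sum_upper:
  assumes s: "1 < s" and \<eta>: "0 < \<eta>" "\<eta> \<le> 1"
  shows "\<exists>C>0. \<forall>n N. 1 \<le> n \<longrightarrow> n < N \<longrightarrow>
    (\<Sum>i\<in>{i \<in> {1..N}. \<eta> * real n < real i}. log_weight s i) \<le> C * (ln (real n + 1) powr (- s) * log_max N n)"
proof -
  define k where "k = (1 + ln (1 / \<eta>) / ln 2) powr s"
  let ?C = "k / \<eta> + 2 + 6 / (s - 1)"
  have k0: "0 \<le> k" by (simp add: k_def)
  have C0: "0 < ?C"
  proof -
    have "0 \<le> k / \<eta>" "0 < 6 / (s - 1)" using k0 \<eta> s by auto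
    then show ?thesis by linarith
  qed
  have "(\<Sum>i\<in>{i \<in> {1..N}. \<eta> * real n < real i}. log_weight s i) \<le> ?C * (ln (real n + 1) powr (- s) * log_max N n)"
    if n: "1 \<le> n" "n < N" for n N
  proof -
    define l where "l = ln (real n + 1) powr (- s)"
    have l0: "0 \<le> l" by (simp add: l_def)
    define M where "M = min N (n\<^sup>2)"
    have nM: "n \<le> M" using n by (auto simp: M_def power2_eq_square)
    let ?A = "{i \<in> {1..n}. \<eta> * real n < real i}"
    have L1: "1 \<le> log_max N n" by (rule log_max_ge_1)
    have A: "(\<Sum>i\<in>?A. log_weight s i) \<le> k / \<eta> * (l * log_max N n)"
    proof -
      have "(\<Sum>i\<in>?A. log_weight s i) \<le> (\<Sum>i\<in>?A. 1 / (\<eta> * real n) * (k * l))"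
      proof (rule sum_mono)
        fix i assume i: "i \<in> ?A"
        have "1 / real i \<le> 1 / (\<eta> * real n)" using i n \<eta> by (intro divide_left_mono) auto
        moreover have "ln (real i + 1) powr (- s) \<le> k * l"
          unfolding k_def l_def using i n \<eta> s by (intro log_weight_upper_single) auto
        ultimately show "log_weight s i \<le> 1 / (\<eta> * real n) * (k * l)"
          unfolding log_weight_def using n \<eta> by (intro mult_mono) auto
      qed
      also have "\<dots> = real (card ?A) * (1 / (\<eta> * real n) * (k * l))" by simp
      also have "\<dots> \<le> real n * (1 / (\<eta> * real n) * (k * l))"
      proof (rule mult_right_mono)
        have "card ?A \<le> card {1..n}" by (rule card_mono) auto
        then show "real (card ?A) \<le> real n" by simp
      qed (use n \<eta> k0 l0 in auto)
      also have "\<dots> = k / \<eta> * (l * 1)" using n \<eta> by simp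
      also have "\<dots> \<le> k / \<eta> * (l * log_max N n)" using k0 l0 \<eta> L1 by (intro mult_left_mono) auto
      finally show ?thesis .
    qed
    have B: "(\<Sum>i\<in>{n<..M}. log_weight s i) \<le> 2 * (l * log_max N n)"
    proof -
      have "(\<Sum>i\<in>{n<..M}. log_weight s i) \<le> (\<Sum>i\<in>{n<..M}. 1 / real i * l)"
        unfolding log_weight_def l_def using n s by (intro sum_mono mult_left_mono powr_mono2') auto
      also have "\<dots> = (\<Sum>i\<in>{n<..M}. 1 / real i) * l" by (simp add: sum_distrib_right)
      also have "\<dots> \<le> (2 * log_max N n) * l"
      proof (rule mult_right_mono[OF _ l0])
        have "(\<Sum>i\<in>{n<..M}. 1 / real i) \<le> ln (real M / real n)" by (rule harmonic_le_ln[OF n(1) nM])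
        also have "\<dots> \<le> 2 * log_max N n"
        proof (cases "N \<le> n\<^sup>2")
          case True then show ?thesis using log_max_upper_aux(1)[OF n] by (simp add: M_def)
        next
          case False
          then have "real M / real n = real n" using n by (simp add: M_def power2_eq_square)
          then show ?thesis using log_max_upper_aux(2)[OF n] False by simp
        qed
        finally show "(\<Sum>i\<in>{n<..M}. 1 / real i) \<le> 2 * log_max N n" .
      qed
      finally show ?thesis by (simp add: mult_ac)
    qed
    have C: "(\<Sum>i\<in>{M<..N}. log_weight s i) \<le> 6 / (s - 1) * (l * log_max N n)"
    proof (cases "N \<le> n\<^sup>2")
      case True then show ?thesis using l0 L1 s by (simp add: M_def)
    next
      case False
      then have M: "M = n\<^sup>2" by (simp add: M_def)
      have "(\<Sum>i\<in>{M<..N}. log_weight s i) \<le> 2 / (s - 1) * ln (real M + 1) powr (1 - s)"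
        by (rule log_weight_tail[OF s]) (use False n M in auto)
      also have "\<dots> \<le> 2 / (s - 1) * ln (real n + 1) powr (1 - s)"
        using s n nM by (intro mult_left_mono powr_mono2') auto
      also have "ln (real n + 1) powr (1 - s) = l * ln (real n + 1)"
        unfolding l_def using n powr_add[of "ln (real n + 1)" "- s" 1] by simp
      also have "ln (real n + 1) \<le> 3 * log_max N n"
      proof -
        have "ln (real n + 1) \<le> ln (2 * real n)" using n by (subst ln_le_cancel_iff) auto
        also have "\<dots> = ln 2 + ln (real n)" using n by (simp add: ln_mult)
        also have "ln (2::real) \<le> 1" using ln_le_minus_one[of "2::real"] by simp
        also have "1 + ln (real n) \<le> 3 * log_max N n" using log_max_upper_aux(2)[OF n] False L1 by simp
        finally show ?thesis by simp
      qed
      finally have "(\<Sum>i\<in>{M<..N}. log_weight s i) \<le> 2 / (s - 1) * (l * (3 * log_max N n))"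
        using s l0 by (simp add: mult_left_mono divide_right_mono)
      then show ?thesis by (simp add: mult_ac)
    qed
    have "{i \<in> {1..N}. \<eta> * real n < real i} \<subseteq> ?A \<union> {n<..M} \<union> {M<..N}"
      using nM by auto
    then have "(\<Sum>i\<in>{i \<in> {1..N}. \<eta> * real n < real i}. log_weight s i) \<le> (\<Sum>i\<in>?A \<union> {n<..M} \<union> {M<..N}. log_weight s i)"
      by (intro sum_mono2) (auto simp: log_weight_nonneg)
    also have "\<dots> = (\<Sum>i\<in>?A. log_weight s i) + (\<Sum>i\<in>{n<..M}. log_weight s i) + (\<Sum>i\<in>{M<..N}. log_weight s i)"
      using nM by (subst sum.union_disjoint, auto)+
    also have "\<dots> \<le> ?C * (l * log_max N n)" using A B C by (simp add: algebra_simps)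
    finally show ?thesis by (simp add: l_def)
  qed
  then show ?thesis using C0 by blast
qed

text \<open>Only indices up to a cut-off of order min(N, n^2) are kept: there the logarithm is
  comparable to ln(n+1), and a harmonic sum remains. The integer \<open>A\<close> is left free
  because the small ball estimate will need the sum to start at a large multiple of n.\<close>

lemma log_weight_sum_lower:
  assumes s: "0 < s" and A: "2 \<le> (A::nat)"
  shows "\<exists>c>0. \<forall>n N. 1 \<le> n \<longrightarrow> 4 * A\<^sup>2 * n \<le> N \<longrightarrow>
    c * (ln (real n + 1) powr (- s) * log_max N n) \<le> (\<Sum>i\<in>{A * n<..N}. log_weight s i)"
proof -
  define k where "k = ln (4 * (real A)\<^sup>2) / ln 2 + 2"
  have lA: "ln (4 * (real A)\<^sup>2) = 2 * ln (2 * real A)"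
  proof -
    have "4 * (real A)\<^sup>2 = (2 * real A)\<^sup>2" by (simp add: power_mult_distrib)
    then show ?thesis using A by (simp only: ln_realpow)
  qed
  have l2A: "1 \<le> ln (2 * real A)"
  proof -
    have "1 \<le> ln (2::real) + ln 2" using ln2_ge_half by simp
    also have "\<dots> \<le> ln 2 + ln (real A)" using A by (simp add: ln_le_cancel_iff)
    finally show ?thesis using A by (simp add: ln_mult)
  qed
  have k2: "2 \<le> k" unfolding k_def lA using l2A by simp
  have "k powr (- s) / 2 * (ln (real n + 1) powr (- s) * log_max N n) \<le> (\<Sum>i\<in>{A * n<..N}. log_weight s i)"
    if n: "1 \<le> n" "4 * A\<^sup>2 * n \<le> N" for n N
  proof -
    have "1 < 4 * A\<^sup>2" using mult_le_mono[OF A A] by (simp add: power2_eq_square)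
    then have "n * 1 < n * (4 * A\<^sup>2)" using n by (intro mult_strict_left_mono) auto
    also have "n * (4 * A\<^sup>2) \<le> N" using n(2) by (simp only: mult.commute)
    finally have nN: "n < N" by simp
    \<comment> \<open>The factor 4 A^2 makes the quotient M/(2 A n) equal to 2 A n when the second
      term is the minimum, so starting at A n costs nothing there.\<close>
    define M where "M = min N (4 * A\<^sup>2 * n\<^sup>2)"
    have AA: "2 * (A * n) \<le> 4 * A\<^sup>2 * n"
      using A by (simp add: power2_eq_square)
    have "4 * A\<^sup>2 * n \<le> 4 * A\<^sup>2 * n\<^sup>2" using n by (simp add: power2_eq_square)
    then have M1: "4 * A\<^sup>2 * n \<le> M" using n by (simp add: M_def)
    have AM: "A * n \<le> M" using AA M1 by linarith
    have "1 \<le> A * n" using A n by simp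
    then have M0: "0 < M" using AM by linarith
    have lM: "ln (real M + 1) \<le> k * ln (real n + 1)"
    proof -
      have "real M \<le> 4 * (real A)\<^sup>2 * (real n)\<^sup>2"
      proof -
        have "real M \<le> real (4 * A\<^sup>2 * n\<^sup>2)" unfolding M_def by (intro of_nat_mono) simp
        then show ?thesis by simp
      qed
      also have "4 * (real A)\<^sup>2 * (real n)\<^sup>2 + 1 \<le> 4 * (real A)\<^sup>2 * (real n + 1)\<^sup>2"
      proof -
        have "1 \<le> 4 * (real A)\<^sup>2 * (2 * real n + 1)"
        proof -
          have "1 * 1 \<le> 4 * (real A)\<^sup>2 * (2 * real n + 1)"
          proof (rule mult_mono)
            have "1 \<le> (real A)\<^sup>2" using A by (intro one_le_power) auto
            then show "1 \<le> 4 * (real A)\<^sup>2" by linarith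
          qed (use n in auto)
          then show ?thesis by simp
        qed
        then show ?thesis by (simp add: power2_eq_square algebra_simps)
      qed
      finally have "ln (real M + 1) \<le> ln (4 * (real A)\<^sup>2 * (real n + 1)\<^sup>2)"
        using A by (subst ln_le_cancel_iff) auto
      also have "\<dots> = ln (4 * (real A)\<^sup>2) + 2 * ln (real n + 1)"
        using A n by (simp add: ln_mult ln_realpow)
      also have "ln (4 * (real A)\<^sup>2) \<le> ln (4 * (real A)\<^sup>2) / ln 2 * ln (real n + 1)"
      proof -
        have "ln (4 * (real A)\<^sup>2) / ln 2 * ln 2 \<le> ln (4 * (real A)\<^sup>2) / ln 2 * ln (real n + 1)"
          using n l2A lA by (intro mult_left_mono) auto
        then show ?thesis by simp
      qed
      finally show ?thesis by (simp add: k_def algebra_simps)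
    qed
    have LM: "log_max N n / 2 \<le> ln (real (M + 1) / real (A * n + 1))"
    proof -
      have "real M / (2 * real A * real n) \<le> real (M + 1) / real (A * n + 1)"
      proof (rule frac_le)
        have "1 \<le> A * n" using A n by simp
        then have "real (A * n + 1) \<le> real (2 * (A * n))" by (intro of_nat_mono) simp
        then show "real (A * n + 1) \<le> 2 * real A * real n" by simp
      qed (auto intro: add_pos_nonneg)
      then have le: "ln (real M / (2 * real A * real n)) \<le> ln (real (M + 1) / real (A * n + 1))"
      proof (rule ln_mono)
        have "1 \<le> A * n" using A n by simp
        then have "0 < M" using AM by linarith
        then show "0 < real M / (2 * real A * real n)" using A n by simp
      qed
      have "log_max N n / 2 \<le> ln (real M / (2 * real A * real n))"
      proof (cases "N \<le> 4 * A\<^sup>2 * n\<^sup>2")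
        case True
        \<comment> \<open>As N/n is at least (2A)^2, dividing it by 2A at most halves its
          logarithm.\<close>
        define R where "R = real N / real n"
        have "real (4 * A\<^sup>2 * n) \<le> real N" using n(2) by (rule of_nat_mono)
        then have R: "4 * (real A)\<^sup>2 \<le> R" using n by (simp add: R_def field_simps)
        have "0 < 4 * (real A)\<^sup>2" using A by simp
        then have lR: "2 * ln (2 * real A) \<le> ln R"
          unfolding lA[symmetric] by (intro ln_mono R)
        have "real M / (2 * real A * real n) = R / (2 * real A)"
          using True by (simp add: M_def R_def)
        moreover have "R > 0" using R \<open>0 < 4 * (real A)\<^sup>2\<close> by linarith
        ultimately have "ln (real M / (2 * real A * real n)) = ln R - ln (2 * real A)"
          using A by (simp add: ln_div)
        moreover have "log_max N n \<le> ln R" using log_max_upper_aux(3)[OF n(1) nN] lR l2A by (simp add: R_def)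
        ultimately show ?thesis using lR by simp
      next
        case False
        then have "real M = 4 * (real A)\<^sup>2 * (real n)\<^sup>2" by (simp add: M_def)
        then have "real M / (2 * real A * real n) = 2 * real A * real n"
          using A n by (simp add: power2_eq_square)
        then have "ln (real M / (2 * real A * real n)) = ln (2 * real A) + ln (real n)"
          using A n by (simp add: ln_mult)
        moreover have "0 \<le> ln (real n)" using n by simp
        ultimately show ?thesis using log_max_upper_aux(4)[OF n(1) nN] l2A by simp
      qed
      then show ?thesis using le by simp
    qed
    have "k powr (- s) / 2 * (ln (real n + 1) powr (- s) * log_max N n) = (k * ln (real n + 1)) powr (- s) * (log_max N n / 2)"
      using k2 n by (simp add: powr_mult)
    also have "\<dots> \<le> ln (real M + 1) powr (- s) * (log_max N n / 2)"
      using lM s M0 log_max_ge_1[of N n] by (intro mult_right_mono powr_mono2') auto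
    also have "\<dots> \<le> ln (real M + 1) powr (- s) * (\<Sum>i\<in>{A * n<..M}. 1 / real i)"
      using LM harmonic_ge_ln[OF AM] by (intro mult_left_mono) auto
    also have "\<dots> \<le> (\<Sum>i\<in>{A * n<..M}. log_weight s i)"
      unfolding sum_distrib_left log_weight_def using s
      by (intro sum_mono) (auto simp: mult.commute intro!: divide_right_mono powr_mono2')
    also have "\<dots> \<le> (\<Sum>i\<in>{A * n<..N}. log_weight s i)"
      by (intro sum_mono2) (auto simp: log_weight_nonneg M_def)
    finally show ?thesis .
  qed
  moreover have "0 < k powr (- s) / 2" using k2 by simp
  ultimately show ?thesis by blast
qed

section \<open>The upper bound\<close>

text \<open>The small ball inequality concerns countable sets of unit vectors; continuity extends
  its conclusions from this dense part to the sphere.\<close>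

definition unit_rat :: "nat \<Rightarrow> (nat \<Rightarrow> real) set"
  where "unit_rat N = (\<lambda>l i. rat_vec N l i / sqrt (ip N (rat_vec N l) (rat_vec N l))) ` {l. ip N (rat_vec N l) (rat_vec N l) \<noteq> 0}"

lemma countable_unit_rat: "countable (unit_rat N)"
  unfolding unit_rat_def by simp

lemma unit_rat_unit: assumes "x \<in> unit_rat N" shows "ip N x x = 1"
proof -
  obtain l where "ip N (rat_vec N l) (rat_vec N l) \<noteq> 0" "x = (\<lambda>i. rat_vec N l i / sqrt (ip N (rat_vec N l) (rat_vec N l)))"
    using assms by (auto simp: unit_rat_def)
  then show ?thesis using ip_self_nonneg[of N "rat_vec N l"] by (simp add: ip_divide_left ip_divide_right)
qed

lemma unit_rat_dense:
  assumes x: "x \<in> Rn N" "ip N x x = 1"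
  obtains u where "\<And>k. u k \<in> unit_rat N" "\<And>i. (\<lambda>k. u k i) \<longlonglongrightarrow> x i"
proof -
  obtain z where z: "\<And>i. (\<lambda>k. rat_vec N (z k) i) \<longlonglongrightarrow> x i" using rat_vec_dense[OF x(1)] by blast
  have ip: "(\<lambda>k. ip N (rat_vec N (z k)) (rat_vec N (z k))) \<longlonglongrightarrow> 1"
    using tendsto_ip[of N "\<lambda>k. rat_vec N (z k)" x "\<lambda>k. rat_vec N (z k)" x] z x(2) by simp
  have "eventually (\<lambda>k. 0 < ip N (rat_vec N (z k)) (rat_vec N (z k))) sequentially"
    by (rule order_tendstoD(1)[OF ip]) simp
  then obtain K where K: "\<And>k. K \<le> k \<Longrightarrow> 0 < ip N (rat_vec N (z k)) (rat_vec N (z k))"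
    by (auto simp: eventually_sequentially)
  define u where "u k = (\<lambda>i. rat_vec N (z (k + K)) i / sqrt (ip N (rat_vec N (z (k + K))) (rat_vec N (z (k + K)))))" for k
  have "u k \<in> unit_rat N" for k
    unfolding unit_rat_def u_def using K[of "k + K"] by (intro imageI) auto
  moreover have "(\<lambda>k. u k i) \<longlonglongrightarrow> x i" for i
  proof -
    have "(\<lambda>k. rat_vec N (z k) i / sqrt (ip N (rat_vec N (z k)) (rat_vec N (z k)))) \<longlonglongrightarrow> x i / sqrt 1"
      by (intro tendsto_divide z tendsto_real_sqrt ip) simp
    from LIMSEQ_ignore_initial_segment[OF this, of K] show ?thesis by (simp add: u_def)
  qed
  ultimately show ?thesis using that by blast
qed

text \<open>According to whether v \<le> u^(p-1), one of the two powers alone dominates the product;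
  the usual weights 1/p and 1/q are given up.\<close>

lemma young_simple:
  fixes u v p q :: real
  assumes "0 \<le> u" "0 \<le> v" "1 < p" "q = p / (p - 1)"
  shows "u * v \<le> u powr p + v powr q"
proof (cases "u = 0 \<or> v = 0")
  case False
  then have uv: "0 < u" "0 < v" using assms by auto
  have q: "0 < q" "(p - 1) * (q - 1) = 1" using assms(3) by (auto simp: assms(4) field_simps)
  show ?thesis
  proof (cases "v \<le> u powr (p - 1)")
    case True
    then have "u * v \<le> u * u powr (p - 1)" using uv by (intro mult_left_mono) auto
    also have "\<dots> = u powr p" using uv powr_add[of u 1 "p - 1"] by simp
    finally show ?thesis by (simp add: add_increasing2)
  next
    case False
    then have "(u powr (p - 1)) powr (q - 1) \<le> v powr (q - 1)"
    proof (intro powr_mono2)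
      show "0 \<le> q - 1" using assms(3) by (simp add: assms(4) field_simps)
    qed (use False in auto)
    then have "u \<le> v powr (q - 1)" using q uv by (simp add: powr_powr)
    then have "u * v \<le> v powr (q - 1) * v" using uv by (intro mult_right_mono) auto
    also have "\<dots> = v powr q" using uv powr_add[of v "q - 1" 1] by simp
    finally show ?thesis by (simp add: add_increasing)
  qed
qed auto

lemma powr_le_exp:
  fixes y a :: real
  assumes "0 \<le> y" "0 < a" shows "y powr a \<le> a powr a * exp y"
proof -
  have "y / a \<le> exp (y / a)" using exp_ge_add_one_self[of "y / a"] by linarith
  then have "(y / a) powr a \<le> exp (y / a) powr a" using assms by (intro powr_mono2) auto
  also have "\<dots> = exp y" using assms by (simp add: powr_def)
  finally have "a powr a * (y / a) powr a \<le> a powr a * exp y" by (intro mult_left_mono) auto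
  then show ?thesis using assms by (simp add: powr_mult[symmetric])
qed

lemma ennreal_affine: "0 \<le> a \<Longrightarrow> 0 \<le> b \<Longrightarrow> 1 + ennreal a * ennreal b = ennreal (1 + a * b)"
  by (simp add: ennreal_mult[symmetric] ennreal_plus[symmetric] del: ennreal_plus flip: ennreal_1)

lemma prod_mono_ennreal:
  fixes f g :: "'a \<Rightarrow> ennreal"
  assumes "\<And>i. i \<in> I \<Longrightarrow> f i \<le> g i" shows "prod f I \<le> prod g I"
  using assms by (induction I rule: infinite_finite_induct) (auto intro: mult_mono)

text \<open>For \<bar>h\<bar> > \<theta> the power part costs at most a factor e \<le> 3, while
  h^2/8 is raised to h^2/4 in exchange for the gain exp(-\<theta>^2/8). Otherwise the exponent y is
  at most 1, exp y \<le> 1 + 2y, and \<bar>h\<bar>^q \<le> K exp(h^2/4) with K = 2^q (q/2)^(q/2).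
  The Gaussian mean of exp(h^2/4) is sqrt 2 \<le> 3/2.\<close>

lemma g1_trunc_exp:
  fixes c q \<theta> :: real
  assumes c: "0 \<le> c" and q: "0 < q" and \<theta>: "0 \<le> \<theta>" and c\<theta>: "c * \<theta> powr q \<le> 1"
  shows "(\<integral>\<^sup>+h. ennreal (exp ((if \<theta> < \<bar>h\<bar> then h\<^sup>2 / 8 else 0) + c * min \<bar>h\<bar> \<theta> powr q)) \<partial>g1)
    \<le> ennreal (exp (4 * c * (2 powr q * (q / 2) powr (q / 2)) + 5 * exp (- \<theta>\<^sup>2 / 8)))"
proof -
  define K where "K = 2 powr q * (q / 2) powr (q / 2)"
  have K0: "0 \<le> K" by (simp add: K_def)
  have hq: "\<bar>h\<bar> powr q \<le> K * exp (h\<^sup>2 / 4)" for h :: real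
  proof -
    have "\<bar>h\<bar> powr q = 2 powr q * (\<bar>h\<bar> / 2) powr q" by (simp add: powr_mult[symmetric])
    also have "(\<bar>h\<bar> / 2) powr q = ((\<bar>h\<bar> / 2) powr 2) powr (q / 2)" by (simp only: powr_powr) simp
    also have "(\<bar>h\<bar> / 2) powr 2 = h\<^sup>2 / 4" by (simp add: power_divide)
    also have "(h\<^sup>2 / 4) powr (q / 2) \<le> (q / 2) powr (q / 2) * exp (h\<^sup>2 / 4)"
      by (rule powr_le_exp) (use q in auto)
    finally show ?thesis by (simp add: K_def mult.assoc)
  qed
  let ?a = "2 * c * K + 3 * exp (- \<theta>\<^sup>2 / 8)"
  have a0: "0 \<le> ?a" using c K0 by simp
  have pw: "exp ((if \<theta> < \<bar>h\<bar> then h\<^sup>2 / 8 else 0) + c * min \<bar>h\<bar> \<theta> powr q) \<le> 1 + ?a * exp (h\<^sup>2 / 4)" for h :: real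
  proof (cases "\<theta> < \<bar>h\<bar>")
    case True
    have "exp (h\<^sup>2 / 8 + c * \<theta> powr q) \<le> exp (h\<^sup>2 / 8 + 1)" using c\<theta> by simp
    also have "\<dots> = exp 1 * exp (h\<^sup>2 / 8)" by (simp add: exp_add mult.commute)
    also have "\<dots> \<le> 3 * exp (h\<^sup>2 / 8)" using exp_le by (intro mult_right_mono) auto
    also have "exp (h\<^sup>2 / 8) \<le> exp (- \<theta>\<^sup>2 / 8) * exp (h\<^sup>2 / 4)"
    proof -
      have "\<theta>\<^sup>2 \<le> h\<^sup>2" using True \<theta> by (metis abs_le_square_iff abs_of_nonneg less_imp_le)
      then show ?thesis by (simp add: exp_add[symmetric])
    qed
    also have "3 * (exp (- \<theta>\<^sup>2 / 8) * exp (h\<^sup>2 / 4)) \<le> 1 + ?a * exp (h\<^sup>2 / 4)"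
      using c K0 by (simp add: algebra_simps add_increasing)
    finally show ?thesis using True by simp
  next
    case False
    let ?y = "c * \<bar>h\<bar> powr q"
    have "?y \<le> c * \<theta> powr q" using False c q by (intro mult_left_mono powr_mono2) auto
    then have y: "0 \<le> ?y" "?y \<le> 1" using c c\<theta> by auto
    have "exp ?y \<le> 1 + ?y + ?y\<^sup>2" using exp_bound y by blast
    also have "\<dots> \<le> 1 + 2 * ?y" using y by (simp add: power2_eq_square mult_left_le)
    also have "\<dots> \<le> 1 + 2 * (c * (K * exp (h\<^sup>2 / 4)))" using hq[of h] c by (simp add: mult_left_mono)
    also have "\<dots> \<le> 1 + ?a * exp (h\<^sup>2 / 4)" by (simp add: algebra_simps)
    finally show ?thesis using False by (simp add: min_def)
  qed
  have "(\<integral>\<^sup>+h. ennreal (exp ((if \<theta> < \<bar>h\<bar> then h\<^sup>2 / 8 else 0) + c * min \<bar>h\<bar> \<theta> powr q)) \<partial>g1)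
      \<le> (\<integral>\<^sup>+h. 1 + ennreal ?a * ennreal (exp (1 / 4 * h\<^sup>2)) \<partial>g1)"
  proof (rule nn_integral_mono)
    fix h
    have "ennreal (exp ((if \<theta> < \<bar>h\<bar> then h\<^sup>2 / 8 else 0) + c * min \<bar>h\<bar> \<theta> powr q)) \<le> ennreal (1 + ?a * exp (h\<^sup>2 / 4))"
      by (rule ennreal_leI[OF pw])
    also have "\<dots> = 1 + ennreal ?a * ennreal (exp (1 / 4 * h\<^sup>2))"
      using a0 by (subst ennreal_plus) (auto simp: ennreal_mult)
    finally show "ennreal (exp ((if \<theta> < \<bar>h\<bar> then h\<^sup>2 / 8 else 0) + c * min \<bar>h\<bar> \<theta> powr q))
        \<le> 1 + ennreal ?a * ennreal (exp (1 / 4 * h\<^sup>2))" .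
  qed
  also have "\<dots> = 1 + ennreal ?a * ennreal (1 / sqrt (1 - 2 * (1 / 4)))"
    using g1_exp_square[of "1 / 4"] g1.emeasure_space_1
    by (subst nn_integral_add) (auto simp: nn_integral_cmult)
  also have "\<dots> \<le> 1 + ennreal ?a * ennreal (3 / 2)"
  proof -
    have "2 / 3 \<le> sqrt (1 / 2 :: real)" by (rule real_le_rsqrt) (simp add: power2_eq_square)
    then have "1 \<le> 3 / 2 * sqrt (1 / 2 :: real)" by simp
    then have "1 / sqrt (1 - 2 * (1 / 4)) \<le> 3 / (2::real)" by (simp add: real_sqrt_divide field_simps)
    then show ?thesis by (intro add_left_mono mult_left_mono ennreal_leI) auto
  qed
  also have "\<dots> = ennreal (1 + ?a * (3 / 2))"
    by (rule ennreal_affine[OF a0]) simp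
  also have "\<dots> \<le> ennreal (exp (4 * c * K + 5 * exp (- \<theta>\<^sup>2 / 8)))"
  proof (rule ennreal_leI)
    have "1 + ?a * (3 / 2) \<le> 1 + (4 * c * K + 5 * exp (- \<theta>\<^sup>2 / 8))" using c K0 by (simp add: algebra_simps)
    also have "\<dots> \<le> exp (4 * c * K + 5 * exp (- \<theta>\<^sup>2 / 8))" by (rule exp_ge_add_one_self)
    finally show "1 + ?a * (3 / 2) \<le> exp (4 * c * K + 5 * exp (- \<theta>\<^sup>2 / 8))" .
  qed
  finally show ?thesis by (simp add: K_def)
qed

lemma sum_inverse_squares:
  assumes "1 \<le> M" shows "(\<Sum>j\<in>{M..N}. 1 / (real j)\<^sup>2) \<le> 2 / real M"
proof -
  have "(\<Sum>j\<in>{M..<M + d}. 1 / (real j)\<^sup>2) \<le> 2 / real M - 2 / real (M + d)" for d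
  proof (induction d)
    case (Suc d)
    have "1 / j\<^sup>2 \<le> 2 / j - 2 / (j + 1)" if j: "1 \<le> j" for j :: real
    proof -
      have "2 / j - 2 / (j + 1) = 2 / (j * (j + 1))" using j by (simp add: field_simps)
      moreover have "1 / j\<^sup>2 = 2 / (j * (2 * j))" using j by (simp add: power2_eq_square)
      moreover have "2 / (j * (2 * j)) \<le> 2 / (j * (j + 1))"
        using j by (intro divide_left_mono mult_left_mono) auto
      ultimately show ?thesis by simp
    qed
    from this[of "real (M + d)"] have "1 / (real (M + d))\<^sup>2 \<le> 2 / real (M + d) - 2 / (real (M + d) + 1)"
      using assms by simp
    then show ?case using Suc.IH by (simp add: add_ac)
  qed simp
  from this[of "N + 1 - M"] have "M \<le> N + 1 \<Longrightarrow> (\<Sum>j\<in>{M..N}. 1 / (real j)\<^sup>2) \<le> 2 / real M"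
    by (simp add: atLeastLessThanSuc_atLeastAtMost) (smt (verit) divide_nonneg_nonneg of_nat_0_le_iff)
  moreover have "\<not> M \<le> N + 1 \<Longrightarrow> ?thesis" by simp
  ultimately show ?thesis by blast
qed

text \<open>Young's inequality applied coordinatewise: large values of \<open>h\<close> are paired with
  the Euclidean norm of \<open>x\<close>, truncated ones with the gauge of the ellipsoid.\<close>

lemma ip_split_bound:
  fixes x h \<sigma> \<theta> :: "nat \<Rightarrow> real"
  assumes x: "ip N x x = 1" and g: "gauge_pow N p \<sigma> x \<le> R" and p: "1 < p" "q = p / (p - 1)"
    and \<sigma>: "\<And>i. 0 < \<sigma> (Suc i)" and \<theta>: "\<And>i. 0 \<le> \<theta> i" and pos: "0 < d" "0 < w" "0 < m"
  shows "2 * m * ip N x h \<le> d * m\<^sup>2 + 2 * m * w powr p * R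
    + (\<Sum>i<N. (if \<theta> i < \<bar>h i\<bar> then (h i)\<^sup>2 / d else 0) + 2 * m * w powr (-q) * \<sigma> (Suc i) powr q * min \<bar>h i\<bar> (\<theta> i) powr q)"
proof -
  let ?a = "\<lambda>i. if \<theta> i < \<bar>h i\<bar> then \<bar>h i\<bar> else 0"
  let ?b = "\<lambda>i. min \<bar>h i\<bar> (\<theta> i)"
  have trm: "2 * m * (x i * h i) \<le> d * m\<^sup>2 * (x i * x i) + (if \<theta> i < \<bar>h i\<bar> then (h i)\<^sup>2 / d else 0)
      + 2 * m * w powr p * (\<bar>x i\<bar> / \<sigma> (Suc i)) powr p
      + 2 * m * w powr (-q) * \<sigma> (Suc i) powr q * ?b i powr q" for i
  proof -
    have b0: "0 \<le> ?b i" using \<theta> by simp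
    have 1: "2 * m * (\<bar>x i\<bar> * ?a i) \<le> d * m\<^sup>2 * (x i * x i) + (if \<theta> i < \<bar>h i\<bar> then (h i)\<^sup>2 / d else 0)"
    proof -
      have "0 \<le> (d * m * \<bar>x i\<bar> - ?a i)\<^sup>2 / d" using pos by simp
      also have "\<dots> = d * m\<^sup>2 * (\<bar>x i\<bar> * \<bar>x i\<bar>) - 2 * m * (\<bar>x i\<bar> * ?a i) + (?a i)\<^sup>2 / d"
        using pos by (simp add: power2_eq_square field_simps)
      finally show ?thesis by (simp split: if_splits)
    qed
    \<comment> \<open>The scale w is moved between the two factors; it is fixed later so that the
      gauge term costs a prescribed multiple of m^2.\<close>
    have "\<bar>x i\<bar> * ?b i = (w * (\<bar>x i\<bar> / \<sigma> (Suc i))) * (\<sigma> (Suc i) * ?b i / w)"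
      using pos less_imp_neq[OF \<sigma>[of i]] by (simp add: field_simps)
    also have "\<dots> \<le> (w * (\<bar>x i\<bar> / \<sigma> (Suc i))) powr p + (\<sigma> (Suc i) * ?b i / w) powr q"
      using pos b0 less_imp_le[OF \<sigma>[of i]] by (intro young_simple p) auto
    also have "(w * (\<bar>x i\<bar> / \<sigma> (Suc i))) powr p = w powr p * (\<bar>x i\<bar> / \<sigma> (Suc i)) powr p" by (rule powr_mult)
    also have "(\<sigma> (Suc i) * ?b i / w) powr q = w powr (-q) * \<sigma> (Suc i) powr q * ?b i powr q"
      by (simp add: powr_divide powr_mult powr_minus_divide)
    finally have "2 * m * (\<bar>x i\<bar> * ?b i) \<le> 2 * m * (w powr p * (\<bar>x i\<bar> / \<sigma> (Suc i)) powr p + w powr (-q) * \<sigma> (Suc i) powr q * ?b i powr q)"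
      using pos by (intro mult_left_mono) auto
    then have 2: "2 * m * (\<bar>x i\<bar> * ?b i) \<le> 2 * m * w powr p * (\<bar>x i\<bar> / \<sigma> (Suc i)) powr p + 2 * m * w powr (-q) * \<sigma> (Suc i) powr q * ?b i powr q"
      by (simp add: algebra_simps)
    have "x i * h i \<le> \<bar>x i\<bar> * \<bar>h i\<bar>" by (metis abs_ge_self abs_mult)
    also have "\<dots> \<le> \<bar>x i\<bar> * (?a i + ?b i)" using \<theta>[of i] by (intro mult_left_mono) auto
    finally have "2 * m * (x i * h i) \<le> 2 * m * (\<bar>x i\<bar> * ?a i) + 2 * m * (\<bar>x i\<bar> * ?b i)"
      using pos mult_left_mono[of "x i * h i" "\<bar>x i\<bar> * (?a i + ?b i)" "2 * m"] by (simp add: algebra_simps)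
    then show ?thesis using 1 2 by linarith
  qed
  have "2 * m * ip N x h = (\<Sum>i<N. 2 * m * (x i * h i))" by (simp add: ip_def sum_distrib_left)
  also have "\<dots> \<le> (\<Sum>i<N. d * m\<^sup>2 * (x i * x i) + (if \<theta> i < \<bar>h i\<bar> then (h i)\<^sup>2 / d else 0)
      + 2 * m * w powr p * (\<bar>x i\<bar> / \<sigma> (Suc i)) powr p
      + 2 * m * w powr (-q) * \<sigma> (Suc i) powr q * ?b i powr q)"
    by (rule sum_mono) (rule trm)
  also have "\<dots> = d * m\<^sup>2 * ip N x x + 2 * m * w powr p * gauge_pow N p \<sigma> x
    + (\<Sum>i<N. (if \<theta> i < \<bar>h i\<bar> then (h i)\<^sup>2 / d else 0) + 2 * m * w powr (-q) * \<sigma> (Suc i) powr q * ?b i powr q)"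
    by (simp add: sum.distrib ip_def gauge_pow_def sum_distrib_left)
  also have "2 * m * w powr p * gauge_pow N p \<sigma> x \<le> 2 * m * w powr p * R"
    using g pos by (intro mult_left_mono) auto
  finally show ?thesis using x by simp
qed

lemma log_semiaxis_pos: "0 < log_semiaxis \<alpha> \<beta> (Suc i)"
  by (simp add: log_semiaxis_def)

lemma log_semiaxis_powr:
  assumes "1 < p" "q = p / (p - 1)"
  shows "log_semiaxis (1 - 1 / p) \<beta> (Suc i) powr q = log_weight (\<beta> * q) (Suc i)"
proof -
  have "- (1 - 1 / p) * q = - 1" using assms(1) by (simp add: assms(2) field_simps)
  then have "log_semiaxis (1 - 1 / p) \<beta> (Suc i) powr q = real (Suc i) powr (- 1) * ln (real (Suc i) + 1) powr (- (\<beta> * q))"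
    unfolding log_semiaxis_def powr_mult powr_powr by (simp only: minus_mult_left)
  then show ?thesis by (simp add: log_weight_def powr_minus_divide del: of_nat_Suc)
qed


text \<open>The comparison costs 24 times the square of this number times n, from the terms 8 m^2
  and 16 m^2 below. The value e0/96 makes this a quarter of the gain
  \<open>rate_const * e0 * n\<close>, and it is absolute.\<close>

definition rate_const :: real where "rate_const = e0 / 96"

lemma rate_const_pos: "0 < rate_const"
  using e0_pos by (simp add: rate_const_def)

text \<open>A quarter of the gain \<open>rate_const * e0 * n\<close> is spent on each of the
  threshold, the quadratic cost and the coordinatewise moments, so a quarter is left in the
  exponent. Coordinates with \<theta> = 0 are paired with the Euclidean norm alone and cost the
  constant 5 each.\<close>

lemma section_radius_upper_core:
  fixes \<theta> \<sigma> :: "nat \<Rightarrow> real"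
  assumes p: "1 < p" "q = p / (p - 1)" and \<sigma>: "\<And>i. 0 < \<sigma> (Suc i)"
    and n: "1 \<le> n" "n < N" and \<mu>: "is_haar_grassmannian N n \<mu>"
    and \<rho>: "0 < \<rho>" and w: "0 < w" "w powr p * \<rho> powr (- p) = 8 * rate_const * sqrt (real n)"
    and \<theta>: "\<And>i. 0 \<le> \<theta> i"
    and c: "\<And>i. c i = 2 * (rate_const * sqrt (real n)) * w powr (-q) * \<sigma> (Suc i) powr q"
    and c1: "\<And>i. i < N \<Longrightarrow> c i * \<theta> i powr q \<le> 1"
    and sum: "(\<Sum>i<N. 4 * (if \<theta> i = 0 then 0 else c i) * (2 powr q * (q / 2) powr (q / 2))
        + 5 * exp (- (\<theta> i)\<^sup>2 / 8)) \<le> rate_const * e0 * real n / 4"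
  shows "1 - exp (- (rate_const * e0 / 4 * real n)) \<le>
    measure \<mu> {E \<in> space \<mu>. section_radius N (p_ellipsoid N p \<sigma>) E \<le> \<rho>}"
proof -
  have q: "0 < q" using p(1) by (simp add: p(2))
  define m where "m = rate_const * sqrt (real n)"
  have m0: "0 < m" using rate_const_pos n by (simp add: m_def)
  \<comment> \<open>Normalising a point of the ellipsoid of norm above \<rho> gives a unit vector
    whose gauge, to the power p, is below \<open>\<rho> powr (- p)\<close>.\<close>
  define D where "D = {x \<in> unit_rat N. gauge_pow N p \<sigma> x \<le> \<rho> powr (- p)}"
  define f where "f i t = (if \<theta> i < \<bar>t\<bar> then t\<^sup>2 / 8 else 0) + c i * min \<bar>t\<bar> (\<theta> i) powr q" for i and t :: real
  define F where "F h = ennreal (exp (24 * rate_const\<^sup>2 * real n)) * (\<Prod>i<N. ennreal (exp (f i (h i))))" for h :: "nat \<Rightarrow> real"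
  have F: "ennreal (exp (2 * m * ip N x h)) \<le> F h" if x: "x \<in> D" for x h
  proof -
    have "2 * m * ip N x h \<le> 8 * m\<^sup>2 + 2 * m * w powr p * \<rho> powr (- p)
      + (\<Sum>i<N. (if \<theta> i < \<bar>h i\<bar> then (h i)\<^sup>2 / 8 else 0) + 2 * m * w powr (-q) * \<sigma> (Suc i) powr q * min \<bar>h i\<bar> (\<theta> i) powr q)"
    proof (rule ip_split_bound)
      show "ip N x x = 1" "gauge_pow N p \<sigma> x \<le> \<rho> powr (- p)" using x unit_rat_unit by (auto simp: D_def)
    qed (use p \<sigma> \<theta> w(1) m0 in auto)
    also have "2 * m * w powr p * \<rho> powr (- p) = 2 * m * (w powr p * \<rho> powr (- p))" by simp
    also have "\<dots> = 16 * m\<^sup>2"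
      unfolding w(2) by (simp add: m_def power2_eq_square)
    also have "8 * m\<^sup>2 + 16 * m\<^sup>2 = 24 * rate_const\<^sup>2 * real n" by (simp add: m_def power_mult_distrib)
    finally have "2 * m * ip N x h \<le> 24 * rate_const\<^sup>2 * real n + (\<Sum>i<N. f i (h i))"
      by (simp add: f_def c m_def)
    then have "exp (2 * m * ip N x h) \<le> exp (24 * rate_const\<^sup>2 * real n) * (\<Prod>i<N. exp (f i (h i)))"
      by (simp add: exp_add[symmetric] exp_sum[symmetric])
    then have "ennreal (exp (2 * m * ip N x h)) \<le> ennreal (exp (24 * rate_const\<^sup>2 * real n) * (\<Prod>i<N. exp (f i (h i))))"
      by (rule ennreal_leI)
    also have "\<dots> = F h" unfolding F_def by (subst ennreal_mult) (auto simp: prod_ennreal intro: prod_nonneg)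
    finally show ?thesis .
  qed
  have c0: "0 \<le> c i" for i using rate_const_pos by (simp add: c)
  have intF: "(\<integral>\<^sup>+h. F h \<partial>Gam N) \<le> ennreal (exp (24 * rate_const\<^sup>2 * real n + rate_const * e0 * real n / 4))"
  proof -
    have fm: "f i \<in> borel_measurable borel" for i unfolding f_def by measurable
    have pm: "(\<lambda>h. \<Prod>i<N. ennreal (exp (f i (h i)))) \<in> borel_measurable (Gam N)"
    proof (rule borel_measurable_prod_ennreal)
      fix i assume "i \<in> {..<N}"
      then have "(\<lambda>h. h i) \<in> borel_measurable (Gam N)"
        using measurable_component_singleton[of i "{..<N}" "\<lambda>_. g1"] by simp
      from measurable_compose[OF this fm[of i]]
      show "(\<lambda>h. ennreal (exp (f i (h i)))) \<in> borel_measurable (Gam N)" by measurable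
    qed
    have 1: "(\<integral>\<^sup>+h. F h \<partial>Gam N) = ennreal (exp (24 * rate_const\<^sup>2 * real n)) * (\<integral>\<^sup>+h. (\<Prod>i<N. ennreal (exp (f i (h i)))) \<partial>Gam N)"
      unfolding F_def by (rule nn_integral_cmult[OF pm])
    have "(\<integral>\<^sup>+h. (\<Prod>i<N. ennreal (exp (f i (h i)))) \<partial>Gam N) = (\<Prod>i<N. \<integral>\<^sup>+t. ennreal (exp (f i t)) \<partial>g1)"
      by (rule gam.product_nn_integral_prod) (use fm in auto)
    also have "\<dots> \<le> (\<Prod>i<N. ennreal (exp (4 * (if \<theta> i = 0 then 0 else c i) * (2 powr q * (q / 2) powr (q / 2)) + 5 * exp (- (\<theta> i)\<^sup>2 / 8))))"
    proof (rule prod_mono_ennreal)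
      fix i assume i: "i \<in> {..<N}"
      \<comment> \<open>For \<theta> i = 0 the truncated factor vanishes, so \<open>c i\<close> is
        replaced by 0 before the moment bound, which would otherwise charge for it.\<close>
      let ?c = "if \<theta> i = 0 then 0 else c i"
      have "f i t = (if \<theta> i < \<bar>t\<bar> then t\<^sup>2 / 8 else 0) + ?c * min \<bar>t\<bar> (\<theta> i) powr q" for t
        using q by (simp add: f_def min_def)
      then have "(\<integral>\<^sup>+t. ennreal (exp (f i t)) \<partial>g1) = (\<integral>\<^sup>+t. ennreal (exp ((if \<theta> i < \<bar>t\<bar> then t\<^sup>2 / 8 else 0) + ?c * min \<bar>t\<bar> (\<theta> i) powr q)) \<partial>g1)"
        by presburger
      also have "\<dots> \<le> ennreal (exp (4 * ?c * (2 powr q * (q / 2) powr (q / 2)) + 5 * exp (- (\<theta> i)\<^sup>2 / 8)))"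
        by (rule g1_trunc_exp) (use c0 q \<theta> c1 i in auto)
      finally show "(\<integral>\<^sup>+t. ennreal (exp (f i t)) \<partial>g1)
        \<le> ennreal (exp (4 * ?c * (2 powr q * (q / 2) powr (q / 2)) + 5 * exp (- (\<theta> i)\<^sup>2 / 8)))" .
    qed
    also have "\<dots> = ennreal (exp (\<Sum>i<N. 4 * (if \<theta> i = 0 then 0 else c i) * (2 powr q * (q / 2) powr (q / 2)) + 5 * exp (- (\<theta> i)\<^sup>2 / 8)))"
      by (subst prod_ennreal) (auto simp: exp_sum)
    also have "\<dots> \<le> ennreal (exp (rate_const * e0 * real n / 4))" using sum by (intro ennreal_leI) simp
    finally have "(\<integral>\<^sup>+h. (\<Prod>i<N. ennreal (exp (f i (h i)))) \<partial>Gam N) \<le> ennreal (exp (rate_const * e0 * real n / 4))" .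
    then show ?thesis unfolding 1 exp_add by (subst ennreal_mult) (auto intro: mult_left_mono)
  qed
  let ?t = "rate_const * e0 * real n / 4"
  let ?Bad = "{G \<in> space (GamM n N). \<exists>x\<in>D. (\<Sum>j<n. rate_const * phi (ip N x (G j))) \<le> ?t}"
  have Dc: "countable D" unfolding D_def by (rule countable_subset[OF _ countable_unit_rat]) auto
  have Du: "ip N x x = 1" if "x \<in> D" for x using that unit_rat_unit by (auto simp: D_def)
  have msq: "m\<^sup>2 = (\<Sum>j<n. rate_const\<^sup>2)" by (simp add: m_def power_mult_distrib)
  have Bad: "?Bad \<in> sets (GamM n N)"
    by (rule small_ball(1)[OF Dc Du _ m0 msq F]) (use rate_const_pos in auto)
  have "emeasure (GamM n N) ?Bad \<le> ennreal (exp (?t - e0 * (\<Sum>j<n. rate_const))) * (\<integral>\<^sup>+h. F h \<partial>Gam N)"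
    by (rule small_ball(2)[OF Dc Du _ m0 msq F]) (use rate_const_pos in auto)
  also have "\<dots> \<le> ennreal (exp (?t - e0 * (\<Sum>j<n. rate_const))) * ennreal (exp (24 * rate_const\<^sup>2 * real n + rate_const * e0 * real n / 4))"
    by (intro mult_left_mono intF) simp
  also have "\<dots> = ennreal (exp (- (rate_const * e0 / 4 * real n)))"
  proof -
    have X: "24 * rate_const\<^sup>2 * real n = rate_const * e0 * real n / 4" by (simp add: rate_const_def power2_eq_square)
    have "(?t - e0 * (\<Sum>j<n. rate_const)) + (24 * rate_const\<^sup>2 * real n + rate_const * e0 * real n / 4) = - (rate_const * e0 / 4 * real n)"
      unfolding X by simp
    then show ?thesis by (simp only: ennreal_mult[symmetric] exp_ge_zero exp_add[symmetric])
  qed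
  finally have "measure (GamM n N) ?Bad \<le> exp (- (rate_const * e0 / 4 * real n))"
    by (simp add: GamM.emeasure_eq_measure)
  then have "1 - exp (- (rate_const * e0 / 4 * real n)) \<le> measure (GamM n N) (space (GamM n N) - ?Bad)"
    using GamM.prob_compl[OF Bad] by simp
  also have "\<dots> \<le> measure \<mu> {E \<in> space \<mu>. section_radius N (p_ellipsoid N p \<sigma>) E \<le> \<rho>}"
  proof (rule haar_ge_kernel[OF \<mu>])
    have p0: "0 < p" using p by simp
    have sp: "space \<mu> = space (grassmannian_borel N n)" "sets \<mu> = sets (grassmannian_borel N n)"
      using \<mu> by (auto simp: is_haar_grassmannian_def space_grassmannian_borel)
    have "section_radius N (p_ellipsoid N p \<sigma>) \<in> borel_measurable (grassmannian_borel N n)"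
      by (rule measurable_section_radius[where s=\<sigma>, OF \<sigma> p0])
    then show "{E \<in> space \<mu>. section_radius N (p_ellipsoid N p \<sigma>) E \<le> \<rho>} \<in> sets \<mu>"
      unfolding sp by measurable
    show "space (GamM n N) - ?Bad \<in> sets (GamM n N)" using Bad by auto
    fix G assume G: "G \<in> space (GamM n N) - ?Bad" and E: "perp N n G \<in> grassmannian_codim N n"
    have "section_radius N (p_ellipsoid N p \<sigma>) (perp N n G) \<le> \<rho>"
    proof (rule section_radius_le[OF E p0], rule ccontr)
      fix y assume y: "y \<in> perp N n G" "y \<in> p_ellipsoid N p \<sigma>" "\<not> sqrt (ip N y y) \<le> \<rho>"
      define r where "r = sqrt (ip N y y)"
      have r1: "\<rho> < r" using y(3) by (simp add: r_def)
      have r: "\<rho> < r" "0 < r" "r\<^sup>2 = ip N y y"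
        using r1 \<rho> ip_self_nonneg[of N y] by (linarith, linarith, simp add: r_def)
      define x where "x = (\<lambda>i. (1 / r) * y i)"
      have xE: "x \<in> perp N n G" unfolding x_def by (rule grassmannian_scale[OF E y(1)])
      have xx: "ip N x x = 1"
        unfolding x_def ip_scale_left ip_scale_right using r by (simp add: r(3)[symmetric] power2_eq_square)
      have "gauge_pow N p \<sigma> x = (1 / r) powr p * gauge_pow N p \<sigma> y"
        unfolding x_def by (subst gauge_pow_scale[where s=\<sigma>, OF \<sigma>]) (use r in simp)
      also have "\<dots> \<le> (1 / r) powr p * 1" using y(2) by (intro mult_left_mono) (auto simp: p_ellipsoid_gauge_pow)
      also have "\<dots> = r powr (- p)" using r by (simp add: powr_divide powr_minus_divide)
      also have "\<dots> < \<rho> powr (- p)" using r \<rho> p0 by (intro powr_less_mono2_neg) auto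
      finally have gx: "gauge_pow N p \<sigma> x < \<rho> powr (- p)" .
      obtain u where u: "\<And>k. u k \<in> unit_rat N" "\<And>i. (\<lambda>k. u k i) \<longlonglongrightarrow> x i"
        using unit_rat_dense[OF _ xx] xE by (auto simp: perp_def)
      have "(\<lambda>k. gauge_pow N p \<sigma> (u k)) \<longlonglongrightarrow> gauge_pow N p \<sigma> x" by (rule tendsto_gauge_pow[where s=\<sigma>, OF p0 u(2) \<sigma>])
      \<comment> \<open>The strict inequality keeps the rational approximations of x in
        \<open>D\<close>, and the positive threshold leaves room for their sums, which tend to 0
        because x lies in the kernel.\<close>
      then have ev1: "eventually (\<lambda>k. gauge_pow N p \<sigma> (u k) < \<rho> powr (- p)) sequentially"
        using gx by (rule order_tendstoD(2))
      have "(\<lambda>k. \<Sum>j<n. rate_const * phi (ip N (u k) (G j))) \<longlonglongrightarrow> (\<Sum>j<n. rate_const * phi (ip N x (G j)))"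
        unfolding phi_def by (intro tendsto_intros tendsto_ip u(2))
      also have "(\<Sum>j<n. rate_const * phi (ip N x (G j))) = 0"
        using xE by (intro sum.neutral) (auto simp: perp_def phi_def)
      finally have ev2: "eventually (\<lambda>k. (\<Sum>j<n. rate_const * phi (ip N (u k) (G j))) < ?t) sequentially"
        by (rule order_tendstoD(2)) (use rate_const_pos e0_pos n in simp)
      obtain k where k: "gauge_pow N p \<sigma> (u k) < \<rho> powr (- p)" "(\<Sum>j<n. rate_const * phi (ip N (u k) (G j))) < ?t"
        using eventually_happens[OF eventually_conj[OF ev1 ev2]] by auto
      then have "u k \<in> D" using u(1) by (simp add: D_def)
      then show False using G k(2) by (auto dest: less_imp_le)
    qed
    then show "perp N n G \<in> {E \<in> space \<mu>. section_radius N (p_ellipsoid N p \<sigma>) E \<le> \<rho>}"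
      using E sp(1) by (simp add: space_grassmannian_borel)
  qed (use n in simp)
  finally show ?thesis .
qed


section \<open>Choice of the parameters in the upper bound\<close>

lemma log_factor_log_max: "log_factor p N n = log_max N n powr (1 - 1 / p)"
  by (simp add: log_factor_def log_max_def)

text \<open>The sum of the weights beyond a multiple of n is of this order, which explains the
  exponent 1 - 1/p = 1/q of the logarithmic factor.\<close>

lemma rate_powr:
  assumes "1 < p" "q = p / (p - 1)" "1 \<le> n"
  shows "(sqrt (real n) * (base_rate \<beta> n * log_factor p N n)) powr q = ln (real n + 1) powr (- (\<beta> * q)) * log_max N n"
proof -
  have q: "(1 - 1 / p) * q = 1" using assms(1) by (simp add: assms(2) field_simps)
  have "sqrt (real n) * (base_rate \<beta> n * log_factor p N n) = ln (real n + 1) powr (- \<beta>) * log_max N n powr (1 - 1 / p)"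
  proof -
    have "sqrt (real n) * real n powr (- 1 / 2) = 1"
      using assms(3) by (simp add: powr_half_sqrt[symmetric] powr_add[symmetric])
    then show ?thesis unfolding base_rate_def log_factor_log_max by (simp add: mult.assoc[symmetric])
  qed
  then show ?thesis using q log_max_ge_1[of N n] by (simp add: powr_mult powr_powr)
qed

lemma rate_pos: "1 \<le> n \<Longrightarrow> 0 < base_rate \<beta> n * log_factor p N n"
  using log_max_ge_1[of N n] by (simp add: base_rate_def log_factor_log_max)

text \<open>The coefficient \<open>c i\<close> is the i-th weight times a multiple of n / (Z l L),
  where Z = C^q. Enlarging C makes the moments as small as required, while the exponent in the
  probability stays absolute.\<close>

lemma section_radius_upper:
  assumes p: "1 < p" and \<beta>: "1 - 1 / p < \<beta>"
  shows "\<exists>C>0. \<forall>N n \<mu>. 1 \<le> n \<longrightarrow> n < N \<longrightarrow> is_haar_grassmannian N n \<mu> \<longrightarrow>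
    1 - exp (- (rate_const * e0 / 4 * real n)) \<le> measure \<mu> {E \<in> space \<mu>.
      section_radius N (p_ellipsoid N p (log_semiaxis (1 - 1 / p) \<beta>)) E \<le> C * (base_rate \<beta> n * log_factor p N n)}"
proof -
  define q where "q = p / (p - 1)"
  define s where "s = \<beta> * q"
  \<comment> \<open>In units of \<open>rate_const * e0 * n\<close> the moments may cost one quarter:
    the first \<eta> n coordinates cost 5 each, together one eighth, and each of the two tail sums
    gets one sixteenth.\<close>
  define \<epsilon> where "\<epsilon> = rate_const * e0 / 16"
  define \<eta> where "\<eta> = rate_const * e0 / 40"
  have q1: "1 < q" "(1 - 1 / p) * q = 1" using p by (simp_all add: q_def field_simps)
  have s1: "1 < s" using mult_strict_right_mono[OF \<beta>, of q] q1 by (simp add: s_def)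
  have \<epsilon>: "0 < \<epsilon>" using rate_const_pos e0_pos by (simp add: \<epsilon>_def)
  have le0: "rate_const * e0 \<le> 1" using mult_mono[of rate_const 1 e0 1] e0_pos e0_le_1 by (simp add: rate_const_def)
  have \<eta>: "0 < \<eta>" "\<eta> \<le> 1" using rate_const_pos e0_pos le0 by (simp_all add: \<eta>_def)
  obtain C1 where C1: "0 < C1" "\<And>n N. 1 \<le> n \<Longrightarrow> n < N \<Longrightarrow>
    (\<Sum>i\<in>{i \<in> {1..N}. \<eta> * real n < real i}. log_weight s i) \<le> C1 * (ln (real n + 1) powr (- s) * log_max N n)"
    using log_weight_sum_upper[OF s1 \<eta>] by blast
  define K where "K = 2 powr q * (q / 2) powr (q / 2)"
  \<comment> \<open>Makes (\<theta>^2/8)^q equal to 10 q^q / (\<eta> \<epsilon>) times (j/n)^2 for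
    the j-th semiaxis, so that exp(-\<theta>^2/8) is a small multiple of (n/j)^2.\<close>
  define B where "B = (10 * (8 * q) powr q / (\<eta> * \<epsilon>)) powr (1 / (2 * q))"
  define \<kappa> where "\<kappa> = (1 + ln (1 / \<eta>) / ln 2) powr s"
  define H where "H = 2 * rate_const * (8 * rate_const) powr (1 - q)"
  \<comment> \<open>The summands secure, in this order, positivity, the bound for the sum of the
    \<open>c i\<close>, and the bound 1 for \<open>c i * \<theta> i powr q\<close>.\<close>
  define Z where "Z = 1 + 4 * K * H * C1 / \<epsilon> + H * B powr q * \<kappa>"
  define C where "C = Z powr (1 / q)"
  have nn: "0 \<le> K" "0 \<le> B" "0 \<le> \<kappa>" "0 < H" using rate_const_pos q1 by (simp_all add: K_def B_def \<kappa>_def H_def)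
  have B0: "0 < B" using \<eta> \<epsilon> q1 by (simp add: B_def)
  have Z: "1 \<le> Z" "4 * K * H * C1 / \<epsilon> \<le> Z" "H * B powr q * \<kappa> \<le> Z"
    using nn C1(1) \<epsilon> by (auto simp: Z_def intro: add_nonneg_nonneg)
  have C: "0 < C" "C powr q = Z" using Z(1) q1 by (auto simp: C_def powr_powr)
  have "1 - exp (- (rate_const * e0 / 4 * real n)) \<le> measure \<mu> {E \<in> space \<mu>.
      section_radius N (p_ellipsoid N p (log_semiaxis (1 - 1 / p) \<beta>)) E \<le> C * (base_rate \<beta> n * log_factor p N n)}"
    if n: "1 \<le> n" "n < N" and \<mu>: "is_haar_grassmannian N n \<mu>" for N n \<mu>
  proof -
    define \<rho> where "\<rho> = C * (base_rate \<beta> n * log_factor p N n)"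
    define l where "l = ln (real n + 1) powr (- s)"
    define L where "L = log_max N n"
    have lL: "0 < l" "1 \<le> L" using n log_max_ge_1 by (auto simp: l_def L_def)
    have \<rho>0: "0 < \<rho>" using C(1) rate_pos[OF n(1)] by (simp add: \<rho>_def)
    have \<rho>q: "(sqrt (real n) * \<rho>) powr q = Z * (l * L)"
    proof -
      have "sqrt (real n) * \<rho> = C * (sqrt (real n) * (base_rate \<beta> n * log_factor p N n))" by (simp add: \<rho>_def)
      also have "\<dots> powr q = C powr q * (sqrt (real n) * (base_rate \<beta> n * log_factor p N n)) powr q" by (rule powr_mult)
      also have "\<dots> = Z * (l * L)" by (simp only: rate_powr[OF p q_def n(1)] C(2) l_def L_def s_def)
      finally show ?thesis .
    qed
    \<comment> \<open>The solution of the scaling condition on w in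
      \<open>section_radius_upper_core\<close>.\<close>
    define w where "w = (8 * rate_const * sqrt (real n)) powr (1 / p) * \<rho>"
    have w0: "0 < w" using rate_const_pos n \<rho>0 by (simp add: w_def)
    have wp: "w powr p * \<rho> powr (- p) = 8 * rate_const * sqrt (real n)"
      using p rate_const_pos n \<rho>0 by (simp add: w_def powr_mult powr_powr powr_add[symmetric])
    define c where "c i = 2 * (rate_const * sqrt (real n)) * w powr (-q) * log_semiaxis (1 - 1 / p) \<beta> (Suc i) powr q" for i
    have pq: "- (q / p) = 1 - q" using p by (simp add: q_def field_simps)
    have ceq: "c i = H / Z * real n * log_weight s (Suc i) / (l * L)" for i
    proof -
      have "w powr (-q) = (8 * rate_const * sqrt (real n)) powr (1 - q) * \<rho> powr (- q)"
        unfolding w_def powr_mult powr_powr using pq by (simp add: powr_mult)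
      also have "\<dots> = (8 * rate_const) powr (1 - q) * (sqrt (real n) * (sqrt (real n) * \<rho>) powr (- q))"
      proof -
        have "sqrt (real n) powr (1 - q) = sqrt (real n) * sqrt (real n) powr (- q)"
          using n powr_add[of "sqrt (real n)" 1 "- q"] by simp
        then show ?thesis by (simp add: powr_mult)
      qed
      also have "(sqrt (real n) * \<rho>) powr (- q) = 1 / (Z * (l * L))"
        by (simp only: powr_minus_divide \<rho>q)
      finally have wq: "w powr (-q) = (8 * rate_const) powr (1 - q) * (sqrt (real n) * (1 / (Z * (l * L))))" .
      have "c i = 2 * rate_const * (8 * rate_const) powr (1 - q) * (sqrt (real n) * sqrt (real n)) * (1 / (Z * (l * L))) * log_weight s (Suc i)"
        unfolding c_def wq s_def log_semiaxis_powr[OF p q_def] by (simp only: mult_ac)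
      then show ?thesis by (simp add: H_def)
    qed
    \<comment> \<open>The j-th weight is at most a multiple of l/j here, so \<theta>^q may grow like
      j/n while its product with the coefficient stays bounded; this growth makes the Gaussian tails
      summable.\<close>
    define \<theta> where "\<theta> i = (if real (Suc i) \<le> \<eta> * real n then 0 else B * (real (Suc i) / real n) powr (1 / q))" for i
    have \<theta>0: "0 \<le> \<theta> i" for i using nn by (simp add: \<theta>_def)
    have c1: "c i * \<theta> i powr q \<le> 1" for i
    proof (cases "real (Suc i) \<le> \<eta> * real n")
      case True then show ?thesis using q1 by (simp add: \<theta>_def)
    next
      case False
      let ?j = "Suc i"
      have "\<theta> i powr q = B powr q * (real ?j / real n)"
        using False q1 n by (simp add: \<theta>_def powr_mult powr_powr del: of_nat_Suc)
      moreover have "H / Z * n' * (1 / r * W) / (l * L) * (b * (r / n')) = H / Z * b * (W / (l * L))"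
        if "r \<noteq> 0" "n' \<noteq> 0" for n' r W b using that by simp
      ultimately have "c i * \<theta> i powr q = H / Z * B powr q * (ln (real ?j + 1) powr (- s) / (l * L))"
        unfolding ceq log_weight_def using n by (simp del: of_nat_Suc)
      also have "\<dots> \<le> H / Z * B powr q * \<kappa>"
      proof (rule mult_left_mono)
        have "ln (real ?j + 1) powr (- s) \<le> \<kappa> * l"
          unfolding \<kappa>_def l_def using False n \<eta> s1 by (intro log_weight_upper_single) auto
        also have "\<dots> \<le> \<kappa> * (l * L)" using nn lL by (intro mult_left_mono) auto
        finally show "ln (real ?j + 1) powr (- s) / (l * L) \<le> \<kappa>" using lL by (simp add: divide_le_eq)
      qed (use nn Z in auto)
      also have "\<dots> \<le> 1" using Z by (simp add: divide_le_eq)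
      finally show ?thesis .
    qed
    let ?T = "{i. i < N \<and> \<eta> * real n < real (Suc i)}"
    have reindex: "(\<Sum>i\<in>?T. g (Suc i)) = (\<Sum>j\<in>{j \<in> {1..N}. \<eta> * real n < real j}. g j)" for g :: "nat \<Rightarrow> real"
      by (rule sum.reindex_bij_witness[of _ "\<lambda>j. j - 1" Suc]) auto
    have head: "5 * real (card {i. i < N \<and> real (Suc i) \<le> \<eta> * real n}) \<le> rate_const * e0 * real n / 8"
    proof -
      have "card {i. i < N \<and> real (Suc i) \<le> \<eta> * real n} \<le> card {..<nat \<lfloor>\<eta> * real n\<rfloor>}"
        by (rule card_mono) (auto, linarith)
      then have "real (card {i. i < N \<and> real (Suc i) \<le> \<eta> * real n}) \<le> real (nat \<lfloor>\<eta> * real n\<rfloor>)" by simp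
      also have "\<dots> \<le> \<eta> * real n" using \<eta> by simp
      finally show ?thesis by (simp add: \<eta>_def)
    qed
    have tail1: "(\<Sum>i\<in>?T. 4 * c i * K) \<le> rate_const * e0 * real n / 16"
    proof -
      have "(\<Sum>i\<in>?T. 4 * c i * K) = 4 * K * (H / Z * real n / (l * L)) * (\<Sum>i\<in>?T. log_weight s (Suc i))"
        unfolding ceq sum_distrib_left by (intro sum.cong refl) (simp only: mult_ac times_divide_eq_right times_divide_eq_left)
      also have "\<dots> \<le> 4 * K * (H / Z * real n / (l * L)) * (C1 * (l * L))"
        unfolding reindex using C1(2)[OF n] nn Z lL by (intro mult_left_mono) (auto simp: l_def L_def)
      also have "\<dots> = (4 * K * H * C1 / Z) * real n" using lL by (simp add: field_simps)
      also have "\<dots> \<le> \<epsilon> * real n"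
        using Z \<epsilon> by (intro mult_right_mono) (auto simp: divide_le_eq mult.commute)
      finally show ?thesis by (simp add: \<epsilon>_def)
    qed
    have tail2: "(\<Sum>i\<in>?T. 5 * exp (- (\<theta> i)\<^sup>2 / 8)) \<le> rate_const * e0 * real n / 16"
    proof -
      \<comment> \<open>exp y \<ge> (y/q)^q turns the growth of \<theta> into quadratic
        decay.\<close>
      have ex: "5 * exp (- (\<theta> i)\<^sup>2 / 8) \<le> \<eta> * \<epsilon> / 2 * (real n)\<^sup>2 * (1 / (real (Suc i))\<^sup>2)" if i: "i \<in> ?T" for i
      proof -
        define r where "r = real (Suc i) / real n"
        have r0: "0 < r" using n by (simp add: r_def)
        have th: "\<theta> i = B * r powr (1 / q)" using i by (simp add: \<theta>_def r_def)
        define y where "y = (\<theta> i)\<^sup>2 / 8"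
        have y0: "0 < y" unfolding y_def th using B0 r0 by simp
        have "y powr q = B powr (2 * q) * r\<^sup>2 / 8 powr q"
        proof -
          have "(\<theta> i)\<^sup>2 = \<theta> i powr 2" using \<theta>0[of i] by (simp add: powr_numeral)
          then have "y = \<theta> i powr 2 / 8" by (simp add: y_def)
          then have "y powr q = \<theta> i powr (2 * q) / 8 powr q" by (simp only: powr_divide powr_powr)
          also have "\<theta> i powr (2 * q) = B powr (2 * q) * r powr 2"
            unfolding th powr_mult powr_powr using q1 by simp
          finally show ?thesis using r0 by (simp add: powr_numeral)
        qed
        also have "B powr (2 * q) = 10 * (8 * q) powr q / (\<eta> * \<epsilon>)"
          using q1 \<eta> \<epsilon> by (simp add: B_def powr_powr)
        finally have yq: "y powr q = 10 * q powr q / (\<eta> * \<epsilon>) * r\<^sup>2" by (simp add: powr_mult)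
        have "y powr q \<le> q powr q * exp y" by (rule powr_le_exp) (use y0 q1 in auto)
        then have "q powr q * (10 / (\<eta> * \<epsilon>) * r\<^sup>2) \<le> q powr q * exp y"
          unfolding yq by (simp only: times_divide_eq_left times_divide_eq_right mult_ac)
        moreover have "0 < q powr q" using q1 by simp
        ultimately have "10 / (\<eta> * \<epsilon>) * r\<^sup>2 \<le> exp y" by (simp only: mult_le_cancel_left_pos)
        then have "5 * exp (- y) \<le> \<eta> * \<epsilon> / 2 * (1 / r\<^sup>2)"
          using r0 \<eta> \<epsilon> by (simp add: exp_minus field_simps)
        then show ?thesis by (simp add: y_def r_def power_divide)
      qed
      have "(\<Sum>i\<in>?T. 5 * exp (- (\<theta> i)\<^sup>2 / 8)) \<le> (\<Sum>i\<in>?T. \<eta> * \<epsilon> / 2 * (real n)\<^sup>2 * (1 / (real (Suc i))\<^sup>2))"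
        by (rule sum_mono) (rule ex)
      also have "\<dots> = \<eta> * \<epsilon> / 2 * (real n)\<^sup>2 * (\<Sum>j\<in>{j \<in> {1..N}. \<eta> * real n < real j}. 1 / (real j)\<^sup>2)"
        unfolding sum_distrib_left[symmetric] using reindex[of "\<lambda>j. 1 / (real j)\<^sup>2"] by (simp only:)
      also have "\<dots> \<le> \<eta> * \<epsilon> / 2 * (real n)\<^sup>2 * (2 / (\<eta> * real n))"
      proof (rule mult_left_mono)
        define M where "M = nat \<lfloor>\<eta> * real n\<rfloor> + 1"
        have M: "1 \<le> M" "\<eta> * real n \<le> real M" unfolding M_def by (simp, linarith)
        have "(\<Sum>j\<in>{j \<in> {1..N}. \<eta> * real n < real j}. 1 / (real j)\<^sup>2) \<le> (\<Sum>j\<in>{M..N}. 1 / (real j)\<^sup>2)"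
        proof (rule sum_mono2)
          show "{j \<in> {1..N}. \<eta> * real n < real j} \<subseteq> {M..N}"
          proof
            fix j assume "j \<in> {j \<in> {1..N}. \<eta> * real n < real j}"
            then have "j \<le> N" "\<lfloor>\<eta> * real n\<rfloor> < int j" "0 \<le> \<eta> * real n" using \<eta> by (auto simp: floor_less_iff)
            then have "nat \<lfloor>\<eta> * real n\<rfloor> < j" by linarith
            then show "j \<in> {M..N}" using \<open>j \<le> N\<close> unfolding M_def by auto
          qed
        qed auto
        also have "\<dots> \<le> 2 / real M" by (rule sum_inverse_squares[OF M(1)])
        also have "\<dots> \<le> 2 / (\<eta> * real n)" using M \<eta> n by (intro divide_left_mono) auto
        finally show "(\<Sum>j\<in>{j \<in> {1..N}. \<eta> * real n < real j}. 1 / (real j)\<^sup>2) \<le> 2 / (\<eta> * real n)" .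
      qed (use \<eta> \<epsilon> in auto)
      also have "\<dots> = \<epsilon> * real n" using \<eta> n by (simp add: power2_eq_square)
      finally show ?thesis by (simp add: \<epsilon>_def)
    qed
    have "(\<Sum>i<N. 4 * (if \<theta> i = 0 then 0 else c i) * K + 5 * exp (- (\<theta> i)\<^sup>2 / 8))
       = (\<Sum>i\<in>{i. i < N \<and> real (Suc i) \<le> \<eta> * real n}. 4 * (if \<theta> i = 0 then 0 else c i) * K + 5 * exp (- (\<theta> i)\<^sup>2 / 8))
        + (\<Sum>i\<in>?T. 4 * (if \<theta> i = 0 then 0 else c i) * K + 5 * exp (- (\<theta> i)\<^sup>2 / 8))"
      by (subst sum.union_disjoint[symmetric]) (auto intro!: sum.cong)
    also have "(\<Sum>i\<in>{i. i < N \<and> real (Suc i) \<le> \<eta> * real n}. 4 * (if \<theta> i = 0 then 0 else c i) * K + 5 * exp (- (\<theta> i)\<^sup>2 / 8))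
       = (\<Sum>i\<in>{i. i < N \<and> real (Suc i) \<le> \<eta> * real n}. 5)"
      by (rule sum.cong) (auto simp: \<theta>_def)
    also have "(\<Sum>i\<in>{i. i < N \<and> real (Suc i) \<le> \<eta> * real n}. 5) = 5 * real (card {i. i < N \<and> real (Suc i) \<le> \<eta> * real n})" by simp
    also have "(\<Sum>i\<in>?T. 4 * (if \<theta> i = 0 then 0 else c i) * K + 5 * exp (- (\<theta> i)\<^sup>2 / 8))
       = (\<Sum>i\<in>?T. 4 * c i * K) + (\<Sum>i\<in>?T. 5 * exp (- (\<theta> i)\<^sup>2 / 8))"
      unfolding sum.distrib[symmetric] using B0 n by (intro sum.cong refl) (auto simp: \<theta>_def)
    finally have total: "(\<Sum>i<N. 4 * (if \<theta> i = 0 then 0 else c i) * K + 5 * exp (- (\<theta> i)\<^sup>2 / 8)) \<le> rate_const * e0 * real n / 4"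
      using head tail1 tail2 by simp
    show ?thesis
      unfolding \<rho>_def[symmetric]
      by (rule section_radius_upper_core[OF p q_def log_semiaxis_pos n \<mu> \<rho>0 w0 wp \<theta>0 c_def c1 total[unfolded K_def]])
  qed
  then show ?thesis using C(1) by blast
qed

section \<open>Lower bounds from flat vectors\<close>

lemma log_semiaxis_antimono:
  assumes "0 \<le> \<alpha>" "0 \<le> \<beta>" "1 \<le> i" "i \<le> j"
  shows "log_semiaxis \<alpha> \<beta> j \<le> log_semiaxis \<alpha> \<beta> i"
  unfolding log_semiaxis_def using assms by (intro mult_mono powr_mono2') auto

text \<open>On the first M coordinates all semiaxes are at least the M-th one, so the ellipsoid
  contains a scaled l_p ball there. The exponents 1/2 - 1/p - (1 - 1/p) add up to -1/2.\<close>

lemma section_radius_ge_flat: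
  assumes p: "1 < p" and \<beta>: "0 < \<beta>" and E: "E \<in> grassmannian_codim N n" and y: "y \<in> E" "y \<in> Rn M"
    and M: "1 \<le> M" "M \<le> N" and a: "0 \<le> a" "a\<^sup>2 * real M \<le> ip M y y"
    and A: "0 < A" "(\<Sum>i<M. \<bar>y i\<bar> powr p) \<le> A * real M"
  shows "a * A powr (- 1 / p) * (real M powr (- 1 / 2) * ln (real M + 1) powr (- \<beta>))
    \<le> section_radius N (p_ellipsoid N p (log_semiaxis (1 - 1 / p) \<beta>)) E"
proof -
  let ?\<sigma> = "log_semiaxis (1 - 1 / p) \<beta>"
  have \<sigma>M: "0 < ?\<sigma> M" using M by (cases M) (auto simp: log_semiaxis_pos)
  define t where "t = (A * real M) powr (1 / p) / ?\<sigma> M"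
  have t0: "0 < t" using A M \<sigma>M by (simp add: t_def)
  have Mi: "y i = 0" if "M \<le> i" for i using y(2) that by (simp add: Rn_iff)
  have "gauge_pow N p ?\<sigma> y = (\<Sum>i<M. (\<bar>y i\<bar> / ?\<sigma> (Suc i)) powr p)"
    unfolding gauge_pow_def by (rule sum.mono_neutral_right) (use M Mi p in auto)
  also have "\<dots> \<le> (\<Sum>i<M. \<bar>y i\<bar> powr p / ?\<sigma> M powr p)"
  proof (rule sum_mono)
    fix i assume i: "i \<in> {..<M}"
    have "?\<sigma> M \<le> ?\<sigma> (Suc i)" using i p \<beta> by (intro log_semiaxis_antimono) auto
    then have "(\<bar>y i\<bar> / ?\<sigma> (Suc i)) powr p \<le> (\<bar>y i\<bar> / ?\<sigma> M) powr p"
      using \<sigma>M p log_semiaxis_pos[of "1 - 1 / p" \<beta> i]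
      by (intro powr_mono2 divide_left_mono) (auto intro: divide_nonneg_nonneg)
    then show "(\<bar>y i\<bar> / ?\<sigma> (Suc i)) powr p \<le> \<bar>y i\<bar> powr p / ?\<sigma> M powr p" by (simp only: powr_divide)
  qed
  also have "\<dots> \<le> A * real M / ?\<sigma> M powr p"
    unfolding sum_divide_distrib[symmetric] using A by (intro divide_right_mono) auto
  also have "\<dots> = t powr p" using A M p by (simp add: t_def powr_divide powr_powr)
  finally have g: "gauge_pow N p ?\<sigma> y \<le> t powr p" .
  have ipMN: "ip N y y = ip M y y"
    unfolding ip_def by (rule sum.mono_neutral_right) (use M Mi in auto)
  have "a * sqrt (real M) / t \<le> sqrt (ip N y y) / t"
  proof (rule divide_right_mono)
    have "a * sqrt (real M) = sqrt (a\<^sup>2 * real M)" using a by (simp add: real_sqrt_mult)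
    then show "a * sqrt (real M) \<le> sqrt (ip N y y)" using a ipMN by simp
  qed (use t0 in simp)
  also have "\<dots> \<le> section_radius N (p_ellipsoid N p ?\<sigma>) E"
    by (rule section_radius_ge_ratio[where s="?\<sigma>", OF log_semiaxis_pos _ E y(1) t0 g]) (use p in simp)
  also have "a * sqrt (real M) / t = a * A powr (- 1 / p) * (real M powr (- 1 / 2) * ln (real M + 1) powr (- \<beta>))"
  proof -
    have M0: "0 < real M" using M by simp
    have "sqrt (real M) / (real M powr (1 / p)) * real M powr (- (1 - 1 / p)) = real M powr (1 / 2 - 1 / p - (1 - 1 / p))"
      using M0 by (simp only: powr_half_sqrt[symmetric] powr_diff[symmetric] powr_add[symmetric] less_imp_le) simp
    also have "1 / 2 - 1 / p - (1 - 1 / p) = - 1 / 2" by simp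
    finally have e: "sqrt (real M) / (real M powr (1 / p)) * real M powr (- (1 - 1 / p)) = real M powr (- 1 / 2)" .
    have "a * sqrt (real M) / t = a * (1 / A powr (1 / p)) * ((sqrt (real M) / (real M powr (1 / p)) * real M powr (- (1 - 1 / p))) * ln (real M + 1) powr (- \<beta>))"
      using A M by (simp add: t_def powr_mult log_semiaxis_def)
    also have "1 / A powr (1 / p) = A powr (- 1 / p)" by (simp add: powr_minus_divide)
    finally show ?thesis unfolding e .
  qed
  finally show ?thesis .
qed

text \<open>The k vectors span fewer than M dimensions, so a completed orthonormal basis has a
  vector left over.\<close>

lemma exists_orthogonal_vector:
  assumes r: "\<And>l. l < k \<Longrightarrow> r l \<in> Rn M" and k: "k < M"
  obtains y where "y \<in> Rn M" "ip M y y = 1" "\<And>l. l < k \<Longrightarrow> ip M y (r l) = 0"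
proof -
  have "orthonormal M 0 unitv" by (simp add: orthonormal_def)
  then obtain m f where f: "orthonormal M m f" "lin_span k r = lin_span m f"
    using orthonormal_extend[OF subspace_lin_span[of k r] lin_span_Rn[OF r], of 0 unitv] by auto
  have "lin_span k r \<subseteq> rfun.span (r ` {..<k})"
    by (rule lin_span_subset_subspace[OF rfun.subspace_span]) (auto intro: rfun.span_base)
  then have "rfun.dim (lin_span k r) \<le> card (r ` {..<k})" by (rule rfun.dim_le_card) simp
  also have "\<dots> \<le> k" using card_image_le[of "{..<k}" r] by simp
  finally have m: "m < M" using dim_lin_span[OF f(1)] f(2) k by simp
  obtain h where h: "orthonormal M M h" "\<forall>l<m. h l = f l" using orthonormal_extend_full[OF f(1)] by blast
  have "ip M (h m) (r l) = 0" if l: "l < k" for l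
  proof -
    have "r l \<in> lin_span m f" using lin_span_base[OF l, of r] f(2) by simp
    then obtain c where c: "r l = lincomb m c f" by (auto simp: lin_span_def)
    have "ip M (h m) (f i) = 0" if "i < m" for i
      using orthonormal_ip[OF h(1) m, of i] m that h(2) by auto
    then show ?thesis unfolding c ip_lincomb_right by simp
  qed
  then show ?thesis using that[of "h m"] orthonormal_Rn[OF h(1) m] orthonormal_ip[OF h(1) m m] by simp
qed

lemma grassmannian_perp:
  assumes "E \<in> grassmannian_codim N n"
  obtains g where "orthonormal N n g" "E = perp N n g"
proof -
  obtain f where f: "orthonormal N (N - n) f" "E = lin_span (N - n) f"
    using grassmannian_obtain_orthonormal[OF assms] .
  have n: "n \<le> N" by (rule grassmannian_le[OF assms])
  obtain h where h: "orthonormal N N h" "\<forall>l<N - n. h l = f l" using orthonormal_extend_full[OF f(1)] by blast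
  \<comment> \<open>A cyclic shift of the basis that lists the complement of \<open>E\<close>
    first.\<close>
  define g where "g i = (if i < n then h (N - n + i) else h (i - n))" for i
  have on: "orthonormal N N g"
    unfolding orthonormal_def
  proof (intro conjI allI impI)
    fix l assume "l < N" then show "g l \<in> Rn N" using orthonormal_Rn[OF h(1)] n by (auto simp: g_def)
  next
    fix l m assume lm: "l < N" "m < N"
    have inj: "(if l < n then N - n + l else l - n) = (if m < n then N - n + m else m - n) \<longleftrightarrow> l = m"
      using lm n by auto
    have "ip N (g l) (g m) = ip N (h (if l < n then N - n + l else l - n)) (h (if m < n then N - n + m else m - n))"
      by (simp add: g_def)
    also have "\<dots> = (if (if l < n then N - n + l else l - n) = (if m < n then N - n + m else m - n) then 1 else 0)"
      by (rule orthonormal_ip[OF h(1)]) (use lm n in auto)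
    finally show "ip N (g l) (g m) = (if l = m then 1 else 0)" by (simp only: inj)
  qed
  have "perp N n g = lin_span (N - n) (\<lambda>l. g (n + l))" unfolding perp_def by (rule orthonormal_perp[OF on n])
  also have "\<dots> = lin_span (N - n) f" by (rule lin_span_cong) (use h(2) in \<open>simp add: g_def\<close>)
  finally have "E = perp N n g" using f(2) by simp
  moreover have "orthonormal N n g" using on n by (auto simp: orthonormal_def)
  ultimately show ?thesis using that by blast
qed

lemma base_rate_compare:
  assumes "0 < \<beta>" "0 < c" "c \<le> 1" "1 \<le> n" "1 \<le> M" "c * real M \<le> real n"
  shows "base_rate \<beta> n \<le> c powr (- 1 / 2) * (1 + ln (1 / c) / ln 2) powr \<beta> * (real M powr (- 1 / 2) * ln (real M + 1) powr (- \<beta>))"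
proof -
  let ?k = "1 + ln (1 / c) / ln 2"
  have "real n powr (- 1 / 2) \<le> (c * real M) powr (- 1 / 2)"
    using assms by (intro powr_mono2') auto
  also have "\<dots> = c powr (- 1 / 2) * real M powr (- 1 / 2)" by (rule powr_mult)
  finally have 1: "real n powr (- 1 / 2) \<le> c powr (- 1 / 2) * real M powr (- 1 / 2)" .
  have 2: "ln (real n + 1) powr (- \<beta>) \<le> ?k powr \<beta> * ln (real M + 1) powr (- \<beta>)"
    by (rule log_weight_upper_single) (use assms in auto)
  have "base_rate \<beta> n \<le> (c powr (- 1 / 2) * real M powr (- 1 / 2)) * (?k powr \<beta> * ln (real M + 1) powr (- \<beta>))"
    unfolding base_rate_def using 1 2 by (intro mult_mono) auto
  then show ?thesis by (simp only: mult_ac)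
qed

text \<open>Deterministic: n linear conditions cannot exhaust n + 1 coordinates, so \<open>E\<close>
  contains a nonzero vector supported there. Scaled to squared norm n + 1 it is flat enough, because
  \<bar>z\<bar>^p \<le> 1 + z^2 for p \<le> 2. The rates at n and n + 1 are comparable since n \<ge>
  (n+1)/2.\<close>

lemma section_radius_lower_le2:
  assumes p: "1 < p" "p \<le> 2" and \<beta>: "0 < \<beta>"
  shows "\<exists>C>0. \<forall>N n E. 1 \<le> n \<longrightarrow> n < N \<longrightarrow> E \<in> grassmannian_codim N n \<longrightarrow>
    base_rate \<beta> n \<le> C * section_radius N (p_ellipsoid N p (log_semiaxis (1 - 1 / p) \<beta>)) E"
proof -
  define D where "D = (1 / 2 :: real) powr (- 1 / 2) * (1 + ln (1 / (1 / 2 :: real)) / ln 2) powr \<beta>"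
  have D0: "0 < D" by (simp add: D_def)
  have "base_rate \<beta> n \<le> (D * 2 powr (1 / p)) * section_radius N (p_ellipsoid N p (log_semiaxis (1 - 1 / p) \<beta>)) E"
    if n: "1 \<le> n" "n < N" and E: "E \<in> grassmannian_codim N n" for N n E
  proof -
    let ?R = "section_radius N (p_ellipsoid N p (log_semiaxis (1 - 1 / p) \<beta>)) E"
    let ?M = "n + 1"
    obtain g where g: "orthonormal N n g" "E = perp N n g" using grassmannian_perp[OF E] .
    obtain y where y: "y \<in> Rn ?M" "ip ?M y y = 1" "\<And>l. l < n \<Longrightarrow> ip ?M y (\<lambda>i. if i < ?M then g l i else 0) = 0"
      using exists_orthogonal_vector[of n "\<lambda>l i. if i < ?M then g l i else 0" ?M] by (auto simp: Rn_iff)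
    have Mi: "y i = 0" if "?M \<le> i" for i using y(1) that by (simp add: Rn_iff)
    have "ip N y (g l) = 0" if l: "l < n" for l
    proof -
      have "ip N y (g l) = (\<Sum>i<?M. y i * g l i)"
        unfolding ip_def by (rule sum.mono_neutral_right) (use n Mi in auto)
      also have "\<dots> = ip ?M y (\<lambda>i. if i < ?M then g l i else 0)" by (simp add: ip_def)
      finally show ?thesis using y(3)[OF l] by simp
    qed
    then have yE: "y \<in> E" using y(1) n by (auto simp: g(2) perp_def Rn_iff)
    define z where "z = (\<lambda>i. sqrt (real ?M) * y i)"
    have zE: "z \<in> E" unfolding z_def by (rule grassmannian_scale[OF E yE])
    have zz: "ip ?M z z = real ?M" unfolding z_def ip_scale_left ip_scale_right y(2) by simp
    have "(\<Sum>i<?M. \<bar>z i\<bar> powr p) \<le> (\<Sum>i<?M. 1 + z i * z i)"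
    proof (rule sum_mono)
      fix i
      show "\<bar>z i\<bar> powr p \<le> 1 + z i * z i"
      proof (cases "\<bar>z i\<bar> \<le> 1")
        case True
        then have "\<bar>z i\<bar> powr p \<le> 1" using p by (simp add: powr_le1)
        then show ?thesis using zero_le_square[of "z i"] by linarith
      next
        case False
        then have "\<bar>z i\<bar> powr p \<le> \<bar>z i\<bar> powr 2" using p by (intro powr_mono) auto
        also have "\<bar>z i\<bar> powr 2 = z i * z i" by (simp add: powr_numeral power2_eq_square)
        finally show ?thesis by simp
      qed
    qed
    also have "\<dots> = 2 * real ?M" using zz by (simp add: sum.distrib ip_def)
    finally have sum: "(\<Sum>i<?M. \<bar>z i\<bar> powr p) \<le> 2 * real ?M" .
    have "1 * 2 powr (- 1 / p) * (real ?M powr (- 1 / 2) * ln (real ?M + 1) powr (- \<beta>)) \<le> ?R"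
      by (rule section_radius_ge_flat[OF p(1) \<beta> E zE _ _ _ _ _ _ sum])
        (use n y(1) zz in \<open>auto simp: Rn_iff z_def\<close>)
    then have "2 powr (1 / p) * (2 powr (- 1 / p) * (real ?M powr (- 1 / 2) * ln (real ?M + 1) powr (- \<beta>))) \<le> 2 powr (1 / p) * ?R"
      by (intro mult_left_mono) auto
    then have le: "real ?M powr (- 1 / 2) * ln (real ?M + 1) powr (- \<beta>) \<le> 2 powr (1 / p) * ?R"
      by (simp add: mult.assoc[symmetric] powr_add[symmetric])
    have "base_rate \<beta> n \<le> D * (real ?M powr (- 1 / 2) * ln (real ?M + 1) powr (- \<beta>))"
      unfolding D_def by (rule base_rate_compare[OF \<beta>]) (use n in auto)
    also have "\<dots> \<le> D * (2 powr (1 / p) * ?R)" using le D0 by (intro mult_left_mono) auto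
    finally show ?thesis by (simp only: mult.assoc)
  qed
  moreover have "0 < D * 2 powr (1 / p)" using D0 by simp
  ultimately show ?thesis by blast
qed

section \<open>Deviation bounds for Gaussian vectors\<close>

lemma prob_Gam_le_prod:
  assumes f: "\<And>i. i < N \<Longrightarrow> f i \<in> borel_measurable borel"
    and B: "B \<in> sets (Gam N)" and le: "\<And>h. h \<in> B \<Longrightarrow> t \<le> (\<Sum>i<N. f i (h i))"
    and int: "\<And>i. i < N \<Longrightarrow> (\<integral>\<^sup>+x. ennreal (exp (f i x)) \<partial>g1) \<le> ennreal (exp (a i))"
  shows "measure (Gam N) B \<le> exp ((\<Sum>i<N. a i) - t)"
proof -
  have pm: "(\<lambda>h. \<Prod>i<N. ennreal (exp (f i (h i)))) \<in> borel_measurable (Gam N)"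
  proof (rule borel_measurable_prod_ennreal)
    fix i assume i: "i \<in> {..<N}"
    then have "(\<lambda>h. h i) \<in> borel_measurable (Gam N)"
      using measurable_component_singleton[of i "{..<N}" "\<lambda>_. g1"] by simp
    moreover have "f i \<in> borel_measurable borel" using f i by simp
    ultimately have "(\<lambda>h. f i (h i)) \<in> borel_measurable (Gam N)" by (rule measurable_compose)
    then show "(\<lambda>h. ennreal (exp (f i (h i)))) \<in> borel_measurable (Gam N)" by measurable
  qed
  have "emeasure (Gam N) B = (\<integral>\<^sup>+h. indicator B h \<partial>Gam N)" using B by simp
  also have "\<dots> \<le> (\<integral>\<^sup>+h. ennreal (exp (- t)) * (\<Prod>i<N. ennreal (exp (f i (h i)))) \<partial>Gam N)"
  proof (rule nn_integral_mono)
    fix h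
    have "(1::ennreal) \<le> ennreal (exp (- t)) * (\<Prod>i<N. ennreal (exp (f i (h i))))" if "h \<in> B"
    proof -
      have "ennreal (exp (- t)) * (\<Prod>i<N. ennreal (exp (f i (h i)))) = ennreal (exp (- t + (\<Sum>i<N. f i (h i))))"
        unfolding exp_add by (subst prod_ennreal) (auto simp: ennreal_mult prod_nonneg exp_sum)
      moreover have "1 \<le> exp (- t + (\<Sum>i<N. f i (h i)))" using le[OF that] by simp
      ultimately show ?thesis by simp
    qed
    then show "indicator B h \<le> ennreal (exp (- t)) * (\<Prod>i<N. ennreal (exp (f i (h i))))"
      by (auto simp: indicator_def)
  qed
  also have "\<dots> = ennreal (exp (- t)) * (\<Prod>i<N. \<integral>\<^sup>+x. ennreal (exp (f i x)) \<partial>g1)"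
  proof -
    have "(\<lambda>x. ennreal (exp (f i x))) \<in> borel_measurable g1" if "i \<in> {..<N}" for i
      using measurable_compose[OF f[of i], of "\<lambda>x. ennreal (exp x)" borel] that by simp
    then show ?thesis
      unfolding nn_integral_cmult[OF pm] by (subst gam.product_nn_integral_prod) auto
  qed
  also have "\<dots> \<le> ennreal (exp (- t)) * (\<Prod>i<N. ennreal (exp (a i)))"
    using int by (intro mult_left_mono prod_mono_ennreal) auto
  also have "\<dots> = ennreal (exp ((\<Sum>i<N. a i) - t))"
    by (subst prod_ennreal) (auto simp: ennreal_mult[symmetric] prod_nonneg exp_diff exp_sum exp_minus field_simps)
  finally show ?thesis by (simp add: Gam.emeasure_eq_measure)
qed

lemma measurable_Gam_coord: "i < N \<Longrightarrow> (\<lambda>h. h i) \<in> borel_measurable (Gam N)"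
  using measurable_component_singleton[of i "{..<N}" "\<lambda>_. g1"] by simp

lemma g1_exp_quarter: "(\<integral>\<^sup>+x. ennreal (exp (1 / 4 * x\<^sup>2)) \<partial>g1) \<le> ennreal (3 / 2)"
proof -
  have "2 / 3 \<le> sqrt (1 / 2 :: real)" by (rule real_le_rsqrt) (simp add: power2_eq_square)
  then have "1 / sqrt (1 - 2 * (1 / 4)) \<le> 3 / (2::real)" by (simp add: real_sqrt_divide field_simps)
  then show ?thesis by (subst g1_exp_square) (auto intro: ennreal_leI)
qed

text \<open>Chernoff bound with multiplier 1/\<epsilon>^2: since 2/\<epsilon>^2 = exp(2(p+1)), each
  coordinate contributes at most exp(-(p+1)), and the threshold gives back exp(N). Letting
  \<epsilon> depend on p buys the factor p in the exponent.\<close>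

lemma Gam_norm_small:
  assumes "0 < p"
  shows "measure (Gam N) {h \<in> space (Gam N). ip N h h < (sqrt 2 * exp (- (p + 1)))\<^sup>2 * real N} \<le> exp (- p * real N)"
proof -
  let ?\<epsilon> = "sqrt 2 * exp (- (p + 1)) :: real"
  have "(exp (p + 1))\<^sup>2 * (exp (- (p + 1)))\<^sup>2 = 1"
    unfolding power_mult_distrib[symmetric] exp_add[symmetric] by simp
  then have e2: "2 / ?\<epsilon>\<^sup>2 = (exp (p + 1))\<^sup>2" by (simp add: power_mult_distrib field_simps)
  have "measure (Gam N) {h \<in> space (Gam N). ip N h h < ?\<epsilon>\<^sup>2 * real N} \<le> exp ((\<Sum>i<N. - (p + 1)) - (- real N))"
  proof (rule prob_Gam_le_prod[where f="\<lambda>i x. - (1 / ?\<epsilon>\<^sup>2) * x\<^sup>2"])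
    show "{h \<in> space (Gam N). ip N h h < ?\<epsilon>\<^sup>2 * real N} \<in> sets (Gam N)"
      unfolding ip_def by measurable
    fix h assume h: "h \<in> {h \<in> space (Gam N). ip N h h < ?\<epsilon>\<^sup>2 * real N}"
    have "(\<Sum>i<N. - (1 / ?\<epsilon>\<^sup>2) * (h i)\<^sup>2) = - (1 / ?\<epsilon>\<^sup>2) * ip N h h"
      unfolding ip_def sum_distrib_left by (simp only: power2_eq_square)
    moreover have "1 / ?\<epsilon>\<^sup>2 * ip N h h \<le> 1 / ?\<epsilon>\<^sup>2 * (?\<epsilon>\<^sup>2 * real N)"
      using h by (intro mult_left_mono) auto
    moreover have "1 / ?\<epsilon>\<^sup>2 * (?\<epsilon>\<^sup>2 * real N) = real N" by simp
    ultimately show "- real N \<le> (\<Sum>i<N. - (1 / ?\<epsilon>\<^sup>2) * (h i)\<^sup>2)" by linarith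
  next
    fix i
    have "(\<integral>\<^sup>+x. ennreal (exp (- (1 / ?\<epsilon>\<^sup>2) * x\<^sup>2)) \<partial>g1) = ennreal (1 / sqrt (1 - 2 * (- (1 / ?\<epsilon>\<^sup>2))))"
      by (rule g1_exp_square) (rule less_trans[of _ 0], auto)
    also have "\<dots> \<le> ennreal (exp (- (p + 1)))"
    proof (rule ennreal_leI)
      have "exp (p + 1) = sqrt ((exp (p + 1))\<^sup>2)" by simp
      also have "\<dots> \<le> sqrt (1 - 2 * (- (1 / ?\<epsilon>\<^sup>2)))" using e2 by (intro real_sqrt_le_mono) simp
      finally have "1 / sqrt (1 - 2 * (- (1 / ?\<epsilon>\<^sup>2))) \<le> 1 / exp (p + 1)"
        by (intro divide_left_mono) (auto intro: mult_pos_pos less_le_trans[OF exp_gt_zero])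
      then show "1 / sqrt (1 - 2 * (- (1 / ?\<epsilon>\<^sup>2))) \<le> exp (- (p + 1))" by (simp only: exp_minus divide_inverse mult_1)
    qed
    finally show "(\<integral>\<^sup>+x. ennreal (exp (- (1 / ?\<epsilon>\<^sup>2) * x\<^sup>2)) \<partial>g1) \<le> ennreal (exp (- (p + 1)))" .
  qed auto
  also have "(\<Sum>i<N. - (p + 1)) - (- real N) = - p * real N" by (simp add: algebra_simps)
  finally show ?thesis .
qed

lemma Gam_max_large:
  assumes "0 \<le> \<theta>"
  shows "measure (Gam N) {h \<in> space (Gam N). \<exists>i<N. \<theta> < \<bar>h i\<bar>} \<le> real N * (3 / 2 * exp (- \<theta>\<^sup>2 / 4))"
proof -
  have one: "measure g1 {x. \<theta> < \<bar>x\<bar>} \<le> 3 / 2 * exp (- \<theta>\<^sup>2 / 4)"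
  proof -
    have "emeasure g1 {x. \<theta> < \<bar>x\<bar>} = (\<integral>\<^sup>+x. indicator {x. \<theta> < \<bar>x\<bar>} x \<partial>g1)" by simp
    also have "\<dots> \<le> (\<integral>\<^sup>+x. ennreal (exp (- \<theta>\<^sup>2 / 4)) * ennreal (exp (1 / 4 * x\<^sup>2)) \<partial>g1)"
    proof (rule nn_integral_mono)
      fix x :: real
      have "1 \<le> exp (- \<theta>\<^sup>2 / 4) * exp (1 / 4 * x\<^sup>2)" if "\<theta> < \<bar>x\<bar>"
      proof -
        have "\<theta>\<^sup>2 \<le> x\<^sup>2" using that assms by (metis abs_le_square_iff abs_of_nonneg less_imp_le)
        then show ?thesis by (simp add: exp_add[symmetric])
      qed
      then show "indicator {x. \<theta> < \<bar>x\<bar>} x \<le> ennreal (exp (- \<theta>\<^sup>2 / 4)) * ennreal (exp (1 / 4 * x\<^sup>2))"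
        by (auto simp: indicator_def ennreal_mult[symmetric] ennreal_leI[of 1, simplified])
    qed
    also have "\<dots> = ennreal (exp (- \<theta>\<^sup>2 / 4)) * (\<integral>\<^sup>+x. ennreal (exp (1 / 4 * x\<^sup>2)) \<partial>g1)"
      by (rule nn_integral_cmult) measurable
    also have "\<dots> \<le> ennreal (exp (- \<theta>\<^sup>2 / 4)) * ennreal (3 / 2)" by (intro mult_left_mono g1_exp_quarter) simp
    also have "\<dots> = ennreal (3 / 2 * exp (- \<theta>\<^sup>2 / 4))" by (simp add: ennreal_mult[symmetric] mult.commute)
    finally show ?thesis by (simp add: g1.emeasure_eq_measure)
  qed
  have m: "{h \<in> space (Gam N). \<theta> < \<bar>h i\<bar>} \<in> sets (Gam N)" if "i < N" for i
    using measurable_Gam_coord[OF that] by measurable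
  have eq: "measure (Gam N) {h \<in> space (Gam N). \<theta> < \<bar>h i\<bar>} = measure g1 {x. \<theta> < \<bar>x\<bar>}" if "i < N" for i
  proof -
    have "measure g1 {x. \<theta> < \<bar>x\<bar>} = measure (distr (Gam N) g1 (\<lambda>h. h i)) {x. \<theta> < \<bar>x\<bar>}"
      by (simp add: Gam_component[OF that])
    also have "\<dots> = measure (Gam N) ((\<lambda>h. h i) -` {x. \<theta> < \<bar>x\<bar>} \<inter> space (Gam N))"
      by (rule measure_distr) (use that in \<open>auto intro: measurable_component_singleton\<close>)
    finally show ?thesis by (simp add: vimage_def Int_def conj_commute)
  qed
  have "{h \<in> space (Gam N). \<exists>i<N. \<theta> < \<bar>h i\<bar>} = (\<Union>i<N. {h \<in> space (Gam N). \<theta> < \<bar>h i\<bar>})" by auto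
  then have "measure (Gam N) {h \<in> space (Gam N). \<exists>i<N. \<theta> < \<bar>h i\<bar>} \<le> (\<Sum>i<N. measure (Gam N) {h \<in> space (Gam N). \<theta> < \<bar>h i\<bar>})"
    using m by (simp only:) (rule Gam.finite_measure_subadditive_finite, auto)
  also have "\<dots> \<le> (\<Sum>i<N. 3 / 2 * exp (- \<theta>\<^sup>2 / 4))" using one eq by (intro sum_mono) auto
  finally show ?thesis by simp
qed

text \<open>For p > 2 the p-th power of a Gaussian variable has no exponential moments. Truncated at
  \<theta> it is at most \<theta>^(p-2) h^2, so the multiplier c keeps the exponent below h^2/8, and
  the exponential exceeds 1 by at most c K exp(h^2/4).\<close>

lemma Gam_trunc_power_large:
  assumes p: "2 \<le> p" and \<theta>: "0 < \<theta>" and c: "c = 1 / (8 * \<theta> powr (p - 2))"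
    and K: "K = 8 powr (p / 2) * (p / 2) powr (p / 2)"
  shows "measure (Gam N) {h \<in> space (Gam N). A * real N < (\<Sum>i<N. min \<bar>h i\<bar> \<theta> powr p)}
    \<le> exp (- (c * real N * (A - 2 * K)))"
proof -
  have c0: "0 < c" using \<theta> by (simp add: c)
  have K0: "0 \<le> K" by (simp add: K)
  have "measure (Gam N) {h \<in> space (Gam N). A * real N < (\<Sum>i<N. min \<bar>h i\<bar> \<theta> powr p)}
     \<le> exp ((\<Sum>i<N. 2 * c * K) - c * A * real N)"
  proof (rule prob_Gam_le_prod[where f="\<lambda>i x. c * min \<bar>x\<bar> \<theta> powr p"])
    show "{h \<in> space (Gam N). A * real N < (\<Sum>i<N. min \<bar>h i\<bar> \<theta> powr p)} \<in> sets (Gam N)"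
    proof -
      have "(\<lambda>h. \<Sum>i<N. min \<bar>h i\<bar> \<theta> powr p) \<in> borel_measurable (Gam N)"
      proof (rule borel_measurable_sum)
        fix i assume "i \<in> {..<N}"
        then have [measurable]: "(\<lambda>h. h i) \<in> borel_measurable (Gam N)" using measurable_Gam_coord by simp
        show "(\<lambda>h. min \<bar>h i\<bar> \<theta> powr p) \<in> borel_measurable (Gam N)" by measurable
      qed
      then show ?thesis by measurable
    qed
    fix h assume "h \<in> {h \<in> space (Gam N). A * real N < (\<Sum>i<N. min \<bar>h i\<bar> \<theta> powr p)}"
    then have "c * (A * real N) \<le> c * (\<Sum>i<N. min \<bar>h i\<bar> \<theta> powr p)" using c0 by (intro mult_left_mono) auto
    then show "c * A * real N \<le> (\<Sum>i<N. c * min \<bar>h i\<bar> \<theta> powr p)" by (simp add: sum_distrib_left mult.assoc)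
  next
    fix i
    have pw: "exp (c * min \<bar>x\<bar> \<theta> powr p) \<le> 1 + c * K * exp (1 / 4 * x\<^sup>2)" for x
    proof -
      define y where "y = c * min \<bar>x\<bar> \<theta> powr p"
      have m0: "0 \<le> min \<bar>x\<bar> \<theta>" using \<theta> by simp
      have y0: "0 \<le> y" using c0 by (simp add: y_def)
      have y1: "y \<le> x\<^sup>2 / 8"
      proof -
        have "min \<bar>x\<bar> \<theta> powr p = min \<bar>x\<bar> \<theta> powr (p - 2) * (min \<bar>x\<bar> \<theta>)\<^sup>2"
        proof (cases "min \<bar>x\<bar> \<theta> = 0")
          case True then show ?thesis using p by simp
        next
          case False
          then have "0 < min \<bar>x\<bar> \<theta>" using m0 by linarith
          then show ?thesis using powr_add[of "min \<bar>x\<bar> \<theta>" "p - 2" 2] by (simp add: powr_numeral)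
        qed
        also have "\<dots> \<le> \<theta> powr (p - 2) * x\<^sup>2"
        proof (rule mult_mono)
          show "min \<bar>x\<bar> \<theta> powr (p - 2) \<le> \<theta> powr (p - 2)" using m0 p by (intro powr_mono2) auto
          have "(min \<bar>x\<bar> \<theta>)\<^sup>2 \<le> \<bar>x\<bar>\<^sup>2" using m0 by (intro power_mono) auto
          then show "(min \<bar>x\<bar> \<theta>)\<^sup>2 \<le> x\<^sup>2" by simp
        qed auto
        finally have "c * min \<bar>x\<bar> \<theta> powr p \<le> c * (\<theta> powr (p - 2) * x\<^sup>2)" using c0 by (intro mult_left_mono) auto
        also have "\<dots> = x\<^sup>2 / 8" using \<theta> by (simp add: c)
        finally show ?thesis by (simp add: y_def)
      qed
      have y2: "y \<le> c * K * exp (x\<^sup>2 / 8)"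
      proof -
        have "min \<bar>x\<bar> \<theta> powr p \<le> \<bar>x\<bar> powr p" using m0 p by (intro powr_mono2) auto
        also have "\<bar>x\<bar> powr p = (\<bar>x\<bar> powr 2) powr (p / 2)" by (simp only: powr_powr) simp
        also have "\<bar>x\<bar> powr 2 = 8 * (x\<^sup>2 / 8)" by (simp add: powr_numeral)
        also have "(8 * (x\<^sup>2 / 8)) powr (p / 2) = 8 powr (p / 2) * (x\<^sup>2 / 8) powr (p / 2)" by (rule powr_mult)
        also have "\<dots> \<le> 8 powr (p / 2) * ((p / 2) powr (p / 2) * exp (x\<^sup>2 / 8))"
          using p by (intro mult_left_mono powr_le_exp) auto
        finally have "c * min \<bar>x\<bar> \<theta> powr p \<le> c * (K * exp (x\<^sup>2 / 8))"
          using c0 by (intro mult_left_mono) (auto simp: K mult.assoc)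
        then show ?thesis by (simp add: y_def mult.assoc)
      qed
      have "exp y \<le> 1 + y * exp y"
      proof -
        have "1 - y \<le> exp (- y)" using exp_ge_add_one_self[of "- y"] by simp
        then have "(1 - y) * exp y \<le> exp (- y) * exp y" by (intro mult_right_mono) auto
        then show ?thesis by (simp add: exp_add[symmetric] algebra_simps)
      qed
      also have "y * exp y \<le> (c * K * exp (x\<^sup>2 / 8)) * exp (x\<^sup>2 / 8)"
        using y0 y1 y2 by (intro mult_mono) auto
      also have "\<dots> = c * K * exp (1 / 4 * x\<^sup>2)" by (simp add: mult.assoc exp_add[symmetric])
      finally show ?thesis by (simp add: y_def)
    qed
    have "(\<integral>\<^sup>+x. ennreal (exp (c * min \<bar>x\<bar> \<theta> powr p)) \<partial>g1) \<le> (\<integral>\<^sup>+x. 1 + ennreal (c * K) * ennreal (exp (1 / 4 * x\<^sup>2)) \<partial>g1)"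
    proof (rule nn_integral_mono)
      fix x
      show "ennreal (exp (c * min \<bar>x\<bar> \<theta> powr p)) \<le> 1 + ennreal (c * K) * ennreal (exp (1 / 4 * x\<^sup>2))"
        by (subst ennreal_affine) (use c0 K0 ennreal_leI[OF pw] in auto)
    qed
    also have "\<dots> = 1 + ennreal (c * K) * (\<integral>\<^sup>+x. ennreal (exp (1 / 4 * x\<^sup>2)) \<partial>g1)"
      using g1.emeasure_space_1 by (subst nn_integral_add) (auto simp: nn_integral_cmult)
    also have "\<dots> \<le> 1 + ennreal (c * K) * ennreal (3 / 2)"
      by (intro add_left_mono mult_left_mono g1_exp_quarter) simp
    also have "\<dots> = ennreal (1 + c * K * (3 / 2))" by (rule ennreal_affine) (use c0 K0 in auto)
    also have "\<dots> \<le> ennreal (exp (2 * c * K))"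
    proof (rule ennreal_leI)
      have "1 + c * K * (3 / 2) \<le> 1 + 2 * c * K" using c0 K0 by simp
      also have "\<dots> \<le> exp (2 * c * K)" by (rule exp_ge_add_one_self)
      finally show "1 + c * K * (3 / 2) \<le> exp (2 * c * K)" .
    qed
    finally show "(\<integral>\<^sup>+x. ennreal (exp (c * min \<bar>x\<bar> \<theta> powr p)) \<partial>g1) \<le> ennreal (exp (2 * c * K))" .
  qed auto
  also have "(\<Sum>i<N. 2 * c * K) - c * A * real N = - (c * real N * (A - 2 * K))" by (simp add: algebra_simps)
  finally show ?thesis .
qed

text \<open>A single coordinate of size N^(1/p) already makes the sum of order N, which is why the
  decay is only exponential in T = N^(2/p). A cut at this size separates that event, treated by a
  union bound, from the truncated sum, for which c N is of order T.\<close>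

lemma Gam_lp_norm_large:
  assumes p: "2 \<le> p"
  shows "\<exists>A>0. \<forall>N\<ge>1. measure (Gam N) {h \<in> space (Gam N). A * real N < (\<Sum>i<N. \<bar>h i\<bar> powr p)} \<le> exp (- p * real N powr (2 / p))"
proof -
  \<comment> \<open>Gives \<theta>^2/4 = (2p+2) T, of which the factor N of the union bound takes at
    most p T.\<close>
  define k where "k = sqrt (8 * p + 8)"
  define K where "K = 8 powr (p / 2) * (p / 2) powr (p / 2)"
  \<comment> \<open>As c N = T / (8 k^(p-2)), this makes the Chernoff exponent for the truncated sum
    equal to (p+1) T.\<close>
  define A where "A = 2 * K + 8 * k powr (p - 2) * (p + 1)"
  have k: "0 < k" "k\<^sup>2 = 8 * p + 8" using p by (auto simp: k_def)
  have A0: "0 < A" using p k by (auto simp: A_def K_def intro!: add_nonneg_pos)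
  have "measure (Gam N) {h \<in> space (Gam N). A * real N < (\<Sum>i<N. \<bar>h i\<bar> powr p)} \<le> exp (- p * real N powr (2 / p))"
    if N: "1 \<le> N" for N
  proof -
    define T where "T = real N powr (2 / p)"
    have T1: "1 \<le> T" using N p by (simp add: T_def ge_one_powr_ge_zero)
    define \<theta> where "\<theta> = k * real N powr (1 / p)"
    have \<theta>0: "0 < \<theta>" using k N by (simp add: \<theta>_def)
    have \<theta>2: "\<theta>\<^sup>2 = (8 * p + 8) * T"
    proof -
      have "(real N powr (1 / p))\<^sup>2 = T" using N by (simp add: T_def powr_numeral[symmetric] powr_powr)
      then show ?thesis by (simp add: \<theta>_def power_mult_distrib k(2))
    qed
    define c where "c = 1 / (8 * \<theta> powr (p - 2))"
    have cN: "c * real N = T / (8 * k powr (p - 2))"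
    proof -
      have "\<theta> powr (p - 2) = k powr (p - 2) * real N powr (1 - 2 / p)"
        using p by (simp add: \<theta>_def powr_mult powr_powr diff_divide_distrib)
      moreover have "real N = real N powr (1 - 2 / p) * T"
        using N by (simp add: T_def powr_add[symmetric])
      ultimately have "c * real N = real N powr (1 - 2 / p) * T / (8 * (k powr (p - 2) * real N powr (1 - 2 / p)))"
        unfolding c_def by (metis mult_1 times_divide_eq_left)
      then show ?thesis using N by simp
    qed
    let ?B1 = "{h \<in> space (Gam N). \<exists>i<N. \<theta> < \<bar>h i\<bar>}"
    let ?B2 = "{h \<in> space (Gam N). A * real N < (\<Sum>i<N. min \<bar>h i\<bar> \<theta> powr p)}"
    have "{h \<in> space (Gam N). A * real N < (\<Sum>i<N. \<bar>h i\<bar> powr p)} \<subseteq> ?B1 \<union> ?B2"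
    proof
      fix h assume h: "h \<in> {h \<in> space (Gam N). A * real N < (\<Sum>i<N. \<bar>h i\<bar> powr p)}"
      show "h \<in> ?B1 \<union> ?B2"
      proof (cases "\<exists>i<N. \<theta> < \<bar>h i\<bar>")
        case False
        then have "(\<Sum>i<N. min \<bar>h i\<bar> \<theta> powr p) = (\<Sum>i<N. \<bar>h i\<bar> powr p)"
          by (intro sum.cong refl) (auto simp: min_def)
        then show ?thesis using h by simp
      qed (use h in auto)
    qed
    moreover have m1: "?B1 \<in> sets (Gam N)"
    proof -
      have "{h \<in> space (Gam N). \<theta> < \<bar>h i\<bar>} \<in> sets (Gam N)" if "i < N" for i
        using measurable_Gam_coord[OF that] by measurable
      then have "(\<Union>i<N. {h \<in> space (Gam N). \<theta> < \<bar>h i\<bar>}) \<in> sets (Gam N)" by auto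
      also have "(\<Union>i<N. {h \<in> space (Gam N). \<theta> < \<bar>h i\<bar>}) = ?B1" by auto
      finally show ?thesis .
    qed
    moreover have m2: "?B2 \<in> sets (Gam N)"
    proof -
      have "(\<lambda>h. \<Sum>i<N. min \<bar>h i\<bar> \<theta> powr p) \<in> borel_measurable (Gam N)"
      proof (rule borel_measurable_sum)
        fix i assume "i \<in> {..<N}"
        then have [measurable]: "(\<lambda>h. h i) \<in> borel_measurable (Gam N)" using measurable_Gam_coord by simp
        show "(\<lambda>h. min \<bar>h i\<bar> \<theta> powr p) \<in> borel_measurable (Gam N)" by measurable
      qed
      then show ?thesis by measurable
    qed
    ultimately have "measure (Gam N) {h \<in> space (Gam N). A * real N < (\<Sum>i<N. \<bar>h i\<bar> powr p)} \<le> measure (Gam N) (?B1 \<union> ?B2)"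
      by (intro Gam.finite_measure_mono sets.Un)
    also have "\<dots> \<le> measure (Gam N) ?B1 + measure (Gam N) ?B2" by (rule measure_Un_le[OF m1 m2])
    also have "measure (Gam N) ?B2 \<le> exp (- (c * real N * (A - 2 * K)))"
      by (rule Gam_trunc_power_large[OF p \<theta>0 c_def K_def])
    also have "c * real N * (A - 2 * K) = (p + 1) * T"
      unfolding cN A_def using k by simp
    also have "measure (Gam N) ?B1 \<le> real N * (3 / 2 * exp (- \<theta>\<^sup>2 / 4))"
      by (rule Gam_max_large) (use \<theta>0 in simp)
    also have "\<dots> \<le> exp (p * T) * (3 / 2 * exp (- \<theta>\<^sup>2 / 4))"
    proof (rule mult_right_mono)
      have "real N = T powr (p / 2)" using N p by (simp add: T_def powr_powr)
      also have "\<dots> \<le> T powr p" using T1 p by (intro powr_mono) auto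
      also have "\<dots> = exp (p * ln T)" using T1 by (simp add: powr_def)
      also have "\<dots> \<le> exp (p * T)" using T1 p ln_le_minus_one[of T] by simp
      finally show "real N \<le> exp (p * T)" .
    qed simp
    also have "\<dots> = 3 / 2 * exp (- (p + 2) * T)"
    proof -
      have "exp (p * T) * exp (- \<theta>\<^sup>2 / 4) = exp (- (p + 2) * T)"
        unfolding \<theta>2 exp_add[symmetric] by (simp add: field_simps)
      then show ?thesis by simp
    qed
    also have "3 / 2 * exp (- (p + 2) * T) + exp (- ((p + 1) * T)) \<le> exp (- p * T)"
    proof -
      have e: "exp (- T) \<le> 1 / 2"
      proof -
        have "2 \<le> exp T" using exp_ge_add_one_self[of T] T1 by linarith
        then show ?thesis by (simp add: exp_minus field_simps)
      qed
      have "exp (- (p + 2) * T) = exp (- p * T) * (exp (- T) * exp (- T))" by (simp add: exp_add[symmetric] algebra_simps)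
      moreover have "exp (- ((p + 1) * T)) = exp (- p * T) * exp (- T)" by (simp add: exp_add[symmetric] algebra_simps)
      moreover have "3 / 2 * (exp (- T) * exp (- T)) + exp (- T) \<le> 1"
        using e mult_mono[OF e e] by simp
      ultimately show ?thesis
        using mult_left_mono[of "3 / 2 * (exp (- T) * exp (- T)) + exp (- T)" 1 "exp (- p * T)"]
        by (simp add: algebra_simps)
    qed
    finally show ?thesis by (simp add: T_def)
  qed
  then show ?thesis using A0 by blast
qed

text \<open>For n \<ge> c N the logarithmic factor is bounded and n may be replaced by N in the
  rate, so one Gaussian vector of the subspace, used on all N coordinates, is enough. Its l_p norm
  is what limits the probability.\<close>

lemma section_radius_lower_proportional:
  assumes p: "2 \<le> p" and \<beta>: "0 < \<beta>" and c: "0 < c" "c \<le> 1"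
  shows "\<exists>C>0. \<forall>N n \<mu>. 1 \<le> n \<longrightarrow> n < N \<longrightarrow> c * real N \<le> real n \<longrightarrow> is_haar_grassmannian N n \<mu> \<longrightarrow>
    1 - 2 * exp (- p * real n powr (2 / p)) \<le> measure \<mu> {E \<in> space \<mu>.
      base_rate \<beta> n * log_factor p N n \<le> C * section_radius N (p_ellipsoid N p (log_semiaxis (1 - 1 / p) \<beta>)) E}"
proof -
  have p1: "1 < p" using p by simp
  obtain A where A: "0 < A" "\<And>N. 1 \<le> N \<Longrightarrow> measure (Gam N) {h \<in> space (Gam N). A * real N < (\<Sum>i<N. \<bar>h i\<bar> powr p)} \<le> exp (- p * real N powr (2 / p))"
    using Gam_lp_norm_large[OF p] by blast
  define \<epsilon> where "\<epsilon> = sqrt 2 * exp (- (p + 1))"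
  have \<epsilon>0: "0 < \<epsilon>" by (simp add: \<epsilon>_def)
  define D1 where "D1 = c powr (- 1 / 2) * (1 + ln (1 / c) / ln 2) powr \<beta>"
  define D2 where "D2 = max 1 (ln (1 / c)) powr (1 - 1 / p)"
  define C where "C = D2 * D1 / (\<epsilon> * A powr (- 1 / p))"
  have "0 < 1 + ln (1 / c) / ln 2" using c by (auto intro!: add_pos_nonneg divide_nonneg_pos)
  then have D: "0 < D1" "0 < D2" using c by (auto simp: D1_def D2_def)
  have C0: "0 < C" using D \<epsilon>0 A by (simp add: C_def)
  have "1 - 2 * exp (- p * real n powr (2 / p)) \<le> measure \<mu> {E \<in> space \<mu>.
      base_rate \<beta> n * log_factor p N n \<le> C * section_radius N (p_ellipsoid N p (log_semiaxis (1 - 1 / p) \<beta>)) E}"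
    if n: "1 \<le> n" "n < N" "c * real N \<le> real n" and \<mu>: "is_haar_grassmannian N n \<mu>" for N n \<mu>
  proof -
    let ?R = "section_radius N (p_ellipsoid N p (log_semiaxis (1 - 1 / p) \<beta>))"
    let ?B1 = "{h \<in> space (Gam N). ip N h h < \<epsilon>\<^sup>2 * real N}"
    let ?B2 = "{h \<in> space (Gam N). A * real N < (\<Sum>i<N. \<bar>h i\<bar> powr p)}"
    have m1: "?B1 \<in> sets (Gam N)" unfolding ip_def by measurable
    have m2: "?B2 \<in> sets (Gam N)"
    proof -
      have "(\<lambda>h. \<Sum>i<N. \<bar>h i\<bar> powr p) \<in> borel_measurable (Gam N)"
      proof (rule borel_measurable_sum)
        fix i assume "i \<in> {..<N}"
        then have [measurable]: "(\<lambda>h. h i) \<in> borel_measurable (Gam N)" using measurable_Gam_coord by simp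
        show "(\<lambda>h. \<bar>h i\<bar> powr p) \<in> borel_measurable (Gam N)" by measurable
      qed
      then show ?thesis by measurable
    qed
    have T: "real n powr (2 / p) \<le> real N powr (2 / p)" "real N powr (2 / p) \<le> real N"
      using n p powr_mono[of "2 / p" 1 "real N"] by (auto intro!: powr_mono2)
    have "measure (Gam N) (?B1 \<union> ?B2) \<le> measure (Gam N) ?B1 + measure (Gam N) ?B2"
      by (rule measure_Un_le[OF m1 m2])
    also have "measure (Gam N) ?B1 \<le> exp (- p * real N)"
      unfolding \<epsilon>_def by (rule Gam_norm_small) (use p in simp)
    also have "exp (- p * real N) \<le> exp (- p * real n powr (2 / p))" using T p by simp
    also have "measure (Gam N) ?B2 \<le> exp (- p * real N powr (2 / p))" by (rule A(2)) (use n in simp)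
    also have "exp (- p * real N powr (2 / p)) \<le> exp (- p * real n powr (2 / p))" using T p by simp
    finally have "measure (Gam N) (?B1 \<union> ?B2) \<le> 2 * exp (- p * real n powr (2 / p))" by simp
    then have "1 - 2 * exp (- p * real n powr (2 / p)) \<le> measure (Gam N) (space (Gam N) - (?B1 \<union> ?B2))"
      using Gam.prob_compl[of "?B1 \<union> ?B2" N] m1 m2 by simp
    also have "\<dots> \<le> measure \<mu> {E \<in> space \<mu>. base_rate \<beta> n * log_factor p N n \<le> C * ?R E}"
    proof (rule haar_ge_span[OF \<mu> n(2)])
      have sp: "space \<mu> = space (grassmannian_borel N n)" "sets \<mu> = sets (grassmannian_borel N n)"
        using \<mu> by (auto simp: is_haar_grassmannian_def space_grassmannian_borel)
      have "?R \<in> borel_measurable (grassmannian_borel N n)"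
        by (rule measurable_section_radius) (use log_semiaxis_pos p in auto)
      then show "{E \<in> space \<mu>. base_rate \<beta> n * log_factor p N n \<le> C * ?R E} \<in> sets \<mu>"
        unfolding sp by measurable
      show "space (Gam N) - (?B1 \<union> ?B2) \<in> sets (Gam N)" using m1 m2 by auto
      fix h E assume h: "h \<in> space (Gam N) - (?B1 \<union> ?B2)" and E: "E \<in> grassmannian_codim N n"
        and hE: "(\<lambda>i. if i < N then h i else 0) \<in> E"
      let ?y = "\<lambda>i. if i < N then h i else 0"
      have "\<epsilon> * A powr (- 1 / p) * (real N powr (- 1 / 2) * ln (real N + 1) powr (- \<beta>)) \<le> ?R E"
      proof (rule section_radius_ge_flat[OF p1 \<beta> E hE _ _ _ _ _ A(1)])
        have "ip N ?y ?y = ip N h h" by (simp add: ip_def)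
        then show "\<epsilon>\<^sup>2 * real N \<le> ip N ?y ?y" using h by auto
        have "(\<Sum>i<N. \<bar>?y i\<bar> powr p) = (\<Sum>i<N. \<bar>h i\<bar> powr p)" by simp
        then show "(\<Sum>i<N. \<bar>?y i\<bar> powr p) \<le> A * real N" using h by auto
      qed (use n \<epsilon>0 in \<open>auto simp: Rn_iff\<close>)
      then have le: "real N powr (- 1 / 2) * ln (real N + 1) powr (- \<beta>) \<le> ?R E / (\<epsilon> * A powr (- 1 / p))"
        using \<epsilon>0 A by (simp add: pos_le_divide_eq mult.commute)
      have 1: "base_rate \<beta> n \<le> D1 * (real N powr (- 1 / 2) * ln (real N + 1) powr (- \<beta>))"
        unfolding D1_def by (rule base_rate_compare[OF \<beta> c]) (use n in auto)
      have 2: "log_factor p N n \<le> D2"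
      proof -
        have "real N / real n \<le> 1 / c" using n c by (simp add: field_simps)
        then have "ln (real N / real n) \<le> ln (1 / c)" using n by (intro ln_mono) auto
        then have "log_max N n \<le> max 1 (ln (1 / c))" using log_max_upper_aux(3)[OF n(1,2)] by linarith
        then show ?thesis unfolding log_factor_log_max D2_def using log_max_ge_1[of N n] p by (intro powr_mono2) auto
      qed
      have "base_rate \<beta> n * log_factor p N n \<le> (D1 * (real N powr (- 1 / 2) * ln (real N + 1) powr (- \<beta>))) * D2"
        using 1 2 D by (intro mult_mono) (auto simp: log_factor_log_max)
      also have "\<dots> \<le> (D1 * (?R E / (\<epsilon> * A powr (- 1 / p)))) * D2"
        using le D by (intro mult_right_mono mult_left_mono) auto
      also have "\<dots> = C * ?R E" by (simp add: C_def)
      finally show "E \<in> {E \<in> space \<mu>. base_rate \<beta> n * log_factor p N n \<le> C * ?R E}"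
        using E sp(1) by (simp add: space_grassmannian_borel)
    qed
    finally show ?thesis .
  qed
  then show ?thesis using C0 by blast
qed

section \<open>The lower bound in small codimension\<close>

text \<open>Positive endpoints fall under the convexity of the power; a zero endpoint reduces to t^p
  \<le> t on the unit interval.\<close>

lemma powr_convex_combination:
  fixes a b t p :: real
  assumes "0 \<le> a" "0 \<le> b" "0 \<le> t" "t \<le> 1" "1 \<le> p"
  shows "((1 - t) * a + t * b) powr p \<le> (1 - t) * a powr p + t * b powr p"
proof -
  have small: "t powr p \<le> t" if "0 \<le> t" "t \<le> 1" for t :: real
    using that assms(5) powr_mono'[of 1 p t] by (cases "t = 0") auto
  consider "a = 0" | "b = 0" | "0 < a" "0 < b" using assms by linarith
  then show ?thesis
  proof cases
    case 1
    then show ?thesis using small[of t] assms by (simp add: powr_mult mult_right_mono)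
  next
    case 2
    then show ?thesis using small[of "1 - t"] assms by (simp add: powr_mult mult_right_mono)
  next
    case 3
    then show ?thesis
      using convex_onD[OF powr_convex[OF assms(5)] assms(3,4), of a b] by simp
  qed
qed

text \<open>Minimise the distance from \<open>w\<close> to the image of the ellipsoid. If the minimum is
  positive, the residual \<open>u\<close> contradicts the lower bound for the support function of the
  image, which is the \<open>q\<close>-norm in the hypothesis.\<close>

lemma ellipsoid_image_contains_ball:
  fixes H :: "nat \<Rightarrow> nat \<Rightarrow> real" and \<sigma> w :: "nat \<Rightarrow> real"
  assumes I: "finite I" and \<sigma>: "\<And>i. i \<in> I \<Longrightarrow> 0 < \<sigma> i" and p: "1 < p" "q = p / (p - 1)" and r: "0 < r"
    and hyp: "\<And>u. r powr q * ip n u u powr (q / 2) \<le> (\<Sum>i\<in>I. \<sigma> i powr q * \<bar>ip n u (H i)\<bar> powr q)"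
    and w: "ip n w w \<le> r\<^sup>2"
  shows "\<exists>x. (\<forall>i. i \<notin> I \<longrightarrow> x i = 0) \<and> (\<Sum>i\<in>I. (\<bar>x i\<bar> / \<sigma> i) powr p) \<le> 1 \<and>
    (\<forall>j<n. (\<Sum>i\<in>I. x i * H i j) = w j)"
proof -
  define g where "g x = (\<Sum>i\<in>I. (\<bar>x i\<bar> / \<sigma> i) powr p)" for x :: "nat \<Rightarrow> real"
  define im where "im x j = (\<Sum>i\<in>I. x i * H i j)" for x j
  define F where "F x = (\<Sum>j<n. (w j - im x j)\<^sup>2)" for x
  \<comment> \<open>Coordinates outside \<open>I\<close> are pinned to 0, so that the set is compact
    in the product topology on all functions, by Tychonoff.\<close>
  define P where "P = Pi\<^sub>E UNIV (\<lambda>i. if i \<in> I then {- \<sigma> i..\<sigma> i} else {0 :: real})"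
  define K where "K = P \<inter> {x. g x \<le> 1}"
  have q: "1 < q" "(q - 1) * p = q" "1 - 1 / p = 1 / q" using p(1) by (simp_all add: p(2) field_simps)
  have co: "continuous_on UNIV (\<lambda>x :: nat \<Rightarrow> real. x i)" for i
    by (rule continuous_on_product_coordinates)
  have "compactin (product_topology (\<lambda>_. euclidean) UNIV) P"
    unfolding P_def compactin_PiE by auto
  then have "compact P" by (simp add: euclidean_product_topology)
  moreover have "closed {x. g x \<le> 1}"
  proof (rule closed_Collect_le)
    have "continuous_on UNIV (\<lambda>x :: nat \<Rightarrow> real. (\<bar>x i\<bar> / \<sigma> i) powr p)" if i: "i \<in> I" for i
    proof (rule continuous_on_powr')
      have "\<sigma> i \<noteq> 0" using \<sigma>[OF i] by simp
      then show "continuous_on UNIV (\<lambda>x :: nat \<Rightarrow> real. \<bar>x i\<bar> / \<sigma> i)"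
        by (intro continuous_intros co) auto
    qed (use p \<sigma>[OF i] in auto)
    then show "continuous_on UNIV g" unfolding g_def by (rule continuous_on_sum)
  qed simp
  ultimately have cK: "compact K" unfolding K_def by (rule compact_Int_closed)
  have K: "x \<in> K \<longleftrightarrow> (\<forall>i. i \<notin> I \<longrightarrow> x i = 0) \<and> g x \<le> 1" for x
  proof -
    have "x i \<in> {- \<sigma> i..\<sigma> i}" if "g x \<le> 1" "i \<in> I" for i
    proof -
      have "(\<bar>x i\<bar> / \<sigma> i) powr p \<le> g x" unfolding g_def by (rule member_le_sum) (use I that in auto)
      then have "(\<bar>x i\<bar> / \<sigma> i) powr p \<le> 1 powr p" using that by simp
      then have "\<bar>x i\<bar> / \<sigma> i \<le> 1"
        using p powr_less_mono2[of p 1 "\<bar>x i\<bar> / \<sigma> i"] by (force simp: not_less[symmetric])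
      then show ?thesis using \<sigma>[OF that(2)] by (auto simp: field_simps abs_le_iff)
    qed
    then show ?thesis unfolding K_def P_def by (auto simp: PiE_iff)
  qed
  have "(\<lambda>_. 0) \<in> K" by (simp add: K g_def)
  then have ne: "K \<noteq> {}" by auto
  have "continuous_on K F"
    unfolding F_def im_def by (intro continuous_intros continuous_on_subset[OF co]) auto
  from continuous_attains_inf[OF cK ne this]
  obtain x where x: "x \<in> K" "\<And>y. y \<in> K \<Longrightarrow> F x \<le> F y" by blast
  define u where "u j = w j - im x j" for j
  have Fu: "F x = ip n u u" by (simp add: F_def u_def ip_def power2_eq_square)
  have "ip n u u = 0"
  proof (rule ccontr)
    assume "ip n u u \<noteq> 0"
    then have uu: "0 < ip n u u" using ip_self_nonneg[of n u] by simp
    define v where "v i = ip n u (H i)" for i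
    define Z where "Z = (\<Sum>i\<in>I. \<sigma> i powr q * \<bar>v i\<bar> powr q)"
    have Z: "r powr q * ip n u u powr (q / 2) \<le> Z" using hyp[of u] by (simp add: Z_def v_def)
    have Z0: "0 < Z" by (rule less_le_trans[OF _ Z]) (use r uu in simp)
    \<comment> \<open>The equality case of Hoelder's inequality: this point of the boundary realises
      the support function of the image in direction u, with value Z^(1/q).\<close>
    define x' where "x' i = (if i \<in> I then \<sigma> i powr q * \<bar>v i\<bar> powr (q - 1) * sgn (v i) / Z powr (1 / p) else 0)" for i
    have gx': "g x' = 1"
    proof -
      have "(\<bar>x' i\<bar> / \<sigma> i) powr p = \<sigma> i powr q * \<bar>v i\<bar> powr q / Z" if i: "i \<in> I" for i
      proof (cases "v i = 0")
        case True then show ?thesis using p q by (simp add: x'_def)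
      next
        case False
        have "\<bar>x' i\<bar> / \<sigma> i = \<sigma> i powr (q - 1) * \<bar>v i\<bar> powr (q - 1) / Z powr (1 / p)"
          using i \<sigma>[OF i] False by (simp add: x'_def abs_mult powr_diff)
        then have "(\<bar>x' i\<bar> / \<sigma> i) powr p = \<sigma> i powr ((q - 1) * p) * \<bar>v i\<bar> powr ((q - 1) * p) / Z powr (1 / p * p)"
          by (simp only: powr_divide powr_mult powr_powr)
        then show ?thesis using q(2) p Z0 by simp
      qed
      then have "g x' = Z / Z" unfolding g_def Z_def sum_divide_distrib by simp
      then show ?thesis using Z0 by simp
    qed
    have x'K: "x' \<in> K" by (simp add: K gx') (simp add: x'_def)
    have ux': "ip n u (im x') = Z powr (1 / q)"
    proof -
      have "ip n u (im x') = (\<Sum>i\<in>I. x' i * v i)"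
        unfolding ip_def im_def v_def sum_distrib_left by (subst sum.swap) (simp add: mult_ac)
      also have "\<dots> = (\<Sum>i\<in>I. \<sigma> i powr q * \<bar>v i\<bar> powr q / Z powr (1 / p))"
      proof (rule sum.cong[OF refl])
        fix i assume i: "i \<in> I"
        have "\<bar>v i\<bar> powr (q - 1) * sgn (v i) * v i = \<bar>v i\<bar> powr q"
        proof (cases "v i = 0")
          case False
          have "\<bar>v i\<bar> powr (q - 1) * (sgn (v i) * v i) = \<bar>v i\<bar> powr (q - 1) * \<bar>v i\<bar> powr 1"
            using linordered_idom_class.abs_sgn[of "v i"] by (simp only: powr_one abs_ge_zero mult.commute)
          also have "\<dots> = \<bar>v i\<bar> powr q" by (simp only: powr_add[symmetric]) simp
          finally show ?thesis by (simp add: mult.assoc)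
        qed (use q in simp)
        then have "\<sigma> i powr q * (\<bar>v i\<bar> powr (q - 1) * sgn (v i) * v i) / Z powr (1 / p) = \<sigma> i powr q * \<bar>v i\<bar> powr q / Z powr (1 / p)"
          by simp
        then show "x' i * v i = \<sigma> i powr q * \<bar>v i\<bar> powr q / Z powr (1 / p)"
          using i by (simp add: x'_def mult.assoc)
      qed
      also have "\<dots> = Z powr 1 / Z powr (1 / p)" unfolding sum_divide_distrib[symmetric] using Z0 by (simp add: Z_def)
      also have "\<dots> = Z powr (1 / q)" by (simp only: powr_diff[symmetric] q(3))
      finally show ?thesis .
    qed
    define d where "d j = im x' j - im x j" for j
    \<comment> \<open>Minimality of x along the segment towards \<open>x'\<close>, divided by t;
      small t then gives the first-order condition.\<close>
    have step: "2 * ip n u d \<le> t * ip n d d" if t: "0 < t" "t \<le> 1" for t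
    proof -
      define z where "z i = (1 - t) * x i + t * x' i" for i
      have "g z \<le> (\<Sum>i\<in>I. (1 - t) * (\<bar>x i\<bar> / \<sigma> i) powr p + t * (\<bar>x' i\<bar> / \<sigma> i) powr p)"
        unfolding g_def
      proof (rule sum_mono)
        fix i assume i: "i \<in> I"
        have "\<bar>z i\<bar> \<le> (1 - t) * \<bar>x i\<bar> + t * \<bar>x' i\<bar>"
          unfolding z_def using t abs_triangle_ineq[of "(1 - t) * x i" "t * x' i"] by (simp add: abs_mult)
        then have "\<bar>z i\<bar> / \<sigma> i \<le> ((1 - t) * \<bar>x i\<bar> + t * \<bar>x' i\<bar>) / \<sigma> i"
          using \<sigma>[OF i] by (intro divide_right_mono) auto
        then have "(\<bar>z i\<bar> / \<sigma> i) powr p \<le> ((1 - t) * (\<bar>x i\<bar> / \<sigma> i) + t * (\<bar>x' i\<bar> / \<sigma> i)) powr p"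
          using p \<sigma>[OF i] by (intro powr_mono2) (auto simp: add_divide_distrib)
        also have "\<dots> \<le> (1 - t) * (\<bar>x i\<bar> / \<sigma> i) powr p + t * (\<bar>x' i\<bar> / \<sigma> i) powr p"
          using t p \<sigma>[OF i] by (intro powr_convex_combination) auto
        finally show "(\<bar>z i\<bar> / \<sigma> i) powr p \<le> (1 - t) * (\<bar>x i\<bar> / \<sigma> i) powr p + t * (\<bar>x' i\<bar> / \<sigma> i) powr p" .
      qed
      also have "\<dots> = (1 - t) * g x + t * g x'" by (simp add: g_def sum.distrib sum_distrib_left)
      also have "\<dots> \<le> (1 - t) * 1 + t * 1"
        using t x(1) gx' by (intro add_mono mult_left_mono) (auto simp: K)
      finally have "z \<in> K" using x(1) x'K by (auto simp: K z_def)
      then have "ip n u u \<le> F z" using x(2) Fu by simp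
      also have "F z = ip n u u - 2 * t * ip n u d + t\<^sup>2 * ip n d d"
      proof -
        have "im z j = im x j + t * d j" for j
          unfolding im_def z_def d_def sum_subtractf[symmetric] sum_distrib_left sum.distrib[symmetric]
          by (intro sum.cong refl) (simp add: algebra_simps)
        then have "(w j - im z j)\<^sup>2 = u j * u j - 2 * t * (u j * d j) + t\<^sup>2 * (d j * d j)" for j
          by (simp add: u_def power2_eq_square algebra_simps)
        then show ?thesis
          by (simp add: F_def ip_def sum.distrib sum_subtractf sum_distrib_left)
      qed
      finally have "t * (2 * ip n u d) \<le> t * (t * ip n d d)" by (simp add: power2_eq_square algebra_simps)
      then show ?thesis using t by simp
    qed
    have "ip n u d \<le> 0"
    proof (rule ccontr)
      assume "\<not> ip n u d \<le> 0"
      then have a: "0 < ip n u d" by simp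
      define b where "b = ip n d d"
      have b: "0 \<le> b" by (simp add: b_def ip_self_nonneg)
      define t where "t = min 1 (ip n u d / (b + 1))"
      have t: "0 < t" "t \<le> 1" using a b by (auto simp: t_def)
      have "t * b \<le> ip n u d / (b + 1) * b" using b by (intro mult_right_mono) (auto simp: t_def)
      also have "\<dots> \<le> ip n u d" using a b by (simp add: field_simps)
      finally show False using step[OF t] a by (simp add: b_def)
    qed
    then have "ip n u (im x') \<le> ip n u (im x)" unfolding d_def by (simp add: ip_diff_right)
    also have "ip n u (im x) = ip n u w - ip n u u"
    proof -
      have "im x = (\<lambda>j. w j - u j)" by (simp add: u_def)
      then show ?thesis by (simp add: ip_diff_right)
    qed
    \<comment> \<open>Cauchy--Schwarz, obtained by expanding the square of (r / \<bar>u\<bar>) u -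
      w.\<close>
    also have "ip n u w \<le> r * sqrt (ip n u u)"
    proof -
      let ?s = "sqrt (ip n u u)"
      have s: "0 < ?s" "?s\<^sup>2 = ip n u u" using uu by auto
      have "0 \<le> ip n (\<lambda>j. (r / ?s) * u j - w j) (\<lambda>j. (r / ?s) * u j - w j)" by (rule ip_self_nonneg)
      also have "\<dots> = (r / ?s)\<^sup>2 * ip n u u - 2 * (r / ?s) * ip n u w + ip n w w"
        by (simp only: ip_diff_left ip_diff_right ip_scale_left ip_scale_right ip_commute[of n w u]) (simp add: power2_eq_square algebra_simps)
      also have "(r / ?s)\<^sup>2 * ip n u u = r\<^sup>2" using s uu by (simp add: power_divide)
      finally have "2 * (r / ?s) * ip n u w \<le> 2 * r\<^sup>2" using w by linarith
      then have "2 * r * ip n u w \<le> 2 * r * (r * ?s)" using s by (simp add: field_simps power2_eq_square)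
      then show ?thesis using r by simp
    qed
    \<comment> \<open>Hence Z^(1/q) \<le> <u, w> - <u, u> < r \<bar>u\<bar>, while the hypothesis
      says that Z^(1/q) is at least r \<bar>u\<bar>.\<close>
    finally have "Z powr (1 / q) < r * sqrt (ip n u u)" using uu ux' by simp
    moreover have "r * sqrt (ip n u u) \<le> Z powr (1 / q)"
    proof -
      have "(r powr q * ip n u u powr (q / 2)) powr (1 / q) \<le> Z powr (1 / q)"
        using Z r q by (intro powr_mono2) auto
      moreover have "(r powr q * ip n u u powr (q / 2)) powr (1 / q) = r * sqrt (ip n u u)"
        using r uu q by (simp add: powr_mult powr_powr powr_half_sqrt)
      ultimately show ?thesis by simp
    qed
    ultimately show False by simp
  qed
  then have "u j = 0" if "j < n" for j using that by (simp add: ip_self_eq_0)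
  then have "\<forall>j<n. im x j = w j" by (auto simp: u_def)
  then show ?thesis using x(1) unfolding K g_def im_def by blast
qed

lemma log_weight_antimono: "0 \<le> s \<Longrightarrow> 1 \<le> i \<Longrightarrow> i \<le> j \<Longrightarrow> log_weight s j \<le> log_weight s i"
  unfolding log_weight_def by (intro mult_mono divide_left_mono powr_mono2') auto

text \<open>The m indices after m carry weights comparable to the m-th one. So no single weight
  dominates the tail sum, which is what \<open>GamM_weighted_small_ball\<close> asks for; it is used
  at A n.\<close>

lemma log_weight_sum_ge_max:
  assumes s: "0 \<le> s" and m: "1 \<le> m" "2 * m \<le> N"
  shows "real m * 2 powr (- s - 1) * log_weight s m \<le> (\<Sum>j\<in>{m<..N}. log_weight s j)"
proof -
  have "2 powr (- s - 1) * log_weight s m \<le> log_weight s (2 * m)"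
  proof -
    have "ln (real (2 * m) + 1) \<le> ln ((real m + 1)\<^sup>2)"
      by (rule ln_mono) (auto simp: power2_eq_square algebra_simps)
    then have "ln (real (2 * m) + 1) \<le> 2 * ln (real m + 1)" by (simp add: ln_realpow)
    then have "(2 * ln (real m + 1)) powr (- s) \<le> ln (real (2 * m) + 1) powr (- s)"
      using m s by (intro powr_mono2') auto
    then have "2 powr (- s) * ln (real m + 1) powr (- s) \<le> ln (real (2 * m) + 1) powr (- s)"
      by (simp only: powr_mult)
    then have "1 / real (2 * m) * (2 powr (- s) * ln (real m + 1) powr (- s)) \<le> log_weight s (2 * m)"
      unfolding log_weight_def by (intro mult_left_mono) auto
    moreover have "2 powr (- s - 1) = 2 powr (- s) / (2::real)" by (simp add: powr_diff)
    then have "2 powr (- s - 1) * log_weight s m = 1 / real (2 * m) * (2 powr (- s) * ln (real m + 1) powr (- s))"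
      unfolding log_weight_def by (simp only: of_nat_mult of_nat_numeral times_divide_times_eq mult_1 times_divide_eq_left times_divide_eq_right divide_divide_eq_left)
    ultimately show ?thesis by simp
  qed
  then have "real m * (2 powr (- s - 1) * log_weight s m) \<le> real m * log_weight s (2 * m)" by (intro mult_left_mono) auto
  also have "\<dots> = (\<Sum>j\<in>{m<..2 * m}. log_weight s (2 * m))" by simp
  also have "\<dots> \<le> (\<Sum>j\<in>{m<..2 * m}. log_weight s j)" using s m by (intro sum_mono log_weight_antimono) auto
  also have "\<dots> \<le> (\<Sum>j\<in>{m<..N}. log_weight s j)" using m by (intro sum_mono2) (auto simp: log_weight_nonneg)
  finally show ?thesis by (simp add: mult.assoc)
qed

text \<open>Passes from \<open>phi\<close> to the power q \<le> 2 through phi^2 \<le>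
  \<bar>t\<bar>^q and a tangent of the square, phi^2 \<ge> (e0/2) phi - e0^2/16. The constant is 1/4
  - 1/16 = 3/16.\<close>

lemma phi_sum_to_powr:
  assumes q: "0 < q" "q \<le> 2" and b: "\<And>i. i \<in> I \<Longrightarrow> 0 \<le> b i"
    and le: "sum b I * e0 / 2 \<le> (\<Sum>i\<in>I. b i * phi (v i))"
  shows "3 / 16 * e0\<^sup>2 * sum b I \<le> (\<Sum>i\<in>I. b i * \<bar>v i\<bar> powr q)"
proof -
  have pw: "e0 / 2 * phi t - e0\<^sup>2 / 16 \<le> \<bar>t\<bar> powr q" for t
  proof -
    have "0 \<le> (phi t - e0 / 4)\<^sup>2" by simp
    then have "e0 / 2 * phi t - e0\<^sup>2 / 16 \<le> (phi t)\<^sup>2" by (simp add: power2_eq_square algebra_simps)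
    also have "(phi t)\<^sup>2 \<le> \<bar>t\<bar> powr q"
    proof (cases "\<bar>t\<bar> \<le> 1")
      case True
      show ?thesis
      proof (cases "t = 0")
        case False
        then have "\<bar>t\<bar> powr 2 \<le> \<bar>t\<bar> powr q" using True q by (intro powr_mono') auto
        then show ?thesis using True by (simp add: phi_def powr_numeral)
      qed (simp add: phi_def)
    next
      case False
      then show ?thesis using q by (simp add: phi_def ge_one_powr_ge_zero)
    qed
    finally show ?thesis .
  qed
  have "3 / 16 * e0\<^sup>2 * sum b I = e0 / 2 * (sum b I * e0 / 2) - e0\<^sup>2 / 16 * sum b I"
    by (simp add: power2_eq_square)
  also have "\<dots> \<le> e0 / 2 * (\<Sum>i\<in>I. b i * phi (v i)) - e0\<^sup>2 / 16 * sum b I"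
    using le e0_pos by (intro diff_right_mono mult_left_mono) auto
  also have "\<dots> = (\<Sum>i\<in>I. b i * (e0 / 2 * phi (v i) - e0\<^sup>2 / 16))"
    by (simp add: sum_distrib_left sum_distrib_right right_diff_distrib sum_subtractf mult_ac)
  also have "\<dots> \<le> (\<Sum>i\<in>I. b i * \<bar>v i\<bar> powr q)" using b pw by (intro sum_mono mult_left_mono) auto
  finally show ?thesis .
qed

lemma Gam_norm_large: "measure (Gam n) {h \<in> space (Gam n). 8 * real n < ip n h h} \<le> exp (- real n)"
proof -
  have "measure (Gam n) {h \<in> space (Gam n). 8 * real n < ip n h h} \<le> exp ((\<Sum>i<n. 1 / 2) - 2 * real n)"
  proof (rule prob_Gam_le_prod[where f="\<lambda>i x. 1 / 4 * x\<^sup>2"])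
    show "{h \<in> space (Gam n). 8 * real n < ip n h h} \<in> sets (Gam n)" unfolding ip_def by measurable
    fix h assume "h \<in> {h \<in> space (Gam n). 8 * real n < ip n h h}"
    then show "2 * real n \<le> (\<Sum>i<n. 1 / 4 * (h i)\<^sup>2)"
      by (simp add: ip_def sum_divide_distrib[symmetric] power2_eq_square)
  next
    have "3 / 2 \<le> exp (1 / 2 :: real)" using exp_ge_add_one_self[of "1 / 2 :: real"] by simp
    then show "(\<integral>\<^sup>+x. ennreal (exp (1 / 4 * x\<^sup>2)) \<partial>g1) \<le> ennreal (exp (1 / 2))"
      by (intro order_trans[OF g1_exp_quarter] ennreal_leI)
  qed auto
  also have "\<dots> \<le> exp (- real n)" by simp
  finally show ?thesis .
qed

text \<open>The index set is dense in the whole sphere of R^n. Instead of a net, 2 d <x, h> \<le> 4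
  d^2 + \<bar>h\<bar>^2/4 is used, whose exponential moment is at most exp(4 d^2 + n/2); the
  weighted rows outweigh it once their total weight is a large multiple of n times the largest
  weight.\<close>

lemma GamM_weighted_small_ball:
  fixes b :: "nat \<Rightarrow> real"
  assumes I: "I \<subseteq> {..<N}" and b: "\<And>i. i \<in> I \<Longrightarrow> 0 \<le> b i" "\<And>i. i \<in> I \<Longrightarrow> b i \<le> m" and m: "0 < m" "0 < sum b I"
    and large: "96 / e0\<^sup>2 * real n * m \<le> sum b I"
  shows "\<exists>B \<in> sets (GamM N n). measure (GamM N n) B \<le> exp (- real n) \<and>
    (\<forall>H \<in> space (GamM N n) - B. \<forall>x \<in> unit_rat n. sum b I * e0 / 2 < (\<Sum>i\<in>I. b i * phi (ip n x (H i))))"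
proof -
  \<comment> \<open>Makes every multiplier at most e0/16. Their squares then sum to S \<le> e0 W/16,
    so 4 S uses only half of the exponent -e0 W/2.\<close>
  define k where "k = e0 / 16 / m"
  have k: "0 < k" "k * m = e0 / 16" using m e0_pos by (auto simp: k_def)
  define l where "l i = (if i \<in> I then k * b i else 0)" for i
  have l0: "0 \<le> l i" for i using k b by (simp add: l_def)
  have fin: "finite I" using I finite_subset by blast
  have sumI: "(\<Sum>i<N. if i \<in> I then g i else 0) = sum g I" for g :: "nat \<Rightarrow> real"
    using I by (simp add: sum.If_cases Int_absorb1)
  have ls: "(\<Sum>i<N. l i) = k * sum b I" unfolding l_def sumI by (simp add: sum_distrib_left)
  define W where "W = k * sum b I"
  have W0: "0 < W" using k m by (simp add: W_def)
  define S where "S = (\<Sum>i<N. (l i)\<^sup>2)"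
  have S: "S \<le> e0 / 16 * W"
  proof -
    have "S \<le> (\<Sum>i<N. e0 / 16 * l i)"
      unfolding S_def
    proof (rule sum_mono)
      fix i
      have "l i \<le> k * m" using k b m by (auto simp: l_def)
      then show "(l i)\<^sup>2 \<le> e0 / 16 * l i" using mult_right_mono[OF _ l0, of "l i" "e0 / 16" i] by (simp only: power2_eq_square k(2))
    qed
    also have "\<dots> = e0 / 16 * W" by (simp only: sum_distrib_left[symmetric] ls W_def)
    finally show ?thesis .
  qed
  have S0: "0 < S"
  proof (rule ccontr)
    assume "\<not> 0 < S"
    then have "S = 0" unfolding S_def by (meson not_less order_antisym sum_nonneg zero_le_power2)
    then have "\<forall>i<N. l i = 0" unfolding S_def by (subst (asm) sum_nonneg_eq_0_iff) auto
    then have "W = 0" using ls by (simp add: W_def)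
    then show False using W0 by simp
  qed
  define d where "d = sqrt S"
  have d: "0 < d" "d\<^sup>2 = (\<Sum>i<N. (l i)\<^sup>2)" using S0 by (auto simp: d_def S_def)
  define F where "F h = ennreal (exp (4 * S)) * (\<Prod>j<n. ennreal (exp (1 / 4 * (h j)\<^sup>2)))" for h :: "nat \<Rightarrow> real"
  have F: "ennreal (exp (2 * d * ip n x h)) \<le> F h" if x: "x \<in> unit_rat n" for x h
  proof -
    have "0 \<le> ip n (\<lambda>j. 1 / 2 * h j - 2 * d * x j) (\<lambda>j. 1 / 2 * h j - 2 * d * x j)" by (rule ip_self_nonneg)
    also have "\<dots> = 1 / 4 * ip n h h - 2 * d * ip n x h + 4 * d\<^sup>2 * ip n x x"
      by (simp only: ip_diff_left ip_diff_right ip_scale_left ip_scale_right ip_commute[of n h x]) (simp add: power2_eq_square algebra_simps)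
    also have "4 * d\<^sup>2 * ip n x x = 4 * S" by (simp add: unit_rat_unit[OF x] d(2) S_def)
    also have "1 / 4 * ip n h h = (\<Sum>j<n. 1 / 4 * (h j)\<^sup>2)" by (simp add: ip_def sum_distrib_left power2_eq_square)
    finally have "exp (2 * d * ip n x h) \<le> exp (4 * S) * (\<Prod>j<n. exp (1 / 4 * (h j)\<^sup>2))"
      unfolding exp_sum[OF finite_lessThan, symmetric] exp_add[symmetric] by simp
    then have "ennreal (exp (2 * d * ip n x h)) \<le> ennreal (exp (4 * S) * (\<Prod>j<n. exp (1 / 4 * (h j)\<^sup>2)))"
      by (rule ennreal_leI)
    also have "\<dots> = F h" unfolding F_def by (subst ennreal_mult) (auto simp: prod_ennreal prod_nonneg)
    finally show ?thesis .
  qed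
  have intF: "(\<integral>\<^sup>+h. F h \<partial>Gam n) \<le> ennreal (exp (4 * S + real n / 2))"
  proof -
    have pm: "(\<lambda>h. \<Prod>j<n. ennreal (exp (1 / 4 * (h j)\<^sup>2))) \<in> borel_measurable (Gam n)"
    proof (rule borel_measurable_prod_ennreal)
      fix j assume "j \<in> {..<n}"
      then have [measurable]: "(\<lambda>h. h j) \<in> borel_measurable (Gam n)" using measurable_Gam_coord by simp
      show "(\<lambda>h. ennreal (exp (1 / 4 * (h j)\<^sup>2))) \<in> borel_measurable (Gam n)" by measurable
    qed
    have "(\<integral>\<^sup>+h. F h \<partial>Gam n) = ennreal (exp (4 * S)) * (\<Prod>j<n. \<integral>\<^sup>+x. ennreal (exp (1 / 4 * x\<^sup>2)) \<partial>g1)"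
      unfolding F_def nn_integral_cmult[OF pm]
      by (subst gam.product_nn_integral_prod) auto
    also have "\<dots> \<le> ennreal (exp (4 * S)) * (\<Prod>j<n. ennreal (exp (1 / 2)))"
    proof (intro mult_left_mono prod_mono_ennreal)
      have "3 / 2 \<le> exp (1 / 2 :: real)" using exp_ge_add_one_self[of "1 / 2 :: real"] by simp
      then show "(\<integral>\<^sup>+x. ennreal (exp (1 / 4 * x\<^sup>2)) \<partial>g1) \<le> ennreal (exp (1 / 2))"
        by (intro order_trans[OF g1_exp_quarter] ennreal_leI)
    qed simp
    also have "\<dots> = ennreal (exp (4 * S + real n / 2))"
    proof -
      have "exp (real n / 2) = exp (1 / 2 :: real) ^ n" by (simp add: exp_of_nat_mult[symmetric])
      then show ?thesis by (simp add: exp_add ennreal_power ennreal_mult)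
    qed
    finally show ?thesis .
  qed
  let ?t = "W * e0 / 2"
  let ?B = "{H \<in> space (GamM N n). \<exists>x\<in>unit_rat n. (\<Sum>i<N. l i * phi (ip n x (H i))) \<le> ?t}"
  have B: "?B \<in> sets (GamM N n)" by (rule small_ball(1)[OF countable_unit_rat unit_rat_unit l0 d F])
  have "emeasure (GamM N n) ?B \<le> ennreal (exp (?t - e0 * (\<Sum>i<N. l i))) * (\<integral>\<^sup>+h. F h \<partial>Gam n)"
    by (rule small_ball(2)[OF countable_unit_rat unit_rat_unit l0 d F])
  also have "\<dots> \<le> ennreal (exp (?t - e0 * W)) * ennreal (exp (4 * S + real n / 2))"
    unfolding ls W_def[symmetric] by (intro mult_left_mono intF) simp
  also have "\<dots> \<le> ennreal (exp (- real n))"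
  proof -
    \<comment> \<open>With this the remaining exponent -e0 W/4 + n/2 is at most -n.\<close>
    have "6 * real n \<le> W * e0"
    proof -
      have "k * (96 / e0\<^sup>2 * real n * m) \<le> W" unfolding W_def using large k by (intro mult_left_mono) auto
      moreover have "k * (96 / e0\<^sup>2 * real n * m) = 96 / e0\<^sup>2 * real n * (e0 / 16)"
        by (simp only: k(2)[symmetric] mult_ac)
      ultimately have "6 * real n / e0 \<le> W" using e0_pos by (simp add: power2_eq_square)
      then show ?thesis using e0_pos by (simp add: field_simps)
    qed
    then have "?t - e0 * W + (4 * S + real n / 2) \<le> - real n" using S by (simp add: algebra_simps)
    then show ?thesis by (simp add: ennreal_mult[symmetric] exp_add[symmetric])
  qed
  finally have "measure (GamM N n) ?B \<le> exp (- real n)" by (simp add: GamM.emeasure_eq_measure)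
  moreover have "sum b I * e0 / 2 < (\<Sum>i\<in>I. b i * phi (ip n x (H i)))"
    if H: "H \<in> space (GamM N n) - ?B" and x: "x \<in> unit_rat n" for H x
  proof -
    have "?t < (\<Sum>i<N. l i * phi (ip n x (H i)))" using H x by auto
    also have "\<dots> = (\<Sum>i<N. if i \<in> I then k * b i * phi (ip n x (H i)) else 0)"
      by (intro sum.cong refl) (simp add: l_def)
    also have "\<dots> = k * (\<Sum>i\<in>I. b i * phi (ip n x (H i)))" unfolding sumI by (simp add: sum_distrib_left mult.assoc)
    finally have "k * (sum b I * e0 / 2) < k * (\<Sum>i\<in>I. b i * phi (ip n x (H i)))" by (simp add: W_def)
    then show ?thesis using k by simp
  qed
  ultimately show ?thesis using B by blast
qed

text \<open>A vector of the kernel is a linear relation between the N rows of the transposed matrix.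
  Weight t on row 0, cancelled by the rows from A n on, yields norm at least t at bounded gauge.
  This t reaches the rate because r^q is of order S, while the squared norm of row 0 is at most 8
  n.\<close>

lemma section_radius_lower_small:
  assumes p: "2 \<le> p" and \<beta>: "1 - 1 / p < \<beta>"
  shows "\<exists>c C. 0 < c \<and> c \<le> 1 \<and> 0 < C \<and> (\<forall>N n \<mu>. 1 \<le> n \<longrightarrow> n < N \<longrightarrow> real n \<le> c * real N \<longrightarrow>
    is_haar_grassmannian N n \<mu> \<longrightarrow> 1 - 2 * exp (- real n) \<le> measure \<mu> {E \<in> space \<mu>.
      base_rate \<beta> n * log_factor p N n \<le> C * section_radius N (p_ellipsoid N p (log_semiaxis (1 - 1 / p) \<beta>)) E})"
proof -
  let ?\<sigma> = "log_semiaxis (1 - 1 / p) \<beta>"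
  define q where "q = p / (p - 1)"
  define s where "s = \<beta> * q"
  have p1: "1 < p" "0 < p" using p by simp_all
  have q: "1 < q" "q \<le> 2" "(1 - 1 / p) * q = 1" using p by (simp_all add: q_def field_simps)
  have s: "1 < s" using mult_strict_right_mono[OF \<beta>, of q] q by (simp add: s_def)
  \<comment> \<open>Lets the A n comparable weights of the tail outweigh the factor 96/e0^2 times n
    in the small ball condition; 2^(s+1) is the loss in
    \<open>log_weight_sum_ge_max\<close>.\<close>
  obtain A :: nat where A: "max 2 (96 / e0\<^sup>2 * 2 powr (s + 1)) \<le> real A" using real_arch_simple by blast
  have A2: "2 \<le> A" using A by simp
  obtain c2 where c2: "0 < c2" "\<And>n N. 1 \<le> n \<Longrightarrow> 4 * A\<^sup>2 * n \<le> N \<Longrightarrow>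
      c2 * (ln (real n + 1) powr (- s) * log_max N n) \<le> (\<Sum>i\<in>{A * n<..N}. log_weight s i)"
    using log_weight_sum_lower[OF _ A2, of s] s by auto
  obtain C1 where C1: "0 < C1" "\<And>n N. 1 \<le> n \<Longrightarrow> n < N \<Longrightarrow>
    (\<Sum>i\<in>{i \<in> {1..N}. 1 / 2 * real n < real i}. log_weight s i) \<le> C1 * (ln (real n + 1) powr (- s) * log_max N n)"
    using log_weight_sum_upper[OF s, of "1 / 2"] by auto
  define c where "c = 1 / (4 * (real A)\<^sup>2)"
  \<comment> \<open>A bound for t free of n and N: S is at most the sum of all weights, which the
    upper estimate with n = 1 and \<eta> = 1/2 controls, since \<open>log_max N 1\<close> is
    1.\<close>
  define t1 where "t1 = (C1 * ln 2 powr (- s)) powr (1 / q)"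
  define T where "T = ((t1 / ?\<sigma> 1) powr p + 1) powr (1 / p)"
  define D where "D = 3 / 16 * e0\<^sup>2 * c2 / 8 powr (q / 2)"
  define C where "C = T / D powr (1 / q)"
  have c: "0 < c" "c \<le> 1"
  proof -
    have "1 \<le> (real A)\<^sup>2" using A2 by (intro one_le_power) auto
    then have "0 < 4 * (real A)\<^sup>2" "1 \<le> 4 * (real A)\<^sup>2" by linarith+
    then show "0 < c" "c \<le> 1" by (simp_all only: c_def zero_less_divide_1_iff divide_le_eq_1_pos)
  qed
  have D0: "0 < D" using c2 e0_pos by (simp add: D_def)
  have T0: "0 < T"
  proof -
    have "0 < (t1 / ?\<sigma> 1) powr p + 1" by (rule add_nonneg_pos) auto
    then show ?thesis unfolding T_def by simp
  qed
  have C0: "0 < C" using T0 D0 by (simp add: C_def)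
  have "1 - 2 * exp (- real n) \<le> measure \<mu> {E \<in> space \<mu>. base_rate \<beta> n * log_factor p N n
      \<le> C * section_radius N (p_ellipsoid N p ?\<sigma>) E}"
    if n: "1 \<le> n" "n < N" "real n \<le> c * real N" and \<mu>: "is_haar_grassmannian N n \<mu>" for N n \<mu>
  proof -
    let ?R = "section_radius N (p_ellipsoid N p ?\<sigma>)"
    let ?m = "A * n"
    have nA: "4 * A\<^sup>2 * n \<le> N"
    proof -
      have "real n * (4 * (real A)\<^sup>2) \<le> real N" using n(3) A2 by (simp add: c_def field_simps)
      then have "real (4 * A\<^sup>2 * n) \<le> real N" by (simp add: mult_ac)
      then show ?thesis by linarith
    qed
    have m: "1 \<le> ?m" "2 * ?m \<le> N"
    proof -
      show "1 \<le> ?m" using A2 n by simp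
      have "2 * ?m \<le> 4 * A\<^sup>2 * n" by (simp add: power2_eq_square)
      then show "2 * ?m \<le> N" using nA by linarith
    qed
    define I where "I = {i. ?m \<le> i \<and> i < N}"
    define b where "b i = log_weight s (Suc i)" for i
    define S where "S = sum b I"
    have Seq: "S = (\<Sum>j\<in>{?m<..N}. log_weight s j)"
      unfolding S_def b_def I_def by (rule sum.reindex_bij_witness[of _ "\<lambda>j. j - 1" Suc]) auto
    have I: "I \<subseteq> {..<N}" "finite I" "0 \<notin> I" using m by (auto simp: I_def)
    have \<sigma>b: "?\<sigma> (Suc i) powr q = b i" for i by (simp add: b_def s_def log_semiaxis_powr[OF p1(1) q_def])
    have Slow: "real ?m * 2 powr (- s - 1) * log_weight s ?m \<le> S"
      unfolding Seq by (rule log_weight_sum_ge_max) (use s m in auto)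
    have lm: "0 < log_weight s ?m" by (rule log_weight_pos[OF m(1)])
    have S0: "0 < S" by (rule less_le_trans[OF _ Slow]) (use m lm in simp)
    have large: "96 / e0\<^sup>2 * real n * log_weight s ?m \<le> S"
    proof -
      have "96 / e0\<^sup>2 = (96 / e0\<^sup>2 * 2 powr (s + 1)) * 2 powr (- s - 1)"
        by (simp add: mult.assoc powr_add[symmetric])
      also have "\<dots> \<le> real A * 2 powr (- s - 1)" using A by (intro mult_right_mono) auto
      finally have "96 / e0\<^sup>2 * (real n * log_weight s ?m) \<le> real A * 2 powr (- s - 1) * (real n * log_weight s ?m)"
        using lm by (intro mult_right_mono) auto
      then show ?thesis using Slow by (simp add: mult_ac)
    qed
    obtain B1 where B1: "B1 \<in> sets (GamM N n)" "measure (GamM N n) B1 \<le> exp (- real n)"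
      "\<And>H x. H \<in> space (GamM N n) - B1 \<Longrightarrow> x \<in> unit_rat n \<Longrightarrow> S * e0 / 2 < (\<Sum>i\<in>I. b i * phi (ip n x (H i)))"
    proof -
      have "\<exists>B \<in> sets (GamM N n). measure (GamM N n) B \<le> exp (- real n) \<and>
        (\<forall>H \<in> space (GamM N n) - B. \<forall>x \<in> unit_rat n. sum b I * e0 / 2 < (\<Sum>i\<in>I. b i * phi (ip n x (H i))))"
        by (rule GamM_weighted_small_ball[OF I(1), where m="log_weight s ?m"])
          (use s m lm S0 large in \<open>auto simp: b_def[symmetric] S_def[symmetric], auto simp: b_def I_def log_weight_nonneg intro!: log_weight_antimono\<close>)
      then show ?thesis using that unfolding S_def by blast
    qed
    define B2 where "B2 = {H \<in> space (GamM N n). 8 * real n < ip n (H 0) (H 0)}"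
    have N0: "0 < N" using n by simp
    have comp: "(\<lambda>H. H 0) \<in> measurable (GamM N n) (Gam n)"
      by (rule measurable_component_singleton) (use N0 in simp)
    have hs: "{h \<in> space (Gam n). 8 * real n < ip n h h} \<in> sets (Gam n)" unfolding ip_def by measurable
    have B2eq: "B2 = (\<lambda>H. H 0) -` {h \<in> space (Gam n). 8 * real n < ip n h h} \<inter> space (GamM N n)"
      using measurable_space[OF comp] by (auto simp: B2_def)
    have B2: "B2 \<in> sets (GamM N n)" unfolding B2eq by (rule measurable_sets[OF comp hs])
    have B2m: "measure (GamM N n) B2 \<le> exp (- real n)"
    proof -
      have "measure (GamM N n) B2 = measure (distr (GamM N n) (Gam n) (\<lambda>H. H 0)) {h \<in> space (Gam n). 8 * real n < ip n h h}"
        unfolding B2eq by (rule measure_distr[symmetric, OF comp hs])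
      also have "distr (GamM N n) (Gam n) (\<lambda>H. H 0) = Gam n"
        by (rule distr_PiM_component) (use N0 in \<open>auto simp: prob_space_Gam\<close>)
      finally show ?thesis using Gam_norm_large[of n] by simp
    qed
    let ?Good = "space (GamM N n) - (B1 \<union> B2)"
    have Good: "?Good \<in> sets (GamM N n)" using B1(1) B2 by auto
    have "measure (GamM N n) (B1 \<union> B2) \<le> 2 * exp (- real n)"
      using measure_Un_le[OF B1(1) B2] B1(2) B2m by linarith
    then have "1 - 2 * exp (- real n) \<le> measure (GamM N n) ?Good"
      using GamM.prob_compl[of "B1 \<union> B2" N n] B1(1) B2 by simp
    also have "\<dots> = measure (distr (GamM n N) (GamM N n) (transp n N)) ?Good" by (simp only: GamM_transp)
    also have "\<dots> = measure (GamM n N) (transp n N -` ?Good \<inter> space (GamM n N))"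
      by (rule measure_distr[OF measurable_transp Good])
    also have "\<dots> \<le> measure \<mu> {E \<in> space \<mu>. base_rate \<beta> n * log_factor p N n \<le> C * ?R E}"
    proof (rule haar_ge_kernel[OF \<mu>])
      have sp: "space \<mu> = space (grassmannian_borel N n)" "sets \<mu> = sets (grassmannian_borel N n)"
        using \<mu> by (auto simp: is_haar_grassmannian_def space_grassmannian_borel)
      have "?R \<in> borel_measurable (grassmannian_borel N n)"
        by (rule measurable_section_radius) (use log_semiaxis_pos p in auto)
      then show "{E \<in> space \<mu>. base_rate \<beta> n * log_factor p N n \<le> C * ?R E} \<in> sets \<mu>"
        unfolding sp by measurable
      show "transp n N -` ?Good \<inter> space (GamM n N) \<in> sets (GamM n N)"
        by (rule measurable_sets[OF measurable_transp Good])
      fix G assume G: "G \<in> transp n N -` ?Good \<inter> space (GamM n N)" and E: "perp N n G \<in> grassmannian_codim N n"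
      define H where "H = transp n N G"
      have H: "H \<in> ?Good" using G by (simp add: H_def)
      have Hij: "H i j = G j i" if "i < N" "j < n" for i j using that by (simp add: H_def transp_def)
      have unit: "3 / 16 * e0\<^sup>2 * S \<le> (\<Sum>i\<in>I. b i * \<bar>ip n u (H i)\<bar> powr q)"
        if u: "u \<in> Rn n" "ip n u u = 1" for u
      proof -
        obtain z where z: "\<And>k. z k \<in> unit_rat n" "\<And>i. (\<lambda>k. z k i) \<longlonglongrightarrow> u i" using unit_rat_dense[OF u] by blast
        have "(\<lambda>k. \<Sum>i\<in>I. b i * phi (ip n (z k) (H i))) \<longlonglongrightarrow> (\<Sum>i\<in>I. b i * phi (ip n u (H i)))"
          unfolding phi_def by (intro tendsto_intros tendsto_ip z(2))
        moreover have "S * e0 / 2 \<le> (\<Sum>i\<in>I. b i * phi (ip n (z k) (H i)))" for k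
          using B1(3)[of H "z k"] H z(1) by (auto intro: less_imp_le)
        ultimately have "S * e0 / 2 \<le> (\<Sum>i\<in>I. b i * phi (ip n u (H i)))" by (intro LIMSEQ_le_const) auto
        then show ?thesis unfolding S_def using q by (intro phi_sum_to_powr) (auto simp: b_def log_weight_nonneg)
      qed
      define r where "r = (3 / 16 * e0\<^sup>2 * S) powr (1 / q)"
      have rq: "r powr q = 3 / 16 * e0\<^sup>2 * S" using e0_pos S0 q by (simp add: r_def powr_powr)
      have r0: "0 < r" using e0_pos S0 by (simp add: r_def)
      have hyp: "r powr q * ip n u u powr (q / 2) \<le> (\<Sum>i\<in>I. ?\<sigma> (Suc i) powr q * \<bar>ip n u (H i)\<bar> powr q)" for u
      proof (cases "ip n u u = 0")
        case True then show ?thesis using q by (simp add: sum_nonneg)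
      next
        case False
        define a where "a = sqrt (ip n u u)"
        have a: "0 < a" "ip n u u = a\<^sup>2" using False ip_self_nonneg[of n u] by (auto simp: a_def)
        define u' where "u' j = (if j < n then 1 / a * u j else 0)" for j
        have u'ip: "ip n u' x = 1 / a * ip n u x" for x
          unfolding ip_def u'_def sum_distrib_left by (intro sum.cong refl) simp
        have "ip n u' u' = 1" unfolding u'ip using a by (subst ip_commute, unfold u'ip) (simp add: power2_eq_square)
        moreover have "u' \<in> Rn n" by (simp add: u'_def Rn_iff)
        ultimately have "r powr q \<le> (\<Sum>i\<in>I. b i * \<bar>ip n u' (H i)\<bar> powr q)" unfolding rq by (rule unit[rotated])
        also have "\<dots> = (1 / a) powr q * (\<Sum>i\<in>I. b i * \<bar>ip n u (H i)\<bar> powr q)"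
          unfolding u'ip sum_distrib_left abs_mult powr_mult using a by (intro sum.cong refl) (simp add: mult_ac)
        finally have "a powr q * r powr q \<le> a powr q * ((1 / a) powr q * (\<Sum>i\<in>I. b i * \<bar>ip n u (H i)\<bar> powr q))"
          by (intro mult_left_mono) auto
        also have "\<dots> = (\<Sum>i\<in>I. b i * \<bar>ip n u (H i)\<bar> powr q)"
          using a by (simp add: mult.assoc[symmetric] powr_mult[symmetric])
        also have "a powr q = ip n u u powr (q / 2)"
          unfolding a(2) using a(1) by (simp add: powr_numeral[symmetric] powr_powr del: powr_numeral)
        finally show ?thesis by (simp add: \<sigma>b mult.commute)
      qed
      \<comment> \<open>The squared norm of \<open>H 0\<close> is at most 8 n, so this multiple of
        it lies in the ball of radius r.\<close>
      define t where "t = r / sqrt (8 * real n)"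
      have t0: "0 < t" using r0 n by (simp add: t_def)
      have w: "ip n (\<lambda>j. t * H 0 j) (\<lambda>j. t * H 0 j) \<le> r\<^sup>2"
      proof -
        have "ip n (H 0) (H 0) \<le> 8 * real n" using H by (auto simp: B2_def)
        then have "t\<^sup>2 * ip n (H 0) (H 0) \<le> t\<^sup>2 * (8 * real n)" by (intro mult_left_mono) auto
        also have "\<dots> = r\<^sup>2" using n by (simp add: t_def power_divide)
        finally show ?thesis unfolding ip_scale_left ip_scale_right by (simp add: power2_eq_square mult.assoc)
      qed
      obtain x where x: "\<And>i. i \<notin> I \<Longrightarrow> x i = 0" "(\<Sum>i\<in>I. (\<bar>x i\<bar> / ?\<sigma> (Suc i)) powr p) \<le> 1"
        "\<And>j. j < n \<Longrightarrow> (\<Sum>i\<in>I. x i * H i j) = t * H 0 j"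
        using ellipsoid_image_contains_ball[OF I(2) log_semiaxis_pos p1(1) q_def r0 hyp w] by blast
      \<comment> \<open>Index 0 is not in \<open>I\<close>, so the relation cancels t times
        \<open>H 0\<close> exactly, and the gauge power splits into one term for t and that of
        x.\<close>
      define y where "y i = (if i = 0 then t else - x i)" for i
      have x0: "x 0 = 0" using x(1) I(3) by simp
      have yRn: "y \<in> Rn N"
      proof -
        have "i \<notin> I" if "N \<le> i" for i using that I(1) by auto
        then show ?thesis using x(1) N0 by (auto simp: Rn_iff y_def)
      qed
      have splitN: "(\<Sum>i<N. f i) = f 0 + (\<Sum>i\<in>I. f i)" if "\<And>i. i \<notin> I \<Longrightarrow> i \<noteq> 0 \<Longrightarrow> f i = 0" for f :: "nat \<Rightarrow> real"
      proof -
        have "(\<Sum>i<N. f i) = sum f (insert 0 I)"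
          by (rule sum.mono_neutral_right) (use I N0 that in auto)
        then show ?thesis using I by simp
      qed
      have yE: "y \<in> perp N n G"
      proof -
        have "ip N y (G j) = 0" if j: "j < n" for j
        proof -
          have "ip N y (G j) = y 0 * G j 0 + (\<Sum>i\<in>I. y i * G j i)"
            unfolding ip_def by (rule splitN) (simp add: y_def x(1))
          also have "(\<Sum>i\<in>I. y i * G j i) = - (\<Sum>i\<in>I. x i * H i j)"
            unfolding sum_negf[symmetric] using I j Hij by (intro sum.cong refl) (auto simp: y_def)
          also have "\<dots> = - (t * G j 0)" using x(3)[OF j] Hij[OF N0 j] by simp
          finally show ?thesis by (simp add: y_def[of 0])
        qed
        then show ?thesis using yRn by (simp add: perp_def)
      qed
      have t1: "t \<le> t1"
      proof -
        have "S \<le> C1 * ln 2 powr (- s)"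
        proof -
          have "S \<le> (\<Sum>i\<in>{i \<in> {1..N}. 1 / 2 * real 1 < real i}. log_weight s i)"
            unfolding Seq by (intro sum_mono2) (auto simp: log_weight_nonneg)
          also have "\<dots> \<le> C1 * (ln (real 1 + 1) powr (- s) * log_max N 1)" by (rule C1(2)) (use n in auto)
          finally show ?thesis by (simp add: log_max_def)
        qed
        moreover have "3 / 16 * e0\<^sup>2 * S \<le> 1 * S"
          using e0_le_1 e0_pos S0 power_mono[of e0 1 2] by (intro mult_right_mono) auto
        ultimately have "3 / 16 * e0\<^sup>2 * S \<le> C1 * ln 2 powr (- s)" by linarith
        then have "r \<le> t1" unfolding r_def t1_def using S0 q by (intro powr_mono2) auto
        moreover have "t \<le> r / 1" unfolding t_def using r0 n by (intro divide_left_mono) auto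
        ultimately show ?thesis by simp
      qed
      have gy: "gauge_pow N p ?\<sigma> y \<le> T powr p"
      proof -
        have "gauge_pow N p ?\<sigma> y = (\<bar>y 0\<bar> / ?\<sigma> (Suc 0)) powr p + (\<Sum>i\<in>I. (\<bar>y i\<bar> / ?\<sigma> (Suc i)) powr p)"
          unfolding gauge_pow_def by (rule splitN) (use p1 x(1) in \<open>simp add: y_def\<close>)
        also have "(\<Sum>i\<in>I. (\<bar>y i\<bar> / ?\<sigma> (Suc i)) powr p) = (\<Sum>i\<in>I. (\<bar>x i\<bar> / ?\<sigma> (Suc i)) powr p)"
          using I by (intro sum.cong refl) (auto simp: y_def)
        also have "(\<bar>y 0\<bar> / ?\<sigma> (Suc 0)) powr p \<le> (t1 / ?\<sigma> 1) powr p"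
          using t0 t1 p1 log_semiaxis_pos[of "1 - 1 / p" \<beta> 0] by (intro powr_mono2) (auto simp: y_def intro!: divide_right_mono)
        also have "(t1 / ?\<sigma> 1) powr p + (\<Sum>i\<in>I. (\<bar>x i\<bar> / ?\<sigma> (Suc i)) powr p) \<le> (t1 / ?\<sigma> 1) powr p + 1"
          using x(2) by simp
        also have "\<dots> = T powr p" using p1 by (simp add: T_def powr_powr add_nonneg_pos[THEN less_imp_le])
        finally show ?thesis by simp
      qed
      have "t / T \<le> sqrt (ip N y y) / T"
      proof (rule divide_right_mono)
        have "t * t \<le> ip N y y" unfolding ip_def
          using member_le_sum[of 0 "{..<N}" "\<lambda>i. y i * y i"] N0 by (simp add: y_def)
        then have "sqrt (t\<^sup>2) \<le> sqrt (ip N y y)" by (intro real_sqrt_le_mono) (simp add: power2_eq_square)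
        then show "t \<le> sqrt (ip N y y)" using t0 by simp
      qed (use T0 in simp)
      also have "\<dots> \<le> ?R (perp N n G)"
        by (rule section_radius_ge_ratio[where s="?\<sigma>", OF log_semiaxis_pos p1(2) E yE T0 gy])
      finally have tR: "t \<le> T * ?R (perp N n G)" using T0 by (simp add: field_simps)
      have "D powr (1 / q) * (base_rate \<beta> n * log_factor p N n) \<le> t"
      proof -
        let ?rate = "base_rate \<beta> n * log_factor p N n"
        have rate0: "0 < ?rate" by (rule rate_pos[OF n(1)])
        have sn: "0 < sqrt (real n)" using n by simp
        have "D * (sqrt (real n) * ?rate) powr q = D * (ln (real n + 1) powr (- s) * log_max N n)"
          by (simp only: rate_powr[OF p1(1) q_def n(1)] s_def)
        also have "\<dots> = 3 / 16 * e0\<^sup>2 / 8 powr (q / 2) * (c2 * (ln (real n + 1) powr (- s) * log_max N n))"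
          by (simp add: D_def)
        also have "\<dots> \<le> 3 / 16 * e0\<^sup>2 / 8 powr (q / 2) * S"
          unfolding Seq using c2(2)[OF n(1) nA] e0_pos by (intro mult_left_mono) auto
        also have "\<dots> = (sqrt (real n) * t) powr q"
        proof -
          have "sqrt (real n) * t = r / sqrt 8" using sn by (simp add: t_def real_sqrt_mult)
          then have "(sqrt (real n) * t) powr q = r powr q / (8 powr (1 / 2)) powr q"
            by (simp add: powr_divide powr_half_sqrt)
          then show ?thesis by (simp only: rq powr_powr) simp
        qed
        finally have le: "(D * (sqrt (real n) * ?rate) powr q) powr (1 / q) \<le> ((sqrt (real n) * t) powr q) powr (1 / q)"
          using D0 q by (intro powr_mono2) auto
        then have "D powr (1 / q) * (sqrt (real n) * ?rate) \<le> sqrt (real n) * t"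
        proof -
          have pp: "(x powr q) powr (1 / q) = x" if "0 < x" for x :: real
            using that q by (simp add: powr_powr)
          have "0 < sqrt (real n) * ?rate" "0 < sqrt (real n) * t" using sn rate0 t0 by (metis mult_pos_pos)+
          then show ?thesis using le by (simp only: powr_mult[of D] pp)
        qed
        then have "sqrt (real n) * (D powr (1 / q) * ?rate) \<le> sqrt (real n) * t" by (simp only: mult_ac)
        then show ?thesis using sn by (simp only: mult_le_cancel_left_pos)
      qed
      then have "D powr (1 / q) * (base_rate \<beta> n * log_factor p N n) \<le> T * ?R (perp N n G)" using tR by linarith
      then have "base_rate \<beta> n * log_factor p N n \<le> C * ?R (perp N n G)"
        using D0 by (simp add: C_def field_simps)
      then show "perp N n G \<in> {E \<in> space \<mu>. base_rate \<beta> n * log_factor p N n \<le> C * ?R E}"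
        using E sp(1) by (simp add: space_grassmannian_borel)
    qed (use n in simp)
    finally show ?thesis .
  qed
  then show ?thesis using c C0 by blast
qed

text \<open>Union bound for the two complements, with the constants enlarged to a common one. The
  rates r and r' are separate because the two bounds differ for p < 2.\<close>

lemma measure_two_sided:
  assumes \<mu>: "is_haar_grassmannian N n \<mu>" and s: "\<And>j. 0 < s (Suc j)" "0 < p" and r: "0 \<le> r"
    and up: "1 - u \<le> measure \<mu> {E \<in> space \<mu>. section_radius N (p_ellipsoid N p s) E \<le> C1 * r}"
    and lo: "1 - v \<le> measure \<mu> {E \<in> space \<mu>. r' \<le> C2 * section_radius N (p_ellipsoid N p s) E}"
    and C: "C1 \<le> C" "C2 \<le> C"
  shows "1 - u - v \<le> measure \<mu> {E \<in> space \<mu>. section_radius N (p_ellipsoid N p s) E \<le> C * r \<and>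
    r' \<le> C * section_radius N (p_ellipsoid N p s) E}"
proof -
  let ?R = "section_radius N (p_ellipsoid N p s)"
  interpret prob_space \<mu> using \<mu> by (simp add: is_haar_grassmannian_def)
  have sp: "space \<mu> = space (grassmannian_borel N n)" "sets \<mu> = sets (grassmannian_borel N n)"
    using \<mu> by (auto simp: is_haar_grassmannian_def space_grassmannian_borel)
  have Rm: "?R \<in> borel_measurable (grassmannian_borel N n)"
    by (rule measurable_section_radius[where s=s, OF s])
  have m: "{E \<in> space \<mu>. ?R E \<le> a} \<in> sets \<mu>" "{E \<in> space \<mu>. a \<le> b * ?R E} \<in> sets \<mu>" for a b
    unfolding sp using Rm by measurable
  let ?A = "{E \<in> space \<mu>. ?R E \<le> C1 * r}" and ?B = "{E \<in> space \<mu>. r' \<le> C2 * ?R E}"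
  have "measure \<mu> (space \<mu> - ?A \<inter> ?B) \<le> measure \<mu> ((space \<mu> - ?A) \<union> (space \<mu> - ?B))"
    using m by (intro finite_measure_mono) auto
  also have "\<dots> \<le> measure \<mu> (space \<mu> - ?A) + measure \<mu> (space \<mu> - ?B)"
    using m by (intro measure_Un_le) auto
  also have "\<dots> \<le> u + v" using up lo prob_compl[OF m(1)[of "C1 * r"]] prob_compl[OF m(2)[of r' C2]] by simp
  finally have "1 - u - v \<le> measure \<mu> (?A \<inter> ?B)"
    using prob_compl[of "?A \<inter> ?B"] m by simp
  also have "\<dots> \<le> measure \<mu> {E \<in> space \<mu>. ?R E \<le> C * r \<and> r' \<le> C * ?R E}"
  proof (rule finite_measure_mono)
    show "?A \<inter> ?B \<subseteq> {E \<in> space \<mu>. ?R E \<le> C * r \<and> r' \<le> C * ?R E}"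
    proof
      fix E assume E: "E \<in> ?A \<inter> ?B"
      then have "E \<in> grassmannian_codim N n" by (simp add: sp space_grassmannian_borel)
      from section_radius_nonneg[where s=s, OF s this] have "0 \<le> ?R E" .
      then have "C2 * ?R E \<le> C * ?R E" "C1 * r \<le> C * r" using C r by (auto intro: mult_right_mono)
      then show "E \<in> {E \<in> space \<mu>. ?R E \<le> C * r \<and> r' \<le> C * ?R E}" using E by auto
    qed
    have "{E \<in> space \<mu>. ?R E \<le> C * r \<and> r' \<le> C * ?R E} = {E \<in> space \<mu>. ?R E \<le> C * r} \<inter> {E \<in> space \<mu>. r' \<le> C * ?R E}" by auto
    then show "{E \<in> space \<mu>. ?R E \<le> C * r \<and> r' \<le> C * ?R E} \<in> sets \<mu>" using m by simp
  qed
  finally show ?thesis .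
qed

theorem proposition6p4:
  shows "\<exists>\<gamma>::real. \<gamma> > 0 \<and>
    (\<forall>(p::real) (\<alpha>::real) (\<beta>::real). p > 1 \<longrightarrow> \<alpha> = 1 - 1 / p \<longrightarrow> \<beta> > 1 - 1 / p \<longrightarrow>
      (p \<ge> 2 \<longrightarrow>
        (\<exists>(c::real) (C::real). c > 0 \<and> C > 0 \<and>
          (\<forall>(N::nat) (n::nat) \<mu>. 1 \<le> n \<longrightarrow> n < N \<longrightarrow> is_haar_grassmannian N n \<mu> \<longrightarrow>
            measure \<mu> {E \<in> space \<mu>.
                section_radius N (p_ellipsoid N p (log_semiaxis \<alpha> \<beta>)) E
                  \<le> C * (base_rate \<beta> n * log_factor p N n) \<and>
                base_rate \<beta> n * log_factor p N n
                  \<le> C * section_radius N (p_ellipsoid N p (log_semiaxis \<alpha> \<beta>)) E}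
              \<ge> (if real n \<le> c * real N then 1 - 3 * exp (- \<gamma> * real n)
                  else 1 - exp (- \<gamma> * real n) - 2 * exp (- \<gamma> * p * real n powr (2 / p)))))) \<and>
      (p < 2 \<longrightarrow>
        (\<exists>C::real. C > 0 \<and>
          (\<forall>(N::nat) (n::nat) \<mu>. 1 \<le> n \<longrightarrow> n < N \<longrightarrow> is_haar_grassmannian N n \<mu> \<longrightarrow>
            measure \<mu> {E \<in> space \<mu>.
                base_rate \<beta> n
                  \<le> C * section_radius N (p_ellipsoid N p (log_semiaxis \<alpha> \<beta>)) E \<and>
                section_radius N (p_ellipsoid N p (log_semiaxis \<alpha> \<beta>)) E
                  \<le> C * (base_rate \<beta> n * log_factor p N n)}
              \<ge> 1 - 2 * exp (- \<gamma> * real n)))))"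
proof -
  \<comment> \<open>Absolute, since \<open>e0\<close> and \<open>rate_const\<close> are. It is at
    most 1, so the failure probabilities exp(-n) and exp(-p n^(2/p)) of the lower bounds only grow
    when \<gamma> is put into the exponent.\<close>
  define \<gamma> where "\<gamma> = rate_const * e0 / 4"
  have \<gamma>0: "0 < \<gamma>" using rate_const_pos e0_pos by (simp add: \<gamma>_def)
  have \<gamma>1: "\<gamma> \<le> 1" using mult_mono[of rate_const 1 e0 1] e0_pos e0_le_1 by (simp add: \<gamma>_def rate_const_def)
  show ?thesis
  proof (rule exI[of _ \<gamma>], intro conjI allI impI \<gamma>0)
    fix p \<alpha> \<beta> :: real assume p: "1 < p" and \<alpha>: "\<alpha> = 1 - 1 / p" and \<beta>: "1 - 1 / p < \<beta>" and p2: "2 \<le> p"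
    let ?s = "log_semiaxis \<alpha> \<beta>"
    have \<beta>0: "0 < \<beta>" using p \<beta> by (smt (verit) divide_le_eq_1_pos)
    obtain Cu where Cu: "0 < Cu" "\<And>N n \<mu>. 1 \<le> n \<Longrightarrow> n < N \<Longrightarrow> is_haar_grassmannian N n \<mu> \<Longrightarrow>
        1 - exp (- (\<gamma> * real n)) \<le> measure \<mu> {E \<in> space \<mu>.
        section_radius N (p_ellipsoid N p ?s) E \<le> Cu * (base_rate \<beta> n * log_factor p N n)}"
      using section_radius_upper[OF p \<beta>] unfolding \<alpha> \<gamma>_def by blast
    obtain c Cl where c: "0 < c" "c \<le> 1" and Cl: "0 < Cl" "\<And>N n \<mu>. 1 \<le> n \<Longrightarrow> n < N \<Longrightarrow> real n \<le> c * real N \<Longrightarrow>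
        is_haar_grassmannian N n \<mu> \<Longrightarrow> 1 - 2 * exp (- real n) \<le> measure \<mu> {E \<in> space \<mu>.
        base_rate \<beta> n * log_factor p N n \<le> Cl * section_radius N (p_ellipsoid N p ?s) E}"
      using section_radius_lower_small[OF p2 \<beta>] unfolding \<alpha> by blast
    \<comment> \<open>This bound is available for every positive c up to 1, so it takes over exactly
      where the range of small n ends.\<close>
    obtain Cm where Cm: "0 < Cm" "\<And>N n \<mu>. 1 \<le> n \<Longrightarrow> n < N \<Longrightarrow> c * real N \<le> real n \<Longrightarrow>
        is_haar_grassmannian N n \<mu> \<Longrightarrow> 1 - 2 * exp (- p * real n powr (2 / p)) \<le> measure \<mu> {E \<in> space \<mu>.
        base_rate \<beta> n * log_factor p N n \<le> Cm * section_radius N (p_ellipsoid N p ?s) E}"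
      using section_radius_lower_proportional[OF p2 \<beta>0 c] unfolding \<alpha> by blast
    define C where "C = max Cu (max Cl Cm)"
    have C: "0 < C" "Cu \<le> C" "Cl \<le> C" "Cm \<le> C" using Cu(1) by (auto simp: C_def)
    show "\<exists>c C. c > 0 \<and> C > 0 \<and>
          (\<forall>(N::nat) (n::nat) \<mu>. 1 \<le> n \<longrightarrow> n < N \<longrightarrow> is_haar_grassmannian N n \<mu> \<longrightarrow>
            measure \<mu> {E \<in> space \<mu>.
                section_radius N (p_ellipsoid N p ?s) E \<le> C * (base_rate \<beta> n * log_factor p N n) \<and>
                base_rate \<beta> n * log_factor p N n \<le> C * section_radius N (p_ellipsoid N p ?s) E}
              \<ge> (if real n \<le> c * real N then 1 - 3 * exp (- \<gamma> * real n)
                  else 1 - exp (- \<gamma> * real n) - 2 * exp (- \<gamma> * p * real n powr (2 / p))))"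
    proof (rule exI[of _ c], rule exI[of _ C], intro conjI allI impI c(1) C(1))
      fix N n :: nat and \<mu> assume n: "1 \<le> n" "n < N" and \<mu>: "is_haar_grassmannian N n \<mu>"
      let ?ev = "measure \<mu> {E \<in> space \<mu>.
                section_radius N (p_ellipsoid N p ?s) E \<le> C * (base_rate \<beta> n * log_factor p N n) \<and>
                base_rate \<beta> n * log_factor p N n \<le> C * section_radius N (p_ellipsoid N p ?s) E}"
      have r0: "0 \<le> base_rate \<beta> n * log_factor p N n" using rate_pos[OF n(1)] by (rule less_imp_le)
      have p0: "0 < p" using p by simp
      show "(if real n \<le> c * real N then 1 - 3 * exp (- \<gamma> * real n)
          else 1 - exp (- \<gamma> * real n) - 2 * exp (- \<gamma> * p * real n powr (2 / p))) \<le> ?ev"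
      proof (cases "real n \<le> c * real N")
        case True
        have "1 - exp (- (\<gamma> * real n)) - 2 * exp (- real n) \<le> ?ev"
          by (rule measure_two_sided[where s="?s", OF \<mu> log_semiaxis_pos p0 r0 Cu(2)[OF n \<mu>] Cl(2)[OF n True \<mu>] C(2,3)])
        moreover have "exp (- real n) \<le> exp (- (\<gamma> * real n))" using mult_right_mono[OF \<gamma>1, of "real n"] by simp
        ultimately have "1 - 3 * exp (- (\<gamma> * real n)) \<le> ?ev" by linarith
        then show ?thesis using True by simp
      next
        case False
        have "1 - exp (- (\<gamma> * real n)) - 2 * exp (- p * real n powr (2 / p)) \<le> ?ev"
          by (rule measure_two_sided[where s="?s", OF \<mu> log_semiaxis_pos p0 r0 Cu(2)[OF n \<mu>] Cm(2)[OF n _ \<mu>] C(2,4)])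
            (use False in simp)
        moreover have "exp (- p * real n powr (2 / p)) \<le> exp (- \<gamma> * p * real n powr (2 / p))"
          using mult_right_mono[OF \<gamma>1, of "p * real n powr (2 / p)"] p0 by (simp add: mult.assoc)
        ultimately have "1 - exp (- (\<gamma> * real n)) - 2 * exp (- \<gamma> * p * real n powr (2 / p)) \<le> ?ev" by linarith
        then show ?thesis using False by simp
      qed
    qed
  next
    fix p \<alpha> \<beta> :: real assume p: "1 < p" and \<alpha>: "\<alpha> = 1 - 1 / p" and \<beta>: "1 - 1 / p < \<beta>" and p2: "p < 2"
    let ?s = "log_semiaxis \<alpha> \<beta>"
    have \<beta>0: "0 < \<beta>" using p \<beta> by (smt (verit) divide_le_eq_1_pos)
    obtain Cu where Cu: "0 < Cu" "\<And>N n \<mu>. 1 \<le> n \<Longrightarrow> n < N \<Longrightarrow> is_haar_grassmannian N n \<mu> \<Longrightarrow>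
        1 - exp (- (\<gamma> * real n)) \<le> measure \<mu> {E \<in> space \<mu>.
        section_radius N (p_ellipsoid N p ?s) E \<le> Cu * (base_rate \<beta> n * log_factor p N n)}"
      using section_radius_upper[OF p \<beta>] unfolding \<alpha> \<gamma>_def by blast
    obtain Cl where Cl: "0 < Cl" "\<And>N n E. 1 \<le> n \<Longrightarrow> n < N \<Longrightarrow> E \<in> grassmannian_codim N n \<Longrightarrow>
        base_rate \<beta> n \<le> Cl * section_radius N (p_ellipsoid N p ?s) E"
      using section_radius_lower_le2[OF p less_imp_le[OF p2] \<beta>0] unfolding \<alpha> by blast
    define C where "C = max Cu Cl"
    have C: "0 < C" "Cu \<le> C" "Cl \<le> C" using Cu(1) by (auto simp: C_def)
    show "\<exists>C. C > 0 \<and>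
          (\<forall>(N::nat) (n::nat) \<mu>. 1 \<le> n \<longrightarrow> n < N \<longrightarrow> is_haar_grassmannian N n \<mu> \<longrightarrow>
            measure \<mu> {E \<in> space \<mu>.
                base_rate \<beta> n \<le> C * section_radius N (p_ellipsoid N p ?s) E \<and>
                section_radius N (p_ellipsoid N p ?s) E \<le> C * (base_rate \<beta> n * log_factor p N n)}
              \<ge> 1 - 2 * exp (- \<gamma> * real n))"
    proof (rule exI[of _ C], intro conjI allI impI C(1))
      fix N n :: nat and \<mu> assume n: "1 \<le> n" "n < N" and \<mu>: "is_haar_grassmannian N n \<mu>"
      interpret prob_space \<mu> using \<mu> by (simp add: is_haar_grassmannian_def)
      have r0: "0 \<le> base_rate \<beta> n * log_factor p N n" using rate_pos[OF n(1)] by (rule less_imp_le)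
      have p0: "0 < p" using p by simp
      \<comment> \<open>For p < 2 the lower bound holds for every subspace, so its event has measure
        1 and only the upper bound costs probability.\<close>
      have "{E \<in> space \<mu>. base_rate \<beta> n \<le> Cl * section_radius N (p_ellipsoid N p ?s) E} = space \<mu>"
        using \<mu> Cl(2)[OF n] by (auto simp: is_haar_grassmannian_def)
      then have lo: "1 - 0 \<le> measure \<mu> {E \<in> space \<mu>. base_rate \<beta> n \<le> Cl * section_radius N (p_ellipsoid N p ?s) E}"
        by (simp add: prob_space)
      have "1 - exp (- (\<gamma> * real n)) - 0 \<le> measure \<mu> {E \<in> space \<mu>.
          section_radius N (p_ellipsoid N p ?s) E \<le> C * (base_rate \<beta> n * log_factor p N n) \<and>
          base_rate \<beta> n \<le> C * section_radius N (p_ellipsoid N p ?s) E}"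
        by (rule measure_two_sided[where s="?s", OF \<mu> log_semiaxis_pos p0 r0 Cu(2)[OF n \<mu>] lo C(2,3)])
      moreover have "0 \<le> exp (- (\<gamma> * real n))" by simp
      ultimately have "1 - 2 * exp (- (\<gamma> * real n)) \<le> measure \<mu> {E \<in> space \<mu>.
          section_radius N (p_ellipsoid N p ?s) E \<le> C * (base_rate \<beta> n * log_factor p N n) \<and>
          base_rate \<beta> n \<le> C * section_radius N (p_ellipsoid N p ?s) E}" by linarith
      then show "1 - 2 * exp (- \<gamma> * real n) \<le> measure \<mu> {E \<in> space \<mu>.
          base_rate \<beta> n \<le> C * section_radius N (p_ellipsoid N p ?s) E \<and>
          section_radius N (p_ellipsoid N p ?s) E \<le> C * (base_rate \<beta> n * log_factor p N n)}"
        by (simp only: conj_commute mult_minus_left)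
    qed
  qed
qed

end
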